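(* Let $\mathcal{M}=(M,<,\ldots)$ be an o-minimal structure and let $\mathcal{N}=(N,<,\ldots)$ be a tame elementary extension of $\mathcal{M}$. Then for every $n\geq 1$ and every $a\in N^n$, the type $\operatorname{tp}(a/M)\in S_n(M)$ is definable.
   Context: O-minimal structures are understood as in van den Dries' book: $\mathcal{M}=(M,<,\ldots)$ is an expansion of a dense linear order without endpoints in which every definable (with parameters) subset of $M$ is a finite union of points and open intervals with endpoints in $M\cup\{-\infty,+\infty\}$. No group or field structure is assumed. An elementary extension $\mathcal{N}=(N,<,\ldots)$ of $\mathcal{M}$ is \emph{tame} if, for every $a\in N$, the set $\{b\in M : b<a\}$ has a supremum in $M\cup\{-\infty,+\infty\}$ (supremum computed in $M\cup\{-\infty,+\infty\}$). "Definable" means definable in $\mathcal{M}$ with parameters from $M$. A type $p\in S_n(M)$ is identified with an ultrafilter in the Boolean algebra of definable subsets of $M^n$. The type $p$ is \emph{definable} if, for every formula $\varphi(u,v)$ (without parameters, in the language of $\mathcal{M}$) with $|u|=n$, the set $\{b\in M^{|v|} : \varphi(M^n,b)\in p\}$ is definable, where $\varphi(M^n,b)=\{x\in M^n : \mathcal{M}\models\varphi(x,b)\}$. For $p=\operatorname{tp}(a/M)$ with $a\in N^n$ this set is $\{b\in M^{|v|} : \mathcal{N}\models\varphi(a,b)\}$. *)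

theory Defs
  imports Main "HOL-Library.NList" "HOL-Library.Extended"
begin

text \<open>
  First-order languages. The order symbol and equality are logical symbols of the syntax below, so
  a language lists only the further symbols; the symbols of a language are those on which the
  arity maps are defined (so there may be none at all), and constants are function symbols of
  arity 0.
\<close>

record ('f, 'r) language =
  fun_arity :: "'f \<Rightarrow> nat option"
  rel_arity :: "'r \<Rightarrow> nat option"

record ('a, 'f, 'r) struct =
  universe :: "'a set"
  lt :: "'a \<Rightarrow> 'a \<Rightarrow> bool"
  fun_interp :: "'f \<Rightarrow> 'a list \<Rightarrow> 'a"
  rel_interp :: "'r \<Rightarrow> 'a list \<Rightarrow> bool"

text \<open>Only the values of the interpretations on tuples of the right length from the universe matter.\<close>

definition is_structure :: "('f, 'r) language \<Rightarrow> ('a, 'f, 'r) struct \<Rightarrow> bool" where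
  "is_structure L M \<longleftrightarrow> universe M \<noteq> {} \<and>
     (\<forall>f k. fun_arity L f = Some k \<longrightarrow>
        (\<forall>xs \<in> nlists k (universe M). fun_interp M f xs \<in> universe M))"

text \<open>
  Formulas use de Bruijn indices: a quantifier binds index 0 and shifts the free variables by one.
  A formula in context \<open>n\<close> has its free variables among \<open>0, \<dots>, n - 1\<close> and is evaluated
  at lists of length \<open>n\<close>; thus \<open>\<phi>(u,v)\<close> with \<open>|u| = n\<close>, \<open>|v| = m\<close> is a formula in context
  \<open>n + m\<close> evaluated at \<open>x @ b\<close>.
\<close>

datatype 'f trm = Var nat | App 'f "'f trm list"

datatype ('f, 'r) fm =
    Eq "'f trm" "'f trm"
  | Lt "'f trm" "'f trm"
  | Rel 'r "'f trm list"
  | Neg "('f, 'r) fm"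
  | And "('f, 'r) fm" "('f, 'r) fm"
  | Exists "('f, 'r) fm"

fun wf_trm :: "('f, 'r) language \<Rightarrow> nat \<Rightarrow> 'f trm \<Rightarrow> bool" where
  "wf_trm L n (Var i) \<longleftrightarrow> i < n"
| "wf_trm L n (App f ts) \<longleftrightarrow> fun_arity L f = Some (length ts) \<and> (\<forall>t \<in> set ts. wf_trm L n t)"

fun wf_fm :: "('f, 'r) language \<Rightarrow> nat \<Rightarrow> ('f, 'r) fm \<Rightarrow> bool" where
  "wf_fm L n (Eq s t) \<longleftrightarrow> wf_trm L n s \<and> wf_trm L n t"
| "wf_fm L n (Lt s t) \<longleftrightarrow> wf_trm L n s \<and> wf_trm L n t"
| "wf_fm L n (Rel r ts) \<longleftrightarrow> rel_arity L r = Some (length ts) \<and> (\<forall>t \<in> set ts. wf_trm L n t)"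
| "wf_fm L n (Neg \<phi>) \<longleftrightarrow> wf_fm L n \<phi>"
| "wf_fm L n (And \<phi> \<psi>) \<longleftrightarrow> wf_fm L n \<phi> \<and> wf_fm L n \<psi>"
| "wf_fm L n (Exists \<phi>) \<longleftrightarrow> wf_fm L (Suc n) \<phi>"

fun tval :: "('a, 'f, 'r) struct \<Rightarrow> 'a list \<Rightarrow> 'f trm \<Rightarrow> 'a" where
  "tval M e (Var i) = e ! i"
| "tval M e (App f ts) = fun_interp M f (map (tval M e) ts)"

fun sat :: "('a, 'f, 'r) struct \<Rightarrow> 'a list \<Rightarrow> ('f, 'r) fm \<Rightarrow> bool" where
  "sat M e (Eq s t) \<longleftrightarrow> tval M e s = tval M e t"
| "sat M e (Lt s t) \<longleftrightarrow> lt M (tval M e s) (tval M e t)"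
| "sat M e (Rel r ts) \<longleftrightarrow> rel_interp M r (map (tval M e) ts)"
| "sat M e (Neg \<phi>) \<longleftrightarrow> \<not> sat M e \<phi>"
| "sat M e (And \<phi> \<psi>) \<longleftrightarrow> sat M e \<phi> \<and> sat M e \<psi>"
| "sat M e (Exists \<phi>) \<longleftrightarrow> (\<exists>a \<in> universe M. sat M (a # e) \<phi>)"

text \<open>The set \<open>\<phi>(M\<^sup>n, b)\<close>; the library set \<^term>\<open>nlists n A\<close> of lists of length \<open>n\<close> over \<open>A\<close> plays
  the role of the Cartesian power.\<close>

definition fibre :: "('a, 'f, 'r) struct \<Rightarrow> nat \<Rightarrow> ('f, 'r) fm \<Rightarrow> 'a list \<Rightarrow> 'a list set" where
  "fibre M n \<phi> b = {x \<in> nlists n (universe M). sat M (x @ b) \<phi>}"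

definition definable ::
  "('f, 'r) language \<Rightarrow> ('a, 'f, 'r) struct \<Rightarrow> nat \<Rightarrow> 'a list set \<Rightarrow> bool" where
  "definable L M n X \<longleftrightarrow>
     (\<exists>m \<phi> b. wf_fm L (n + m) \<phi> \<and> b \<in> nlists m (universe M) \<and> X = fibre M n \<phi> b)"

text \<open>With \<open>\<phi>\<close> ranging over atomic formulas, the last condition makes \<open>M\<close> a substructure.\<close>

definition elementary_extension ::
  "('f, 'r) language \<Rightarrow> ('a, 'f, 'r) struct \<Rightarrow> ('a, 'f, 'r) struct \<Rightarrow> bool" where
  "elementary_extension L M N \<longleftrightarrow>
     is_structure L M \<and> is_structure L N \<and> universe M \<subseteq> universe N \<and>
     (\<forall>k \<phi>. wf_fm L k \<phi> \<longrightarrow> (\<forall>b \<in> nlists k (universe M). sat M b \<phi> \<longleftrightarrow> sat N b \<phi>))"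

definition dense_linear_order_without_endpoints :: "('a, 'f, 'r) struct \<Rightarrow> bool" where
  "dense_linear_order_without_endpoints M \<longleftrightarrow>
     irreflp_on (universe M) (lt M) \<and> transp_on (universe M) (lt M) \<and> totalp_on (universe M) (lt M) \<and>
     (\<forall>x \<in> universe M. \<forall>y \<in> universe M. lt M x y \<longrightarrow> (\<exists>z \<in> universe M. lt M x z \<and> lt M z y)) \<and>
     (\<forall>x \<in> universe M. (\<exists>y \<in> universe M. lt M y x) \<and> (\<exists>y \<in> universe M. lt M x y))"

text \<open>
  The set \<open>M \<union> {-\<infinity>, +\<infinity>}\<close> and its order. The order that the library puts on \<^typ>\<open>'a extended\<close>
  comes from a type class instance on \<^typ>\<open>'a\<close> and is not the one needed here.
\<close>

definition ext_universe :: "('a, 'f, 'r) struct \<Rightarrow> 'a extended set" where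
  "ext_universe M = Fin ` universe M \<union> {Minf, Pinf}"

fun ext_lt :: "('a, 'f, 'r) struct \<Rightarrow> 'a extended \<Rightarrow> 'a extended \<Rightarrow> bool" where
  "ext_lt M (Fin x) (Fin y) \<longleftrightarrow> lt M x y"
| "ext_lt M Minf y \<longleftrightarrow> y \<noteq> Minf"
| "ext_lt M x Pinf \<longleftrightarrow> x \<noteq> Pinf"
| "ext_lt M Pinf y \<longleftrightarrow> False"
| "ext_lt M x Minf \<longleftrightarrow> False"

definition open_interval :: "('a, 'f, 'r) struct \<Rightarrow> 'a extended \<Rightarrow> 'a extended \<Rightarrow> 'a set" where
  "open_interval M l u = {x \<in> universe M. ext_lt M l (Fin x) \<and> ext_lt M (Fin x) u}"

definition points_and_intervals :: "('a, 'f, 'r) struct \<Rightarrow> 'a set set" where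
  "points_and_intervals M =
     {{x} | x. x \<in> universe M} \<union>
     {open_interval M l u | l u. l \<in> ext_universe M \<and> u \<in> ext_universe M \<and> ext_lt M l u}"

text \<open>A definable subset of \<open>M\<close> is given as a set of one-element lists.\<close>

definition o_minimal :: "('f, 'r) language \<Rightarrow> ('a, 'f, 'r) struct \<Rightarrow> bool" where
  "o_minimal L M \<longleftrightarrow>
     is_structure L M \<and> dense_linear_order_without_endpoints M \<and>
     (\<forall>X. definable L M 1 X \<longrightarrow>
        (\<exists>F. finite F \<and> F \<subseteq> points_and_intervals M \<and> {x. [x] \<in> X} = \<Union>F))"

definition is_ext_sup :: "('a, 'f, 'r) struct \<Rightarrow> 'a set \<Rightarrow> 'a extended \<Rightarrow> bool" where
  "is_ext_sup M S s \<longleftrightarrow>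
     s \<in> ext_universe M \<and> (\<forall>x \<in> S. Fin x = s \<or> ext_lt M (Fin x) s) \<and>
     (\<forall>t \<in> ext_universe M. (\<forall>x \<in> S. Fin x = t \<or> ext_lt M (Fin x) t) \<longrightarrow> s = t \<or> ext_lt M s t)"

definition tame_extension ::
  "('f, 'r) language \<Rightarrow> ('a, 'f, 'r) struct \<Rightarrow> ('a, 'f, 'r) struct \<Rightarrow> bool" where
  "tame_extension L M N \<longleftrightarrow>
     elementary_extension L M N \<and>
     (\<forall>a \<in> universe N. \<exists>s. is_ext_sup M {b \<in> universe M. lt N b a} s)"

text \<open>\<open>S\<^sub>n(M)\<close>: the ultrafilters in the Boolean algebra of definable subsets of \<open>M\<^sup>n\<close>.\<close>

definition types :: "('f, 'r) language \<Rightarrow> ('a, 'f, 'r) struct \<Rightarrow> nat \<Rightarrow> 'a list set set set" where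
  "types L M n = {p.
     (\<forall>X \<in> p. definable L M n X) \<and>
     nlists n (universe M) \<in> p \<and> {} \<notin> p \<and>
     (\<forall>X \<in> p. \<forall>Y \<in> p. X \<inter> Y \<in> p) \<and>
     (\<forall>X \<in> p. \<forall>Y. definable L M n Y \<and> X \<subseteq> Y \<longrightarrow> Y \<in> p) \<and>
     (\<forall>X. definable L M n X \<longrightarrow> X \<in> p \<or> nlists n (universe M) - X \<in> p)}"

text \<open>
  The type \<open>tp(a/M)\<close> of a tuple \<open>a\<close> of \<open>N\<close>, as a family of definable sets. For \<open>N\<close> an elementary
  extension of \<open>M\<close>, whether \<open>N \<Turnstile> \<phi>(a,b)\<close> depends only on the set \<open>\<phi>(M\<^sup>n,b)\<close>, not on the choice of
  \<open>\<phi>\<close> and \<open>b\<close>.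
\<close>

definition tp :: "('f, 'r) language \<Rightarrow> ('a, 'f, 'r) struct \<Rightarrow> ('a, 'f, 'r) struct \<Rightarrow> 'a list
    \<Rightarrow> 'a list set set" where
  "tp L M N a = {fibre M (length a) \<phi> b | m \<phi> b.
     wf_fm L (length a + m) \<phi> \<and> b \<in> nlists m (universe M) \<and> sat N (a @ b) \<phi>}"

definition definable_type ::
  "('f, 'r) language \<Rightarrow> ('a, 'f, 'r) struct \<Rightarrow> nat \<Rightarrow> 'a list set set \<Rightarrow> bool" where
  "definable_type L M n p \<longleftrightarrow>
     (\<forall>m \<phi>. wf_fm L (n + m) \<phi> \<longrightarrow>
        definable L M m {b \<in> nlists m (universe M). fibre M n \<phi> b \<in> p})"

end

theory Submission imports Defs
begin

text \<open>
  By induction on the length of \<open>a\<close>, every set definable in \<open>N\<close> with parameters \<open>a\<close> is shown to have a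
  definable trace on \<open>M\<^sup>m\<close>. For a parameter \<open>d\<close>, whether \<open>d\<close> lies in a fibre \<open>X\<^sub>b\<close> is decided by the
  position of \<open>d\<close> among the boundary points of \<open>X\<^sub>b\<close>, whose number is bounded by uniform finiteness. The
  set of those \<open>b\<close> for which \<open>d\<close> has at least a given number of boundary points below it is a cut \<open>P\<close>
  in a preorder on \<open>M\<^sup>m\<close> that is definable by the induction hypothesis.

  So it suffices that such a cut is definable. Tameness gives this when a family \<open>F\<^sub>x\<close> indexed by the
  line, no member of which is split by \<open>P\<close>, is cut into an initial and a final part: \<open>N\<close> realizes no
  cut of \<open>M\<close> without end points, and a set definable in \<open>N\<close> cannot change infinitely often near such a
  cut. In general, the preorder is piecewise constant or strictly monotone along lines. If \<open>P\<close> splits a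
  piece of a line, it is determined by the point of the splitting; otherwise \<open>P\<close> is transported along
  correspondences to lower dimension.
\<close>

text \<open>The boundary points of the fibres lie in \<open>N\<close>, so the position of
  \<open>d\<close> is not a cut in the line \<open>M\<close>. It is recorded as a cut among the
  parameter tuples instead: comparing two tuples means comparing sets of points of \<open>N\<close>
  without naming \<open>d\<close>, so the comparison needs one parameter fewer and falls under the
  induction hypothesis.

  The obstacle throughout is that no group structure is given, hence no definable choice. A
  selection is possible only where the order provides one: a least element, the point of given rank
  in a finite set, the first place where a predicate changes. Where it provides none, a whole
  component takes the place of a chosen point.

  A splitting point \<open>s\<close> of a line settles the cut except on the gap at
  \<open>s\<close>, the tuples that no point of the line near \<open>s\<close> separates from it.
  Along a strictly monotone stretch these gaps are disjoint, so only finitely many have full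
  dimension. Such points are removed from the line beforehand; any other gap is covered by finitely
  many images of a space of lower dimension.\<close>

declare nlists_appendE [rule del] nlists_Cons_Suc [rule del] nlistsE_length [simp del] nlistsE_set [simp del]

section \<open>Predicates defined by formulas\<close>

text \<open>In an environment \<open>e @ b\<close> the parameters stand behind the variables, so
  their indices move whenever variables or parameters are added. Renaming indices suffices, because
  coordinates are only ever replaced by coordinates or parameters, never by compound terms.\<close>

fun ren_trm :: "(nat \<Rightarrow> nat) \<Rightarrow> 'f trm \<Rightarrow> 'f trm" where
  "ren_trm f (Var i) = Var (f i)"
| "ren_trm f (App g ts) = App g (map (ren_trm f) ts)"

primrec ren_fm :: "(nat \<Rightarrow> nat) \<Rightarrow> ('f, 'r) fm \<Rightarrow> ('f, 'r) fm" where
  "ren_fm f (Eq s t) = Eq (ren_trm f s) (ren_trm f t)"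
| "ren_fm f (Lt s t) = Lt (ren_trm f s) (ren_trm f t)"
| "ren_fm f (Rel r ts) = Rel r (map (ren_trm f) ts)"
| "ren_fm f (Neg \<phi>) = Neg (ren_fm f \<phi>)"
| "ren_fm f (And \<phi> \<psi>) = And (ren_fm f \<phi>) (ren_fm f \<psi>)"
| "ren_fm f (Exists \<phi>) = Exists (ren_fm (case_nat 0 (\<lambda>i. Suc (f i))) \<phi>)"

lemma wf_ren_trm: "wf_trm L n t \<Longrightarrow> (\<And>i. i < n \<Longrightarrow> f i < k) \<Longrightarrow> wf_trm L k (ren_trm f t)"
  by (induction t) auto

lemma wf_ren_fm: "wf_fm L n \<psi> \<Longrightarrow> (\<And>i. i < n \<Longrightarrow> f i < k) \<Longrightarrow> wf_fm L k (ren_fm f \<psi>)"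
proof (induction \<psi> arbitrary: n k f)
  case (Exists \<psi>)
  have "wf_fm L (Suc k) (ren_fm (case_nat 0 (\<lambda>i. Suc (f i))) \<psi>)"
    by (rule Exists.IH[of "Suc n"]) (use Exists.prems in \<open>auto split: nat.splits\<close>)
  then show ?case by simp
qed (auto intro: wf_ren_trm)

lemma tval_ren_trm:
  "wf_trm L n t \<Longrightarrow> (\<And>i. i < n \<Longrightarrow> e' ! f i = e ! i) \<Longrightarrow> tval S e' (ren_trm f t) = tval S e t"
proof (induction t)
  case (App g ts)
  then have "map (tval S e') (map (ren_trm f) ts) = map (tval S e) ts" by simp
  then show ?case by (simp del: map_map)
qed auto

lemma sat_ren_fm:
  "wf_fm L n \<psi> \<Longrightarrow> (\<And>i. i < n \<Longrightarrow> e' ! f i = e ! i) \<Longrightarrow> sat S e' (ren_fm f \<psi>) = sat S e \<psi>"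
proof (induction \<psi> arbitrary: n f e e')
  case (Rel r ts)
  then have "map (tval S e') (map (ren_trm f) ts) = map (tval S e) ts"
    by (auto intro: tval_ren_trm)
  then show ?case by (simp del: map_map)
next
  case (Exists \<psi>)
  have "sat S (a # e') (ren_fm (case_nat 0 (\<lambda>i. Suc (f i))) \<psi>) = sat S (a # e) \<psi>" for a
    by (rule Exists.IH[of "Suc n"]) (use Exists.prems in \<open>auto split: nat.splits\<close>)
  then show ?case by simp
next
  case (And \<psi>1 \<psi>2)
  from And.IH(1)[of n e' f e] And.IH(2)[of n e' f e] And.prems show ?case by simp
next
  case (Neg \<psi>)
  from Neg.IH[of n e' f e] Neg.prems show ?case by simp
next
  case (Eq s t)
  then show ?case using tval_ren_trm[of L n _ e' f e S] by simp
next
  case (Lt s t)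
  then show ?case using tval_ren_trm[of L n _ e' f e S] by simp
qed

text \<open>The formula and the parameters may not depend on the structure \<open>S\<close>: with \<open>SS = {M, N}\<close> and
  \<open>A = M\<close> this speaks about the interpretations in \<open>M\<close> and in \<open>N\<close> of one formula over \<open>M\<close>.\<close>

definition defble :: "('f, 'r) language \<Rightarrow> ('a, 'f, 'r) struct set \<Rightarrow> 'a set \<Rightarrow> nat \<Rightarrow>
    (('a, 'f, 'r) struct \<Rightarrow> 'a list \<Rightarrow> bool) \<Rightarrow> bool" where
  "defble L SS A n \<phi> \<longleftrightarrow> (\<exists>m \<psi> b. wf_fm L (n + m) \<psi> \<and> b \<in> nlists m A \<and>
     (\<forall>S\<in>SS. \<forall>e\<in>nlists n (universe S). \<phi> S e = sat S (e @ b) \<psi>))"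

text \<open>Maps on tuples each of whose coordinates is a coordinate of the argument or a constant.\<close>

definition adm :: "'a set \<Rightarrow> nat \<Rightarrow> nat \<Rightarrow> ('a list \<Rightarrow> 'a list) \<Rightarrow> bool" where
  "adm A n k \<tau> \<longleftrightarrow> (\<exists>sp. length sp = k \<and> (\<forall>s\<in>set sp. case s of Inl i \<Rightarrow> i < n | Inr a \<Rightarrow> a \<in> A) \<and>
     (\<forall>e. length e = n \<longrightarrow> \<tau> e = map (case_sum (\<lambda>i. e ! i) id) sp))"

lemma defbleI:
  assumes "wf_fm L (n + m) \<psi>" "b \<in> nlists m A"
    "\<And>S e. S \<in> SS \<Longrightarrow> e \<in> nlists n (universe S) \<Longrightarrow> \<phi> S e = sat S (e @ b) \<psi>"
  shows "defble L SS A n \<phi>"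
  unfolding defble_def by (intro exI[of _ m] exI[of _ \<psi>] exI[of _ b]) (use assms in auto)

lemma defbleE:
  assumes "defble L SS A n \<phi>"
  obtains m \<psi> b where "wf_fm L (n + m) \<psi>" "b \<in> nlists m A"
    "\<And>S e. S \<in> SS \<Longrightarrow> e \<in> nlists n (universe S) \<Longrightarrow> \<phi> S e = sat S (e @ b) \<psi>"
  using assms unfolding defble_def by blast

lemma defble_cong:
  assumes "defble L SS A n \<phi>" "\<And>S e. S \<in> SS \<Longrightarrow> e \<in> nlists n (universe S) \<Longrightarrow> \<phi> S e = \<psi> S e"
  shows "defble L SS A n \<psi>"
  using assms(1) by (rule defbleE) (rule defbleI; use assms(2) in auto)

lemma defble_neg:
  assumes "defble L SS A n \<phi>" shows "defble L SS A n (\<lambda>S e. \<not> \<phi> S e)"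
  using assms
proof (rule defbleE)
  fix m \<psi> b assume "wf_fm L (n + m) \<psi>" "b \<in> nlists m A"
    "\<And>S e. S \<in> SS \<Longrightarrow> e \<in> nlists n (universe S) \<Longrightarrow> \<phi> S e = sat S (e @ b) \<psi>"
  then show ?thesis by (intro defbleI[of L n m "Neg \<psi>" b]) auto
qed

lemma defble_and:
  assumes "defble L SS A n \<phi>" "defble L SS A n \<psi>"
  shows "defble L SS A n (\<lambda>S e. \<phi> S e \<and> \<psi> S e)"
proof -
  obtain m \<phi>' b where 1: "wf_fm L (n + m) \<phi>'" "b \<in> nlists m A"
    "\<And>S e. S \<in> SS \<Longrightarrow> e \<in> nlists n (universe S) \<Longrightarrow> \<phi> S e = sat S (e @ b) \<phi>'"
    using assms(1) by (rule defbleE) (rule that)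
  obtain m' \<psi>' c where 2: "wf_fm L (n + m') \<psi>'" "c \<in> nlists m' A"
    "\<And>S e. S \<in> SS \<Longrightarrow> e \<in> nlists n (universe S) \<Longrightarrow> \<psi> S e = sat S (e @ c) \<psi>'"
    using assms(2) by (rule defbleE) (rule that)
  \<comment> \<open>The common parameter list is \<open>b @ c\<close>, so the parameters of the
    second formula move behind the \<open>m\<close> entries of \<open>b\<close>.\<close>
  let ?f = "\<lambda>i. if i < n then i else i + m"
  let ?\<chi> = "And (ren_fm id \<phi>') (ren_fm ?f \<psi>')"
  have "wf_fm L (n + (m + m')) ?\<chi>"
    unfolding wf_fm.simps
  proof
    show "wf_fm L (n + (m + m')) (ren_fm id \<phi>')" by (rule wf_ren_fm[OF 1(1)]) simp
    show "wf_fm L (n + (m + m')) (ren_fm ?f \<psi>')" by (rule wf_ren_fm[OF 2(1)]) simp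
  qed
  moreover have "b @ c \<in> nlists (m + m') A"
    by (rule nlists_appendI[OF 1(2) 2(2)])
  moreover have "(\<phi> S e \<and> \<psi> S e) = sat S (e @ b @ c) ?\<chi>"
    if "S \<in> SS" "e \<in> nlists n (universe S)" for S e
  proof -
    have l: "length e = n" "length b = m" using that(2) 1(2) by (simp_all add: nlists_def)
    have "sat S (e @ b @ c) (ren_fm id \<phi>') = sat S (e @ b) \<phi>'"
      by (rule sat_ren_fm[OF 1(1)]) (use l in \<open>auto simp: nth_append\<close>)
    moreover have "sat S (e @ b @ c) (ren_fm ?f \<psi>') = sat S (e @ c) \<psi>'"
      by (rule sat_ren_fm[OF 2(1)]) (use l in \<open>auto simp: nth_append\<close>)
    ultimately show ?thesis using 1(3)[OF that] 2(3)[OF that] by simp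
  qed
  ultimately show ?thesis by (rule defbleI)
qed

text \<open>The bound variable is entry 0 of the environment. This is why predicates under a
  quantifier are written through \<open>hd e\<close> and \<open>tl e\<close>, here and in all later
  closure rules.\<close>

lemma defble_ex:
  assumes "defble L SS A (Suc n) (\<lambda>S e. \<phi> S (hd e) (tl e))"
  shows "defble L SS A n (\<lambda>S e. \<exists>x\<in>universe S. \<phi> S x e)"
proof -
  obtain m \<psi> b where 1: "wf_fm L (Suc n + m) \<psi>" "b \<in> nlists m A"
    "\<And>S e. S \<in> SS \<Longrightarrow> e \<in> nlists (Suc n) (universe S) \<Longrightarrow> \<phi> S (hd e) (tl e) = sat S (e @ b) \<psi>"
    using assms by (rule defbleE) (rule that)
  have "(\<exists>x\<in>universe S. \<phi> S x e) = sat S (e @ b) (Exists \<psi>)"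
    if "S \<in> SS" "e \<in> nlists n (universe S)" for S e
    using 1(3)[OF that(1), of "_ # e"] that(2) by auto
  moreover have "wf_fm L (n + m) (Exists \<psi>)" using 1(1) by simp
  ultimately show ?thesis using 1(2) by (intro defbleI[of L n m "Exists \<psi>" b])
qed

lemma defble_subst:
  assumes "defble L SS A k \<phi>" "adm A n k \<tau>" "a0 \<in> A" "\<And>S. S \<in> SS \<Longrightarrow> A \<subseteq> universe S"
  shows "defble L SS A n (\<lambda>S e. \<phi> S (\<tau> e))"
proof -
  obtain m \<psi> b where 1: "wf_fm L (k + m) \<psi>" "b \<in> nlists m A"
    "\<And>S e. S \<in> SS \<Longrightarrow> e \<in> nlists k (universe S) \<Longrightarrow> \<phi> S e = sat S (e @ b) \<psi>"
    using assms(1) by (rule defbleE) (rule that)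
  obtain sp where sp: "length sp = k" "\<And>i. Inl i \<in> set sp \<Longrightarrow> i < n" "\<And>a. Inr a \<in> set sp \<Longrightarrow> a \<in> A"
    "\<And>e. length e = n \<Longrightarrow> \<tau> e = map (case_sum (\<lambda>i. e ! i) id) sp"
    using assms(2) unfolding adm_def by fastforce
  \<comment> \<open>A constant coordinate of \<open>\<tau>\<close> becomes a new parameter. One new
    parameter is added per coordinate, with the default \<open>a0\<close> where the coordinate is a
    variable, so that coordinate \<open>i\<close> always has index \<open>n + m + i\<close>.\<close>
  let ?c = "map (case_sum (\<lambda>_. a0) id) sp"
  let ?f = "\<lambda>i. if i < k then (case sp ! i of Inl j \<Rightarrow> j | Inr _ \<Rightarrow> n + m + i) else n + (i - k)"
  have fi: "?f i < n + (m + k)" if "i < k + m" for i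
  proof (cases "i < k")
    case True
    have *: "sp ! i \<in> set sp" using sp(1) True by simp
    show ?thesis
    proof (cases "sp ! i")
      case (Inl j)
      then show ?thesis using True sp(2)[of j] * by simp
    qed (use True in auto)
  qed (use that in auto)
  have "wf_fm L (n + (m + k)) (ren_fm ?f \<psi>)"
    by (rule wf_ren_fm[OF 1(1)])
      (use fi in auto)
  moreover have "b @ ?c \<in> nlists (m + k) A"
    using 1(2) sp(1,3) assms(3) by (auto simp: nlists_def split: sum.splits)
  moreover have "\<phi> S (\<tau> e) = sat S (e @ b @ ?c) (ren_fm ?f \<psi>)"
    if S: "S \<in> SS" "e \<in> nlists n (universe S)" for S e
  proof -
    have l: "length e = n" "length b = m" "set e \<subseteq> universe S"
      using S(2) 1(2) by (simp_all add: nlists_def)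
    have "case_sum (\<lambda>i. e ! i) id s \<in> universe S" if "s \<in> set sp" for s
    proof (cases s)
      case (Inl j)
      then show ?thesis using sp(2)[of j] that l nth_mem[of j e] by auto
    next
      case (Inr a)
      then show ?thesis using sp(3)[of a] that assms(4)[OF S(1)] by auto
    qed
    then have "\<tau> e \<in> nlists k (universe S)"
      using sp(1) sp(4)[of e] l by (auto simp: nlists_def)
    then have "\<phi> S (\<tau> e) = sat S (\<tau> e @ b) \<psi>" using 1(3) S by blast
    also have "\<dots> = sat S (e @ b @ ?c) (ren_fm ?f \<psi>)"
    proof (rule sym, rule sat_ren_fm[OF 1(1)])
      fix i assume i: "i < k + m"
      show "(e @ b @ ?c) ! ?f i = (\<tau> e @ b) ! i"
      proof (cases "i < k")
        case True
        have *: "sp ! i \<in> set sp" using sp(1) True by simp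
        show ?thesis
        proof (cases "sp ! i")
          case (Inl j)
          then show ?thesis using True sp(1) sp(2)[of j] sp(4)[of e] * l by (simp add: nth_append)
        next
          case (Inr a)
          then show ?thesis using True sp(1) sp(4)[of e] l by (simp add: nth_append)
        qed
      next
        case False
        then show ?thesis using i l sp(1) by (auto simp: nth_append sp(4))
      qed
    qed
    finally show ?thesis .
  qed
  ultimately show ?thesis by (rule defbleI)
qed

lemma defble_lt: "defble L SS A 2 (\<lambda>S e. lt S (hd e) (hd (tl e)))"
  by (rule defbleI[of L 2 0 "Lt (Var 0) (Var 1)" "[]"]) (auto simp: numeral_2_eq_2 in_nlists_Suc_iff)

lemma defble_eq: "defble L SS A 2 (\<lambda>S e. hd e = hd (tl e))"
  by (rule defbleI[of L 2 0 "Eq (Var 0) (Var 1)" "[]"]) (auto simp: numeral_2_eq_2 in_nlists_Suc_iff)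

lemma defble_True:
  assumes "a \<in> A" shows "defble L SS A n (\<lambda>_ _. True)"
  by (rule defbleI[of L n 1 "Eq (Var n) (Var n)" "[a]"]) (use assms in \<open>auto simp: nlists_def\<close>)

lemma defble_fm:
  assumes "wf_fm L (n + m) \<psi>" "b \<in> nlists m A"
  shows "defble L SS A n (\<lambda>S e. sat S (e @ b) \<psi>)"
  using assms by (rule defbleI) simp

section \<open>Coordinate maps built from list operations\<close>

lemma adm_id: "n = k \<Longrightarrow> adm A n k (\<lambda>e. e)"
  unfolding adm_def by (intro exI[of _ "map Inl [0..<n]"]) (auto simp: map_nth comp_def)

lemma adm_drop:
  assumes "adm A n j \<tau>" "k = j - i" shows "adm A n k (\<lambda>e. drop i (\<tau> e))"
proof -
  obtain sp where "length sp = j" "\<forall>s\<in>set sp. case s of Inl i \<Rightarrow> i < n | Inr a \<Rightarrow> a \<in> A"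
     "\<forall>e. length e = n \<longrightarrow> \<tau> e = map (case_sum (\<lambda>i. e ! i) id) sp"
    using assms unfolding adm_def by blast
  then show ?thesis unfolding adm_def
    by (intro exI[of _ "drop i sp"]) (auto simp: assms(2) drop_map dest: in_set_dropD)
qed

lemma adm_take:
  assumes "adm A n j \<tau>" "k \<le> j" shows "adm A n k (\<lambda>e. take k (\<tau> e))"
proof -
  obtain sp where "length sp = j" "\<forall>s\<in>set sp. case s of Inl i \<Rightarrow> i < n | Inr a \<Rightarrow> a \<in> A"
     "\<forall>e. length e = n \<longrightarrow> \<tau> e = map (case_sum (\<lambda>i. e ! i) id) sp"
    using assms unfolding adm_def by blast
  then show ?thesis unfolding adm_def
    by (intro exI[of _ "take k sp"]) (use assms(2) in \<open>auto simp: take_map dest: in_set_takeD\<close>)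
qed

lemma adm_tl: "adm A n j \<tau> \<Longrightarrow> k = j - 1 \<Longrightarrow> adm A n k (\<lambda>e. tl (\<tau> e))"
  using adm_drop[of A n j \<tau> k 1] by (simp add: drop_Suc)

lemma adm_append:
  assumes "adm A n i \<tau>" "adm A n j \<sigma>" "k = i + j" shows "adm A n k (\<lambda>e. \<tau> e @ \<sigma> e)"
proof -
  obtain sp where 1: "length sp = i" "\<forall>s\<in>set sp. case s of Inl i \<Rightarrow> i < n | Inr a \<Rightarrow> a \<in> A"
     "\<forall>e. length e = n \<longrightarrow> \<tau> e = map (case_sum (\<lambda>i. e ! i) id) sp"
    using assms(1) unfolding adm_def by blast
  obtain sp' where 2: "length sp' = j" "\<forall>s\<in>set sp'. case s of Inl i \<Rightarrow> i < n | Inr a \<Rightarrow> a \<in> A"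
     "\<forall>e. length e = n \<longrightarrow> \<sigma> e = map (case_sum (\<lambda>i. e ! i) id) sp'"
    using assms(2) unfolding adm_def by blast
  show ?thesis unfolding adm_def
    by (intro exI[of _ "sp @ sp'"]) (use 1 2 assms(3) in auto)
qed

lemma adm_const: "t \<in> nlists k A \<Longrightarrow> adm A n k (\<lambda>_. t)"
  unfolding adm_def by (intro exI[of _ "map Inr t"]) (auto simp: nlists_def comp_def)

lemma adm_length: "adm A n k \<tau> \<Longrightarrow> length e = n \<Longrightarrow> length (\<tau> e) = k"
  unfolding adm_def by auto

definition adm1 :: "'a set \<Rightarrow> nat \<Rightarrow> ('a list \<Rightarrow> 'a) \<Rightarrow> bool" where
  "adm1 A n s \<longleftrightarrow> adm A n 1 (\<lambda>e. [s e])"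

lemma adm1_const: "a \<in> A \<Longrightarrow> adm1 A n (\<lambda>_. a)"
  unfolding adm1_def by (rule adm_const) (simp add: nlists_def)

lemma adm1_hd:
  assumes "adm A n j \<tau>" "0 < j" shows "adm1 A n (\<lambda>e. hd (\<tau> e))"
proof -
  have "adm A n 1 (\<lambda>e. take 1 (\<tau> e))" by (rule adm_take[OF assms(1)]) (use assms in auto)
  moreover have "take 1 (\<tau> e) = [hd (\<tau> e)]" if "length e = n" for e
    using adm_length[OF assms(1) that] assms(2) by (cases "\<tau> e") auto
  ultimately show ?thesis unfolding adm1_def adm_def by auto
qed

lemma adm_Nil: "k = 0 \<Longrightarrow> adm A n k (\<lambda>_. [])"
  by (rule adm_const) simp

lemma adm_Cons:
  assumes "adm1 A n s" "adm A n j \<tau>" "k = Suc j" shows "adm A n k (\<lambda>e. s e # \<tau> e)"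
  using adm_append[of A n 1 "\<lambda>e. [s e]" j \<tau> k] assms unfolding adm1_def by simp

lemmas adm_intros = adm_const adm_Nil adm_tl adm_take adm_drop adm_append adm_Cons adm1_const adm1_hd adm_id

section \<open>O-minimal structures\<close>

text \<open>The order is total on the whole type, while density and all quantifiers are relative to \<open>U\<close>.
  \<open>D n \<phi>\<close> says that \<open>\<phi>\<close> is a definable predicate on \<open>U\<^sup>n\<close>.\<close>

locale omin = linorder less_eq less
  for less_eq :: "'a \<Rightarrow> 'a \<Rightarrow> bool" (infix "\<sqsubseteq>" 50) and less :: "'a \<Rightarrow> 'a \<Rightarrow> bool" (infix "\<sqsubset>" 50) +
  fixes U :: "'a set" and D :: "nat \<Rightarrow> ('a list \<Rightarrow> bool) \<Rightarrow> bool"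
  assumes D_cong: "D n \<phi> \<Longrightarrow> (\<And>e. e \<in> nlists n U \<Longrightarrow> \<phi> e = \<psi> e) \<Longrightarrow> D n \<psi>"
    and D_neg: "D n \<phi> \<Longrightarrow> D n (\<lambda>e. \<not> \<phi> e)"
    and D_and: "D n \<phi> \<Longrightarrow> D n \<psi> \<Longrightarrow> D n (\<lambda>e. \<phi> e \<and> \<psi> e)"
    and D_ex: "D (Suc n) (\<lambda>e. \<chi> (hd e) (tl e)) \<Longrightarrow> D n (\<lambda>e. \<exists>x\<in>U. \<chi> x e)"
    and D_subst: "D k \<phi> \<Longrightarrow> adm U n k \<tau> \<Longrightarrow> D n (\<lambda>e. \<phi> (\<tau> e))"
    and D_lt0: "D 2 (\<lambda>e. hd e \<sqsubset> hd (tl e))"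
    and D_eq0: "D 2 (\<lambda>e. hd e = hd (tl e))"
    and U_ne: "U \<noteq> {}"
    and dns: "x \<in> U \<Longrightarrow> y \<in> U \<Longrightarrow> x \<sqsubset> y \<Longrightarrow> \<exists>z\<in>U. x \<sqsubset> z \<and> z \<sqsubset> y"
    and below: "x \<in> U \<Longrightarrow> \<exists>y\<in>U. y \<sqsubset> x"
    and above: "x \<in> U \<Longrightarrow> \<exists>y\<in>U. x \<sqsubset> y"
    and finite_break: "D 1 (\<lambda>e. P (hd e)) \<Longrightarrow> \<exists>E. finite E \<and> E \<subseteq> U \<and>
      (\<forall>x\<in>U. \<forall>y\<in>U. x \<sqsubset> y \<longrightarrow> (\<forall>z\<in>E. z \<sqsubset> x \<or> y \<sqsubset> z) \<longrightarrow> P x = P y)"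

named_theorems dint

lemmas [dint] = adm_intros

context omin
begin

section \<open>Definable predicates under connectives, quantifiers and substitution\<close>

lemma D_eq [dint]: "adm1 U n s \<Longrightarrow> adm1 U n t \<Longrightarrow> D n (\<lambda>e. s e = t e)"
  using D_subst[OF D_eq0 adm_append[of U n 1 "\<lambda>e. [s e]" 1 "\<lambda>e. [t e]" 2]] unfolding adm1_def by simp

lemma D_lt [dint]: "adm1 U n s \<Longrightarrow> adm1 U n t \<Longrightarrow> D n (\<lambda>e. s e \<sqsubset> t e)"
  using D_subst[OF D_lt0 adm_append[of U n 1 "\<lambda>e. [s e]" 1 "\<lambda>e. [t e]" 2]] unfolding adm1_def by simp

lemma D_le [dint]: "adm1 U n s \<Longrightarrow> adm1 U n t \<Longrightarrow> D n (\<lambda>e. s e \<sqsubseteq> t e)"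
  using D_neg[OF D_lt[of n t s]] by (simp add: not_less)

lemma D_const [dint]: "D n (\<lambda>_. c)"
proof -
  obtain a where "a \<in> U" using U_ne by blast
  then have "D n (\<lambda>e. a = a)" by (intro D_eq adm1_const)
  then show ?thesis using D_neg[of n "\<lambda>e. a = a"] by (cases c) auto
qed

lemmas [dint] = D_neg D_and D_ex

lemma D_or [dint]:
  assumes "D n \<phi>" "D n \<psi>" shows "D n (\<lambda>e. \<phi> e \<or> \<psi> e)"
  by (rule D_cong[OF D_neg[OF D_and[OF D_neg[OF assms(1)] D_neg[OF assms(2)]]]]) blast

lemma D_imp [dint]:
  assumes "D n \<phi>" "D n \<psi>" shows "D n (\<lambda>e. \<phi> e \<longrightarrow> \<psi> e)"
  by (rule D_cong[OF D_or[OF D_neg[OF assms(1)] assms(2)]]) blast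

lemma D_iff [dint]:
  assumes "D n \<phi>" "D n \<psi>" shows "D n (\<lambda>e. \<phi> e = \<psi> e)"
  by (rule D_cong[OF D_and[OF D_imp[OF assms] D_imp[OF assms(2,1)]]]) blast

lemma D_all [dint]:
  assumes "D (Suc n) (\<lambda>e. \<chi> (hd e) (tl e))" shows "D n (\<lambda>e. \<forall>x\<in>U. \<chi> x e)"
  by (rule D_cong[OF D_neg[OF D_ex[of n "\<lambda>x e. \<not> \<chi> x e", OF D_neg[OF assms]]]]) blast

lemma D_exl [dint]:
  "D (k + n) (\<lambda>e. \<chi> (take k e) (drop k e)) \<Longrightarrow> D n (\<lambda>e. \<exists>t\<in>nlists k U. \<chi> t e)"
proof (induction k arbitrary: n \<chi>)
  case 0
  then show ?case by simp
next
  case (Suc k)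
  have "adm U (k + Suc n) (Suc k + n) (\<lambda>e. (hd (drop k e) # take k e) @ tl (drop k e))"
    by (rule dint refl | simp)+
  from D_subst[OF Suc.prems this]
  have "D (k + Suc n) (\<lambda>e. \<chi> (hd (drop k e) # take k e) (tl (drop k e)))"
    by (rule D_cong) (simp add: nlists_def)
  then have "D (Suc n) (\<lambda>e. \<exists>t\<in>nlists k U. \<chi> (hd e # t) (tl e))" by (rule Suc.IH)
  then have "D n (\<lambda>e. \<exists>x\<in>U. \<exists>t\<in>nlists k U. \<chi> (x # t) e)" by (rule D_ex)
  then show ?case by (simp add: nlists_Suc)
qed

lemma D_alll [dint]:
  assumes "D (k + n) (\<lambda>e. \<chi> (take k e) (drop k e))" shows "D n (\<lambda>e. \<forall>t\<in>nlists k U. \<chi> t e)"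
  by (rule D_cong[OF D_neg[OF D_exl[of k n "\<lambda>t e. \<not> \<chi> t e", OF D_neg[OF assms]]]]) blast

lemma D_fin_ex: "finite I \<Longrightarrow> (\<And>i. i \<in> I \<Longrightarrow> D n (\<phi> i)) \<Longrightarrow> D n (\<lambda>e. \<exists>i\<in>I. \<phi> i e)"
proof (induction I rule: finite_induct)
  case (insert i I)
  then show ?case using D_or[of n "\<phi> i" "\<lambda>e. \<exists>i\<in>I. \<phi> i e"] by simp
qed (simp add: D_const)

text \<open>The variants that follow are \<open>D_subst\<close> for predicates in curried form. Each
  letter of the suffix stands for one argument, \<open>e\<close> for a point and \<open>l\<close>
  for a tuple. Instantiated with a predicate already known to be definable, they join the rules
  \<open>dint\<close>, which decompose a definability goal along its syntax.\<close>

lemma D_l: "D k R \<Longrightarrow> adm U n k \<tau> \<Longrightarrow> D n (\<lambda>e. R (\<tau> e))"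
  by (rule D_subst)

lemma D_e: "D 1 (\<lambda>e. R (hd e)) \<Longrightarrow> adm1 U n s \<Longrightarrow> D n (\<lambda>e. R (s e))"
  using D_subst[of 1 "\<lambda>e. R (hd e)" n "\<lambda>e. [s e]"] by (simp add: adm1_def)

lemma D_ee: "D 2 (\<lambda>e. R (hd e) (hd (tl e))) \<Longrightarrow> adm1 U n s \<Longrightarrow> adm1 U n t \<Longrightarrow> D n (\<lambda>e. R (s e) (t e))"
  using D_subst[of 2 "\<lambda>e. R (hd e) (hd (tl e))" n "\<lambda>e. [s e, t e]"]
    adm_Cons[of U n s 1 "\<lambda>e. [t e]" 2] by (simp add: adm1_def)

lemma D_el: "D (Suc k) (\<lambda>e. R (hd e) (tl e)) \<Longrightarrow> adm1 U n s \<Longrightarrow> adm U n k \<tau> \<Longrightarrow> D n (\<lambda>e. R (s e) (\<tau> e))"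
  using D_subst[of "Suc k" "\<lambda>e. R (hd e) (tl e)" n "\<lambda>e. s e # \<tau> e"] adm_Cons[of U n s k \<tau> "Suc k"]
  by simp

lemma D_ll:
  assumes "D (j + k) (\<lambda>e. R (take j e) (drop j e))" "adm U n j \<sigma>" "adm U n k \<tau>"
  shows "D n (\<lambda>e. R (\<sigma> e) (\<tau> e))"
proof -
  have "D n (\<lambda>e. R (take j (\<sigma> e @ \<tau> e)) (drop j (\<sigma> e @ \<tau> e)))"
    by (rule D_subst[OF assms(1)]) (rule adm_append[OF assms(2,3) refl])
  then show ?thesis by (rule D_cong) (simp add: nlists_def adm_length[OF assms(2)])
qed

lemma D_eel:
  assumes "D (Suc (Suc k)) (\<lambda>e. R (hd e) (hd (tl e)) (tl (tl e)))" "adm1 U n s" "adm1 U n t" "adm U n k \<tau>"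
  shows "D n (\<lambda>e. R (s e) (t e) (\<tau> e))"
  using D_subst[OF assms(1) adm_Cons[OF assms(2) adm_Cons[OF assms(3,4) refl] refl]] by simp

lemma D_eeel:
  assumes "D (Suc (Suc (Suc k))) (\<lambda>e. R (hd e) (hd (tl e)) (hd (tl (tl e))) (tl (tl (tl e))))"
    "adm1 U n s" "adm1 U n t" "adm1 U n u" "adm U n k \<tau>"
  shows "D n (\<lambda>e. R (s e) (t e) (u e) (\<tau> e))"
  using D_subst[OF assms(1) adm_Cons[OF assms(2) adm_Cons[OF assms(3) adm_Cons[OF assms(4,5) refl] refl] refl]]
  by simp

lemma D_ell:
  assumes "D (Suc (j + k)) (\<lambda>e. R (hd e) (take j (tl e)) (drop j (tl e)))"
    "adm1 U n s" "adm U n j \<sigma>" "adm U n k \<tau>"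
  shows "D n (\<lambda>e. R (s e) (\<sigma> e) (\<tau> e))"
proof -
  have "D n (\<lambda>e. R (s e) (take j (\<sigma> e @ \<tau> e)) (drop j (\<sigma> e @ \<tau> e)))"
    using D_subst[OF assms(1) adm_Cons[OF assms(2) adm_append[OF assms(3,4) refl] refl]] by simp
  then show ?thesis by (rule D_cong) (simp add: nlists_def adm_length[OF assms(3)])
qed

lemma D_eell:
  assumes "D (Suc (Suc (j + k))) (\<lambda>e. R (hd e) (hd (tl e)) (take j (tl (tl e))) (drop j (tl (tl e))))"
    "adm1 U n s" "adm1 U n t" "adm U n j \<sigma>" "adm U n k \<tau>"
  shows "D n (\<lambda>e. R (s e) (t e) (\<sigma> e) (\<tau> e))"
proof -
  have "D n (\<lambda>e. R (s e) (t e) (take j (\<sigma> e @ \<tau> e)) (drop j (\<sigma> e @ \<tau> e)))"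
    using D_subst[OF assms(1) adm_Cons[OF assms(2) adm_Cons[OF assms(3) adm_append[OF assms(4,5) refl] refl] refl]]
    by simp
  then show ?thesis by (rule D_cong) (simp add: nlists_def adm_length[OF assms(4)])
qed

lemma nlists_hd: "e \<in> nlists (Suc n) U \<Longrightarrow> hd e \<in> U"
  and nlists_tl: "e \<in> nlists (Suc n) U \<Longrightarrow> tl e \<in> nlists n U"
  by (auto simp: in_nlists_Suc_iff)

lemma D_fibre: "D (Suc n) (\<lambda>e. \<chi> (hd e) (tl e)) \<Longrightarrow> t \<in> nlists n U \<Longrightarrow> D 1 (\<lambda>e. \<chi> (hd e) t)"
  by (rule D_el; (rule dint refl | simp)+)

text \<open>The axioms are symmetric under reversal of the order, so facts about the left side of a
  point follow from those about the right side.\<close>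

lemma dual: "omin (\<lambda>x y. y \<sqsubseteq> x) (\<lambda>x y. y \<sqsubset> x) U D"
proof (intro omin.intro dual_linorder omin_axioms.intro)
  show "D 2 (\<lambda>e. hd (tl e) \<sqsubset> hd e)" by (rule dint refl | simp)+
  show "\<exists>z\<in>U. z \<sqsubset> x \<and> y \<sqsubset> z" if "x \<in> U" "y \<in> U" "y \<sqsubset> x" for x y
    using dns[of y x] that by blast
  show "\<exists>E. finite E \<and> E \<subseteq> U \<and>
      (\<forall>x\<in>U. \<forall>y\<in>U. y \<sqsubset> x \<longrightarrow> (\<forall>z\<in>E. x \<sqsubset> z \<or> z \<sqsubset> y) \<longrightarrow> P x = P y)"
    if P: "D 1 (\<lambda>e. P (hd e))" for P
  proof -
    obtain E where E: "finite E" "E \<subseteq> U"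
      "\<forall>x\<in>U. \<forall>y\<in>U. x \<sqsubset> y \<longrightarrow> (\<forall>z\<in>E. z \<sqsubset> x \<or> y \<sqsubset> z) \<longrightarrow> P x = P y"
      using finite_break[OF P] by blast
    have "P x = P y" if "x \<in> U" "y \<in> U" "y \<sqsubset> x" "\<forall>z\<in>E. x \<sqsubset> z \<or> z \<sqsubset> y" for x y
    proof -
      have "\<forall>z\<in>E. z \<sqsubset> y \<or> x \<sqsubset> z" using that(4) by blast
      then show ?thesis using E(3) that(1-3) by blast
    qed
    then show ?thesis using E(1,2) by blast
  qed
  show "D n \<psi>" if "D n \<phi>" "\<And>e. e \<in> nlists n U \<Longrightarrow> \<phi> e = \<psi> e" for n \<phi> \<psi>
    using that by (rule D_cong)
  show "D n (\<lambda>e. \<phi> (\<tau> e))" if "D k \<phi>" "adm U n k \<tau>" for n k \<phi> \<tau>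
    using that by (rule D_subst)
qed (erule D_neg D_ex below above | erule (1) D_and | rule D_eq0 U_ne)+

subsection \<open>Definable subsets of the line\<close>

lemma fin_max: "finite E \<Longrightarrow> E \<noteq> {} \<Longrightarrow> \<exists>m\<in>E. \<forall>z\<in>E. z \<sqsubseteq> m"
proof (induction E rule: finite_ne_induct)
  case (insert x F)
  then show ?case by (metis insert_iff linear order_trans order_refl)
qed simp

lemma fin_min: "finite E \<Longrightarrow> E \<noteq> {} \<Longrightarrow> \<exists>m\<in>E. \<forall>z\<in>E. m \<sqsubseteq> z"
proof (induction E rule: finite_ne_induct)
  case (insert x F)
  then show ?case by (metis insert_iff linear order_trans order_refl)
qed simp

lemma dns_min:
  assumes "a \<in> U" "b \<in> U" "c \<in> U" "a \<sqsubset> b" "a \<sqsubset> c"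
  shows "\<exists>z\<in>U. a \<sqsubset> z \<and> z \<sqsubset> b \<and> z \<sqsubset> c"
proof (cases "b \<sqsubseteq> c")
  case True
  then show ?thesis using dns[of a b] assms less_le_trans by blast
next
  case False
  then show ?thesis using dns[of a c] assms less_trans not_le by blast
qed

lemma dns_max:
  assumes "a \<in> U" "b \<in> U" "c \<in> U" "b \<sqsubset> a" "c \<sqsubset> a"
  shows "\<exists>z\<in>U. b \<sqsubset> z \<and> c \<sqsubset> z \<and> z \<sqsubset> a"
proof (cases "b \<sqsubseteq> c")
  case True
  then show ?thesis using dns[of c a] assms le_less_trans by blast
next
  case False
  then show ?thesis using dns[of b a] assms less_trans not_le by blast
qed

definition itv :: "'a \<Rightarrow> 'a \<Rightarrow> 'a set" where
  "itv u v = {x\<in>U. u \<sqsubset> x \<and> x \<sqsubset> v}"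

lemma in_itv [simp]: "x \<in> itv u v \<longleftrightarrow> x \<in> U \<and> u \<sqsubset> x \<and> x \<sqsubset> v"
  by (auto simp: itv_def)

lemma right_gap:
  assumes "finite E" "E \<subseteq> U" "x \<in> U"
  shows "\<exists>v\<in>U. x \<sqsubset> v \<and> (\<forall>z\<in>E. x \<sqsubset> z \<longrightarrow> v \<sqsubset> z)"
proof (cases "{z\<in>E. x \<sqsubset> z} = {}")
  case True
  then show ?thesis using above[OF assms(3)] by blast
next
  case False
  then obtain m where m: "m \<in> E" "x \<sqsubset> m" "\<forall>z\<in>E. x \<sqsubset> z \<longrightarrow> m \<sqsubseteq> z"
    using fin_min[of "{z\<in>E. x \<sqsubset> z}"] assms(1) by auto
  then obtain v where "v \<in> U" "x \<sqsubset> v" "v \<sqsubset> m" using dns[of x m] assms by blast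
  then show ?thesis using m by (meson less_le_trans)
qed

lemma infinite_itv:
  assumes "u \<in> U" "v \<in> U" "u \<sqsubset> v" shows "infinite (itv u v)"
proof
  assume fin: "finite (itv u v)"
  have "itv u v \<noteq> {}" using dns[of u v] assms by (auto simp: itv_def)
  then obtain m where m: "m \<in> itv u v" "\<forall>z\<in>itv u v. z \<sqsubseteq> m" using fin_max fin by blast
  then obtain z where "z \<in> U" "m \<sqsubset> z" "z \<sqsubset> v" using dns[of m v] assms by auto
  then show False using m by (meson in_itv less_trans not_le)
qed

text \<open>The boundary of the set \<open>P\<close> in the order topology. Being a formula in
  \<open>P\<close>, it turns a definable family into a definable family of boundaries.\<close>

definition bd :: "('a \<Rightarrow> bool) \<Rightarrow> 'a \<Rightarrow> bool" where
  "bd P x \<longleftrightarrow> (\<forall>u\<in>U. \<forall>v\<in>U. u \<sqsubset> x \<and> x \<sqsubset> v \<longrightarrow> (\<exists>y\<in>U. u \<sqsubset> y \<and> y \<sqsubset> v \<and> P y \<noteq> P x))"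

lemma not_bdD:
  "\<not> bd P x \<Longrightarrow> \<exists>u\<in>U. \<exists>v\<in>U. u \<sqsubset> x \<and> x \<sqsubset> v \<and> (\<forall>y\<in>U. u \<sqsubset> y \<longrightarrow> y \<sqsubset> v \<longrightarrow> P y = P x)"
  unfolding bd_def by blast

lemma right_germ:
  assumes "D 1 (\<lambda>e. P (hd e))" "x \<in> U"
  shows "\<exists>v\<in>U. x \<sqsubset> v \<and> ((\<forall>y\<in>itv x v. P y) \<or> (\<forall>y\<in>itv x v. \<not> P y))"
proof -
  obtain E where E: "finite E" "E \<subseteq> U"
    "\<forall>x\<in>U. \<forall>y\<in>U. x \<sqsubset> y \<longrightarrow> (\<forall>z\<in>E. z \<sqsubset> x \<or> y \<sqsubset> z) \<longrightarrow> P x = P y"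
    using finite_break[OF assms(1)] by blast
  obtain v where v: "v \<in> U" "x \<sqsubset> v" "\<forall>z\<in>E. x \<sqsubset> z \<longrightarrow> v \<sqsubset> z"
    using right_gap[OF E(1,2) assms(2)] by blast
  obtain w where w: "w \<in> U" "x \<sqsubset> w" "w \<sqsubset> v" using dns assms(2) v by blast
  have "P y = P w" if "y \<in> itv x v" for y
  proof -
    have "z \<sqsubset> y \<and> z \<sqsubset> w \<or> y \<sqsubset> z \<and> w \<sqsubset> z" if "z \<in> E" for z
      using v(3) that w \<open>y \<in> itv x v\<close> by (metis in_itv le_less_trans less_trans not_less)
    then show ?thesis using E(3) that w by (metis in_itv neqE)
  qed
  then show ?thesis using v by metis
qed

lemma left_germ:
  assumes "D 1 (\<lambda>e. P (hd e))" "x \<in> U"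
  shows "\<exists>u\<in>U. u \<sqsubset> x \<and> ((\<forall>y\<in>itv u x. P y) \<or> (\<forall>y\<in>itv u x. \<not> P y))"
proof -
  interpret d: omin "\<lambda>x y. y \<sqsubseteq> x" "\<lambda>x y. y \<sqsubset> x" U D by (rule dual)
  show ?thesis using d.right_germ[OF assms] by (simp add: d.itv_def itv_def conj_commute)
qed

lemma finite_bd:
  assumes "D 1 (\<lambda>e. P (hd e))" shows "finite {x\<in>U. bd P x}"
proof -
  obtain E where E: "finite E" "E \<subseteq> U"
    "\<forall>x\<in>U. \<forall>y\<in>U. x \<sqsubset> y \<longrightarrow> (\<forall>z\<in>E. z \<sqsubset> x \<or> y \<sqsubset> z) \<longrightarrow> P x = P y"
    using finite_break[OF assms(1)] by blast
  interpret d: omin "\<lambda>x y. y \<sqsubseteq> x" "\<lambda>x y. y \<sqsubset> x" U D by (rule dual)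
  have "x \<in> E" if x: "x \<in> U" "bd P x" for x
  proof (rule ccontr)
    assume xE: "x \<notin> E"
    obtain v where v: "v \<in> U" "x \<sqsubset> v" "\<forall>z\<in>E. x \<sqsubset> z \<longrightarrow> v \<sqsubset> z"
      using right_gap[OF E(1,2) x(1)] by blast
    obtain u where u: "u \<in> U" "u \<sqsubset> x" "\<forall>z\<in>E. z \<sqsubset> x \<longrightarrow> z \<sqsubset> u"
      using d.right_gap[OF E(1,2) x(1)] by blast
    obtain y where y: "y \<in> U" "u \<sqsubset> y" "y \<sqsubset> v" "P y \<noteq> P x" using x(2) u v unfolding bd_def by blast
    have "z \<sqsubset> y \<and> z \<sqsubset> x \<or> y \<sqsubset> z \<and> x \<sqsubset> z" if "z \<in> E" for z
      using v(3) u(3) that xE y by (metis less_trans neqE)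
    then show False using E(3) y x(1) by (metis neqE)
  qed
  then have "{x\<in>U. bd P x} \<subseteq> E" by blast
  then show ?thesis using E(1) by (rule finite_subset)
qed

text \<open>Definable connectedness of intervals, which replaces suprema in what follows. Among
  \<open>a\<close>, \<open>b\<close> and the break points between them take the last one where the
  value is still \<open>P a\<close>, and its successor. The predicate is constant in the gap between
  these two, so it must jump at one of them.\<close>

lemma ex_bd:
  assumes "D 1 (\<lambda>e. P (hd e))" "a \<in> U" "b \<in> U" "a \<sqsubset> b" "P a \<noteq> P b"
  shows "\<exists>s\<in>U. a \<sqsubseteq> s \<and> s \<sqsubseteq> b \<and> bd P s"
proof (rule ccontr)
  assume nbd: "\<not> ?thesis"
  obtain E where E: "finite E" "E \<subseteq> U"
    "\<forall>x\<in>U. \<forall>y\<in>U. x \<sqsubset> y \<longrightarrow> (\<forall>z\<in>E. z \<sqsubset> x \<or> y \<sqsubset> z) \<longrightarrow> P x = P y"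
    using finite_break[OF assms(1)] by blast
  let ?W = "insert a (insert b {z\<in>E. a \<sqsubseteq> z \<and> z \<sqsubseteq> b})"
  have W: "finite ?W" "?W \<subseteq> U" "\<And>z. z \<in> ?W \<Longrightarrow> a \<sqsubseteq> z \<and> z \<sqsubseteq> b" using E assms by auto
  obtain c where c: "c \<in> ?W" "P c = P a" "\<forall>z\<in>?W. P z = P a \<longrightarrow> z \<sqsubseteq> c"
    using fin_max[of "{z\<in>?W. P z = P a}"] W(1) by auto
  have "c \<noteq> b" using c(2) assms(5) by auto
  then have "c \<sqsubset> b" using W(3)[OF c(1)] by auto
  then obtain d where d: "d \<in> ?W" "c \<sqsubset> d" "\<forall>z\<in>?W. c \<sqsubset> z \<longrightarrow> d \<sqsubseteq> z"
    using fin_min[of "{z\<in>?W. c \<sqsubset> z}"] W(1) by auto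
  have Pd: "P d \<noteq> P c" using c d by (metis not_le)
  have cU: "c \<in> U" "d \<in> U" using W(2) c(1) d(1) by blast+
  have nb: "\<not> bd P c" "\<not> bd P d" using nbd W(3)[OF c(1)] W(3)[OF d(1)] cU by blast+
  obtain u v where uv: "v \<in> U" "u \<sqsubset> c" "c \<sqsubset> v" "\<And>y. y \<in> U \<Longrightarrow> u \<sqsubset> y \<Longrightarrow> y \<sqsubset> v \<Longrightarrow> P y = P c"
    using not_bdD[OF nb(1)] by blast
  obtain u' v' where uv': "u' \<in> U" "u' \<sqsubset> d" "d \<sqsubset> v'" "\<And>y. y \<in> U \<Longrightarrow> u' \<sqsubset> y \<Longrightarrow> y \<sqsubset> v' \<Longrightarrow> P y = P d"
    using not_bdD[OF nb(2)] by blast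
  obtain y where y: "y \<in> U" "c \<sqsubset> y" "y \<sqsubset> v" "y \<sqsubset> d"
    using dns_min[of c v d] uv d cU by blast
  obtain y' where y': "y' \<in> U" "y \<sqsubset> y'" "u' \<sqsubset> y'" "y' \<sqsubset> d"
    using dns_max[of d y u'] uv' y cU by blast
  have "z \<sqsubset> y \<or> y' \<sqsubset> z" if "z \<in> E" for z
  proof (rule ccontr)
    assume "\<not> ?thesis"
    then have "y \<sqsubseteq> z" "z \<sqsubseteq> y'" by auto
    moreover from this have "z \<in> ?W" using that W(3)[OF c(1)] W(3)[OF d(1)] y y'
      by (auto intro: order_trans less_imp_le)
    ultimately show False using d(3) y y' by (meson le_less_trans less_le_trans not_le)
  qed
  then have "P y = P y'" using E(3) y y' by blast
  moreover have "P y = P c" using uv(2) y by (intro uv(4)) (auto intro: less_trans)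
  moreover have "P y' = P d" using uv'(3) y' by (intro uv'(4)) (auto intro: less_trans)
  ultimately show False using Pd by simp
qed

text \<open>Infinitely many points of \<open>P\<close> are not break points, and only finitely many
  sets of break points can lie below a point. So two of these points have the same break points
  below them, and none lies in between.\<close>

lemma infinite_ex_itv:
  assumes "D 1 (\<lambda>e. P (hd e))" "infinite {x\<in>U. P x}"
  shows "\<exists>u\<in>U. \<exists>v\<in>U. u \<sqsubset> v \<and> (\<forall>x\<in>itv u v. P x)"
proof -
  obtain E where E: "finite E" "E \<subseteq> U"
    "\<forall>x\<in>U. \<forall>y\<in>U. x \<sqsubset> y \<longrightarrow> (\<forall>z\<in>E. z \<sqsubset> x \<or> y \<sqsubset> z) \<longrightarrow> P x = P y"
    using finite_break[OF assms(1)] by blast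
  let ?X = "{x\<in>U. P x} - E" and ?f = "\<lambda>x. {z\<in>E. z \<sqsubset> x}"
  have "?f ` ?X \<subseteq> Pow E" by auto
  then have "finite (?f ` ?X)" using E(1) finite_subset[of _ "Pow E"] by simp
  moreover have "infinite ?X" using assms(2) E(1) by simp
  ultimately have "\<not> inj_on ?f ?X" using finite_imageD by blast
  then obtain x y where xy: "x \<in> ?X" "y \<in> ?X" "?f x = ?f y" "x \<noteq> y" unfolding inj_on_def by blast
  obtain x y where xy: "x \<in> ?X" "y \<in> ?X" "?f x = ?f y" "x \<sqsubset> y"
  proof (cases "x \<sqsubset> y")
    case True then show ?thesis using xy that by blast
  next
    case False then show ?thesis using xy that[of y x] by (metis neqE)
  qed
  have "P w" if "w \<in> itv x y" for w
  proof -
    have "z \<sqsubset> x \<or> w \<sqsubset> z" if "z \<in> E" for z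
      using xy that \<open>w \<in> itv x y\<close> by (metis (mono_tags, lifting) DiffD2 in_itv le_less_trans mem_Collect_eq neqE not_less)
    then show ?thesis using E(3) xy(1) that by auto
  qed
  then show ?thesis using xy by blast
qed

lemma infinite_iff:
  assumes "D 1 (\<lambda>e. P (hd e))"
  shows "infinite {x\<in>U. P x} \<longleftrightarrow> (\<exists>u\<in>U. \<exists>v\<in>U. u \<sqsubset> v \<and> (\<forall>x\<in>U. u \<sqsubset> x \<and> x \<sqsubset> v \<longrightarrow> P x))"
proof
  assume "infinite {x\<in>U. P x}"
  then show "\<exists>u\<in>U. \<exists>v\<in>U. u \<sqsubset> v \<and> (\<forall>x\<in>U. u \<sqsubset> x \<and> x \<sqsubset> v \<longrightarrow> P x)"
    using infinite_ex_itv[OF assms] by (auto simp: Ball_def)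
next
  assume "\<exists>u\<in>U. \<exists>v\<in>U. u \<sqsubset> v \<and> (\<forall>x\<in>U. u \<sqsubset> x \<and> x \<sqsubset> v \<longrightarrow> P x)"
  then obtain u v where uv: "u \<in> U" "v \<in> U" "u \<sqsubset> v" "itv u v \<subseteq> {x\<in>U. P x}" by (auto simp: itv_def)
  then show "infinite {x\<in>U. P x}" using infinite_itv infinite_super by metis
qed

text \<open>Being infinite amounts to containing an interval, so "there are infinitely many" behaves
  like a first-order quantifier. The whole treatment of dimension rests on this.\<close>

lemma D_infinite [dint]:
  assumes "D (Suc n) (\<lambda>e. \<chi> (hd e) (tl e))" shows "D n (\<lambda>e. infinite {x\<in>U. \<chi> x e})"
proof -
  have "D n (\<lambda>e. \<exists>u\<in>U. \<exists>v\<in>U. u \<sqsubset> v \<and> (\<forall>x\<in>U. u \<sqsubset> x \<and> x \<sqsubset> v \<longrightarrow> \<chi> x e))"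
    by (rule dint refl D_el[OF assms] | simp)+
  then show ?thesis
    by (rule D_cong) (use D_fibre[OF assms] infinite_iff in simp)
qed

lemma D_finite [dint]:
  assumes "D (Suc n) (\<lambda>e. \<chi> (hd e) (tl e))" shows "D n (\<lambda>e. finite {x\<in>U. \<chi> x e})"
  by (rule D_cong[OF D_neg[OF D_infinite[of n \<chi>, OF assms]]]) blast

lemma D_bd [dint]:
  assumes "D (Suc n) (\<lambda>e. \<chi> (hd e) (tl e))" "adm1 U n s"
  shows "D n (\<lambda>e. bd (\<lambda>x. \<chi> x e) (s e))"
proof -
  have "D (Suc n) (\<lambda>e. bd (\<lambda>x. \<chi> x (tl e)) (hd e))"
    unfolding bd_def by (rule dint refl D_el[OF assms(1)] | simp)+
  from D_el[OF this assms(2) adm_id[OF refl]] show ?thesis .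
qed

lemma itv_split:
  assumes "D 1 (\<lambda>e. P (hd e))" "u \<in> U" "v \<in> U" "u \<sqsubset> v"
  shows "\<exists>u'\<in>U. \<exists>v'\<in>U. u \<sqsubseteq> u' \<and> u' \<sqsubset> v' \<and> v' \<sqsubseteq> v \<and> ((\<forall>x\<in>itv u' v'. P x) \<or> (\<forall>x\<in>itv u' v'. \<not> P x))"
  using right_germ[OF assms(1,2)]
proof (elim bexE conjE)
  fix w assume w: "w \<in> U" "u \<sqsubset> w" "(\<forall>y\<in>itv u w. P y) \<or> (\<forall>y\<in>itv u w. \<not> P y)"
  show ?thesis
  proof (cases "w \<sqsubset> v")
    case True
    then show ?thesis using w assms by (intro bexI[of _ u] bexI[of _ w]) auto
  next
    case False
    then show ?thesis using w assms by (intro bexI[of _ u] bexI[of _ v]) auto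
  qed
qed

end

context omin begin

lemma D_ball_itv [dint]:
  assumes "D (Suc n) (\<lambda>e. \<chi> (hd e) (tl e))" "adm1 U n s" "adm1 U n t"
  shows "D n (\<lambda>e. \<forall>y\<in>itv (s e) (t e). \<chi> y e)"
proof -
  have "D (2 + n) (\<lambda>e. \<forall>y\<in>U. hd e \<sqsubset> y \<and> y \<sqsubset> hd (tl e) \<longrightarrow> \<chi> y (tl (tl e)))"
    by (rule dint refl D_el[OF assms(1)] | simp)+
  from D_subst[OF this, of n "\<lambda>e. s e # t e # e"]
  have "D n (\<lambda>e. \<forall>y\<in>U. s e \<sqsubset> y \<and> y \<sqsubset> t e \<longrightarrow> \<chi> y e)"
    using adm_Cons[OF assms(2) adm_Cons[OF assms(3) adm_id]] by simp
  then show ?thesis by (rule D_cong) (auto simp: itv_def)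
qed

lemma D_bex_itv [dint]:
  assumes "D (Suc n) (\<lambda>e. \<chi> (hd e) (tl e))" "adm1 U n s" "adm1 U n t"
  shows "D n (\<lambda>e. \<exists>y\<in>itv (s e) (t e). \<chi> y e)"
  by (rule D_cong[OF D_neg[OF D_ball_itv[of n "\<lambda>y e. \<not> \<chi> y e", OF D_neg[OF assms(1)] assms(2,3)]]]) blast

end

subsection \<open>Monotonicity of definable preorders\<close>

text \<open>A preorder stands in for the definable map to an ordered set that would induce it. The
  monotonicity theorem in this form also applies to end points of components, which may be infinite,
  and to the preorder of a cut, where no map is given.\<close>

locale line_preorder = omin less_eq less U D
  for less_eq :: "'a \<Rightarrow> 'a \<Rightarrow> bool" (infix "\<sqsubseteq>" 50) and less :: "'a \<Rightarrow> 'a \<Rightarrow> bool" (infix "\<sqsubset>" 50)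
    and U :: "'a set" and D :: "nat \<Rightarrow> ('a list \<Rightarrow> bool) \<Rightarrow> bool" +
  fixes le :: "'a \<Rightarrow> 'a \<Rightarrow> bool" and a b :: 'a
  assumes le_D: "D 2 (\<lambda>e. le (hd e) (hd (tl e)))"
    and ab: "a \<in> U" "b \<in> U"
    and le_total: "x \<in> itv a b \<Longrightarrow> y \<in> itv a b \<Longrightarrow> le x y \<or> le y x"
    and le_trans: "x \<in> itv a b \<Longrightarrow> y \<in> itv a b \<Longrightarrow> z \<in> itv a b \<Longrightarrow> le x y \<Longrightarrow> le y z \<Longrightarrow> le x z"
begin

lemma dual_pre: "line_preorder (\<lambda>x y. y \<sqsubseteq> x) (\<lambda>x y. y \<sqsubset> x) U D le b a"
proof -
  interpret d: omin "\<lambda>x y. y \<sqsubseteq> x" "\<lambda>x y. y \<sqsubset> x" U D by (rule dual)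
  have it: "d.itv x y = itv y x" for x y by (auto simp: d.itv_def itv_def)
  show ?thesis
  proof unfold_locales
    show "le x y \<or> le y x" if "x \<in> d.itv b a" "y \<in> d.itv b a" for x y
      using that le_total unfolding it by blast
    show "le x z" if "x \<in> d.itv b a" "y \<in> d.itv b a" "z \<in> d.itv b a" "le x y" "le y z" for x y z
      using that le_trans unfolding it by blast
  qed (rule le_D ab)+
qed

lemma rev_pre: "line_preorder (\<sqsubseteq>) (\<sqsubset>) U D (\<lambda>x y. le y x) a b"
proof unfold_locales
  show "D 2 (\<lambda>e. le (hd (tl e)) (hd e))" by (rule dint refl D_ee[OF le_D] | simp)+
qed (use ab le_total le_trans in blast)+

abbreviation ls :: "'a \<Rightarrow> 'a \<Rightarrow> bool" where "ls x y \<equiv> \<not> le y x"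

lemma le_ls_trans: "x \<in> itv a b \<Longrightarrow> y \<in> itv a b \<Longrightarrow> z \<in> itv a b \<Longrightarrow> le x y \<Longrightarrow> ls y z \<Longrightarrow> ls x z"
  and ls_le_trans: "x \<in> itv a b \<Longrightarrow> y \<in> itv a b \<Longrightarrow> z \<in> itv a b \<Longrightarrow> ls x y \<Longrightarrow> le y z \<Longrightarrow> ls x z"
  using le_trans by blast+

lemma ls_le: "x \<in> itv a b \<Longrightarrow> y \<in> itv a b \<Longrightarrow> ls x y \<Longrightarrow> le x y"
  using le_total by blast

lemmas le_dint = D_ee[OF le_D]

text \<open>Consider the \<open>z\<close> for which everything in \<open>(x, z]\<close> lies
  strictly above \<open>x\<close>. The first failure would be at a boundary point \<open>s\<close>,
  and there the left hypothesis gives the property at \<open>s\<close> and the right hypothesis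
  carries it beyond \<open>s\<close>.\<close>

lemma locally_increasing:
  assumes uv: "u \<in> U" "v \<in> U" "a \<sqsubseteq> u" "v \<sqsubseteq> b"
    and right: "\<And>x. x \<in> itv u v \<Longrightarrow> \<exists>q\<in>U. x \<sqsubset> q \<and> (\<forall>y\<in>itv x q. ls x y)"
    and left: "\<And>x. x \<in> itv u v \<Longrightarrow> \<exists>p\<in>U. p \<sqsubset> x \<and> (\<forall>y\<in>itv p x. ls y x)"
    and xy: "x \<in> itv u v" "y \<in> itv u v" "x \<sqsubset> y"
  shows "ls x y"
proof (rule ccontr)
  assume nxy: "\<not> ls x y"
  have I: "z \<in> itv a b" if "z \<in> U" "u \<sqsubset> z" "z \<sqsubset> v" for z
    using uv that by (auto intro: le_less_trans less_le_trans)
  obtain q where q: "q \<in> U" "x \<sqsubset> q" "\<forall>y\<in>itv x q. ls x y" using right[OF xy(1)] by blast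
  obtain z0 where z0: "z0 \<in> U" "x \<sqsubset> z0" "z0 \<sqsubset> q" "z0 \<sqsubset> y" using dns_min[of x q y] q xy by auto
  define P where "P = (\<lambda>z. \<forall>w\<in>U. x \<sqsubset> w \<and> w \<sqsubseteq> z \<longrightarrow> ls x w)"
  have PD: "D 1 (\<lambda>e. P (hd e))" unfolding P_def
    by (rule dint refl le_dint | use xy in simp)+
  have "P z0" unfolding P_def using q z0 by (auto intro: le_less_trans)
  moreover have "\<not> P y" unfolding P_def using nxy xy by auto
  ultimately obtain s where s: "s \<in> U" "z0 \<sqsubseteq> s" "s \<sqsubseteq> y" "bd P s"
    using ex_bd[OF PD z0(1), of y] z0(4) xy(2) by auto
  have sI: "s \<in> itv u v" "x \<sqsubset> s" using s z0 xy by (auto intro: less_trans less_le_trans le_less_trans)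
  obtain p' where p: "p' \<in> U" "p' \<sqsubset> s" "\<forall>y\<in>itv p' s. ls y s" using left[OF sI(1)] by blast
  obtain q' where q': "q' \<in> U" "s \<sqsubset> q'" "\<forall>y\<in>itv s q'. ls s y" using right[OF sI(1)] by blast
  obtain p where p: "p \<in> U" "p \<sqsubset> s" "\<forall>y\<in>itv p s. ls y s" "x \<sqsubset> p"
    using dns_max[of s p' x] p s sI(2) xy(1) by (metis in_itv less_trans)
  have anti: "P z'" if "P z" "z' \<sqsubseteq> z" for z z' using that unfolding P_def by (blast intro: order_trans)
  have Pbelow: "P z" if z: "z \<in> U" "z \<sqsubset> s" for z
  proof (rule ccontr)
    assume nz: "\<not> P z"
    then have "\<not> P s" using anti z by (meson less_imp_le)
    moreover obtain z' where "z' \<in> U" "z \<sqsubset> z'" "P z' \<noteq> P s"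
      using s(4) z q' unfolding bd_def by blast
    ultimately show False using nz anti by (meson less_imp_le)
  qed
  have lts: "ls x s"
  proof -
    obtain w where w: "w \<in> U" "p \<sqsubset> w" "w \<sqsubset> s" using dns[of p s] p s by blast
    then have "ls x w" using Pbelow[of w] p(4) unfolding P_def by (meson less_trans order_refl)
    moreover have "ls w s" using p(3) w by auto
    moreover have "x \<in> itv a b" "w \<in> itv a b" "s \<in> itv a b"
      by (rule I; use w p sI xy in \<open>auto intro: less_trans\<close>)+
    ultimately show ?thesis using le_ls_trans ls_le by blast
  qed
  obtain q2 where q2: "q2 \<in> U" "s \<sqsubset> q2" "q2 \<sqsubset> q'" "q2 \<sqsubset> v"
    using dns_min[of s q' v] q' s uv sI by auto
  have "P w" if w: "w \<in> U" "w \<sqsubset> q2" for w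
    unfolding P_def
  proof (intro ballI impI)
    fix z assume z: "z \<in> U" "x \<sqsubset> z \<and> z \<sqsubseteq> w"
    have zI: "z \<in> itv a b" "x \<in> itv a b" "s \<in> itv a b"
      by (rule I; use z w q2 sI xy in \<open>auto intro: less_trans le_less_trans\<close>)+
    consider "z \<sqsubset> s" | "z = s" | "s \<sqsubset> z" by (metis neqE)
    then show "ls x z"
    proof cases
      case 1
      then show ?thesis using Pbelow[of z] z unfolding P_def by auto
    next
      case 2
      then show ?thesis using lts by simp
    next
      case 3
      then have "ls s z" using q'(3) z w q2 by (auto intro: less_trans le_less_trans)
      then show ?thesis using lts zI le_ls_trans ls_le by blast
    qed
  qed
  then show False using s(1,4) q2(1,2) p(1,2) unfolding bd_def by metis
qed

text \<open>One half of the refutation in \<open>no_local_min\<close>: a lopsided conclusion near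
  the end \<open>v\<close>, which contradicts its own mirror image. Close to \<open>v\<close> no
  point lies below everything to its right. Hence every such point \<open>c\<close> is eventually
  above all points near \<open>v\<close>, and where the values drop below \<open>c\<close> for good,
  they are larger on the left than on the right.\<close>

lemma local_min_aux:
  assumes uv: "u \<in> U" "v \<in> U" "a \<sqsubseteq> u" "u \<sqsubset> v" "v \<sqsubseteq> b"
    and right: "\<And>x. x \<in> itv u v \<Longrightarrow> \<exists>q\<in>U. x \<sqsubset> q \<and> (\<forall>y\<in>itv x q. ls x y)"
    and left: "\<And>x. x \<in> itv u v \<Longrightarrow> \<exists>p\<in>U. p \<sqsubset> x \<and> (\<forall>y\<in>itv p x. ls x y)"
  shows "\<exists>u'\<in>U. u \<sqsubseteq> u' \<and> u' \<sqsubset> v \<and>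
    (\<forall>x\<in>itv u' v. \<exists>p\<in>U. \<exists>q\<in>U. p \<sqsubset> x \<and> x \<sqsubset> q \<and> (\<forall>y\<in>itv p x. \<forall>z\<in>itv x q. ls z y))"
proof -
  interpret d: omin "\<lambda>x y. y \<sqsubseteq> x" "\<lambda>x y. y \<sqsubset> x" U D by (rule dual)
  have I: "z \<in> itv a b" if "z \<in> U" "u \<sqsubset> z" "z \<sqsubset> v" for z
    using uv that by (auto intro: le_less_trans less_le_trans)
  define B where "B = (\<lambda>x. u \<sqsubset> x \<and> x \<sqsubset> v \<and> (\<forall>y\<in>itv x v. ls x y))"
  have BD: "D 1 (\<lambda>e. B (hd e))" unfolding B_def by (rule dint refl le_dint | use uv in simp)+
  \<comment> \<open>On an interval contained in \<open>B\<close> the preorder would be strictly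
    increasing, against the strict minima on the left.\<close>
  have "finite {x\<in>U. B x}"
  proof (rule ccontr)
    assume "infinite {x\<in>U. B x}"
    then obtain s t where st: "s \<in> U" "t \<in> U" "s \<sqsubset> t" "\<forall>x\<in>itv s t. B x"
      using infinite_ex_itv[OF BD] by blast
    obtain x where x: "x \<in> U" "s \<sqsubset> x" "x \<sqsubset> t" using dns[of s t] st by blast
    then have Bx: "B x" using st by auto
    obtain p where p: "p \<in> U" "p \<sqsubset> x" "\<forall>y\<in>itv p x. ls x y" using left[of x] Bx x unfolding B_def by auto
    obtain y where y: "y \<in> U" "p \<sqsubset> y" "s \<sqsubset> y" "y \<sqsubset> x" using dns_max[of x p s] p x st by blast
    then have "B y" using st(4) x by (auto intro: less_trans)
    then have "ls y x" using y Bx x unfolding B_def by auto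
    moreover have "ls x y" using p y by auto
    moreover have "x \<in> itv a b" "y \<in> itv a b" using Bx \<open>B y\<close> x y unfolding B_def by (blast intro: I)+
    ultimately show False using le_total by blast
  qed
  then obtain w where w: "w \<in> U" "w \<sqsubset> v" "\<forall>z\<in>{x\<in>U. B x}. z \<sqsubset> v \<longrightarrow> z \<sqsubset> w"
    using d.right_gap[of "{x\<in>U. B x}" v] uv by auto
  obtain a' where a': "a' \<in> U" "u \<sqsubset> a'" "w \<sqsubset> a'" "a' \<sqsubset> v" using dns_max[of v u w] w uv by blast
  have nB: "\<exists>y\<in>itv x v. le y x" if "x \<in> itv a' v" for x
  proof -
    have "\<not> x \<sqsubset> w" using that a' by (auto intro: less_trans)
    then have "\<not> B x" using w(3) that by auto
    then show ?thesis using that a' unfolding B_def by (auto intro: less_trans)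
  qed
  have step2: "\<exists>w\<in>U. c \<sqsubset> w \<and> w \<sqsubset> v \<and> (\<forall>y\<in>itv w v. ls y c)" if c: "c \<in> itv a' v" for c
  proof -
    have cU: "c \<in> U" "u \<sqsubset> c" "c \<sqsubset> v" using c a' by (auto intro: less_trans)
    have "D 1 (\<lambda>e. ls (hd e) c)" by (rule dint refl le_dint | use cU in simp)+
    from left_germ[OF this uv(2)] obtain w0 where w0: "w0 \<in> U" "w0 \<sqsubset> v"
      "(\<forall>y\<in>itv w0 v. ls y c) \<or> (\<forall>y\<in>itv w0 v. le c y)" by auto
    show ?thesis
    proof (cases "\<forall>y\<in>itv w0 v. ls y c")
      case True
      obtain w where "w \<in> U" "c \<sqsubset> w" "w0 \<sqsubset> w" "w \<sqsubset> v" using dns_max[of v c w0] w0 uv cU by blast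
      then show ?thesis using True by (auto intro: less_trans intro!: bexI[of _ w])
    next
      case False
      then have lec: "\<forall>y\<in>itv w0 v. le c y" using w0(3) by blast
      have "D 1 (\<lambda>e. ls c (hd e))" by (rule dint refl le_dint | use cU in simp)+
      from left_germ[OF this uv(2)] obtain w1 where w1: "w1 \<in> U" "w1 \<sqsubset> v"
        "(\<forall>y\<in>itv w1 v. ls c y) \<or> (\<forall>y\<in>itv w1 v. le y c)" by auto
      have False
      proof (cases "\<forall>y\<in>itv w1 v. ls c y")
        case False
        then have lec': "\<forall>y\<in>itv w1 v. le y c" using w1(3) by blast
        obtain y0 where y0: "y0 \<in> U" "w1 \<sqsubset> y0" "w0 \<sqsubset> y0" "y0 \<sqsubset> v" using dns_max[of v w1 w0] w0 w1 uv by blast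
        obtain y where y: "y \<in> U" "y0 \<sqsubset> y" "c \<sqsubset> y" "y \<sqsubset> v" using dns_max[of v y0 c] y0 uv cU by blast
        have yI: "y \<in> itv u v" using y cU by (auto intro: less_trans)
        obtain q where q: "q \<in> U" "y \<sqsubset> q" "\<forall>z\<in>itv y q. ls y z" using right[OF yI] by blast
        obtain z where z: "z \<in> U" "y \<sqsubset> z" "z \<sqsubset> q" "z \<sqsubset> v" using dns_min[of y q v] y q uv by blast
        have "le c y" using lec y y0 by (auto intro: less_trans)
        moreover have "w1 \<sqsubset> z" using y0 y z less_trans by metis
        then have "le z c" using lec' z by auto
        moreover have "ls y z" using q z by auto
        moreover have "u \<sqsubset> y" "u \<sqsubset> z" using y cU z less_trans by metis+
        note uI = this
        have "c \<in> itv a b" "y \<in> itv a b" "z \<in> itv a b" by (rule I; use uI cU y z in auto)+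
        ultimately show False using le_trans by blast
      next
        case True
        \<comment> \<open>Here \<open>d\<close> becomes the first point behind which everything lies
          above \<open>c\<close>. If \<open>d\<close> itself lies above \<open>c\<close>, then
          points arbitrarily close on its left do not, against the minimum at \<open>d\<close>. If
          it does not, some point behind \<open>d\<close> is not above \<open>d\<close>, hence not
          above \<open>c\<close>.\<close>
        define Q where "Q = (\<lambda>z. \<forall>y\<in>itv z v. ls c y)"
        have QD: "D 1 (\<lambda>e. Q (hd e))" unfolding Q_def by (rule dint refl le_dint | use cU uv in simp)+
        have up: "Q z'" if "Q z" "z \<sqsubseteq> z'" for z z' using that unfolding Q_def by (auto intro: le_less_trans)
        obtain w where w: "w \<in> U" "c \<sqsubset> w" "w1 \<sqsubset> w" "w \<sqsubset> v" using dns_max[of v c w1] w1 uv cU by blast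
        have "Q w" using True w unfolding Q_def by (auto intro: less_trans)
        moreover have "\<not> Q c" using nB[OF c] unfolding Q_def by blast
        ultimately obtain d where d: "d \<in> U" "c \<sqsubseteq> d" "d \<sqsubseteq> w" "bd Q d"
          using ex_bd[OF QD cU(1) w(1,2)] by auto
        obtain d0 where d0: "d0 \<in> U" "d0 \<sqsubset> d" using below d by blast
        have Qd: "Q d"
        proof (rule ccontr)
          assume nQ: "\<not> Q d"
          then obtain y where y: "y \<in> itv d v" "\<not> ls c y" unfolding Q_def by blast
          obtain z where z: "z \<in> U" "z \<sqsubset> y" "Q z \<noteq> Q d" using d(4) d0 y unfolding bd_def by auto
          then show False using nQ y unfolding Q_def by auto
        qed
        have cd: "c \<sqsubset> d" using d(2) Qd \<open>\<not> Q c\<close> by (metis le_less)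
        have dv: "d \<in> itv a' v" "d \<in> itv u v" using d w c cd a' by (auto intro: less_trans le_less_trans)
        have low: "\<exists>y\<in>U. z \<sqsubset> y \<and> y \<sqsubseteq> d \<and> le y c" if z: "z \<in> U" "z \<sqsubset> d" for z
        proof -
          obtain y' where "y' \<in> U" "z \<sqsubset> y'" "\<not> Q y'" using d(4) Qd z dv uv unfolding bd_def by auto
          then obtain y where "y \<in> itv y' v" "le y c" unfolding Q_def by blast
          moreover from this have "\<not> d \<sqsubset> y" using Qd unfolding Q_def by auto
          ultimately show ?thesis using \<open>z \<sqsubset> y'\<close> by (auto intro: less_trans)
        qed
        show False
        proof (cases "le d c")
          case True
          obtain y where "y \<in> itv d v" "le y d" using nB[OF dv(1)] by blast
          moreover from this have "ls c y" using Qd unfolding Q_def by blast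
          moreover have "c \<in> itv a b" "d \<in> itv a b" "y \<in> itv a b"
            by (rule I; use cU dv calculation in \<open>auto intro: less_trans\<close>)+
          ultimately show False using True le_trans by blast
        next
          case False
          obtain p where p: "p \<in> U" "p \<sqsubset> d" "\<forall>y\<in>itv p d. ls d y" using left[OF dv(2)] by blast
          obtain p' where p': "p' \<in> U" "p \<sqsubset> p'" "c \<sqsubset> p'" "p' \<sqsubset> d" using dns_max[of d p c] p d cd cU by blast
          obtain y where y: "y \<in> U" "p' \<sqsubset> y" "y \<sqsubseteq> d" "le y c" using low[OF p'(1,4)] by blast
          then have "y \<noteq> d" using False by blast
          then have yd: "y \<sqsubset> d" using y by auto
          then have "ls d y" using p(3) p' y by (auto intro: less_trans)
          moreover have "u \<sqsubset> y" "y \<sqsubset> v" using cU p' y yd dv less_trans by (metis, metis in_itv)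
          note uI = this
          have "c \<in> itv a b" "d \<in> itv a b" "y \<in> itv a b" by (rule I; use cU dv y uI in auto)+
          ultimately show False using False y le_total le_trans by blast
        qed
      qed
      then show ?thesis ..
    qed
  qed
  define \<Psi> where "\<Psi> = (\<lambda>x. \<exists>p\<in>U. \<exists>q\<in>U. p \<sqsubset> x \<and> x \<sqsubset> q \<and> (\<forall>y\<in>itv p x. \<forall>z\<in>itv x q. ls z y))"
  have \<Psi>D: "D 1 (\<lambda>e. \<Psi> (hd e))" unfolding \<Psi>_def by (rule dint refl le_dint | simp)+
  have step3: "\<exists>\<beta>\<in>itv c v. \<Psi> \<beta>" if c: "c \<in> itv a' v" for c
  proof -
    have cU: "c \<in> U" "u \<sqsubset> c" "c \<sqsubset> v" using c a' by (auto intro: less_trans)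
    obtain w where w: "w \<in> U" "c \<sqsubset> w" "w \<sqsubset> v" "\<forall>y\<in>itv w v. ls y c" using step2[OF c] by blast
    \<comment> \<open>Now \<open>d\<close> becomes the first point behind which everything lies
      below \<open>c\<close>; close on its left all values are at least \<open>c\<close>, so
      \<open>\<Psi> d\<close> holds.\<close>
    define Q where "Q = (\<lambda>z. \<forall>y\<in>itv z v. ls y c)"
    have QD: "D 1 (\<lambda>e. Q (hd e))" unfolding Q_def by (rule dint refl le_dint | use cU uv in simp)+
    have "Q w" using w unfolding Q_def by auto
    moreover have "\<not> Q c"
    proof
      assume Qc: "Q c"
      obtain q where q: "q \<in> U" "c \<sqsubset> q" "\<forall>z\<in>itv c q. ls c z" using right[of c] cU by auto
      obtain z where z: "z \<in> U" "c \<sqsubset> z" "z \<sqsubset> q" "z \<sqsubset> v" using dns_min[of c q v] q uv cU by blast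
      have "ls z c" "ls c z" using Qc q z unfolding Q_def by auto
      moreover have "z \<in> itv a b" "c \<in> itv a b" by (rule I; use z cU in \<open>auto intro: less_trans\<close>)+
      ultimately show False using le_total by blast
    qed
    ultimately obtain d where d: "d \<in> U" "c \<sqsubseteq> d" "d \<sqsubseteq> w" "bd Q d"
      using ex_bd[OF QD cU(1) w(1,2)] by auto
    obtain d0 where d0: "d0 \<in> U" "d0 \<sqsubset> d" using below d by blast
    have Qd: "Q d"
    proof (rule ccontr)
      assume nQ: "\<not> Q d"
      then obtain y where y: "y \<in> itv d v" "\<not> ls y c" unfolding Q_def by blast
      obtain z where z: "z \<in> U" "z \<sqsubset> y" "Q z \<noteq> Q d" using d(4) d0 y unfolding bd_def by auto
      then show False using nQ y unfolding Q_def by auto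
    qed
    have cd: "c \<sqsubset> d" using d(2) Qd \<open>\<not> Q c\<close> by (metis le_less)
    have dv: "d \<in> itv u v" using d w cU cd by (auto intro: less_trans le_less_trans)
    have dI: "d \<in> itv a b" "c \<in> itv a b" by (rule I; use dv cU in auto)+
    have low: "\<exists>y\<in>U. z \<sqsubset> y \<and> y \<sqsubseteq> d \<and> le c y" if z: "z \<in> U" "z \<sqsubset> d" for z
    proof -
      obtain y' where "y' \<in> U" "z \<sqsubset> y'" "\<not> Q y'" using d(4) Qd z dv uv unfolding bd_def by auto
      then obtain y where "y \<in> itv y' v" "le c y" unfolding Q_def by blast
      moreover from this have "\<not> d \<sqsubset> y" using Qd unfolding Q_def by auto
      ultimately show ?thesis using \<open>z \<sqsubset> y'\<close> by (auto intro: less_trans)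
    qed
    have dc: "ls d c"
    proof -
      obtain q where q: "q \<in> U" "d \<sqsubset> q" "\<forall>z\<in>itv d q. ls d z" using right[OF dv] by blast
      obtain z where z: "z \<in> U" "d \<sqsubset> z" "z \<sqsubset> q" "z \<sqsubset> v" using dns_min[of d q v] q uv dv by auto
      have "ls z c" "ls d z" using Qd q z unfolding Q_def by auto
      moreover have "u \<sqsubset> z" using z dv less_trans by (metis in_itv)
      note uI = this
          have "z \<in> itv a b" by (rule I; use z uI in auto)+
      ultimately show ?thesis using dI le_ls_trans ls_le by blast
    qed
    have "D 1 (\<lambda>e. ls (hd e) c)" by (rule dint refl le_dint | use cU in simp)+
    from left_germ[OF this d(1)] obtain p where p: "p \<in> U" "p \<sqsubset> d"
      "(\<forall>y\<in>itv p d. ls y c) \<or> (\<forall>y\<in>itv p d. le c y)" by auto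
    have cle: "\<forall>y\<in>itv p d. le c y"
    proof (rule ccontr)
      assume n: "\<not> ?thesis"
      obtain y where y: "y \<in> U" "p \<sqsubset> y" "y \<sqsubseteq> d" "le c y" using low[OF p(1,2)] by blast
      then have "y \<noteq> d" using dc by blast
      then show False using n p(3) y by auto
    qed
    obtain p' where p': "p' \<in> U" "p \<sqsubset> p'" "u \<sqsubset> p'" "p' \<sqsubset> d" using dns_max[of d p u] p d uv dv by auto
    have "ls z y" if y: "y \<in> itv p' d" and z: "z \<in> itv d v" for y z
    proof -
      have "le c y" using cle y p' by (auto intro: less_trans)
      moreover have "ls z c" using Qd z unfolding Q_def by blast
      moreover have "u \<sqsubset> y" "y \<sqsubset> v" "u \<sqsubset> z" using y z dv p' less_trans by (metis in_itv)+
      note uI = this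
          have "y \<in> itv a b" "z \<in> itv a b" by (rule I; use y z uI in auto)+
      ultimately show ?thesis using dI le_trans by blast
    qed
    then have "\<Psi> d" unfolding \<Psi>_def using p' uv dv by (intro bexI[of _ p'] bexI[of _ v]) auto
    then show ?thesis using dv cd by auto
  qed
  from left_germ[OF \<Psi>D uv(2)] obtain w where w: "w \<in> U" "w \<sqsubset> v" "(\<forall>y\<in>itv w v. \<Psi> y) \<or> (\<forall>y\<in>itv w v. \<not> \<Psi> y)"
    by blast
  obtain c where c: "c \<in> U" "a' \<sqsubset> c" "w \<sqsubset> c" "c \<sqsubset> v" using dns_max[of v a' w] a' w uv by blast
  obtain \<beta> where "\<beta> \<in> itv c v" "\<Psi> \<beta>" using step3[of c] c by auto
  then have "\<forall>y\<in>itv w v. \<Psi> y" using w(3) c by (auto intro: less_trans)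
  then have "\<forall>y\<in>itv c v. \<Psi> y" using c by (auto intro: less_trans)
  moreover have "u \<sqsubset> c" using a' c less_trans by metis
  ultimately show ?thesis unfolding \<Psi>_def using c(1,4) less_imp_le by metis
qed

lemma no_local_min:
  assumes uv: "u \<in> U" "v \<in> U" "a \<sqsubseteq> u" "u \<sqsubset> v" "v \<sqsubseteq> b"
    and right: "\<And>x. x \<in> itv u v \<Longrightarrow> \<exists>q\<in>U. x \<sqsubset> q \<and> (\<forall>y\<in>itv x q. ls x y)"
    and left: "\<And>x. x \<in> itv u v \<Longrightarrow> \<exists>p\<in>U. p \<sqsubset> x \<and> (\<forall>y\<in>itv p x. ls x y)"
  shows False
proof -
  interpret d: line_preorder "\<lambda>x y. y \<sqsubseteq> x" "\<lambda>x y. y \<sqsubset> x" U D le b a by (rule dual_pre)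
  have it: "d.itv x y = itv y x" for x y by (auto simp: d.itv_def itv_def)
  obtain u' where u': "u' \<in> U" "u \<sqsubseteq> u'" "u' \<sqsubset> v" and
    \<Psi>: "\<And>x. x \<in> itv u' v \<Longrightarrow> \<exists>p\<in>U. \<exists>q\<in>U. p \<sqsubset> x \<and> x \<sqsubset> q \<and> (\<forall>y\<in>itv p x. \<forall>z\<in>itv x q. ls z y)"
    using local_min_aux[OF assms] by blast
  have sub: "x \<in> itv u v" if "x \<in> itv u' v" for x using that u' by (auto intro: le_less_trans)
  have "\<exists>v'\<in>U. v' \<sqsubseteq> v \<and> u' \<sqsubset> v' \<and>
    (\<forall>x\<in>itv u' v'. \<exists>p\<in>U. \<exists>q\<in>U. x \<sqsubset> p \<and> q \<sqsubset> x \<and> (\<forall>y\<in>itv x p. \<forall>z\<in>itv q x. ls z y))"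
    by (rule d.local_min_aux[of v u', unfolded it]; (rule left[OF sub] right[OF sub])?)
      (use uv u' in \<open>auto intro: order_trans\<close>)
  then obtain v' where v': "v' \<in> U" "v' \<sqsubseteq> v" "u' \<sqsubset> v'" and
    \<Psi>': "\<And>x. x \<in> itv u' v' \<Longrightarrow> \<exists>p\<in>U. \<exists>q\<in>U. x \<sqsubset> p \<and> q \<sqsubset> x \<and> (\<forall>y\<in>itv x p. \<forall>z\<in>itv q x. ls z y)"
    by blast
  obtain x where x: "x \<in> U" "u' \<sqsubset> x" "x \<sqsubset> v'" using dns[of u' v'] u' v' by blast
  then have xI: "x \<in> itv u' v'" "x \<in> itv u' v" using v' by (auto intro: less_le_trans)
  obtain p q where pq: "p \<in> U" "q \<in> U" "p \<sqsubset> x" "x \<sqsubset> q" "\<And>y z. y \<in> itv p x \<Longrightarrow> z \<in> itv x q \<Longrightarrow> ls z y"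
    using \<Psi>[OF xI(2)] by blast
  obtain p' q' where pq': "p' \<in> U" "q' \<in> U" "x \<sqsubset> p'" "q' \<sqsubset> x" "\<And>y z. y \<in> itv x p' \<Longrightarrow> z \<in> itv q' x \<Longrightarrow> ls z y"
    using \<Psi>'[OF xI(1)] by blast
  obtain y0 where y0: "y0 \<in> U" "p \<sqsubset> y0" "q' \<sqsubset> y0" "y0 \<sqsubset> x" using dns_max[of x p q'] pq pq' x by blast
  obtain y where y: "y \<in> U" "y0 \<sqsubset> y" "u' \<sqsubset> y" "y \<sqsubset> x" using dns_max[of x y0 u'] y0 u' x by blast
  obtain z0 where z0: "z0 \<in> U" "x \<sqsubset> z0" "z0 \<sqsubset> q" "z0 \<sqsubset> p'" using dns_min[of x q p'] pq pq' x by blast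
  obtain z where z: "z \<in> U" "x \<sqsubset> z" "z \<sqsubset> z0" "z \<sqsubset> v'" using dns_min[of x z0 v'] z0 v' x by blast
  have "p \<sqsubset> y" "q' \<sqsubset> y" "z \<sqsubset> q" "z \<sqsubset> p'" using y0 y z0 z less_trans by metis+
  then have "ls z y" "ls y z" using pq(5)[of y z] pq'(5)[of z y] y z by auto
  moreover have "y \<sqsubset> v" "u' \<sqsubset> z" "z \<sqsubset> v" using y z x v' less_trans less_le_trans by metis+
  then have "y \<in> itv u v" "z \<in> itv u v" using y z sub by auto
  then have "y \<in> itv a b" "z \<in> itv a b" using uv by (auto intro: le_less_trans less_le_trans)
  ultimately show False using le_total by blast
qed

text \<open>On either side of \<open>x\<close> the comparison with \<open>x\<close> is eventually
  constant. If on one side neither strict comparison occurs, the points there are all equivalent to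
  \<open>x\<close>. Otherwise shrink to an interval on which the kind of strict comparison is fixed
  on each side: two combinations are local monotonicity, the other two make every point a strict
  minimum or every point a strict maximum.\<close>

lemma preorder_monotone:
  assumes "a \<sqsubset> b"
  shows "\<exists>u\<in>U. \<exists>v\<in>U. a \<sqsubseteq> u \<and> u \<sqsubset> v \<and> v \<sqsubseteq> b \<and>
    ((\<forall>x\<in>itv u v. \<forall>y\<in>itv u v. le x y) \<or> (\<forall>x\<in>itv u v. \<forall>y\<in>itv u v. x \<sqsubset> y \<longrightarrow> ls x y) \<or>
     (\<forall>x\<in>itv u v. \<forall>y\<in>itv u v. x \<sqsubset> y \<longrightarrow> ls y x))"
proof -
  interpret r: line_preorder "(\<sqsubseteq>)" "(\<sqsubset>)" U D "\<lambda>x y. le y x" a b by (rule rev_pre)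
  define A1 where "A1 = (\<lambda>x. \<exists>q\<in>U. x \<sqsubset> q \<and> (\<forall>y\<in>itv x q. ls x y))"
  define A2 where "A2 = (\<lambda>x. \<exists>q\<in>U. x \<sqsubset> q \<and> (\<forall>y\<in>itv x q. ls y x))"
  define B1 where "B1 = (\<lambda>x. \<exists>p\<in>U. p \<sqsubset> x \<and> (\<forall>y\<in>itv p x. ls y x))"
  define B2 where "B2 = (\<lambda>x. \<exists>p\<in>U. p \<sqsubset> x \<and> (\<forall>y\<in>itv p x. ls x y))"
  have AD: "D 1 (\<lambda>e. A1 (hd e))" unfolding A1_def by (rule dint refl le_dint | simp)+
  have BD: "D 1 (\<lambda>e. B1 (hd e))" unfolding B1_def by (rule dint refl le_dint | simp)+
  have D1: "D 1 (\<lambda>e. ls x (hd e))" "D 1 (\<lambda>e. ls (hd e) x)" if "x \<in> U" for x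
    by (rule dint refl le_dint | use that in simp)+
  show ?thesis
  proof (cases "\<forall>x\<in>itv a b. (A1 x \<or> A2 x) \<and> (B1 x \<or> B2 x)")
    case False
    then obtain x where x: "x \<in> itv a b" "\<not> ((A1 x \<or> A2 x) \<and> (B1 x \<or> B2 x))" by blast
    have xU: "x \<in> U" using x by simp
    have "\<exists>u\<in>U. \<exists>v\<in>U. a \<sqsubseteq> u \<and> u \<sqsubset> v \<and> v \<sqsubseteq> b \<and> (\<forall>y\<in>itv u v. le x y \<and> le y x)"
    proof (cases "A1 x \<or> A2 x")
      case False
      obtain q1 where q1: "q1 \<in> U" "x \<sqsubset> q1" "\<forall>y\<in>itv x q1. le y x"
        using right_germ[OF D1(1)[OF xU] xU] False unfolding A1_def by blast
      obtain q2 where q2: "q2 \<in> U" "x \<sqsubset> q2" "\<forall>y\<in>itv x q2. le x y"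
        using right_germ[OF D1(2)[OF xU] xU] False unfolding A2_def by blast
      obtain q3 where q3: "q3 \<in> U" "x \<sqsubset> q3" "q3 \<sqsubset> q1" "q3 \<sqsubset> q2" using dns_min[of x q1 q2] q1 q2 xU by blast
      obtain q where q: "q \<in> U" "x \<sqsubset> q" "q \<sqsubset> q3" "q \<sqsubset> b" using dns_min[of x q3 b] q3 x ab by auto
      have "q \<sqsubset> q1" "q \<sqsubset> q2" using q q3 less_trans by metis+
      then show ?thesis using x q q1 q2 by (intro bexI[of _ x] bexI[of _ q]) (auto intro: less_trans)
    next
      case True
      then have False: "\<not> B1 x" "\<not> B2 x" using x by blast+
      obtain q1 where q1: "q1 \<in> U" "q1 \<sqsubset> x" "\<forall>y\<in>itv q1 x. le y x"
        using left_germ[OF D1(1)[OF xU] xU] False unfolding B2_def by blast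
      obtain q2 where q2: "q2 \<in> U" "q2 \<sqsubset> x" "\<forall>y\<in>itv q2 x. le x y"
        using left_germ[OF D1(2)[OF xU] xU] False unfolding B1_def by blast
      obtain q3 where q3: "q3 \<in> U" "q1 \<sqsubset> q3" "q2 \<sqsubset> q3" "q3 \<sqsubset> x" using dns_max[of x q1 q2] q1 q2 xU by blast
      obtain q where q: "q \<in> U" "q3 \<sqsubset> q" "a \<sqsubset> q" "q \<sqsubset> x" using dns_max[of x q3 a] q3 x ab by auto
      have "q1 \<sqsubset> q" "q2 \<sqsubset> q" using q q3 less_trans by metis+
      then show ?thesis using x q q1 q2 by (intro bexI[of _ q] bexI[of _ x]) (auto intro: less_trans)
    qed
    then obtain u v where uv: "u \<in> U" "v \<in> U" "a \<sqsubseteq> u" "u \<sqsubset> v" "v \<sqsubseteq> b" "\<forall>y\<in>itv u v. le x y \<and> le y x"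
      by blast
    have "le y z" if "y \<in> itv u v" "z \<in> itv u v" for y z
    proof -
      have "y \<in> itv a b" "z \<in> itv a b" using uv that by (auto intro: le_less_trans less_le_trans)
      then show ?thesis using uv(6) that le_trans x(1) by blast
    qed
    then show ?thesis using uv by blast
  next
    case True
    obtain u1 v1 where 1: "u1 \<in> U" "v1 \<in> U" "a \<sqsubseteq> u1" "u1 \<sqsubset> v1" "v1 \<sqsubseteq> b"
      "(\<forall>x\<in>itv u1 v1. A1 x) \<or> (\<forall>x\<in>itv u1 v1. \<not> A1 x)"
      using itv_split[OF AD ab assms] by blast
    obtain u v where 2: "u \<in> U" "v \<in> U" "u1 \<sqsubseteq> u" "u \<sqsubset> v" "v \<sqsubseteq> v1"
      "(\<forall>x\<in>itv u v. B1 x) \<or> (\<forall>x\<in>itv u v. \<not> B1 x)"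
      using itv_split[OF BD 1(1,2,4)] by blast
    have au: "a \<sqsubseteq> u" "v \<sqsubseteq> b" using 1 2 order_trans by metis+
    have sub: "x \<in> itv u1 v1" "x \<in> itv a b" if "x \<in> itv u v" for x
      using that 1 2 au by (auto intro: le_less_trans less_le_trans)
    have A: "(\<forall>x\<in>itv u v. A1 x) \<or> (\<forall>x\<in>itv u v. A2 x)" using 1(6) True sub by blast
    have B: "(\<forall>x\<in>itv u v. B1 x) \<or> (\<forall>x\<in>itv u v. B2 x)" using 2(6) True sub by blast
    have "(\<forall>x\<in>itv u v. \<forall>y\<in>itv u v. x \<sqsubset> y \<longrightarrow> ls x y) \<or> (\<forall>x\<in>itv u v. \<forall>y\<in>itv u v. x \<sqsubset> y \<longrightarrow> ls y x)"
      using A B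
    proof (elim disjE)
      assume "\<forall>x\<in>itv u v. A1 x" "\<forall>x\<in>itv u v. B1 x"
      then show ?thesis using locally_increasing[OF 2(1,2) au] unfolding A1_def B1_def by blast
    next
      assume "\<forall>x\<in>itv u v. A1 x" "\<forall>x\<in>itv u v. B2 x"
      then show ?thesis using no_local_min[OF 2(1,2) au(1) 2(4) au(2)] unfolding A1_def B2_def by blast
    next
      assume "\<forall>x\<in>itv u v. A2 x" "\<forall>x\<in>itv u v. B1 x"
      then show ?thesis using r.no_local_min[OF 2(1,2) au(1) 2(4) au(2)] unfolding A2_def B1_def by blast
    next
      assume "\<forall>x\<in>itv u v. A2 x" "\<forall>x\<in>itv u v. B2 x"
      then show ?thesis using r.locally_increasing[OF 2(1,2) au] unfolding A2_def B2_def by blast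
    qed
    then show ?thesis using 2 au by blast
  qed
qed

end

subsection \<open>Families of subsets of the line\<close>

text \<open>For fixed \<open>k\<close> this unfolds to a first-order formula that lists
  \<open>k\<close> elements in increasing order. Carrier and order are arguments because the same
  formula is read in \<open>M\<close> and in \<open>N\<close>.\<close>

primrec at_least :: "'a set \<Rightarrow> ('a \<Rightarrow> 'a \<Rightarrow> bool) \<Rightarrow> nat \<Rightarrow> ('a \<Rightarrow> bool) \<Rightarrow> bool" where
  "at_least A r 0 P \<longleftrightarrow> True"
| "at_least A r (Suc k) P \<longleftrightarrow> (\<exists>x\<in>A. P x \<and> at_least A r k (\<lambda>y. P y \<and> r x y))"

lemma (in linorder) at_least_iff:
  "at_least A less k P \<longleftrightarrow> (\<exists>S. finite S \<and> card S = k \<and> S \<subseteq> {x\<in>A. P x})"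
proof (induction k arbitrary: P)
  case 0
  then show ?case by (auto intro: exI[of _ "{}"])
next
  case (Suc k)
  show ?case
  proof
    assume "at_least A less (Suc k) P"
    then obtain x S where "x \<in> A" "P x" "finite S" "card S = k" "S \<subseteq> {y\<in>A. P y \<and> less x y}"
      using Suc.IH by auto
    moreover from this have "x \<notin> S" by auto
    ultimately show "\<exists>S. finite S \<and> card S = Suc k \<and> S \<subseteq> {x\<in>A. P x}"
      by (intro exI[of _ "insert x S"]) auto
  next
    assume "\<exists>S. finite S \<and> card S = Suc k \<and> S \<subseteq> {x\<in>A. P x}"
    then obtain S where S: "finite S" "card S = Suc k" "S \<subseteq> {x\<in>A. P x}" by blast
    then have "S \<noteq> {}" by auto
    then have x: "Min S \<in> S" "\<And>z. z \<in> S \<Longrightarrow> less_eq (Min S) z" using S(1) by auto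
    have "finite (S - {Min S})" "card (S - {Min S}) = k" using S x(1) by auto
    moreover have "S - {Min S} \<subseteq> {y\<in>A. P y \<and> less (Min S) y}" using S(3) x(2) le_less by blast
    ultimately have "at_least A less k (\<lambda>y. P y \<and> less (Min S) y)" using Suc.IH by blast
    then show "at_least A less (Suc k) P" using S(3) x(1) by auto
  qed
qed

context omin begin

lemma bdD: "bd P x \<Longrightarrow> u \<in> U \<Longrightarrow> v \<in> U \<Longrightarrow> u \<sqsubset> x \<Longrightarrow> x \<sqsubset> v \<Longrightarrow> \<exists>y\<in>U. u \<sqsubset> y \<and> y \<sqsubset> v \<and> P y \<noteq> P x"
  unfolding bd_def by blast

text \<open>Look at the left end points of the stretches in the sets \<open>J x\<close>. By
  disjointness a right germ belongs to only one \<open>x\<close>, so there are infinitely many such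
  end points and hence an interval of them. But the points just to the right of an end point lie
  inside the same stretch and cannot be end points.\<close>

lemma no_disjoint_family:
  assumes ID: "D 1 (\<lambda>e. I (hd e))" and JD: "D 2 (\<lambda>e. J (hd e) (hd (tl e)))"
    and inf: "infinite {x\<in>U. I x}" "\<And>x. x \<in> U \<Longrightarrow> I x \<Longrightarrow> infinite {y\<in>U. J x y}"
    and disj: "\<And>x x' y. x \<in> U \<Longrightarrow> x' \<in> U \<Longrightarrow> y \<in> U \<Longrightarrow> I x \<Longrightarrow> I x' \<Longrightarrow> J x y \<Longrightarrow> J x' y \<Longrightarrow> x = x'"
  shows False
proof -
  note d = D_e[OF ID] D_ee[OF JD]
  define R where "R = (\<lambda>x y. \<exists>v\<in>U. y \<sqsubset> v \<and> (\<forall>z\<in>itv y v. J x z))"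
  have RD: "D 2 (\<lambda>e. R (hd e) (hd (tl e)))" unfolding R_def by (rule dint refl d | simp)+
  note d = d D_ee[OF RD]
  define S where "S = (\<lambda>x y. I x \<and> R x y \<and> \<not> (\<exists>p\<in>U. p \<sqsubset> y \<and> (\<forall>z\<in>itv p y. R x z)))"
  have SD: "D 2 (\<lambda>e. S (hd e) (hd (tl e)))" unfolding S_def by (rule dint refl d | simp)+
  have R_disj: "x = x'" if xy: "x \<in> U" "x' \<in> U" "y \<in> U" "I x" "I x'" "R x y" "R x' y" for x x' y
  proof -
    obtain v where v: "v \<in> U" "y \<sqsubset> v" "\<forall>z\<in>itv y v. J x z" using \<open>R x y\<close> unfolding R_def by blast
    obtain v' where v': "v' \<in> U" "y \<sqsubset> v'" "\<forall>z\<in>itv y v'. J x' z" using \<open>R x' y\<close> unfolding R_def by blast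
    obtain z where "z \<in> U" "y \<sqsubset> z" "z \<sqsubset> v" "z \<sqsubset> v'" using dns_min[of y v v'] v v' xy(3) by blast
    then show ?thesis using disj[of x x' z] xy v v' by auto
  qed
  \<comment> \<open>A stretch that is unbounded below has no left end point in \<open>U\<close>; by
    disjointness this happens for at most one \<open>x\<close>.\<close>
  define unb where "unb = (\<lambda>x. \<exists>c\<in>U. \<forall>z\<in>U. z \<sqsubset> c \<longrightarrow> R x z)"
  have unb1: "x = x'" if xx: "x \<in> U" "x' \<in> U" "I x" "I x'" "unb x" "unb x'" for x x'
  proof -
    obtain c c' where c: "c \<in> U" "c' \<in> U" "\<forall>z\<in>U. z \<sqsubset> c \<longrightarrow> R x z" "\<forall>z\<in>U. z \<sqsubset> c' \<longrightarrow> R x' z"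
      using xx unfolding unb_def by blast
    obtain z where "z \<in> U" "z \<sqsubset> c" "z \<sqsubset> c'"
      using below[OF c(1)] below[OF c(2)] by (metis le_cases less_le_trans)
    then show ?thesis using R_disj[of x x' z] c xx by blast
  qed
  have ex: "\<exists>y\<in>U. S x y" if x: "x \<in> U" "I x" "\<not> unb x" for x
  proof -
    have "D 1 (\<lambda>e. J x (hd e))" by (rule dint refl d | use x in simp)+
    then obtain u v where uv: "u \<in> U" "v \<in> U" "u \<sqsubset> v" "\<forall>z\<in>itv u v. J x z"
      using infinite_ex_itv[of "J x"] inf(2)[OF x(1,2)] by blast
    have Ruv: "R x z" if "z \<in> U" "u \<sqsubseteq> z" "z \<sqsubset> v" for z
      unfolding R_def using uv that by (intro bexI[of _ v]) (auto intro: le_less_trans)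
    obtain z0 where z0: "z0 \<in> U" "z0 \<sqsubset> u" "\<not> R x z0" using x(3) uv(1) unfolding unb_def by blast
    obtain z1 where z1: "z1 \<in> U" "z1 \<sqsubset> z0" using below z0 by blast
    define Q where "Q = (\<lambda>z. \<forall>w\<in>itv z v. R x w)"
    have QD: "D 1 (\<lambda>e. Q (hd e))" unfolding Q_def by (rule dint refl d | use x uv in simp)+
    have "Q u" unfolding Q_def using Ruv by auto
    moreover have "\<not> Q z1" unfolding Q_def using z0 z1 uv less_trans by (metis in_itv)
    ultimately obtain t where t: "t \<in> U" "z1 \<sqsubseteq> t" "t \<sqsubseteq> u" "bd Q t"
      using ex_bd[OF QD z1(1) uv(1)] z0 z1 by (metis less_trans)
    have tv: "t \<sqsubset> v" using t uv by (metis le_less_trans)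
    obtain t0 where t0: "t0 \<in> U" "t0 \<sqsubset> t" using below t by blast
    have Qt: "Q t"
    proof (rule ccontr)
      assume nQ: "\<not> Q t"
      then obtain y where y: "y \<in> itv t v" "\<not> R x y" unfolding Q_def by blast
      obtain z where z: "z \<in> U" "z \<sqsubset> y" "Q z \<noteq> Q t" using t(4) t0 y unfolding bd_def by auto
      then show False using nQ y unfolding Q_def by auto
    qed
    have nQ: "\<not> Q z" if z: "z \<in> U" "z \<sqsubset> t" for z
    proof
      assume "Q z"
      obtain y where "y \<in> U" "z \<sqsubset> y" "\<not> Q y" using bdD[OF t(4) z(1) uv(2) z(2) tv] Qt by auto
      then show False using \<open>Q z\<close> unfolding Q_def by (auto intro: less_trans)
    qed
    have Rt: "R x t"
    proof (rule ccontr)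
      assume nR: "\<not> R x t"
      have "D 1 (\<lambda>e. J x (hd e))" by (rule dint refl d | use x in simp)+
      from right_germ[OF this t(1)] obtain w where w: "w \<in> U" "t \<sqsubset> w" "\<forall>y\<in>itv t w. \<not> J x y"
        using nR unfolding R_def by blast
      obtain y where y: "y \<in> U" "t \<sqsubset> y" "y \<sqsubset> w" "y \<sqsubset> v" using dns_min[of t w v] t w tv uv by blast
      then have "R x y" using Qt unfolding Q_def by auto
      then obtain y' where y': "y' \<in> U" "y \<sqsubset> y'" "\<forall>z\<in>itv y y'. J x z" unfolding R_def by blast
      obtain z where z: "z \<in> U" "y \<sqsubset> z" "z \<sqsubset> y'" "z \<sqsubset> w" using dns_min[of y y' w] y y' w by blast
      moreover have "t \<sqsubset> z" using y(2) z(2) by (rule less_trans)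
      ultimately have "z \<in> itv y y'" "z \<in> itv t w" by auto
      then show False using y'(3) w(3) by blast
    qed
    have "\<not> (\<exists>p\<in>U. p \<sqsubset> t \<and> (\<forall>z\<in>itv p t. R x z))"
    proof
      assume "\<exists>p\<in>U. p \<sqsubset> t \<and> (\<forall>z\<in>itv p t. R x z)"
      then obtain p where p: "p \<in> U" "p \<sqsubset> t" "\<forall>z\<in>itv p t. R x z" by blast
      have "R x z" if "z \<in> itv p v" for z
        using p(3) Rt Qt that unfolding Q_def by (cases z t rule: linorder_cases) auto
      then have "Q p" unfolding Q_def by blast
      then show False using nQ p by blast
    qed
    then show ?thesis unfolding S_def using Rt x t by blast
  qed
  have "infinite {y\<in>U. \<exists>x\<in>U. S x y}"
  proof
    assume fin: "finite {y\<in>U. \<exists>x\<in>U. S x y}"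
    let ?A = "{x\<in>U. I x \<and> \<not> unb x}"
    have "\<forall>x\<in>?A. \<exists>y\<in>U. S x y" using ex by blast
    then obtain f where f: "\<And>x. x \<in> ?A \<Longrightarrow> f x \<in> U \<and> S x (f x)" by (metis (lifting))
    have "inj_on f ?A"
    proof (rule inj_onI)
      fix x x' assume "x \<in> ?A" "x' \<in> ?A" "f x = f x'"
      then show "x = x'" using R_disj[of x x' "f x"] f[of x] f[of x'] unfolding S_def by auto
    qed
    moreover have "f ` ?A \<subseteq> {y\<in>U. \<exists>x\<in>U. S x y}" using f by blast
    ultimately have finA: "finite ?A" using fin by (meson finite_imageD finite_subset)
    have "finite {x\<in>U. I x \<and> unb x}"
    proof (cases "\<exists>x\<in>U. I x \<and> unb x")
      case True
      then obtain x where "x \<in> U" "I x" "unb x" by blast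
      then have "{x\<in>U. I x \<and> unb x} \<subseteq> {x}" using unb1 by blast
      then show ?thesis by (rule finite_subset) simp
    next
      case False
      then have "{x\<in>U. I x \<and> unb x} = {}" by blast
      then show ?thesis by (simp only: finite.emptyI)
    qed
    then have "finite (?A \<union> {x\<in>U. I x \<and> unb x})" using finA by simp
    moreover have "?A \<union> {x\<in>U. I x \<and> unb x} = {x\<in>U. I x}" by blast
    ultimately show False using inf(1) by simp
  qed
  moreover have "D 1 (\<lambda>e. \<exists>x\<in>U. S x (hd e))" by (rule dint refl D_ee[OF SD] | simp)+
  ultimately obtain p q where pq: "p \<in> U" "q \<in> U" "p \<sqsubset> q" "\<forall>y\<in>itv p q. \<exists>x\<in>U. S x y"
    using infinite_ex_itv[of "\<lambda>y. \<exists>x\<in>U. S x y"] by blast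
  obtain y where y: "y \<in> U" "p \<sqsubset> y" "y \<sqsubset> q" using dns[of p q] pq by blast
  then have "y \<in> itv p q" by simp
  then obtain x where x: "x \<in> U" "S x y" using pq(4) by blast
  then obtain v where v: "v \<in> U" "y \<sqsubset> v" "\<forall>z\<in>itv y v. J x z" unfolding S_def R_def by blast
  have Rv: "R x z" if "z \<in> itv y v" for z
    unfolding R_def using v that by (intro bexI[of _ v]) (auto intro: less_trans)
  obtain y' where y': "y' \<in> U" "y \<sqsubset> y'" "y' \<sqsubset> v" "y' \<sqsubset> q" using dns_min[of y v q] y v pq by blast
  then have "y' \<in> itv p q" using y by (auto intro: less_trans)
  then obtain x' where x': "x' \<in> U" "S x' y'" using pq(4) by blast
  have "R x y'" using Rv y' by auto
  then have "x' = x" using R_disj[of x' x y'] x x' y' unfolding S_def by blast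
  moreover have "\<forall>z\<in>itv y y'. R x z" using Rv y' by (auto intro: less_trans)
  ultimately show False using x'(2) y y' unfolding S_def by blast
qed

text \<open>Otherwise the end points of a component of \<open>J\<^sub>x\<close> would be monotone in \<open>x\<close> on an interval:
  if they move in opposite directions the components are nested, and if they move in the same
  direction the components are disjoint.\<close>

lemma ex_infinite_fibre:
  assumes ID: "D 1 (\<lambda>e. I (hd e))" and JD: "D 2 (\<lambda>e. J (hd e) (hd (tl e)))"
    and inf: "infinite {x\<in>U. I x}" "\<And>x. x \<in> U \<Longrightarrow> I x \<Longrightarrow> infinite {y\<in>U. J x y}"
  shows "\<exists>y\<in>U. infinite {x\<in>U. I x \<and> J x y}"
proof (rule ccontr)
  assume "\<not> ?thesis"
  then have fin: "finite {x\<in>U. I x \<and> J x y}" if "y \<in> U" for y using that by blast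
  obtain a b where ab: "a \<in> U" "b \<in> U" "a \<sqsubset> b" "\<And>x. x \<in> itv a b \<Longrightarrow> I x"
    using infinite_ex_itv[OF ID inf(1)] by blast
  have infJ: "infinite {y\<in>U. J x y}" if "x \<in> itv a b" for x using that inf(2) ab(4) by simp
  note d = D_ee[OF JD]
  \<comment> \<open>\<open>N x\<close> is the interior of \<open>J x\<close>, and \<open>E x\<close>
    below is its leftmost component. Taking the leftmost one is what makes the component definable
    in \<open>x\<close>.\<close>
  define N where "N = (\<lambda>x y. \<exists>u\<in>U. \<exists>v\<in>U. u \<sqsubset> y \<and> y \<sqsubset> v \<and> (\<forall>z\<in>itv u v. J x z))"
  have ND: "D 2 (\<lambda>e. N (hd e) (hd (tl e)))" unfolding N_def by (rule dint refl d | simp)+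
  note d = d D_ee[OF ND]
  define E where "E = (\<lambda>x y. N x y \<and> (\<forall>z\<in>U. z \<sqsubset> y \<and> N x z \<longrightarrow> (\<forall>w\<in>itv z y. N x w)))"
  have ED: "D 2 (\<lambda>e. E (hd e) (hd (tl e)))" unfolding E_def by (rule dint refl d | simp)+
  note d = D_ee[OF ED]
  have EJ: "J x y" if "E x y" "y \<in> U" for x y using that unfolding E_def N_def by auto
  have conv: "E x w" if "E x y" "E x y'" "y \<in> U" "y' \<in> U" "w \<in> U" "y \<sqsubseteq> w" "w \<sqsubseteq> y'" for x y y' w
  proof (cases "y = w \<or> w = y'")
    case True
    then show ?thesis using that by blast
  next
    case False
    then have w: "w \<in> itv y y'" using that by auto
    then have "y \<sqsubset> y'" by (auto intro: less_trans)
    then have "N x w" using w that unfolding E_def by blast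
    moreover have "N x t" if "z \<in> U" "z \<sqsubset> w" "N x z" "t \<in> itv z w" for z t
    proof -
      have "z \<sqsubset> y'" "t \<in> itv z y'" using that w by (auto intro: less_trans)
      then show ?thesis using \<open>E x y'\<close> that unfolding E_def by blast
    qed
    ultimately show ?thesis unfolding E_def by blast
  qed
  have infE: "infinite {y\<in>U. E x y}" if x: "x \<in> itv a b" for x
  proof -
    have xU: "x \<in> U" using x by simp
    have "D 1 (\<lambda>e. J x (hd e))" by (rule dint refl D_ee[OF JD] | use xU in simp)+
    then obtain u v where uv: "u \<in> U" "v \<in> U" "u \<sqsubset> v" "\<forall>z\<in>itv u v. J x z"
      using infinite_ex_itv[of "J x"] infJ[OF x] by blast
    obtain n where n: "n \<in> U" "u \<sqsubset> n" "n \<sqsubset> v" using dns[of u v] uv by blast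
    then have Nn: "N x n" unfolding N_def using uv by blast
    have nbh: "\<exists>u\<in>U. u \<sqsubset> y \<and> (\<forall>z\<in>itv u y. N x z)" if Ny: "N x y" for y
    proof -
      obtain u v where uv: "u \<in> U" "v \<in> U" "u \<sqsubset> y" "y \<sqsubset> v" "\<forall>z\<in>itv u v. J x z"
        using Ny unfolding N_def by blast
      have "N x z" if z: "z \<in> itv u y" for z
        unfolding N_def using uv z by (intro bexI[of _ u] bexI[of _ v]) (auto intro: less_trans)
      then show ?thesis using uv by blast
    qed
    have "D 1 (\<lambda>e. N x (hd e))" by (rule dint refl D_ee[OF ND] | use xU in simp)+
    from finite_break[OF this] obtain F where F: "finite F" "F \<subseteq> U"
      "\<forall>s\<in>U. \<forall>t\<in>U. s \<sqsubset> t \<longrightarrow> (\<forall>z\<in>F. z \<sqsubset> s \<or> t \<sqsubset> z) \<longrightarrow> N x s = N x t" by blast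
    let ?F = "{f\<in>F. \<exists>w\<in>U. N x w \<and> w \<sqsubseteq> f}"
    have "\<exists>y\<in>U. N x y \<and> (\<forall>f\<in>?F. y \<sqsubset> f)"
    proof (cases "?F = {}")
      case True
      then show ?thesis using Nn n by blast
    next
      case False
      then obtain f where f: "f \<in> ?F" "\<forall>g\<in>?F. f \<sqsubseteq> g" using fin_min[of ?F] F(1) by auto
      then obtain w where w: "w \<in> U" "N x w" "w \<sqsubseteq> f" by blast
      obtain u where u: "u \<in> U" "u \<sqsubset> w" "\<forall>z\<in>itv u w. N x z" using nbh[OF w(2)] by blast
      obtain y where y: "y \<in> U" "u \<sqsubset> y" "y \<sqsubset> w" using dns[of u w] u w by blast
      have "\<forall>g\<in>?F. y \<sqsubset> g" using f y w by (metis less_le_trans)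
      moreover have "N x y" using y u by auto
      ultimately show ?thesis using y(1) by blast
    qed
    then obtain y where y: "y \<in> U" "N x y" "\<forall>f\<in>?F. y \<sqsubset> f" by blast
    have Ey: "N x w" if "z \<in> U" "z \<sqsubset> y" "N x z" "w \<in> itv z y" for z w
    proof -
      have "f \<sqsubset> z \<or> w \<sqsubset> f" if "f \<in> F" for f
        using y(3) that \<open>z \<in> U\<close> \<open>N x z\<close> \<open>w \<in> itv z y\<close> by (cases "f \<sqsubset> z") (auto simp: not_less intro: less_trans)
      then show ?thesis using F(3) that by auto
    qed
    obtain u where u: "u \<in> U" "u \<sqsubset> y" "\<forall>z\<in>itv u y. N x z" using nbh[OF y(2)] by blast
    have "E x w" if w: "w \<in> itv u y" for w
    proof -
      have "N x t" if "z \<in> U" "z \<sqsubset> w" "N x z" "t \<in> itv z w" for z t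
        using Ey[of z t] that w by (auto intro: less_trans)
      then show ?thesis unfolding E_def using u w by blast
    qed
    then have "itv u y \<subseteq> {y\<in>U. E x y}" by auto
    then show ?thesis using infinite_itv[OF u(1) y(1) u(2)] infinite_super by metis
  qed
  \<comment> \<open>\<open>leA\<close> compares the left ends of two components and
    \<open>leB\<close> the right ends. Comparing the sets avoids forming the ends, which may be
    infinite.\<close>
  define leA where "leA = (\<lambda>x x'. \<forall>y'\<in>U. E x' y' \<longrightarrow> (\<exists>y\<in>U. E x y \<and> y \<sqsubseteq> y'))"
  define leB where "leB = (\<lambda>x x'. \<forall>y\<in>U. E x y \<longrightarrow> (\<exists>y'\<in>U. E x' y' \<and> y \<sqsubseteq> y'))"
  have tA: "leA x x' \<or> leA x' x" and tB: "leB x x' \<or> leB x' x" for x x'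
    unfolding leA_def leB_def by (meson le_cases)+
  have trA: "leA x z" if "leA x y" "leA y z" for x y z
    using that unfolding leA_def by (meson order_trans)
  have trB: "leB x z" if "leB x y" "leB y z" for x y z
    using that unfolding leB_def by (meson order_trans)
  have AD: "D 2 (\<lambda>e. leA (hd e) (hd (tl e)))" unfolding leA_def by (rule dint refl d | simp)+
  have BD: "D 2 (\<lambda>e. leB (hd e) (hd (tl e)))" unfolding leB_def by (rule dint refl d | simp)+
  have "line_preorder (\<sqsubseteq>) (\<sqsubset>) U D leA a b"
    by unfold_locales (use AD ab tA trA in blast)+
  from line_preorder.preorder_monotone[OF this ab(3)] obtain u1 v1 where 1: "u1 \<in> U" "v1 \<in> U"
      "a \<sqsubseteq> u1" "u1 \<sqsubset> v1" "v1 \<sqsubseteq> b"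
    and mA: "(\<forall>x\<in>itv u1 v1. \<forall>y\<in>itv u1 v1. x \<sqsubset> y \<longrightarrow> leA x y) \<or> (\<forall>x\<in>itv u1 v1. \<forall>y\<in>itv u1 v1. x \<sqsubset> y \<longrightarrow> leA y x)"
    using tA by blast
  have "line_preorder (\<sqsubseteq>) (\<sqsubset>) U D leB u1 v1"
    by unfold_locales (use BD 1 tB trB in blast)+
  from line_preorder.preorder_monotone[OF this 1(4)] obtain u v where 2: "u \<in> U" "v \<in> U"
      "u1 \<sqsubseteq> u" "u \<sqsubset> v" "v \<sqsubseteq> v1"
    and mB: "(\<forall>x\<in>itv u v. \<forall>y\<in>itv u v. x \<sqsubset> y \<longrightarrow> leB x y) \<or> (\<forall>x\<in>itv u v. \<forall>y\<in>itv u v. x \<sqsubset> y \<longrightarrow> leB y x)"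
    using tB by blast
  have sub: "x \<in> itv u1 v1" "x \<in> itv a b" if "x \<in> itv u v" for x
    using that 1 2 by (auto intro: le_less_trans less_le_trans)
  have mA: "(\<forall>x\<in>itv u v. \<forall>y\<in>itv u v. x \<sqsubset> y \<longrightarrow> leA x y) \<or> (\<forall>x\<in>itv u v. \<forall>y\<in>itv u v. x \<sqsubset> y \<longrightarrow> leA y x)"
    using mA sub by blast
  have mid: "E x y" if "leA x x1" "leB x2 x" "E x1 y" "E x2 y" "y \<in> U" for x x1 x2 y
    using that conv unfolding leA_def leB_def by blast
  obtain x1 where x1: "x1 \<in> U" "u \<sqsubset> x1" "x1 \<sqsubset> v" using dns[of u v] 2 by blast
  have "{y\<in>U. E x1 y} \<noteq> {}" using infE[OF sub(2)[of x1]] x1 by (metis finite.emptyI in_itv)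
  then obtain y1 where y1: "y1 \<in> U" "E x1 y1" by blast
  have nest: False if "itv s t \<subseteq> itv u v" "s \<in> U" "t \<in> U" "s \<sqsubset> t" "\<And>x. x \<in> itv s t \<Longrightarrow> E x y" "y \<in> U" for s t y
  proof -
    have "itv s t \<subseteq> {x\<in>U. I x \<and> J x y}" using that EJ ab(4) sub by (auto simp: subset_iff)
    then show False using infinite_itv[OF that(2-4)] fin[OF that(6)] finite_subset by metis
  qed
  \<comment> \<open>If both ends move in the same direction, a point common to \<open>E x\<close>
    and \<open>E x'\<close> lies in \<open>E w\<close> for all \<open>w\<close> between, which would
    give it an infinite fibre. So the components are disjoint and \<open>no_disjoint_family\<close>
    applies.\<close>
  have disj: False if conv: "\<And>x w x'. x \<in> itv u v \<Longrightarrow> x' \<in> itv u v \<Longrightarrow> w \<in> itv x x' \<Longrightarrow>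
    (leA w x \<and> leB x' w) \<or> (leA w x' \<and> leB x w)"
  proof (rule no_disjoint_family[of "\<lambda>x. u \<sqsubset> x \<and> x \<sqsubset> v" E])
    show "D 1 (\<lambda>e. u \<sqsubset> hd e \<and> hd e \<sqsubset> v)" by (rule dint refl | use 2 in simp)+
    show "infinite {x\<in>U. u \<sqsubset> x \<and> x \<sqsubset> v}" using infinite_itv[OF 2(1,2,4)] unfolding itv_def .
    show "infinite {y\<in>U. E x y}" if "x \<in> U" "u \<sqsubset> x \<and> x \<sqsubset> v" for x using that infE sub by simp
    have less: False if "x \<sqsubset> x'" "x \<in> itv u v" "x' \<in> itv u v" "y \<in> U" "E x y" "E x' y" for x x' y
    proof (rule nest[of x x' y])
      show "itv x x' \<subseteq> itv u v" using that by (auto intro: less_trans)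
      show "E w y" if "w \<in> itv x x'" for w
        using conv[OF \<open>x \<in> itv u v\<close> \<open>x' \<in> itv u v\<close> that] mid \<open>E x y\<close> \<open>E x' y\<close> \<open>y \<in> U\<close> by blast
    qed (use that in auto)
    show "x = x'" if "x \<in> U" "x' \<in> U" "y \<in> U" "u \<sqsubset> x \<and> x \<sqsubset> v" "u \<sqsubset> x' \<and> x' \<sqsubset> v" "E x y" "E x' y" for x x' y
      using less[of x x' y] less[of x' x y] that by (cases x x' rule: linorder_cases) auto
  qed (rule ED)
  from mA mB show False
  proof (elim disjE)
    assume A: "\<forall>x\<in>itv u v. \<forall>y\<in>itv u v. x \<sqsubset> y \<longrightarrow> leA x y" and B: "\<forall>x\<in>itv u v. \<forall>y\<in>itv u v. x \<sqsubset> y \<longrightarrow> leB x y"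
    show False
    proof (rule disj)
      fix x w x' assume "x \<in> itv u v" "x' \<in> itv u v" "w \<in> itv x x'"
      moreover from this have "w \<in> itv u v" by (auto intro: less_trans)
      ultimately show "(leA w x \<and> leB x' w) \<or> (leA w x' \<and> leB x w)" using A B by auto
    qed
  next
    assume A: "\<forall>x\<in>itv u v. \<forall>y\<in>itv u v. x \<sqsubset> y \<longrightarrow> leA y x" and B: "\<forall>x\<in>itv u v. \<forall>y\<in>itv u v. x \<sqsubset> y \<longrightarrow> leB y x"
    show False
    proof (rule disj)
      fix x w x' assume "x \<in> itv u v" "x' \<in> itv u v" "w \<in> itv x x'"
      moreover from this have "w \<in> itv u v" by (auto intro: less_trans)
      ultimately show "(leA w x \<and> leB x' w) \<or> (leA w x' \<and> leB x w)" using A B by auto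
    qed
  next
    assume A: "\<forall>x\<in>itv u v. \<forall>y\<in>itv u v. x \<sqsubset> y \<longrightarrow> leA x y" and B: "\<forall>x\<in>itv u v. \<forall>y\<in>itv u v. x \<sqsubset> y \<longrightarrow> leB y x"
    show False
    proof (rule nest[of u x1 y1])
      show "itv u x1 \<subseteq> itv u v" using x1 by (auto intro: less_trans)
      show "E x y1" if "x \<in> itv u x1" for x
      proof (rule mid[OF _ _ y1(2,2,1)])
        have "x \<in> itv u v" using that x1 by (auto intro: less_trans)
        then show "leA x x1" "leB x1 x" using A B that x1 by auto
      qed
    qed (use x1 y1 2 in auto)
  next
    assume A: "\<forall>x\<in>itv u v. \<forall>y\<in>itv u v. x \<sqsubset> y \<longrightarrow> leA y x" and B: "\<forall>x\<in>itv u v. \<forall>y\<in>itv u v. x \<sqsubset> y \<longrightarrow> leB x y"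
    show False
    proof (rule nest[of x1 v y1])
      show "itv x1 v \<subseteq> itv u v" using x1 by (auto intro: less_trans)
      show "E x y1" if "x \<in> itv x1 v" for x
      proof (rule mid[OF _ _ y1(2,2,1)])
        have "x \<in> itv u v" using that x1 by (auto intro: less_trans)
        then show "leA x x1" "leB x1 x" using A B that x1 by auto
      qed
    qed (use x1 y1 2 in auto)
  qed
qed

text \<open>The exchange principle for generic points. In its uses \<open>B x z\<close> says that
  \<open>x\<close> is exceptional for the auxiliary point \<open>z\<close>. If each auxiliary point
  has finitely many exceptional \<open>x\<close>, then all but finitely many \<open>x\<close> leave
  cofinitely many auxiliary points usable.\<close>

corollary finite_infinite_fibres:
  assumes BD: "D 2 (\<lambda>e. B (hd e) (hd (tl e)))" and fin: "\<And>z. z \<in> U \<Longrightarrow> finite {x\<in>U. B x z}"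
  shows "finite {x\<in>U. infinite {z\<in>U. B x z}}"
proof (rule ccontr)
  assume inf: "infinite {x\<in>U. infinite {z\<in>U. B x z}}"
  have "D 1 (\<lambda>e. infinite {z\<in>U. B (hd e) z})" by (rule dint refl D_ee[OF BD] | simp)+
  from ex_infinite_fibre[OF this BD inf] obtain z where
    z: "z \<in> U" "infinite {x\<in>U. infinite {z\<in>U. B x z} \<and> B x z}" by blast
  have "{x\<in>U. infinite {z\<in>U. B x z} \<and> B x z} \<subseteq> {x\<in>U. B x z}" by blast
  from finite_subset[OF this fin[OF z(1)]] show False using z(2) by blast
qed

abbreviation atl :: "nat \<Rightarrow> ('a \<Rightarrow> bool) \<Rightarrow> bool" where "atl \<equiv> at_least U (\<sqsubset>)"

lemma atl_card:
  assumes "finite {x\<in>U. P x}" shows "atl k P \<longleftrightarrow> k \<le> card {x\<in>U. P x}"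
proof
  assume "atl k P"
  then obtain S where S: "card S = k" "S \<subseteq> {x\<in>U. P x}" unfolding at_least_iff by blast
  then show "k \<le> card {x\<in>U. P x}" using card_mono[OF assms S(2)] by simp
next
  assume "k \<le> card {x\<in>U. P x}"
  then obtain S where "S \<subseteq> {x\<in>U. P x}" "card S = k" "finite S" by (rule obtain_subset_with_card_n)
  then show "atl k P" unfolding at_least_iff by blast
qed

lemma D_atl [dint]: "D (Suc n) (\<lambda>e. \<chi> (hd e) (tl e)) \<Longrightarrow> D n (\<lambda>e. atl k (\<lambda>x. \<chi> x e))"
proof (induction k arbitrary: n \<chi>)
  case 0
  then show ?case by (simp add: D_const)
next
  case (Suc k)
  have "D (Suc (Suc n)) (\<lambda>e. \<chi> (hd e) (tl (tl e)) \<and> hd (tl e) \<sqsubset> hd e)"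
    by (rule dint refl D_el[OF Suc.prems] | simp)+
  then have "D (Suc n) (\<lambda>e. atl k (\<lambda>y. \<chi> y (tl e) \<and> hd e \<sqsubset> y))"
    by (rule Suc.IH)
  then have "D n (\<lambda>e. \<exists>x\<in>U. \<chi> x e \<and> atl k (\<lambda>y. \<chi> y e \<and> x \<sqsubset> y))"
    by (intro D_ex D_and Suc.prems)
  then show ?case by simp
qed

end

section \<open>Uniform finiteness\<close>

context omin begin

text \<open>Values in an arbitrary type are allowed because the notion is applied to fibre sizes,
  which are not elements of \<open>U\<close>. For predicates it is the negation of
  \<open>bd\<close>.\<close>

definition lcon :: "('a \<Rightarrow> 'b) \<Rightarrow> 'a \<Rightarrow> bool" where
  "lcon f x \<longleftrightarrow> (\<exists>u\<in>U. \<exists>v\<in>U. u \<sqsubset> x \<and> x \<sqsubset> v \<and> (\<forall>y\<in>itv u v. f y = f x))"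

lemma lcon_iff: "lcon P x \<longleftrightarrow> \<not> bd P x"
  unfolding lcon_def bd_def itv_def by blast

lemma lcon_pair:
  assumes "lcon f x" "lcon g x" "x \<in> U" shows "lcon (\<lambda>x. (f x, g x)) x"
proof -
  obtain u v where 1: "u \<in> U" "v \<in> U" "u \<sqsubset> x" "x \<sqsubset> v" "\<forall>y\<in>itv u v. f y = f x"
    using assms(1) unfolding lcon_def by blast
  obtain u' v' where 2: "u' \<in> U" "v' \<in> U" "u' \<sqsubset> x" "x \<sqsubset> v'" "\<forall>y\<in>itv u' v'. g y = g x"
    using assms(2) unfolding lcon_def by blast
  obtain p where p: "p \<in> U" "u \<sqsubset> p" "u' \<sqsubset> p" "p \<sqsubset> x" using dns_max[of x u u'] 1 2 assms by blast
  obtain q where q: "q \<in> U" "x \<sqsubset> q" "q \<sqsubset> v" "q \<sqsubset> v'" using dns_min[of x v v'] 1 2 assms by blast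
  have "(f y, g y) = (f x, g x)" if "y \<in> itv p q" for y
  proof -
    have "y \<in> itv u v" "y \<in> itv u' v'" using that p q by (auto intro: less_trans)
    then show ?thesis using 1(5) 2(5) by simp
  qed
  then show ?thesis unfolding lcon_def using p q by blast
qed

lemma lcon_map:
  assumes "lcon f x" "\<And>y. y \<in> U \<Longrightarrow> f y = f x \<Longrightarrow> g y = g x" shows "lcon g x"
  using assms unfolding lcon_def in_itv by (meson in_itv)

text \<open>A point of \<open>X\<^sub>x\<close> is isolated from the others by two generic points \<open>z, z'\<close>, and for generic
  \<open>x\<close> whether the window \<open>(z, z')\<close> contains no, one or more points of \<open>X\<^sub>x\<close> is locally constant.\<close>

lemma card_locally_constant:
  assumes XD: "D (Suc (Suc p)) (\<lambda>e. X (hd e) (hd (tl e)) (tl (tl e)))"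
    and fin: "\<And>x w. x \<in> U \<Longrightarrow> w \<in> nlists p U \<Longrightarrow> finite {z\<in>U. X z x w}"
  shows "\<exists>C. D (Suc p) (\<lambda>e. C (hd e) (tl e)) \<and> (\<forall>w\<in>nlists p U. finite {x\<in>U. C x w} \<and>
    (\<forall>x\<in>U. \<not> C x w \<longrightarrow> lcon (\<lambda>x. card {z\<in>U. X z x w}) x))"
proof -
  note d = D_eel[OF XD]
  define h1 where "h1 = (\<lambda>z x w. \<exists>y\<in>U. X y x w \<and> y \<sqsubset> z)"
  define h2 where "h2 = (\<lambda>z x w. \<exists>y\<in>U. X y x w \<and> z \<sqsubset> y)"
  define e0 where "e0 = (\<lambda>z z' x w. \<exists>y\<in>itv z z'. X y x w)"
  define e1 where "e1 = (\<lambda>z z' x w. \<exists>y\<in>itv z z'. \<exists>y'\<in>itv y z'. X y x w \<and> X y' x w)"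
  have h1D: "D (Suc (Suc p)) (\<lambda>e. h1 (hd e) (hd (tl e)) (tl (tl e)))"
    unfolding h1_def by (rule dint refl d | simp)+
  have h2D: "D (Suc (Suc p)) (\<lambda>e. h2 (hd e) (hd (tl e)) (tl (tl e)))"
    unfolding h2_def by (rule dint refl d | simp)+
  have e0D: "D (Suc (Suc (Suc p))) (\<lambda>e. e0 (hd e) (hd (tl e)) (hd (tl (tl e))) (tl (tl (tl e))))"
    unfolding e0_def by (rule dint refl d | simp)+
  have e1D: "D (Suc (Suc (Suc p))) (\<lambda>e. e1 (hd e) (hd (tl e)) (hd (tl (tl e))) (tl (tl (tl e))))"
    unfolding e1_def by (rule dint refl d | simp)+
  note d = d D_eel[OF h1D] D_eel[OF h2D] D_eeel[OF e0D] D_eeel[OF e1D]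
  \<comment> \<open>\<open>B2\<close> collects the changes at \<open>x\<close> of what is visible
    from a single point \<open>z\<close>: membership of \<open>z\<close> and the presence of points
    on either side. \<open>B3\<close> does the same for what is visible in the window between
    \<open>z\<close> and \<open>z'\<close>.\<close>
  define B2 where "B2 = (\<lambda>z x w. bd (\<lambda>x. X z x w) x \<or> bd (\<lambda>x. h1 z x w) x \<or> bd (\<lambda>x. h2 z x w) x)"
  define B3 where "B3 = (\<lambda>z z' x w. bd (\<lambda>x. e0 z z' x w) x \<or> bd (\<lambda>x. e1 z z' x w) x)"
  have B2D: "D (Suc (Suc p)) (\<lambda>e. B2 (hd e) (hd (tl e)) (tl (tl e)))"
    unfolding B2_def by (rule dint refl d | simp)+
  have B3D: "D (Suc (Suc (Suc p))) (\<lambda>e. B3 (hd e) (hd (tl e)) (hd (tl (tl e))) (tl (tl (tl e))))"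
    unfolding B3_def by (rule dint refl d | simp)+
  note d = d D_eel[OF B2D] D_eeel[OF B3D]
  define F where "F = (\<lambda>z x w. infinite {z'\<in>U. B3 z z' x w})"
  have FD: "D (Suc (Suc p)) (\<lambda>e. F (hd e) (hd (tl e)) (tl (tl e)))"
    unfolding F_def by (rule dint refl d | simp)+
  note d = d D_eel[OF FD]
  define C where "C = (\<lambda>x w. infinite {z\<in>U. B2 z x w \<or> F z x w})"
  have CD: "D (Suc p) (\<lambda>e. C (hd e) (tl e))" unfolding C_def by (rule dint refl d | simp)+
  have "finite {x\<in>U. C x w} \<and> (\<forall>x\<in>U. \<not> C x w \<longrightarrow> lcon (\<lambda>x. card {z\<in>U. X z x w}) x)"
    if w: "w \<in> nlists p U" for w
  proof
    \<comment> \<open>For fixed \<open>z\<close> and \<open>z'\<close> only finitely many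
      \<open>x\<close> are bad, since definable sets have finite boundary. Exchanging the roles of
      \<open>x\<close> and \<open>z'\<close> here, and of \<open>x\<close> and \<open>z\<close> for
      \<open>C\<close>, shows that off finitely many \<open>x\<close> almost all \<open>z\<close>,
      and for these almost all \<open>z'\<close>, are usable.\<close>
    have finF: "finite {x\<in>U. F z x w}" if z: "z \<in> U" for z
      unfolding F_def
    proof (rule finite_infinite_fibres)
      show "D 2 (\<lambda>e. B3 z (hd (tl e)) (hd e) w)" by (rule dint refl d | use z w in simp)+
      show "finite {x\<in>U. B3 z z' x w}" if z': "z' \<in> U" for z'
      proof -
        have "D 1 (\<lambda>e. e0 z z' (hd e) w)" "D 1 (\<lambda>e. e1 z z' (hd e) w)"
          by (rule dint refl d | use z z' w in simp)+
        then show ?thesis unfolding B3_def using finite_bd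
          by (simp add: conj_disj_distribL Collect_disj_eq)
      qed
    qed
    show "finite {x\<in>U. C x w}"
      unfolding C_def
    proof (rule finite_infinite_fibres)
      show "D 2 (\<lambda>e. B2 (hd (tl e)) (hd e) w \<or> F (hd (tl e)) (hd e) w)"
        by (rule dint refl d | use w in simp)+
      show "finite {x\<in>U. B2 z x w \<or> F z x w}" if z: "z \<in> U" for z
      proof -
        have "D 1 (\<lambda>e. X z (hd e) w)" "D 1 (\<lambda>e. h1 z (hd e) w)" "D 1 (\<lambda>e. h2 z (hd e) w)"
          by (rule dint refl d | use z w in simp)+
        then show ?thesis unfolding B2_def using finite_bd finF[OF z]
          by (simp add: conj_disj_distribL Collect_disj_eq)
      qed
    qed
    show "\<forall>x\<in>U. \<not> C x w \<longrightarrow> lcon (\<lambda>x. card {z\<in>U. X z x w}) x"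
    proof (intro ballI impI)
      fix x0 assume x0: "x0 \<in> U" "\<not> C x0 w"
      define good where "good = (\<lambda>z. \<not> B2 z x0 w \<and> \<not> F z x0 w)"
      have cofin: "finite {z\<in>U. \<not> good z}" using x0(2) unfolding C_def good_def by simp
      have fin': "finite {y\<in>U. X y x w \<and> z \<sqsubset> y}" if "x \<in> U" for x z
        using finite_subset[OF _ fin[OF that w]] by (metis (no_types, lifting) mem_Collect_eq subsetI)
      \<comment> \<open>Induction on the number of points of the fibre beyond \<open>z\<close>: a
        generic \<open>z'\<close> right behind the first of these points isolates it in the window
        from \<open>z\<close> to \<open>z'\<close>, and the remaining ones are counted from
        \<open>z'\<close>.\<close>
      have claim: "lcon (\<lambda>x. card {y\<in>U. X y x w \<and> z \<sqsubset> y}) x0"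
        if "z \<in> U" "good z" "\<not> X z x0 w" "card {y\<in>U. X y x0 w \<and> z \<sqsubset> y} = n" for z n
        using that
      proof (induction n arbitrary: z)
        case 0
        then have "{y\<in>U. X y x0 w \<and> z \<sqsubset> y} = {}" using fin'[OF x0(1), of z] by simp
        moreover have "lcon (\<lambda>x. h2 z x w) x0" using 0(2) unfolding good_def B2_def lcon_iff by blast
        ultimately show ?case
        proof (elim lcon_map)
          fix x assume e: "{y\<in>U. X y x0 w \<and> z \<sqsubset> y} = {}" "x \<in> U" "h2 z x w = h2 z x0 w"
          then have "\<not> h2 z x0 w" unfolding h2_def by blast
          then have "{y\<in>U. X y x w \<and> z \<sqsubset> y} = {}" using e(3) unfolding h2_def by blast
          then show "card {y\<in>U. X y x w \<and> z \<sqsubset> y} = card {y\<in>U. X y x0 w \<and> z \<sqsubset> y}" using e(1) by (simp only:)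
        qed
      next
        case (Suc n)
        let ?S = "{y\<in>U. X y x0 w \<and> z \<sqsubset> y}"
        have "?S \<noteq> {}" using Suc.prems(4) by (metis card.empty nat.distinct(1))
        then obtain y1 where y1: "y1 \<in> ?S" "\<forall>y\<in>?S. y1 \<sqsubseteq> y" using fin_min[of ?S] fin'[OF x0(1)] by blast
        have y1': "y1 \<in> U" "X y1 x0 w" "z \<sqsubset> y1" using y1(1) by auto
        have "\<exists>t\<in>U. y1 \<sqsubset> t \<and> (\<forall>y\<in>?S. y1 \<sqsubset> y \<longrightarrow> t \<sqsubseteq> y)"
        proof -
          obtain t where "t \<in> U" "y1 \<sqsubset> t" "\<forall>y\<in>?S. y1 \<sqsubset> y \<longrightarrow> t \<sqsubset> y"
            using right_gap[of ?S y1] fin'[OF x0(1), of z] y1'(1) by blast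
          then show ?thesis by (meson less_imp_le)
        qed
        then obtain t where t: "t \<in> U" "y1 \<sqsubset> t" "\<forall>y\<in>?S. y1 \<sqsubset> y \<longrightarrow> t \<sqsubseteq> y" by blast
        have finB3: "finite {z'\<in>U. B3 z z' x0 w}" using Suc.prems(2) unfolding good_def F_def by blast
        have "infinite (itv y1 t - ({z\<in>U. \<not> good z} \<union> {z'\<in>U. B3 z z' x0 w}))"
          using infinite_itv[OF y1'(1) t(1,2)] cofin finB3 by (intro Diff_infinite_finite) auto
        then obtain z' where "z' \<in> itv y1 t - ({z\<in>U. \<not> good z} \<union> {z'\<in>U. B3 z z' x0 w})"
          by (metis finite.emptyI ex_in_conv)
        then have z': "z' \<in> U" "y1 \<sqsubset> z'" "z' \<sqsubset> t" "good z'" "\<not> B3 z z' x0 w" by auto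
        have zz': "z \<sqsubset> z'" using y1'(3) z'(2) by (rule less_trans)
        have nX: "\<not> X z' x0 w"
        proof
          assume "X z' x0 w"
          then have "z' \<in> ?S" using z' zz' by simp
          then show False using t(3) z' by auto
        qed
        have rest: "{y\<in>U. X y x0 w \<and> z' \<sqsubset> y} = ?S - {y1}"
        proof (intro equalityI subsetI)
          fix y assume "y \<in> {y\<in>U. X y x0 w \<and> z' \<sqsubset> y}"
          then have y: "y \<in> U" "X y x0 w" "z' \<sqsubset> y" by auto
          then have "z \<sqsubset> y" "y1 \<sqsubset> y" using zz' z'(2) less_trans by blast+
          then show "y \<in> ?S - {y1}" using y by auto
        next
          fix y assume y: "y \<in> ?S - {y1}"
          then have "y1 \<sqsubset> y" using y1(2) by (metis DiffE insertCI le_less)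
          then have "t \<sqsubseteq> y" using t(3) y by blast
          then show "y \<in> {y\<in>U. X y x0 w \<and> z' \<sqsubset> y}" using y z'(3) by (auto intro: less_le_trans)
        qed
        have "card (?S - {y1}) = n" using y1(1) Suc.prems(4) fin'[OF x0(1), of z] by simp
        then have "card {y\<in>U. X y x0 w \<and> z' \<sqsubset> y} = n" using rest by simp
        from Suc.IH[OF z'(1,4) nX this] have
          l1: "lcon (\<lambda>x. card {y\<in>U. X y x w \<and> z' \<sqsubset> y}) x0" .
        have l2: "lcon (\<lambda>x. X z' x w) x0" using z'(4) unfolding good_def B2_def lcon_iff by blast
        have l3: "lcon (\<lambda>x. e0 z z' x w) x0" "lcon (\<lambda>x. e1 z z' x w) x0"
          using z'(5) unfolding B3_def lcon_iff by blast+
        have card_eq: "card {y\<in>U. X y x w \<and> z \<sqsubset> y} = Suc (card {y\<in>U. X y x w \<and> z' \<sqsubset> y})"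
          if x: "x \<in> U" "\<not> X z' x w" "e0 z z' x w" "\<not> e1 z z' x w" for x
        proof -
          obtain y0 where y0: "y0 \<in> itv z z'" "X y0 x w" using x(3) unfolding e0_def by blast
          have uniq: "y = y0" if "y \<in> itv z z'" "X y x w" for y
          proof (cases y y0 rule: linorder_cases)
            case less
            then have "y0 \<in> itv y z'" using y0 by simp
            then show ?thesis using x(4) that y0 unfolding e1_def by blast
          next
            case greater
            then have "y \<in> itv y0 z'" using that by simp
            then show ?thesis using x(4) that y0 unfolding e1_def by blast
          qed
          have "{y\<in>U. X y x w \<and> z \<sqsubset> y} = insert y0 {y\<in>U. X y x w \<and> z' \<sqsubset> y}"
          proof (intro equalityI subsetI)
            fix y assume "y \<in> {y\<in>U. X y x w \<and> z \<sqsubset> y}"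
            then have y: "y \<in> U" "X y x w" "z \<sqsubset> y" by auto
            then have "y \<noteq> z'" using x(2) by blast
            then show "y \<in> insert y0 {y\<in>U. X y x w \<and> z' \<sqsubset> y}" using y uniq[of y] by auto
          next
            fix y assume y: "y \<in> insert y0 {y\<in>U. X y x w \<and> z' \<sqsubset> y}"
            then show "y \<in> {y\<in>U. X y x w \<and> z \<sqsubset> y}" using y0 zz' by (auto intro: less_trans)
          qed
          moreover have "y0 \<notin> {y\<in>U. X y x w \<and> z' \<sqsubset> y}" using y0 by auto
          ultimately show ?thesis using fin'[OF x(1), of z'] by simp
        qed
        have e0x0: "e0 z z' x0 w" unfolding e0_def using y1' z' by (intro bexI[of _ y1]) auto
        have e1x0: "\<not> e1 z z' x0 w"
        proof
          assume "e1 z z' x0 w"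
          then obtain y y' where yy: "y \<in> itv z z'" "y' \<in> itv y z'" "X y x0 w" "X y' x0 w"
            unfolding e1_def by blast
          then have "y \<in> ?S" "y' \<in> ?S" by (auto intro: less_trans)
          then have "y1 \<sqsubseteq> y" "y1 \<sqsubset> y'" using y1(2) yy(2) by (auto intro: le_less_trans)
          then have "t \<sqsubseteq> y'" using t(3) \<open>y' \<in> ?S\<close> by blast
          then show False using yy z' by auto
        qed
        show ?case
          by (rule lcon_map[OF lcon_pair[OF l1 lcon_pair[OF l2 lcon_pair[OF l3 x0(1)] x0(1)] x0(1)]])
            (use card_eq nX e0x0 e1x0 x0(1) in simp)
      qed
      let ?S = "{y\<in>U. X y x0 w}"
      \<comment> \<open>A generic \<open>z\<close> to the left of the whole fibre at
        \<open>x0\<close> reduces its size to \<open>claim\<close>. That no point enters on the left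
        of \<open>z\<close> for nearby \<open>x\<close> is ensured by \<open>h1\<close>.\<close>
      have "\<exists>s\<in>U. \<forall>y\<in>?S. s \<sqsubseteq> y"
      proof (cases "?S = {}")
        case False
        then show ?thesis using fin_min[of ?S] fin[OF x0(1) w] by blast
      qed (use U_ne in blast)
      then obtain s where s: "s \<in> U" "\<forall>y\<in>?S. s \<sqsubseteq> y" by blast
      obtain s' where s': "s' \<in> U" "s' \<sqsubset> s" using below s by blast
      have "infinite (itv s' s - {z\<in>U. \<not> good z})"
        using infinite_itv[OF s'(1) s(1) s'(2)] cofin by (intro Diff_infinite_finite) auto
      then obtain z where "z \<in> itv s' s - {z\<in>U. \<not> good z}" by (metis finite.emptyI ex_in_conv)
      then have z: "z \<in> U" "z \<sqsubset> s" "good z" by auto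
      have nX: "\<not> X z x0 w" using s(2) z by (metis (mono_tags, lifting) mem_Collect_eq not_le)
      have nh: "\<not> h1 z x0 w"
      proof
        assume "h1 z x0 w"
        then obtain y where "y \<in> ?S" "y \<sqsubset> z" unfolding h1_def by blast
        then show False using s(2) z by (meson less_le_not_le order_trans less_trans)
      qed
      have l1: "lcon (\<lambda>x. card {y\<in>U. X y x w \<and> z \<sqsubset> y}) x0" using claim[OF z(1,3) nX refl] .
      have l2: "lcon (\<lambda>x. X z x w) x0" "lcon (\<lambda>x. h1 z x w) x0"
        using z(3) unfolding good_def B2_def lcon_iff by blast+
      have eq: "{y\<in>U. X y x w} = {y\<in>U. X y x w \<and> z \<sqsubset> y}" if "\<not> X z x w" "\<not> h1 z x w" for x
      proof -
        have "z \<sqsubset> y" if "y \<in> U" "X y x w" for y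
          using that \<open>\<not> X z x w\<close> \<open>\<not> h1 z x w\<close> unfolding h1_def by (cases y z rule: linorder_cases) blast+
        then show ?thesis by blast
      qed
      show "lcon (\<lambda>x. card {z\<in>U. X z x w}) x0"
        by (rule lcon_map[OF lcon_pair[OF l1 lcon_pair[OF l2 x0(1)] x0(1)]]) (use eq nX nh in simp)
    qed
  qed
  then show ?thesis using CD by blast
qed

end

context omin begin

section \<open>Ranks in finite sets\<close>

definition rank :: "nat \<Rightarrow> ('a \<Rightarrow> bool) \<Rightarrow> 'a \<Rightarrow> bool" where
  "rank j P x \<longleftrightarrow> atl j (\<lambda>t. P t \<and> t \<sqsubset> x) \<and> \<not> atl (Suc j) (\<lambda>t. P t \<and> t \<sqsubset> x)"

lemma rank_iff:
  assumes "finite {t\<in>U. P t}" shows "rank j P x \<longleftrightarrow> card {t\<in>U. P t \<and> t \<sqsubset> x} = j"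
proof -
  have fin: "finite {t\<in>U. P t \<and> t \<sqsubset> x}" by (rule finite_subset[OF _ assms]) blast
  show ?thesis unfolding rank_def atl_card[OF fin] by arith
qed

text \<open>A point \<open>t\<close> as described is counted below \<open>x'\<close> but not below
  \<open>x\<close>. The interval is half open, since \<open>x'\<close> may itself satisfy
  \<open>P\<close>; a piece of the line is therefore described by a rank together with the truth
  value of \<open>P\<close>.\<close>

lemma rank_gap:
  assumes "finite {t\<in>U. P t}" "rank j P x" "rank j P x'" "t \<in> U" "P t" "x \<sqsubseteq> t" "t \<sqsubset> x'"
  shows False
proof -
  let ?A = "{t\<in>U. P t \<and> t \<sqsubset> x}" and ?B = "{t\<in>U. P t \<and> t \<sqsubset> x'}"
  have "finite ?B" by (rule finite_subset[OF _ assms(1)]) blast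
  moreover have "?A \<subset> ?B"
  proof
    have xx': "x \<sqsubset> x'" using assms(6,7) by (rule le_less_trans)
    show "?A \<subseteq> ?B" using less_trans[OF _ xx'] by blast
    have "t \<in> ?B" "t \<notin> ?A" using assms(4-7) by auto
    then show "?A \<noteq> ?B" by blast
  qed
  ultimately have "card ?A < card ?B" by (rule psubset_card_mono)
  then show False using assms(2,3) unfolding rank_iff[OF assms(1)] by simp
qed

lemma rank_ex:
  assumes "finite {t\<in>U. P t}" "card {t\<in>U. P t} \<le> K" shows "\<exists>j\<le>K. rank j P x"
proof -
  have "card {t\<in>U. P t \<and> t \<sqsubset> x} \<le> card {t\<in>U. P t}" by (rule card_mono[OF assms(1)]) blast
  then show ?thesis using assms unfolding rank_iff[OF assms(1)] by auto
qed

lemma D_rank [dint]: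
  assumes "D (Suc n) (\<lambda>e. \<chi> (hd e) (tl e))" "adm1 U n s"
  shows "D n (\<lambda>e. rank j (\<lambda>x. \<chi> x e) (s e))"
proof -
  have "D (Suc n) (\<lambda>e. rank j (\<lambda>x. \<chi> x (tl e)) (hd e))"
    unfolding rank_def by (rule dint refl D_el[OF assms(1)] | simp)+
  from D_el[OF this assms(2) adm_id[OF refl]] show ?thesis .
qed

text \<open>The common size of the fibres over the tuples in \<open>J\<close>, and
  \<open>None\<close> if there is no such tuple. The representative picked by \<open>SOME\<close> is
  harmless where all these fibres have the same size, which is the hypothesis of
  \<open>cnt_eq\<close>.\<close>

definition cnt :: "nat \<Rightarrow> ('a list \<Rightarrow> bool) \<Rightarrow> ('a \<Rightarrow> 'a list \<Rightarrow> bool) \<Rightarrow> nat option" where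
  "cnt r J X = (if \<exists>y\<in>nlists r U. J y
     then Some (card {z\<in>U. X z (SOME y. y \<in> nlists r U \<and> J y)}) else None)"

lemma cnt_eq:
  assumes "y \<in> nlists r U" "J y"
    "\<And>y y'. y \<in> nlists r U \<Longrightarrow> y' \<in> nlists r U \<Longrightarrow> J y \<Longrightarrow> J y' \<Longrightarrow> card {z\<in>U. X z y} = card {z\<in>U. X z y'}"
  shows "cnt r J X = Some (card {z\<in>U. X z y})"
proof -
  let ?y = "SOME y. y \<in> nlists r U \<and> J y"
  have "?y \<in> nlists r U \<and> J ?y" using someI[of "\<lambda>y. y \<in> nlists r U \<and> J y" y] assms(1,2) by blast
  then have "card {z\<in>U. X z ?y} = card {z\<in>U. X z y}" using assms by blast
  then show ?thesis unfolding cnt_def using assms(1,2) by auto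
qed

lemma cnt_SomeD: "cnt r J X = Some k \<Longrightarrow> \<exists>y\<in>nlists r U. J y"
  unfolding cnt_def by (metis option.distinct(1))

lemma cnt_None: "cnt r J X = None \<longleftrightarrow> \<not> (\<exists>y\<in>nlists r U. J y)"
  unfolding cnt_def by simp

text \<open>Definable choice is not available. The coordinates \<open>y\<close> on which the fibre size does not depend
  are eliminated one after the other: either the least possible first coordinate is a definable
  function of \<open>x\<close>, or there are infinitely many possible first coordinates and one of them stays
  possible near \<open>x\<close>.\<close>

lemma cnt_locally_constant:
  assumes "D (Suc (p + r)) (\<lambda>e. J (hd e) (take p (tl e)) (drop p (tl e)))"
    and "D (Suc (Suc (p + r))) (\<lambda>e. X (hd e) (hd (tl e)) (take p (tl (tl e))) (drop p (tl (tl e))))"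
    and "\<And>x w y. x \<in> U \<Longrightarrow> w \<in> nlists p U \<Longrightarrow> y \<in> nlists r U \<Longrightarrow> J x w y \<Longrightarrow> finite {z\<in>U. X z x w y}"
    and "\<And>x w y y'. x \<in> U \<Longrightarrow> w \<in> nlists p U \<Longrightarrow> y \<in> nlists r U \<Longrightarrow> y' \<in> nlists r U \<Longrightarrow>
      J x w y \<Longrightarrow> J x w y' \<Longrightarrow> card {z\<in>U. X z x w y} = card {z\<in>U. X z x w y'}"
  shows "\<exists>C. D (Suc p) (\<lambda>e. C (hd e) (tl e)) \<and> (\<forall>w\<in>nlists p U. finite {x\<in>U. C x w} \<and>
    (\<forall>x\<in>U. \<not> C x w \<longrightarrow> lcon (\<lambda>x. cnt r (J x w) (\<lambda>z. X z x w)) x))"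
  using assms
proof (induction r arbitrary: p J X)
  case 0
  note d = D_ell[OF 0(1)] D_eell[OF 0(2)]
  let ?X = "\<lambda>z x w. J x w [] \<and> X z x w []"
  have "D (Suc (Suc p)) (\<lambda>e. ?X (hd e) (hd (tl e)) (tl (tl e)))"
    by (rule dint refl d | simp)+
  moreover have "finite {z\<in>U. ?X z x w}" if "x \<in> U" "w \<in> nlists p U" for x w
    using 0(3)[OF that, of "[]"] by (cases "J x w []") auto
  ultimately obtain C where C: "D (Suc p) (\<lambda>e. C (hd e) (tl e))"
    "\<And>w. w \<in> nlists p U \<Longrightarrow> finite {x\<in>U. C x w}"
    "\<And>w x. w \<in> nlists p U \<Longrightarrow> x \<in> U \<Longrightarrow> \<not> C x w \<Longrightarrow> lcon (\<lambda>x. card {z\<in>U. ?X z x w}) x"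
    using card_locally_constant[of p ?X] by blast
  let ?C = "\<lambda>x w. C x w \<or> bd (\<lambda>x. J x w []) x"
  have cnt0: "cnt 0 (J x w) (\<lambda>z. X z x w) = (if J x w [] then Some (card {z\<in>U. ?X z x w}) else None)"
    if "x \<in> U" "w \<in> nlists p U" for x w
    using cnt_eq[of "[]" 0 "J x w" "\<lambda>z. X z x w"] cnt_None[of 0 "J x w" "\<lambda>z. X z x w"] by auto
  have "D (Suc p) (\<lambda>e. ?C (hd e) (tl e))" by (rule dint refl d D_el[OF C(1)] | simp)+
  moreover have "finite {x\<in>U. ?C x w}" if w: "w \<in> nlists p U" for w
  proof -
    have "D 1 (\<lambda>e. J (hd e) w [])" by (rule dint refl d | use w in simp)+
    then show ?thesis using C(2)[OF w] finite_bd by (simp add: conj_disj_distribL Collect_disj_eq)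
  qed
  moreover have "lcon (\<lambda>x. cnt 0 (J x w) (\<lambda>z. X z x w)) x" if "w \<in> nlists p U" "x \<in> U" "\<not> ?C x w" for w x
  proof (rule lcon_map[OF lcon_pair])
    show "lcon (\<lambda>x. card {z\<in>U. ?X z x w}) x" using C(3) that by blast
    show "lcon (\<lambda>x. J x w []) x" using that unfolding lcon_iff by blast
  qed (use cnt0 that in auto)
  ultimately show ?case by (intro exI[of _ ?C]) blast
next
  case (Suc r)
  note d = D_ell[OF Suc.prems(1)] D_eell[OF Suc.prems(2)]
  \<comment> \<open>The first coordinate of \<open>y\<close> joins the parameters. This is for a
    fixed \<open>t\<close> that remains possible for nearby \<open>x\<close>.\<close>
  define J1 where "J1 = (\<lambda>x v y. J x (tl v) (hd v # y))"
  define X1 where "X1 = (\<lambda>z x v y. X z x (tl v) (hd v # y))"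
  have "\<exists>C. D (Suc (Suc p)) (\<lambda>e. C (hd e) (tl e)) \<and> (\<forall>w\<in>nlists (Suc p) U. finite {x\<in>U. C x w} \<and>
    (\<forall>x\<in>U. \<not> C x w \<longrightarrow> lcon (\<lambda>x. cnt r (J1 x w) (\<lambda>z. X1 z x w)) x))"
  proof (rule Suc.IH)
    show "D (Suc (Suc p + r)) (\<lambda>e. J1 (hd e) (take (Suc p) (tl e)) (drop (Suc p) (tl e)))"
      unfolding J1_def by (rule dint refl d | simp)+
    show "D (Suc (Suc (Suc p + r)))
      (\<lambda>e. X1 (hd e) (hd (tl e)) (take (Suc p) (tl (tl e))) (drop (Suc p) (tl (tl e))))"
      unfolding X1_def by (rule dint refl d | simp)+
    fix x w y assume "x \<in> U" "w \<in> nlists (Suc p) U" "y \<in> nlists r U" "J1 x w y"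
    then show "finite {z\<in>U. X1 z x w y}"
      unfolding J1_def X1_def by (intro Suc.prems(3)) (auto simp: nlists_hd nlists_tl)
  next
    fix x w y y'
    assume "x \<in> U" "w \<in> nlists (Suc p) U" "y \<in> nlists r U" "y' \<in> nlists r U" "J1 x w y" "J1 x w y'"
    then show "card {z\<in>U. X1 z x w y} = card {z\<in>U. X1 z x w y'}"
      unfolding J1_def X1_def by (intro Suc.prems(4)) (auto simp: nlists_hd nlists_tl)
  qed
  then obtain C1 where C1: "D (Suc (Suc p)) (\<lambda>e. C1 (hd e) (tl e))"
    "\<And>w. w \<in> nlists (Suc p) U \<Longrightarrow> finite {x\<in>U. C1 x w}"
    "\<And>w x. w \<in> nlists (Suc p) U \<Longrightarrow> x \<in> U \<Longrightarrow> \<not> C1 x w \<Longrightarrow> lcon (\<lambda>x. cnt r (J1 x w) (\<lambda>z. X1 z x w)) x"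
    by blast
  define E where "E = (\<lambda>t x w. \<exists>y\<in>nlists r U. J x w (t # y))"
  have ED: "D (Suc (Suc p)) (\<lambda>e. E (hd e) (hd (tl e)) (tl (tl e)))"
    unfolding E_def by (rule dint refl d | simp)+
  note d = d D_eel[OF ED] D_el[OF C1(1)]
  define mn where "mn = (\<lambda>t x w. E t x w \<and> (\<forall>s\<in>U. s \<sqsubset> t \<longrightarrow> \<not> E s x w))"
  have mnD: "D (Suc (Suc p)) (\<lambda>e. mn (hd e) (hd (tl e)) (tl (tl e)))"
    unfolding mn_def by (rule dint refl d | simp)+
  have mn_unique: "t = t'" if "mn t x w" "mn t' x w" "t \<in> U" "t' \<in> U" for t t' x w
    using that unfolding mn_def by (metis neqE)
  note d = d D_eel[OF mnD]
  \<comment> \<open>The first coordinate is bound to the least possible one. It is unique, so it can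
    be quantified away without any choice.\<close>
  define J2 where "J2 = (\<lambda>x w y. \<exists>t\<in>U. mn t x w \<and> J x w (t # y))"
  define X2 where "X2 = (\<lambda>z x w y. \<exists>t\<in>U. mn t x w \<and> X z x w (t # y))"
  have X2_eq: "{z\<in>U. X2 z x w y} = {z\<in>U. X z x w (t # y)}" if "mn t x w" "t \<in> U" for t x w y
    using that mn_unique unfolding X2_def by blast
  have "\<exists>C. D (Suc p) (\<lambda>e. C (hd e) (tl e)) \<and> (\<forall>w\<in>nlists p U. finite {x\<in>U. C x w} \<and>
    (\<forall>x\<in>U. \<not> C x w \<longrightarrow> lcon (\<lambda>x. cnt r (J2 x w) (\<lambda>z. X2 z x w)) x))"
  proof (rule Suc.IH)
    show "D (Suc (p + r)) (\<lambda>e. J2 (hd e) (take p (tl e)) (drop p (tl e)))"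
      unfolding J2_def by (rule dint refl d | simp)+
    show "D (Suc (Suc (p + r)))
      (\<lambda>e. X2 (hd e) (hd (tl e)) (take p (tl (tl e))) (drop p (tl (tl e))))"
      unfolding X2_def by (rule dint refl d | simp)+
    fix x w y assume *: "x \<in> U" "w \<in> nlists p U" "y \<in> nlists r U" "J2 x w y"
    then obtain t where t: "t \<in> U" "mn t x w" "J x w (t # y)" unfolding J2_def by blast
    then show "finite {z\<in>U. X2 z x w y}"
      unfolding X2_eq[OF t(2,1)] using * by (intro Suc.prems(3)) auto
  next
    fix x w y y'
    assume *: "x \<in> U" "w \<in> nlists p U" "y \<in> nlists r U" "y' \<in> nlists r U" "J2 x w y" "J2 x w y'"
    then obtain t where t: "t \<in> U" "mn t x w" "J x w (t # y)" unfolding J2_def by blast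
    moreover have "J x w (t # y')" using * t mn_unique unfolding J2_def by blast
    ultimately show "card {z\<in>U. X2 z x w y} = card {z\<in>U. X2 z x w y'}"
      unfolding X2_eq[OF t(2,1)] using * by (intro Suc.prems(4)) auto
  qed
  then obtain C2 where C2: "D (Suc p) (\<lambda>e. C2 (hd e) (tl e))"
    "\<And>w. w \<in> nlists p U \<Longrightarrow> finite {x\<in>U. C2 x w}"
    "\<And>w x. w \<in> nlists p U \<Longrightarrow> x \<in> U \<Longrightarrow> \<not> C2 x w \<Longrightarrow> lcon (\<lambda>x. cnt r (J2 x w) (\<lambda>z. X2 z x w)) x"
    by blast
  \<comment> \<open>At \<open>x\<close> outside \<open>S\<close>, if there are infinitely many
    possible first coordinates, one of them is not exceptional for \<open>x\<close>, and the
    hypothesis for \<open>C1\<close> applies to it.\<close>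
  define S where "S = (\<lambda>x w. infinite {t\<in>U. E t x w \<and> C1 x (t # w)})"
  define em where "em = (\<lambda>x w. \<exists>t\<in>U. E t x w)"
  have SD: "D (Suc p) (\<lambda>e. S (hd e) (tl e))" unfolding S_def by (rule dint refl d | simp)+
  have emD: "D (Suc p) (\<lambda>e. em (hd e) (tl e))" unfolding em_def by (rule dint refl d | simp)+
  note d = d D_el[OF C2(1)] D_el[OF SD] D_el[OF emD]
  let ?C = "\<lambda>x w. S x w \<or> C2 x w \<or> bd (\<lambda>x. em x w) x"
  let ?c = "\<lambda>w x. cnt (Suc r) (J x w) (\<lambda>z. X z x w)"
  have CD: "D (Suc p) (\<lambda>e. ?C (hd e) (tl e))" by (rule dint refl d | simp)+
  have fin: "finite {x\<in>U. ?C x w}" if w: "w \<in> nlists p U" for w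
  proof -
    have "D 1 (\<lambda>e. em (hd e) w)" by (rule dint refl d | use w in simp)+
    note 1 = finite_bd[OF this]
    have "finite {x\<in>U. S x w}" unfolding S_def
    proof (rule finite_infinite_fibres)
      show "D 2 (\<lambda>e. E (hd (tl e)) (hd e) w \<and> C1 (hd e) (hd (tl e) # w))"
        by (rule dint refl d | use w in simp)+
      show "finite {x\<in>U. E t x w \<and> C1 x (t # w)}" if "t \<in> U" for t
        by (rule finite_subset[OF _ C1(2)[of "t # w"]]) (use that w in auto)
    qed
    then show ?thesis using 1 C2(2)[OF w] by (simp add: conj_disj_distribL Collect_disj_eq)
  qed
  have c_ne: "?c w x = None \<longleftrightarrow> \<not> em x w" for w x
    unfolding cnt_None em_def E_def nlists_Suc by auto
  have c_eq: "?c w x = Some (card {z\<in>U. X z x w (t # y)})"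
    if "x \<in> U" "w \<in> nlists p U" "t \<in> U" "y \<in> nlists r U" "J x w (t # y)" for x w t y
  proof (rule cnt_eq[of "t # y" "Suc r" "J x w" "\<lambda>z. X z x w", OF _ that(5)])
    show "t # y \<in> nlists (Suc r) U" using that by simp
  qed (rule Suc.prems(4)[OF that(1,2)])
  have c1: "?c w x = cnt r (J1 x (t # w)) (\<lambda>z. X1 z x (t # w))"
    if tw: "x \<in> U" "w \<in> nlists p U" "t \<in> U" "E t x w" for x w t
  proof -
    obtain y where y: "y \<in> nlists r U" "J x w (t # y)" using tw(4) unfolding E_def by blast
    have "cnt r (J1 x (t # w)) (\<lambda>z. X1 z x (t # w)) = Some (card {z\<in>U. X1 z x (t # w) y})"
    proof (rule cnt_eq[of y r "J1 x (t # w)" "\<lambda>z. X1 z x (t # w)", OF y(1)])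
      show "J1 x (t # w) y" using y by (simp add: J1_def)
      show "card {z\<in>U. X1 z x (t # w) y} = card {z\<in>U. X1 z x (t # w) y'}"
        if "y \<in> nlists r U" "y' \<in> nlists r U" "J1 x (t # w) y" "J1 x (t # w) y'" for y y'
        using Suc.prems(4)[OF \<open>x \<in> U\<close> \<open>w \<in> nlists p U\<close>, of "t # y" "t # y'"] that \<open>t \<in> U\<close>
        by (simp add: J1_def X1_def)
    qed
    then show ?thesis using c_eq[OF tw(1-3) y] by (simp add: X1_def)
  qed
  have c2: "?c w x = cnt r (J2 x w) (\<lambda>z. X2 z x w)"
    if xw: "x \<in> U" "w \<in> nlists p U" "y \<in> nlists r U" "J2 x w y" for x w y
  proof -
    obtain t where t: "t \<in> U" "mn t x w" "J x w (t # y)" using xw unfolding J2_def by blast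
    have J2: "J x w (t # y')" if "J2 x w y'" for y' using that t mn_unique unfolding J2_def by blast
    have "cnt r (J2 x w) (\<lambda>z. X2 z x w) = Some (card {z\<in>U. X2 z x w y})"
    proof (rule cnt_eq[of y r "J2 x w" "\<lambda>z. X2 z x w", OF xw(3,4)])
      show "card {z\<in>U. X2 z x w y} = card {z\<in>U. X2 z x w y'}"
        if "y \<in> nlists r U" "y' \<in> nlists r U" "J2 x w y" "J2 x w y'" for y y'
        unfolding X2_eq[OF t(2,1)]
        using Suc.prems(4)[OF xw(1,2), of "t # y" "t # y'"] that t(1) J2 by simp
    qed
    then show ?thesis using c_eq[OF xw(1,2) t(1) xw(3) t(3)] by (simp add: X2_eq[OF t(2,1)])
  qed
  have "lcon (?c w) x" if w: "w \<in> nlists p U" and x: "x \<in> U" "\<not> ?C x w" for w x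
  proof (cases "em x w")
    case False
    have "lcon (\<lambda>x. em x w) x" using x unfolding lcon_iff by blast
    then show ?thesis by (rule lcon_map) (use False c_ne in metis)
  next
    case True
    show ?thesis
    proof (cases "\<exists>t\<in>U. mn t x w")
      case True
      then obtain y where y: "y \<in> nlists r U" "J2 x w y" unfolding J2_def mn_def E_def by blast
      have "lcon (\<lambda>x. cnt r (J2 x w) (\<lambda>z. X2 z x w)) x" using C2(3) w x by blast
      then show ?thesis
      proof (rule lcon_map)
        fix x' assume x': "x' \<in> U" "cnt r (J2 x' w) (\<lambda>z. X2 z x' w) = cnt r (J2 x w) (\<lambda>z. X2 z x w)"
        obtain k where "cnt r (J2 x w) (\<lambda>z. X2 z x w) = Some k"
          using y cnt_None by (metis not_None_eq)
        then obtain y' where "y' \<in> nlists r U" "J2 x' w y'" using x' cnt_SomeD by metis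
        then show "?c w x' = ?c w x" using c2[OF x'(1) w] c2[OF x(1) w y] x'(2) by simp
      qed
    next
      case False
      have "infinite {t\<in>U. E t x w}"
      proof
        assume "finite {t\<in>U. E t x w}"
        then obtain t where "t \<in> U" "E t x w" "\<forall>s\<in>{t\<in>U. E t x w}. t \<sqsubseteq> s"
          using fin_min[of "{t\<in>U. E t x w}"] True unfolding em_def by blast
        then have "mn t x w" unfolding mn_def using not_le by blast
        then show False using False \<open>t \<in> U\<close> by blast
      qed
      moreover have "finite {t\<in>U. E t x w \<and> C1 x (t # w)}" using x unfolding S_def by blast
      ultimately have "\<not> {t\<in>U. E t x w} \<subseteq> {t\<in>U. E t x w \<and> C1 x (t # w)}"
        using finite_subset by blast
      then obtain t where t: "t \<in> U" "E t x w" "\<not> C1 x (t # w)" by blast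
      have "lcon (\<lambda>x. cnt r (J1 x (t # w)) (\<lambda>z. X1 z x (t # w))) x" using C1(3) t w x by simp
      then show ?thesis
      proof (rule lcon_map)
        fix x' assume x': "x' \<in> U"
          "cnt r (J1 x' (t # w)) (\<lambda>z. X1 z x' (t # w)) = cnt r (J1 x (t # w)) (\<lambda>z. X1 z x (t # w))"
        have "cnt r (J1 x (t # w)) (\<lambda>z. X1 z x (t # w)) \<noteq> None"
          using t unfolding cnt_None E_def J1_def by auto
        then have "E t x' w" using x' cnt_None[of r "J1 x' (t # w)" "\<lambda>z. X1 z x' (t # w)"]
          unfolding E_def J1_def by auto
        then show "?c w x' = ?c w x" using c1[OF x'(1) w t(1)] c1[OF x(1) w t(1,2)] x'(2) by simp
      qed
    qed
  qed
  then show ?case using CD fin by (intro exI[of _ ?C]) blast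
qed

text \<open>Induction on the number \<open>q\<close> of coordinates on which the size may depend.
  Between consecutive exceptional values of the first coordinate the size is locally constant, hence
  constant. So on each piece this coordinate can be moved from \<open>w\<close> to the tuple
  \<open>y\<close>, on which the size does not depend, and the pieces are uniformly finite in number
  by the same induction hypothesis with \<open>r = 0\<close>.\<close>

lemma card_bounded:
  assumes "D (q + r) (\<lambda>e. J (take q e) (drop q e))"
    and "D (Suc (q + r)) (\<lambda>e. X (hd e) (take q (tl e)) (drop q (tl e)))"
    and "\<And>w y. w \<in> nlists q U \<Longrightarrow> y \<in> nlists r U \<Longrightarrow> J w y \<Longrightarrow> finite {z\<in>U. X z w y}"
    and "\<And>w y y'. w \<in> nlists q U \<Longrightarrow> y \<in> nlists r U \<Longrightarrow> y' \<in> nlists r U \<Longrightarrow>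
      J w y \<Longrightarrow> J w y' \<Longrightarrow> card {z\<in>U. X z w y} = card {z\<in>U. X z w y'}"
  shows "\<exists>K. \<forall>w\<in>nlists q U. \<forall>y\<in>nlists r U. J w y \<longrightarrow> card {z\<in>U. X z w y} \<le> K"
  using assms
proof (induction q arbitrary: r J X)
  case 0
  show ?case
  proof (cases "\<exists>y\<in>nlists r U. J [] y")
    case True
    then obtain y where y: "y \<in> nlists r U" "J [] y" by blast
    have "card {z\<in>U. X z [] y'} \<le> card {z\<in>U. X z [] y}" if "y' \<in> nlists r U" "J [] y'" for y'
      by (rule eq_imp_le) (rule 0(4); use that y in simp)
    then show ?thesis by (intro exI[of _ "card {z\<in>U. X z [] y}"]) simp
  qed auto
next
  case (Suc q)
  note d = D_ll[OF Suc.prems(1)] D_ell[OF Suc.prems(2)]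
  have "\<exists>C. D (Suc q) (\<lambda>e. C (hd e) (tl e)) \<and> (\<forall>w\<in>nlists q U. finite {x\<in>U. C x w} \<and>
    (\<forall>x\<in>U. \<not> C x w \<longrightarrow> lcon (\<lambda>x. cnt r (J (x # w)) (\<lambda>z. X z (x # w))) x))"
  proof (rule cnt_locally_constant)
    show "D (Suc (q + r)) (\<lambda>e. J (hd e # take q (tl e)) (drop q (tl e)))"
      by (rule dint refl d | simp)+
    show "D (Suc (Suc (q + r))) (\<lambda>e. X (hd e) (hd (tl e) # take q (tl (tl e))) (drop q (tl (tl e))))"
      by (rule dint refl d | simp)+
    show "finite {z\<in>U. X z (x # w) y}" if "x \<in> U" "w \<in> nlists q U" "y \<in> nlists r U" "J (x # w) y" for x w y
      by (rule Suc.prems(3); use that in simp)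
    show "card {z\<in>U. X z (x # w) y} = card {z\<in>U. X z (x # w) y'}"
      if "x \<in> U" "w \<in> nlists q U" "y \<in> nlists r U" "y' \<in> nlists r U" "J (x # w) y" "J (x # w) y'" for x w y y'
      by (rule Suc.prems(4); use that in simp)
  qed
  then obtain C where C: "D (Suc q) (\<lambda>e. C (hd e) (tl e))"
    "\<And>w. w \<in> nlists q U \<Longrightarrow> finite {x\<in>U. C x w}"
    "\<And>w x. w \<in> nlists q U \<Longrightarrow> x \<in> U \<Longrightarrow> \<not> C x w \<Longrightarrow> lcon (\<lambda>x. cnt r (J (x # w)) (\<lambda>z. X z (x # w))) x"
    by blast
  note d = d D_el[OF C(1)]
  have "\<exists>K. \<forall>w\<in>nlists q U. \<forall>y\<in>nlists 0 U. True \<longrightarrow> card {z\<in>U. C z w} \<le> K"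
    by (rule Suc.IH[of 0 "\<lambda>_ _. True" "\<lambda>z w y. C z w"]; (rule dint refl d | use C(2) in simp)+)
  then obtain K where K: "\<And>w. w \<in> nlists q U \<Longrightarrow> card {z\<in>U. C z w} \<le> K" by auto
  let ?J = "\<lambda>b j w v. J (hd v # w) (tl v) \<and> C (hd v) w = b \<and> rank j (\<lambda>t. C t w) (hd v)"
  let ?X = "\<lambda>z w v. X z (hd v # w) (tl v)"
  have "\<exists>K. \<forall>w\<in>nlists q U. \<forall>v\<in>nlists (Suc r) U. ?J b j w v \<longrightarrow> card {z\<in>U. ?X z w v} \<le> K" for b j
  proof (rule Suc.IH)
    show "D (q + Suc r) (\<lambda>e. ?J b j (take q e) (drop q e))"
      by (rule dint refl d | simp)+
    show "D (Suc (q + Suc r)) (\<lambda>e. ?X (hd e) (take q (tl e)) (drop q (tl e)))"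
      by (rule dint refl d | simp)+
    fix w v assume "w \<in> nlists q U" "v \<in> nlists (Suc r) U" "?J b j w v"
    then show "finite {z\<in>U. ?X z w v}" by (intro Suc.prems(3)) (auto simp: nlists_hd nlists_tl)
  next
    fix w v v' assume w: "w \<in> nlists q U" and "v \<in> nlists (Suc r) U" "v' \<in> nlists (Suc r) U"
      "?J b j w v" "?J b j w v'"
    then obtain x y x' y' where xy: "v = x # y" "x \<in> U" "y \<in> nlists r U" "J (x # w) y" "C x w = b"
      "rank j (\<lambda>t. C t w) x" "v' = x' # y'" "x' \<in> U" "y' \<in> nlists r U" "J (x' # w) y'" "C x' w = b"
      "rank j (\<lambda>t. C t w) x'"
      by (auto simp: in_nlists_Suc_iff)
    let ?c = "\<lambda>x. cnt r (J (x # w)) (\<lambda>z. X z (x # w))"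
    have c: "?c x = Some (card {z\<in>U. X z (x # w) y})" if "x \<in> U" "y \<in> nlists r U" "J (x # w) y" for x y
    proof (rule cnt_eq[of y r "J (x # w)" "\<lambda>z. X z (x # w)", OF that(2,3)])
      have "x # w \<in> nlists (Suc q) U" using that w by simp
      from Suc.prems(4)[OF this]
      show "card {z\<in>U. X z (x # w) y} = card {z\<in>U. X z (x # w) y'}"
        if "y \<in> nlists r U" "y' \<in> nlists r U" "J (x # w) y" "J (x # w) y'" for y y'
        using that by blast
    qed
    have eq: "?c x = ?c x'" if xx: "x \<in> U" "x' \<in> U" "x \<sqsubset> x'" "C x w = b" "C x' w = b"
      "rank j (\<lambda>t. C t w) x" "rank j (\<lambda>t. C t w) x'" "y \<in> nlists r U" "J (x # w) y" for x x' y
    proof (rule ccontr)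
      assume ne: "?c x \<noteq> ?c x'"
      note gap = rank_gap[OF C(2)[OF w] xx(6,7)]
      have "\<not> C x w" using gap[OF xx(1)] xx(3) by auto
      then have "\<not> C x' w" using xx by blast
      \<comment> \<open>The map \<open>?c\<close> does not take values in \<open>U\<close>. Its
        level set at the single value \<open>k\<close> is definable, though, so a change of the size
        forces a boundary point of \<open>P\<close>, at which \<open>?c\<close> is not locally
        constant.\<close>
      define k where "k = card {z\<in>U. X z (x # w) y}"
      define P where "P = (\<lambda>t. \<exists>y\<in>nlists r U. J (t # w) y \<and> atl k (\<lambda>z. X z (t # w) y) \<and>
        \<not> atl (Suc k) (\<lambda>z. X z (t # w) y))"
      have PD: "D 1 (\<lambda>e. P (hd e))" unfolding P_def by (rule dint refl d | use w in simp)+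
      have P: "P t \<longleftrightarrow> ?c t = Some k" if t: "t \<in> U" for t
      proof
        assume "P t"
        then obtain y where y: "y \<in> nlists r U" "J (t # w) y" "atl k (\<lambda>z. X z (t # w) y)"
          "\<not> atl (Suc k) (\<lambda>z. X z (t # w) y)" unfolding P_def by blast
        have "finite {z\<in>U. X z (t # w) y}" using Suc.prems(3) t w y by simp
        then have "card {z\<in>U. X z (t # w) y} = k" using y(3,4) by (simp add: atl_card del: at_least.simps)
        then show "?c t = Some k" using c[OF t y(1,2)] by simp
      next
        assume ct: "?c t = Some k"
        then obtain y where y: "y \<in> nlists r U" "J (t # w) y" using cnt_SomeD by blast
        have "finite {z\<in>U. X z (t # w) y}" using Suc.prems(3) t w y by simp
        moreover have "card {z\<in>U. X z (t # w) y} = k" using c[OF t y(1,2)] ct by simp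
        ultimately show "P t" unfolding P_def using y by (intro bexI[of _ y]) (simp_all add: atl_card del: at_least.simps)
      qed
      have "P x \<noteq> P x'" using P xx(1,2) c[OF xx(1,8,9)] ne unfolding k_def by simp
      then obtain s where s: "s \<in> U" "x \<sqsubseteq> s" "s \<sqsubseteq> x'" "bd P s" using ex_bd[OF PD xx(1-3)] by blast
      have "\<not> C s w" using gap[OF s(1)] s \<open>\<not> C x' w\<close> by (metis le_less)
      from C(3)[OF w s(1) this] have "lcon P s" by (rule lcon_map) (use P s in auto)
      then show False using s(4) unfolding lcon_iff by blast
    qed
    have "?c x = ?c x'"
    proof (cases x x' rule: linorder_cases)
      case less
      show ?thesis by (rule eq[OF xy(2,8) less xy(5,11,6,12,3,4)])
    next
      case greater
      show ?thesis by (rule eq[OF xy(8,2) greater xy(11,5,12,6,9,10), symmetric])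
    qed simp
    then show "card {z\<in>U. ?X z w v} = card {z\<in>U. ?X z w v'}"
      using c[OF xy(2-4)] c[OF xy(8-10)] xy(1,7) by simp
  qed
  note ex = this
  define k where "k = (\<lambda>b j. SOME K. \<forall>w\<in>nlists q U. \<forall>v\<in>nlists (Suc r) U. ?J b j w v \<longrightarrow> card {z\<in>U. ?X z w v} \<le> K)"
  have k: "card {z\<in>U. ?X z w v} \<le> k b j" if "w \<in> nlists q U" "v \<in> nlists (Suc r) U" "?J b j w v" for b j w v
    using someI_ex[OF ex[of b j]] that unfolding k_def by blast
  let ?K = "Max ((\<lambda>(b, j). k b j) ` (UNIV \<times> {..K}))"
  have "card {z\<in>U. X z w y} \<le> ?K" if w: "w \<in> nlists (Suc q) U" and y: "y \<in> nlists r U" and J: "J w y" for w y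
  proof -
    obtain x s where xs: "w = x # s" "x \<in> U" "s \<in> nlists q U" using w by (auto simp: in_nlists_Suc_iff)
    obtain j where j: "j \<le> K" "rank j (\<lambda>t. C t s) x" using rank_ex[OF C(2) K] xs by blast
    have "card {z\<in>U. X z w y} \<le> k (C x s) j" using k[of s "x # y" "C x s" j] xs y J j by simp
    also have "\<dots> \<le> ?K" by (rule linorder_class.Max_ge) (use j in \<open>auto intro!: image_eqI[of _ _ "(C x s, j)"]\<close>)
    finally show ?thesis .
  qed
  then show ?case by blast
qed

corollary uniform_finiteness:
  assumes "D (Suc q) (\<lambda>e. X (hd e) (tl e))" "\<And>w. w \<in> nlists q U \<Longrightarrow> finite {z\<in>U. X z w}"
  shows "\<exists>K. \<forall>w\<in>nlists q U. card {z\<in>U. X z w} \<le> K"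
proof -
  have "\<exists>K. \<forall>w\<in>nlists q U. \<forall>y\<in>nlists 0 U. True \<longrightarrow> card {z\<in>U. X z w} \<le> K"
    by (rule card_bounded[of q 0 "\<lambda>_ _. True" "\<lambda>z w y. X z w"];
      (rule dint refl D_el[OF assms(1)] | use assms(2) in simp)+)
  then show ?thesis by auto
qed

end

section \<open>Cuts in definable preorders\<close>

context omin begin

lemma D_eql [dint]: "adm U n k \<sigma> \<Longrightarrow> adm U n k \<tau> \<Longrightarrow> D n (\<lambda>e. \<sigma> e = \<tau> e)"
proof (induction k arbitrary: \<sigma> \<tau>)
  case 0
  have "D n (\<lambda>_. True)" by (rule D_const)
  then show ?case
    by (rule D_cong) (use adm_length[OF 0(1)] adm_length[OF 0(2)] in \<open>simp add: nlists_def\<close>)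
next
  case (Suc k)
  note d = Suc.prems
  have "D n (\<lambda>e. tl (\<sigma> e) = tl (\<tau> e))" by (rule Suc.IH; (rule adm_tl refl d | simp)+)
  moreover have "D n (\<lambda>e. hd (\<sigma> e) = hd (\<tau> e))" by (rule dint refl d | simp)+
  ultimately have "D n (\<lambda>e. tl (\<sigma> e) = tl (\<tau> e) \<and> hd (\<sigma> e) = hd (\<tau> e))" by (rule D_and)
  then show ?case
  proof (rule D_cong)
    fix e assume "e \<in> nlists n U"
    then have "length (\<sigma> e) = Suc k" "length (\<tau> e) = Suc k"
      using adm_length[OF d(1)] adm_length[OF d(2)] by (simp_all add: nlists_def)
    then show "(tl (\<sigma> e) = tl (\<tau> e) \<and> hd (\<sigma> e) = hd (\<tau> e)) = (\<sigma> e = \<tau> e)"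
      by (cases "\<sigma> e"; cases "\<tau> e") auto
  qed
qed

text \<open>\<open>nsm m G\<close> says that \<open>G \<subseteq> U\<^sup>m\<close> has dimension \<open>m\<close>.\<close>

primrec nsm :: "nat \<Rightarrow> ('a list \<Rightarrow> bool) \<Rightarrow> bool" where
  "nsm 0 G \<longleftrightarrow> G []"
| "nsm (Suc m) G \<longleftrightarrow> nsm m (\<lambda>t. infinite {x\<in>U. G (x # t)})"

lemma D_nsm [dint]: "D (m + n) (\<lambda>e. \<chi> (take m e) (drop m e)) \<Longrightarrow> D n (\<lambda>e. nsm m (\<lambda>t. \<chi> t e))"
proof (induction m arbitrary: \<chi>)
  case 0
  then show ?case by simp
next
  case (Suc m)
  note d = D_ll[OF Suc.prems]
  have "D (m + n) (\<lambda>e. infinite {x\<in>U. \<chi> (x # take m e) (drop m e)})"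
    by (rule dint refl d | simp)+
  then have "D n (\<lambda>e. nsm m (\<lambda>t. infinite {x\<in>U. \<chi> (x # t) e}))" by (rule Suc.IH)
  then show ?case by simp
qed

text \<open>A dimension count: the set of pairs of \<open>x\<close> and \<open>t\<close> has finite
  fibres over the \<open>t\<close>, so its dimension is at most \<open>m\<close>, and this leaves no
  room for infinitely many \<open>x\<close> whose \<open>G x\<close> has dimension \<open>m\<close>.
  Each coordinate is removed by one exchange with \<open>finite_infinite_fibres\<close>.\<close>

lemma finite_nsm:
  assumes "D (Suc m) (\<lambda>e. G (hd e) (tl e))" "\<And>t. t \<in> nlists m U \<Longrightarrow> finite {x\<in>U. G x t}"
  shows "finite {x\<in>U. nsm m (G x)}"
  using assms
proof (induction m arbitrary: G)
  case 0
  then show ?case by simp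
next
  case (Suc m)
  note d = D_el[OF Suc.prems(1)]
  have "finite {x\<in>U. nsm m (\<lambda>t. infinite {y\<in>U. G x (y # t)})}"
  proof (rule Suc.IH)
    show "D (Suc m) (\<lambda>e. infinite {y\<in>U. G (hd e) (y # tl e)})" by (rule dint refl d | simp)+
    show "finite {x\<in>U. infinite {y\<in>U. G x (y # t)}}" if t: "t \<in> nlists m U" for t
    proof (rule finite_infinite_fibres)
      show "D 2 (\<lambda>e. G (hd e) (hd (tl e) # t))" by (rule dint refl d | use t in simp)+
      show "finite {x\<in>U. G x (y # t)}" if "y \<in> U" for y
        by (rule Suc.prems(2)) (use that t in simp)
    qed
  qed
  then show ?case by simp
qed

section \<open>Sets of smaller dimension as images\<close>

definition functional :: "nat \<Rightarrow> nat \<Rightarrow> ('a list \<Rightarrow> 'a list \<Rightarrow> bool) \<Rightarrow> bool" where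
  "functional m k R \<longleftrightarrow> D (m + k) (\<lambda>e. R (take m e) (drop m e)) \<and>
     (\<forall>u\<in>nlists m U. \<forall>b\<in>nlists k U. \<forall>b'\<in>nlists k U. R u b \<longrightarrow> R u b' \<longrightarrow> b = b')"

text \<open>The finite fibres have at most \<open>K\<close> points, and the order numbers the points
  of each. So the point of rank \<open>j\<close> is a definable partial function of
  \<open>t\<close>, without any choice.\<close>

lemma finite_fibres_cover:
  assumes GD: "D (Suc m) G"
  shows "\<exists>(k::nat) R. (\<forall>i<k. functional m (Suc m) (R i)) \<and>
    (\<forall>b\<in>nlists (Suc m) U. G b \<longrightarrow> finite {x\<in>U. G (x # tl b)} \<longrightarrow> (\<exists>i<k. \<exists>u\<in>nlists m U. R i u b))"
proof -
  note d = D_l[OF GD]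
  let ?X = "\<lambda>x t. G (x # t) \<and> finite {x\<in>U. G (x # t)}"
  have XD: "D (Suc m) (\<lambda>e. ?X (hd e) (tl e))" by (rule dint refl d | simp)+
  have Xfin: "finite {x\<in>U. ?X x t}" for t by (cases "finite {x\<in>U. G (x # t)}") auto
  then obtain K where K: "\<And>t. t \<in> nlists m U \<Longrightarrow> card {x\<in>U. ?X x t} \<le> K"
    using uniform_finiteness[OF XD] by blast
  define R where "R = (\<lambda>j u b. u = tl b \<and> ?X (hd b) u \<and> rank j (\<lambda>x. ?X x u) (hd b))"
  have RD: "D (m + Suc m) (\<lambda>e. R j (take m e) (drop m e))" for j
    unfolding R_def by (rule dint refl d | simp)+
  have "functional m (Suc m) (R j)" for j
    unfolding functional_def
  proof (intro conjI RD ballI impI)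
    fix u b b' assume u: "u \<in> nlists m U" and b: "b \<in> nlists (Suc m) U" "b' \<in> nlists (Suc m) U" "R j u b" "R j u b'"
    obtain x x' where x: "b = x # u" "b' = x' # u" "x \<in> U" "x' \<in> U"
      using b unfolding R_def by (auto simp: in_nlists_Suc_iff)
    have r: "?X x u" "?X x' u" "rank j (\<lambda>x. ?X x u) x" "rank j (\<lambda>x. ?X x u) x'"
      using b unfolding R_def x list.sel by blast+
    have "x = x'"
    proof (cases x x' rule: linorder_cases)
      case less
      then show ?thesis using rank_gap[OF Xfin r(3,4) x(3) r(1)] by blast
    next
      case greater
      then show ?thesis using rank_gap[OF Xfin r(4,3) x(4) r(2)] by blast
    qed
    then show "b = b'" using x by simp
  qed
  moreover have "\<exists>j<Suc K. \<exists>u\<in>nlists m U. R j u b" if b: "b \<in> nlists (Suc m) U" "G b" "finite {x\<in>U. G (x # tl b)}" for b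
  proof -
    obtain j where "j \<le> K" "rank j (\<lambda>x. ?X x (tl b)) (hd b)"
      using rank_ex[OF Xfin K[of "tl b"]] nlists_tl b by blast
    moreover have "hd b # tl b = b" using b(1) by (auto simp: in_nlists_Suc_iff)
    ultimately have "R j (tl b) b" unfolding R_def using b by simp
    then show ?thesis using \<open>j \<le> K\<close> nlists_tl[OF b(1)] less_Suc_eq_le by blast
  qed
  ultimately show ?thesis by (intro exI[of _ "Suc K"] exI[of _ R]) blast
qed

text \<open>The tails \<open>t\<close> with an infinite fibre form a small set, which is covered by
  induction; the covering functions are lifted by carrying the first coordinate along unchanged. All
  remaining points lie in finite fibres.\<close>

lemma small_cover:
  assumes "D (Suc m) G" "\<not> nsm (Suc m) G"
  shows "\<exists>(k::nat) R. (\<forall>i<k. functional m (Suc m) (R i)) \<and>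
    (\<forall>b\<in>nlists (Suc m) U. G b \<longrightarrow> (\<exists>i<k. \<exists>u\<in>nlists m U. R i u b))"
  using assms
proof (induction m arbitrary: G)
  case 0
  obtain k :: nat and R where R: "\<forall>i<k. functional 0 (Suc 0) (R i)" "\<forall>b\<in>nlists (Suc 0) U. G b \<longrightarrow>
      finite {x\<in>U. G (x # tl b)} \<longrightarrow> (\<exists>i<k. \<exists>u\<in>nlists 0 U. R i u b)"
    using finite_fibres_cover[OF 0(1)] by blast
  have "finite {x\<in>U. G (x # tl b)}" if "b \<in> nlists (Suc 0) U" for b
    using 0(2) that by (auto simp: in_nlists_Suc_iff)
  then show ?case using R by (intro exI[of _ k] exI[of _ R]) blast
next
  case (Suc m)
  note d = D_l[OF Suc.prems(1)]
  let ?T = "\<lambda>t. infinite {x\<in>U. G (x # t)}"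
  have TD: "D (Suc m) ?T" by (rule dint refl d | simp)+
  have "\<not> nsm (Suc m) ?T" using Suc.prems(2) by simp
  from Suc.IH[OF TD this] obtain k :: nat and R where
    R: "\<And>i. i < k \<Longrightarrow> functional m (Suc m) (R i)"
      "\<And>b. b \<in> nlists (Suc m) U \<Longrightarrow> ?T b \<Longrightarrow> \<exists>i<k. \<exists>u\<in>nlists m U. R i u b"
    by blast
  obtain l :: nat and R' where R': "\<And>i. i < l \<Longrightarrow> functional (Suc m) (Suc (Suc m)) (R' i)"
    "\<And>b. b \<in> nlists (Suc (Suc m)) U \<Longrightarrow> G b \<Longrightarrow> finite {x\<in>U. G (x # tl b)} \<Longrightarrow>
      \<exists>i<l. \<exists>u\<in>nlists (Suc m) U. R' i u b"
    using finite_fibres_cover[OF Suc.prems(1)] by blast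
  define Q where "Q = (\<lambda>i. if i < k then (\<lambda>u b. hd u = hd b \<and> R i (tl u) (tl b)) else R' (i - k))"
  have "functional (Suc m) (Suc (Suc m)) (Q i)" if "i < k + l" for i
  proof (cases "i < k")
    case True
    have RD: "D (m + Suc m) (\<lambda>e. R i (take m e) (drop m e))"
      using R(1)[OF True] unfolding functional_def by blast
    have "D (Suc m + Suc (Suc m)) (\<lambda>e. hd (take (Suc m) e) = hd (drop (Suc m) e) \<and>
        R i (tl (take (Suc m) e)) (tl (drop (Suc m) e)))"
      by (rule dint refl D_ll[OF RD] | simp)+
    moreover have "b = b'" if "u \<in> nlists (Suc m) U" "b \<in> nlists (Suc (Suc m)) U" "b' \<in> nlists (Suc (Suc m)) U"
      "hd u = hd b \<and> R i (tl u) (tl b)" "hd u = hd b' \<and> R i (tl u) (tl b')" for u b b'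
    proof -
      have "tl b = tl b'" using R(1)[OF True] that nlists_tl unfolding functional_def by blast
      then show ?thesis using that(2-5) by (auto simp: in_nlists_Suc_iff[of _ "Suc m"])
    qed
    ultimately show ?thesis using True unfolding functional_def Q_def by auto
  next
    case False
    then show ?thesis using R'(1)[of "i - k"] that unfolding Q_def by simp
  qed
  moreover have "\<exists>i<k + l. \<exists>u\<in>nlists (Suc m) U. Q i u b" if b: "b \<in> nlists (Suc (Suc m)) U" "G b" for b
  proof (cases "?T (tl b)")
    case True
    then obtain i u where iu: "i < k" "u \<in> nlists m U" "R i u (tl b)" using R(2)[OF nlists_tl[OF b(1)]] by blast
    then have "Q i (hd b # u) b" unfolding Q_def by simp
    moreover have "hd b # u \<in> nlists (Suc m) U" using iu nlists_hd[OF b(1)] by simp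
    ultimately show ?thesis using iu(1) by (intro exI[of _ i]) auto
  next
    case False
    then obtain i u where "i < l" "u \<in> nlists (Suc m) U" "R' i u b" using R'(2)[OF b] by blast
    then show ?thesis unfolding Q_def by (intro exI[of _ "k + i"]) auto
  qed
  ultimately show ?case by (intro exI[of _ "k + l"] exI[of _ Q]) blast
qed

text \<open>What is used of a trace \<open>P\<close> of a set that is definable in a tame extension; unlike
  definability it passes to images and preimages under correspondences.\<close>

definition tame :: "nat \<Rightarrow> ('a list \<Rightarrow> bool) \<Rightarrow> ('a list \<Rightarrow> bool) \<Rightarrow> bool" where
  "tame m B P \<longleftrightarrow> (\<forall>F. D (Suc m) (\<lambda>e. F (hd e) (tl e)) \<longrightarrow>
     (\<forall>x\<in>U. \<forall>t\<in>nlists m U. F x t \<longrightarrow> B t) \<longrightarrow>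
     (\<forall>x\<in>U. \<forall>t\<in>nlists m U. \<forall>t'\<in>nlists m U. F x t \<longrightarrow> F x t' \<longrightarrow> P t = P t') \<longrightarrow>
     (\<forall>x\<in>U. \<forall>y\<in>U. x \<sqsubset> y \<longrightarrow> (\<exists>t\<in>nlists m U. F x t) \<longrightarrow>
        (\<exists>t\<in>nlists m U. F y t \<and> P t) \<longrightarrow> (\<exists>t\<in>nlists m U. F x t \<and> P t)) \<or>
     (\<forall>x\<in>U. \<forall>y\<in>U. x \<sqsubset> y \<longrightarrow> (\<exists>t\<in>nlists m U. F y t) \<longrightarrow>
        (\<exists>t\<in>nlists m U. F x t \<and> P t) \<longrightarrow> (\<exists>t\<in>nlists m U. F y t \<and> P t)) \<longrightarrow>
     D 1 (\<lambda>e. \<exists>t\<in>nlists m U. F (hd e) t \<and> P t))"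

definition is_cut :: "nat \<Rightarrow> ('a list \<Rightarrow> bool) \<Rightarrow> ('a list \<Rightarrow> 'a list \<Rightarrow> bool) \<Rightarrow> ('a list \<Rightarrow> bool) \<Rightarrow> bool" where
  "is_cut m B le P \<longleftrightarrow> D m B \<and> D (m + m) (\<lambda>e. le (take m e) (drop m e)) \<and>
     (\<forall>s\<in>nlists m U. \<forall>t\<in>nlists m U. B s \<longrightarrow> B t \<longrightarrow> le s t \<or> le t s) \<and>
     (\<forall>s\<in>nlists m U. \<forall>t\<in>nlists m U. \<forall>r\<in>nlists m U. B s \<longrightarrow> B t \<longrightarrow> B r \<longrightarrow> le s t \<longrightarrow> le t r \<longrightarrow> le s r) \<and>
     (\<forall>t\<in>nlists m U. P t \<longrightarrow> B t) \<and>
     (\<forall>s\<in>nlists m U. \<forall>t\<in>nlists m U. B s \<longrightarrow> P t \<longrightarrow> le s t \<longrightarrow> P s) \<and>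
     tame m B P"

text \<open>Preorder and cut are carried over to \<open>U\<close> to the power \<open>k\<close>:
  \<open>le'\<close> compares the fibres of \<open>R\<close> as if by their suprema, and
  \<open>P'\<close> holds of the fibres inside \<open>P\<close>. Because no fibre is split,
  \<open>P'\<close> is again an initial segment and determines \<open>P\<close> on the fibres. It
  stays tame, since a family of tuples of length \<open>k\<close> can be pulled along
  \<open>R\<close> to a family of tuples of length \<open>m\<close>.\<close>

lemma cut_correspondence:
  assumes CUT: "\<And>B le P. is_cut k B le P \<Longrightarrow> D k P"
    and cut: "is_cut m B le P"
    and RD: "D (k + m) (\<lambda>e. R (take k e) (drop k e))"
    and nonsplit: "\<And>t b b'. t \<in> nlists k U \<Longrightarrow> b \<in> nlists m U \<Longrightarrow> b' \<in> nlists m U \<Longrightarrow>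
      R t b \<Longrightarrow> R t b' \<Longrightarrow> B b \<Longrightarrow> B b' \<Longrightarrow> P b = P b'"
  shows "D m (\<lambda>b. B b \<and> (\<exists>t\<in>nlists k U. R t b) \<and> P b)"
proof -
  have BD: "D m B" and leD: "D (m + m) (\<lambda>e. le (take m e) (drop m e))"
    and tot: "\<And>s t. s \<in> nlists m U \<Longrightarrow> t \<in> nlists m U \<Longrightarrow> B s \<Longrightarrow> B t \<Longrightarrow> le s t \<or> le t s"
    and tr: "\<And>s t r. s \<in> nlists m U \<Longrightarrow> t \<in> nlists m U \<Longrightarrow> r \<in> nlists m U \<Longrightarrow> B s \<Longrightarrow> B t \<Longrightarrow> B r \<Longrightarrow>
      le s t \<Longrightarrow> le t r \<Longrightarrow> le s r"
    and PB: "\<And>t. t \<in> nlists m U \<Longrightarrow> P t \<Longrightarrow> B t"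
    and down: "\<And>s t. s \<in> nlists m U \<Longrightarrow> t \<in> nlists m U \<Longrightarrow> B s \<Longrightarrow> P t \<Longrightarrow> le s t \<Longrightarrow> P s"
    and tm: "tame m B P"
    using cut unfolding is_cut_def by blast+
  note d = D_l[OF BD] D_ll[OF leD] D_ll[OF RD]
  define T where "T = (\<lambda>t. \<exists>b\<in>nlists m U. R t b \<and> B b)"
  define le' where "le' = (\<lambda>t t'. \<forall>b\<in>nlists m U. R t b \<and> B b \<longrightarrow> (\<exists>b'\<in>nlists m U. R t' b' \<and> B b' \<and> le b b'))"
  define P' where "P' = (\<lambda>t. \<exists>b\<in>nlists m U. R t b \<and> B b \<and> P b)"
  have P'_iff: "P' t \<longleftrightarrow> P b" if "t \<in> nlists k U" "b \<in> nlists m U" "R t b" "B b" for t b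
    using that nonsplit unfolding P'_def by blast
  have "is_cut k T le' P'"
    unfolding is_cut_def
  proof (intro conjI ballI impI)
    show "D k T" unfolding T_def by (rule dint refl d | simp)+
    show "D (k + k) (\<lambda>e. le' (take k e) (drop k e))" unfolding le'_def by (rule dint refl d | simp)+
    show "le' s t \<or> le' t s" for s t unfolding le'_def using tot by blast
    show "le' s r" if st: "le' s t" "le' t r" for s t r
      unfolding le'_def
    proof (intro ballI impI)
      fix b assume b: "b \<in> nlists m U" "R s b \<and> B b"
      then obtain b' where b': "b' \<in> nlists m U" "R t b' \<and> B b'" "le b b'" using st(1) unfolding le'_def by blast
      then obtain b2 where b2: "b2 \<in> nlists m U" "R r b2 \<and> B b2" "le b' b2" using st(2) unfolding le'_def by blast
      then have "le b b2" using tr[OF b(1) b'(1) b2(1)] b b' b2 by blast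
      then show "\<exists>b'\<in>nlists m U. R r b' \<and> B b' \<and> le b b'" using b2 by blast
    qed
    show "T t" if "P' t" for t using that unfolding T_def P'_def by blast
    show "P' s" if st: "s \<in> nlists k U" "t \<in> nlists k U" "T s" "P' t" "le' s t" for s t
    proof -
      obtain b where b: "b \<in> nlists m U" "R s b" "B b" using st(3) unfolding T_def by blast
      then obtain b' where b': "b' \<in> nlists m U" "R t b'" "B b'" "le b b'" using st(5) unfolding le'_def by blast
      then have "P b'" using P'_iff st by blast
      then show ?thesis using down b b' unfolding P'_def by blast
    qed
    show "tame k T P'"
      unfolding tame_def
    proof (intro allI impI)
      fix F' assume F'D: "D (Suc k) (\<lambda>e. F' (hd e) (tl e))" and F'T: "\<forall>x\<in>U. \<forall>t\<in>nlists k U. F' x t \<longrightarrow> T t"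
        and ns: "\<forall>x\<in>U. \<forall>t\<in>nlists k U. \<forall>t'\<in>nlists k U. F' x t \<longrightarrow> F' x t' \<longrightarrow> P' t = P' t'"
        and mono: "(\<forall>x\<in>U. \<forall>y\<in>U. x \<sqsubset> y \<longrightarrow> (\<exists>t\<in>nlists k U. F' x t) \<longrightarrow>
            (\<exists>t\<in>nlists k U. F' y t \<and> P' t) \<longrightarrow> (\<exists>t\<in>nlists k U. F' x t \<and> P' t)) \<or>
          (\<forall>x\<in>U. \<forall>y\<in>U. x \<sqsubset> y \<longrightarrow> (\<exists>t\<in>nlists k U. F' y t) \<longrightarrow>
            (\<exists>t\<in>nlists k U. F' x t \<and> P' t) \<longrightarrow> (\<exists>t\<in>nlists k U. F' y t \<and> P' t))"
      define F where "F = (\<lambda>x b. B b \<and> (\<exists>t\<in>nlists k U. F' x t \<and> R t b))"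
      have FD: "D (Suc m) (\<lambda>e. F (hd e) (tl e))"
        unfolding F_def by (rule dint refl d D_el[OF F'D] | simp)+
      have FP: "P b \<longleftrightarrow> P' t" if xt: "x \<in> U" "t \<in> nlists k U" "b \<in> nlists m U" "F' x t" "F x b" for x t b
      proof -
        obtain t' where t': "t' \<in> nlists k U" "F' x t'" "R t' b" "B b" using xt(5) unfolding F_def by blast
        then have "P' t' = P b" using P'_iff xt by blast
        moreover have "P' t' = P' t" using ns xt t' by blast
        ultimately show ?thesis by simp
      qed
      have dom: "(\<exists>b\<in>nlists m U. F x b) \<longleftrightarrow> (\<exists>t\<in>nlists k U. F' x t)" if "x \<in> U" for x
        using F'T that unfolding F_def T_def by blast
      have A: "(\<exists>b\<in>nlists m U. F x b \<and> P b) \<longleftrightarrow> (\<exists>t\<in>nlists k U. F' x t \<and> P' t)" if "x \<in> U" for x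
        using FP[OF that] dom[OF that] by blast
      have "D 1 (\<lambda>e. \<exists>b\<in>nlists m U. F (hd e) b \<and> P b)"
      proof (rule tm[unfolded tame_def, rule_format])
        show "D (Suc m) (\<lambda>e. F (hd e) (tl e))" by (rule FD)
        show "B t" if "F x t" for x t using that unfolding F_def by blast
        show "P t = P t'" if xt: "x \<in> U" "t \<in> nlists m U" "t' \<in> nlists m U" "F x t" "F x t'" for x t t'
        proof -
          obtain s where s: "s \<in> nlists k U" "F' x s" using dom[OF xt(1)] xt(2,4) by blast
          show ?thesis using FP[OF xt(1) s(1) xt(2) s(2) xt(4)] FP[OF xt(1) s(1) xt(3) s(2) xt(5)] by simp
        qed
        show "(\<forall>x\<in>U. \<forall>y\<in>U. x \<sqsubset> y \<longrightarrow> (\<exists>t\<in>nlists m U. F x t) \<longrightarrow>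
            (\<exists>t\<in>nlists m U. F y t \<and> P t) \<longrightarrow> (\<exists>t\<in>nlists m U. F x t \<and> P t)) \<or>
          (\<forall>x\<in>U. \<forall>y\<in>U. x \<sqsubset> y \<longrightarrow> (\<exists>t\<in>nlists m U. F y t) \<longrightarrow>
            (\<exists>t\<in>nlists m U. F x t \<and> P t) \<longrightarrow> (\<exists>t\<in>nlists m U. F y t \<and> P t))"
          using mono by (simp add: A dom cong: ball_cong)
      qed
      then show "D 1 (\<lambda>e. \<exists>t\<in>nlists k U. F' (hd e) t \<and> P' t)"
        by (rule D_cong) (use A nlists_hd[of _ 0] in simp)
    qed
  qed
  from CUT[OF this] have P'D: "D k P'" .
  have "D m (\<lambda>b. B b \<and> (\<exists>t\<in>nlists k U. R t b \<and> P' t))"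
    by (rule dint refl d D_l[OF P'D] | simp)+
  then show ?thesis by (rule D_cong) (use P'_iff in blast)
qed

text \<open>The gap of the cut at \<open>b\<close> along the line through \<open>b\<close> in the direction of the first coordinate.\<close>

definition gap :: "('a list \<Rightarrow> bool) \<Rightarrow> ('a list \<Rightarrow> 'a list \<Rightarrow> bool) \<Rightarrow> 'a list \<Rightarrow> 'a list \<Rightarrow> bool" where
  "gap B le b e \<longleftrightarrow> B e \<and> (\<exists>u\<in>U. \<exists>v\<in>U. u \<sqsubset> hd b \<and> hd b \<sqsubset> v \<and> (\<forall>x\<in>itv u v. B (x # tl b) \<longrightarrow>
     (\<not> le b (x # tl b) \<longrightarrow> \<not> le e (x # tl b)) \<and> (\<not> le (x # tl b) b \<longrightarrow> \<not> le (x # tl b) e)))"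

lemma gap_rev: "gap B (\<lambda>a b. le b a) = gap B le"
  unfolding gap_def by (intro ext) blast

text \<open>Choose \<open>p\<close> just behind \<open>y1\<close> and \<open>q\<close> just before
  \<open>y2\<close>, with \<open>p\<close> before \<open>q\<close>. An \<open>e\<close> in both gaps
  would lie strictly below the point at \<open>p\<close> and strictly above the point at
  \<open>q\<close>, against monotonicity.\<close>

lemma gap_disjoint:
  assumes tot: "\<And>s t. s \<in> nlists (Suc m) U \<Longrightarrow> t \<in> nlists (Suc m) U \<Longrightarrow> B s \<Longrightarrow> B t \<Longrightarrow> le s t \<or> le t s"
    and tr: "\<And>s t r. s \<in> nlists (Suc m) U \<Longrightarrow> t \<in> nlists (Suc m) U \<Longrightarrow> r \<in> nlists (Suc m) U \<Longrightarrow>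
      B s \<Longrightarrow> B t \<Longrightarrow> B r \<Longrightarrow> le s t \<Longrightarrow> le t r \<Longrightarrow> le s r"
    and t: "t \<in> nlists m U" and BI: "\<And>y. y \<in> itv u v \<Longrightarrow> B (y # t)"
    and inc: "\<And>y z. y \<in> itv u v \<Longrightarrow> z \<in> itv u v \<Longrightarrow> y \<sqsubset> z \<Longrightarrow> \<not> le (z # t) (y # t)"
    and y: "y1 \<in> itv u v" "y2 \<in> itv u v" "y1 \<sqsubset> y2"
    and e: "e \<in> nlists (Suc m) U" "gap B le (y1 # t) e" "gap B le (y2 # t) e"
  shows False
proof -
  obtain u1 v1 where 1: "u1 \<in> U" "v1 \<in> U" "u1 \<sqsubset> y1" "y1 \<sqsubset> v1"
    "\<And>x. x \<in> itv u1 v1 \<Longrightarrow> B (x # t) \<Longrightarrow> \<not> le (x # t) (y1 # t) \<Longrightarrow> \<not> le (x # t) e"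
    using e(2) unfolding gap_def by auto
  obtain u2 v2 where 2: "u2 \<in> U" "v2 \<in> U" "u2 \<sqsubset> y2" "y2 \<sqsubset> v2"
    "\<And>x. x \<in> itv u2 v2 \<Longrightarrow> B (x # t) \<Longrightarrow> \<not> le (y2 # t) (x # t) \<Longrightarrow> \<not> le e (x # t)"
    using e(3) unfolding gap_def by auto
  have Be: "B e" using e(2) unfolding gap_def by blast
  have yU: "y1 \<in> U" "y2 \<in> U" using y by auto
  obtain p where p: "p \<in> U" "y1 \<sqsubset> p" "p \<sqsubset> v1" "p \<sqsubset> y2" using dns_min[of y1 v1 y2] 1 y yU by blast
  obtain q where q: "q \<in> U" "p \<sqsubset> q" "u2 \<sqsubset> q" "q \<sqsubset> y2" using dns_max[of y2 p u2] 2 p yU by blast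
  have yv: "u \<sqsubset> y1" "y2 \<sqsubset> v" using y by auto
  have up: "u \<sqsubset> p" using yv(1) p(2) by (rule less_trans)
  have uq: "u \<sqsubset> q" using up q(2) by (rule less_trans)
  have pv: "p \<sqsubset> v" using p(4) yv(2) by (rule less_trans)
  have qv: "q \<sqsubset> v" using q(4) yv(2) by (rule less_trans)
  have I: "p \<in> itv u v" "q \<in> itv u v" using p(1) q(1) up uq pv qv by auto
  have "u1 \<sqsubset> p" using 1(3) p(2) by (rule less_trans)
  then have "p \<in> itv u1 v1" using p by auto
  then have a: "\<not> le (p # t) e" using 1(5) BI[OF I(1)] inc[OF y(1) I(1) p(2)] by blast
  have "q \<sqsubset> v2" using q(4) 2(4) by (rule less_trans)
  then have "q \<in> itv u2 v2" using q by auto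
  then have b: "\<not> le e (q # t)" using 2(5) BI[OF I(2)] inc[OF I(2) y(2) q(4)] by blast
  have L: "p # t \<in> nlists (Suc m) U" "q # t \<in> nlists (Suc m) U" using p q t by auto
  have "le e (p # t)" using a tot[OF e(1) L(1)] Be BI[OF I(1)] by blast
  moreover have "le (p # t) (q # t)" using tot[OF L] inc[OF I q(2)] BI[OF I(1)] BI[OF I(2)] by blast
  ultimately show False using b tr[OF e(1) L] Be BI[OF I(1)] BI[OF I(2)] by blast
qed

end

context omin begin

definition inc_on :: "('a \<Rightarrow> 'a \<Rightarrow> bool) \<Rightarrow> 'a \<Rightarrow> 'a \<Rightarrow> bool" where
  "inc_on le u v \<longleftrightarrow> (\<forall>y\<in>itv u v. \<forall>z\<in>itv u v. y \<sqsubset> z \<longrightarrow> \<not> le z y)"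

definition const_on :: "('a \<Rightarrow> 'a \<Rightarrow> bool) \<Rightarrow> 'a \<Rightarrow> 'a \<Rightarrow> bool" where
  "const_on le u v \<longleftrightarrow> (\<forall>y\<in>itv u v. \<forall>z\<in>itv u v. le y z)"

text \<open>On an interval around every point of which a preorder is constant or strictly monotone, an
  initial segment that is neither empty nor everything has its supremum inside.\<close>

lemma itv_between: "x \<in> itv a b \<Longrightarrow> y \<in> itv a b \<Longrightarrow> s \<in> U \<Longrightarrow> x \<sqsubseteq> s \<Longrightarrow> s \<sqsubseteq> y \<Longrightarrow> s \<in> itv a b"
  unfolding in_itv using less_le_trans le_less_trans by blast

lemma split_point:
  assumes leD: "D 2 (\<lambda>e. le (hd e) (hd (tl e)))"
    and tot: "\<And>x y. x \<in> itv a b \<Longrightarrow> y \<in> itv a b \<Longrightarrow> le x y \<or> le y x"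
    and tr: "\<And>x y z. x \<in> itv a b \<Longrightarrow> y \<in> itv a b \<Longrightarrow> z \<in> itv a b \<Longrightarrow> le x y \<Longrightarrow> le y z \<Longrightarrow> le x z"
    and nice: "\<And>x. x \<in> itv a b \<Longrightarrow> \<exists>u\<in>U. \<exists>v\<in>U. u \<sqsubset> x \<and> x \<sqsubset> v \<and>
      (const_on le u v \<or> inc_on le u v \<or> inc_on (\<lambda>x y. le y x) u v)"
    and ab: "a \<in> U" "b \<in> U"
    and down: "\<And>x y. x \<in> itv a b \<Longrightarrow> y \<in> itv a b \<Longrightarrow> P y \<Longrightarrow> le x y \<Longrightarrow> P x"
    and PD: "(\<forall>x\<in>itv a b. \<forall>y\<in>itv a b. x \<sqsubset> y \<longrightarrow> P y \<longrightarrow> P x) \<or>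
      (\<forall>x\<in>itv a b. \<forall>y\<in>itv a b. x \<sqsubset> y \<longrightarrow> P x \<longrightarrow> P y) \<Longrightarrow> D 1 (\<lambda>e. a \<sqsubset> hd e \<and> hd e \<sqsubset> b \<and> P (hd e))"
    and x12: "x1 \<in> itv a b" "x2 \<in> itv a b" "P x1" "\<not> P x2"
  shows "\<exists>s\<in>itv a b. (\<forall>z\<in>itv a b. (\<not> le s z \<longrightarrow> P z) \<and> (\<not> le z s \<longrightarrow> \<not> P z)) \<and>
    \<not> (\<exists>u\<in>U. \<exists>v\<in>U. u \<sqsubset> s \<and> s \<sqsubset> v \<and> const_on le u v)"
proof -
  define C where "C = (\<lambda>x. \<exists>u\<in>U. \<exists>v\<in>U. u \<sqsubset> x \<and> x \<sqsubset> v \<and> const_on le u v)"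
  define I where "I = (\<lambda>x. \<exists>u\<in>U. \<exists>v\<in>U. u \<sqsubset> x \<and> x \<sqsubset> v \<and> inc_on le u v)"
  define J where "J = (\<lambda>x. \<exists>u\<in>U. \<exists>v\<in>U. u \<sqsubset> x \<and> x \<sqsubset> v \<and> inc_on (\<lambda>x y. le y x) u v)"
  note d = D_ee[OF leD]
  have CD: "D 1 (\<lambda>e. C (hd e))" unfolding C_def const_on_def by (rule dint refl d | simp)+
  have ID: "D 1 (\<lambda>e. I (hd e))" unfolding I_def inc_on_def by (rule dint refl d | simp)+
  have open_C: "lcon C x" if "C x" for x using that unfolding lcon_def C_def by (metis in_itv)
  have open_I: "lcon I x" if "I x" for x using that unfolding lcon_def I_def by (metis in_itv)
  have open_J: "lcon J x" if "J x" for x using that unfolding lcon_def J_def by (metis in_itv)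
  have two: "\<exists>y\<in>U. \<exists>z\<in>U. y \<in> itv u v \<and> z \<in> itv u v \<and> y \<in> itv u' v' \<and> z \<in> itv u' v' \<and> y \<sqsubset> z \<and> y \<in> itv a b \<and> z \<in> itv a b"
    if uv: "u \<in> U" "v \<in> U" "u \<sqsubset> x" "x \<sqsubset> v" "u' \<in> U" "v' \<in> U" "u' \<sqsubset> x" "x \<sqsubset> v'" "x \<in> itv a b" for u v u' v' x
  proof -
    have xU: "x \<in> U" "x \<sqsubset> b" "a \<sqsubset> x" using uv by auto
    obtain z0 where z0: "z0 \<in> U" "x \<sqsubset> z0" "z0 \<sqsubset> v" "z0 \<sqsubset> v'" using dns_min[of x v v'] uv xU by blast
    obtain z1 where z1: "z1 \<in> U" "x \<sqsubset> z1" "z1 \<sqsubset> z0" "z1 \<sqsubset> b" using dns_min[of x z0 b] z0 xU ab by blast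
    have l: "z1 \<sqsubset> v" "z1 \<sqsubset> v'" "u \<sqsubset> z1" "u' \<sqsubset> z1" "a \<sqsubset> z1" using z0 z1 uv xU less_trans by metis+
    have "x \<in> itv u v" "z1 \<in> itv u v" "x \<in> itv u' v'" "z1 \<in> itv u' v'" "z1 \<in> itv a b"
      using uv xU z1 l by auto
    then show ?thesis using z1 xU uv(9) by blast
  qed
  have excl_CI: "\<not> (C x \<and> (I x \<or> J x))" if "x \<in> itv a b" for x
  proof (clarify, elim disjE)
    assume "C x" "I x"
    then obtain u v u' v' where uv: "u \<in> U" "v \<in> U" "u \<sqsubset> x" "x \<sqsubset> v" "const_on le u v"
      "u' \<in> U" "v' \<in> U" "u' \<sqsubset> x" "x \<sqsubset> v'" "inc_on le u' v'" unfolding C_def I_def by blast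
    then show False using two[OF uv(1-4,6-9) that] unfolding const_on_def inc_on_def by blast
  next
    assume "C x" "J x"
    then obtain u v u' v' where uv: "u \<in> U" "v \<in> U" "u \<sqsubset> x" "x \<sqsubset> v" "const_on le u v"
      "u' \<in> U" "v' \<in> U" "u' \<sqsubset> x" "x \<sqsubset> v'" "inc_on (\<lambda>x y. le y x) u' v'" unfolding C_def J_def by blast
    then show False using two[OF uv(1-4,6-9) that] unfolding const_on_def inc_on_def by blast
  qed
  have excl_IJ: "\<not> (I x \<and> J x)" if "x \<in> itv a b" for x
  proof
    assume "I x \<and> J x"
    then obtain u v u' v' where uv: "u \<in> U" "v \<in> U" "u \<sqsubset> x" "x \<sqsubset> v" "inc_on le u v"
      "u' \<in> U" "v' \<in> U" "u' \<sqsubset> x" "x \<sqsubset> v'" "inc_on (\<lambda>x y. le y x) u' v'" unfolding I_def J_def by blast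
    then show False using two[OF uv(1-4,6-9) that] tot unfolding inc_on_def by blast
  qed
  have cov: "C x \<or> I x \<or> J x" if "x \<in> itv a b" for x
    using nice[OF that] unfolding C_def I_def J_def by blast
  have lc: "lcon C x \<and> lcon I x" if x: "x \<in> itv a b" for x
  proof -
    have xU: "x \<in> U" using x by simp
    have lab: "lcon (\<lambda>y. y \<in> itv a b) x" unfolding lcon_def using x ab by (intro bexI[of _ a] bexI[of _ b]) auto
    consider "C x" | "I x" | "J x" using cov[OF x] by blast
    then show ?thesis
    proof cases
      case 1
      have "lcon I x" by (rule lcon_map[OF lcon_pair[OF open_C[OF 1] lab xU]]) (use excl_CI x 1 in auto)
      then show ?thesis using open_C[OF 1] by blast
    next
      case 2
      have "lcon C x" by (rule lcon_map[OF lcon_pair[OF open_I[OF 2] lab xU]]) (use excl_CI x 2 in auto)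
      then show ?thesis using open_I[OF 2] by blast
    next
      case 3
      have "lcon C x" by (rule lcon_map[OF lcon_pair[OF open_J[OF 3] lab xU]]) (use excl_CI x 3 in auto)
      moreover have "lcon I x" by (rule lcon_map[OF lcon_pair[OF open_J[OF 3] lab xU]]) (use excl_IJ x 3 in auto)
      ultimately show ?thesis by blast
    qed
  qed
  \<comment> \<open>A definable predicate that is locally constant on the interval is constant
    there. The conditions \<open>C\<close>, \<open>I\<close> and \<open>J\<close> are open, cover
    the interval and exclude each other, so one of them holds throughout.\<close>
  have conn: "Q x = Q y" if QD: "D 1 (\<lambda>e. Q (hd e))" and Q: "\<And>x. x \<in> itv a b \<Longrightarrow> lcon Q x"
    and xy: "x \<in> itv a b" "y \<in> itv a b" for Q x y
  proof -
    have *: "Q x = Q y" if xy: "x \<in> itv a b" "y \<in> itv a b" "x \<sqsubset> y" for x y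
    proof (rule ccontr)
      assume ne: "Q x \<noteq> Q y"
      have "x \<in> U" "y \<in> U" using xy by auto
      from ex_bd[OF QD this xy(3) ne] obtain s where s: "s \<in> U" "x \<sqsubseteq> s" "s \<sqsubseteq> y" "bd Q s" by blast
      then have "lcon Q s" using itv_between[OF xy(1,2)] Q by blast
      then show False using s(4) unfolding lcon_iff by blast
    qed
    show ?thesis
    proof (cases x y rule: linorder_cases)
      case less
      show ?thesis by (rule *[OF xy less])
    next
      case greater
      show ?thesis by (rule *[OF xy(2,1) greater, symmetric])
    qed simp
  qed
  \<comment> \<open>If the preorder were locally constant everywhere, \<open>x1\<close> and
    \<open>x2\<close> would be equivalent, whereas \<open>P\<close> separates them.\<close>
  have noC: "\<not> C x" if "x \<in> itv a b" for x
  proof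
    assume "C x"
    then have allC: "C y" if "y \<in> itv a b" for y
      using conn[OF CD _ \<open>x \<in> itv a b\<close> that] lc by blast
    define Q where "Q = (\<lambda>z. le x1 z \<and> le z x1)"
    have QD: "D 1 (\<lambda>e. Q (hd e))" unfolding Q_def by (rule dint refl d | use x12 in simp)+
    have "lcon Q y" if y: "y \<in> itv a b" for y
    proof -
      obtain u v where uv: "u \<in> U" "v \<in> U" "u \<sqsubset> y" "y \<sqsubset> v" "const_on le u v"
        using allC[OF y] unfolding C_def by blast
      have lab: "lcon (\<lambda>y. y \<in> itv a b) y" unfolding lcon_def using y ab by (intro bexI[of _ a] bexI[of _ b]) auto
      have luv: "lcon (\<lambda>y. y \<in> itv u v) y" unfolding lcon_def using y uv by (intro bexI[of _ u] bexI[of _ v]) auto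
      have yU: "y \<in> U" using y by simp
      show ?thesis
      proof (rule lcon_map[OF lcon_pair[OF lab luv yU]])
        fix z assume "z \<in> U" "(z \<in> itv a b, z \<in> itv u v) = (y \<in> itv a b, y \<in> itv u v)"
        then have z: "z \<in> itv a b" "z \<in> itv u v" "y \<in> itv u v" using y uv by auto
        then have "le y z" "le z y" using uv(5) unfolding const_on_def by blast+
        then show "Q z = Q y" unfolding Q_def using tr[of x1 y z] tr[of x1 z y] tr[of z y x1] tr[of y z x1] z y x12(1) by blast
      qed
    qed
    from conn[OF QD this x12(1,2)] have "Q x1 = Q x2" .
    moreover have "Q x1" unfolding Q_def using tot[OF x12(1,1)] by blast
    ultimately show False using down[OF x12(2,1,3)] x12(4) unfolding Q_def by blast
  qed
  have "(\<forall>x\<in>itv a b. I x) \<or> (\<forall>x\<in>itv a b. J x)" using cov noC conn[OF ID] lc by metis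
  then have gl: "(\<forall>x\<in>itv a b. \<forall>y\<in>itv a b. x \<sqsubset> y \<longrightarrow> \<not> le y x) \<or> (\<forall>x\<in>itv a b. \<forall>y\<in>itv a b. x \<sqsubset> y \<longrightarrow> \<not> le x y)"
  proof
    assume I: "\<forall>x\<in>itv a b. I x"
    interpret p: line_preorder "(\<sqsubseteq>)" "(\<sqsubset>)" U D le a b
      by unfold_locales (use leD ab tot tr in blast)+
    have "\<not> le y x" if xy: "x \<in> itv a b" "y \<in> itv a b" "x \<sqsubset> y" for x y
    proof (rule p.locally_increasing[OF ab order_refl order_refl _ _ xy])
      fix z assume z: "z \<in> itv a b"
      then have "I z" using I by blast
      then obtain u v where uv: "u \<in> U" "v \<in> U" "u \<sqsubset> z" "z \<sqsubset> v" "inc_on le u v"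
        unfolding I_def by blast
      have uv: "u \<in> U" "v \<in> U" "u \<sqsubset> z" "z \<sqsubset> v" "inc_on le u v" "z \<in> U" using uv z by simp_all
      have "\<forall>y\<in>itv z v. \<not> le y z"
        using uv less_trans[of u z] unfolding inc_on_def by (metis in_itv)
      then show "\<exists>q\<in>U. z \<sqsubset> q \<and> (\<forall>y\<in>itv z q. \<not> le y z)" using uv by blast
      have "\<forall>y\<in>itv u z. \<not> le z y"
        using uv less_trans[of _ z v] unfolding inc_on_def by (metis in_itv)
      then show "\<exists>p\<in>U. p \<sqsubset> z \<and> (\<forall>y\<in>itv p z. \<not> le z y)" using uv by blast
    qed
    then show ?thesis by blast
  next
    assume J: "\<forall>x\<in>itv a b. J x"
    have rD: "D 2 (\<lambda>e. le (hd (tl e)) (hd e))" by (rule dint refl d | simp)+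
    interpret p: line_preorder "(\<sqsubseteq>)" "(\<sqsubset>)" U D "\<lambda>x y. le y x" a b
      by unfold_locales (use rD ab tot tr in blast)+
    have "\<not> le x y" if xy: "x \<in> itv a b" "y \<in> itv a b" "x \<sqsubset> y" for x y
    proof (rule p.locally_increasing[OF ab order_refl order_refl _ _ xy])
      fix z assume z: "z \<in> itv a b"
      then have "J z" using J by blast
      then obtain u v where uv: "u \<in> U" "v \<in> U" "u \<sqsubset> z" "z \<sqsubset> v" "inc_on (\<lambda>x y. le y x) u v"
        unfolding J_def by blast
      have uv: "u \<in> U" "v \<in> U" "u \<sqsubset> z" "z \<sqsubset> v" "inc_on (\<lambda>x y. le y x) u v" "z \<in> U" using uv z by simp_all
      have "\<forall>y\<in>itv z v. \<not> le z y"
        using uv less_trans[of u z] unfolding inc_on_def by (metis in_itv)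
      then show "\<exists>q\<in>U. z \<sqsubset> q \<and> (\<forall>y\<in>itv z q. \<not> le z y)" using uv by blast
      have "\<forall>y\<in>itv u z. \<not> le y z"
        using uv less_trans[of _ z v] unfolding inc_on_def by (metis in_itv)
      then show "\<exists>p\<in>U. p \<sqsubset> z \<and> (\<forall>y\<in>itv p z. \<not> le y z)" using uv by blast
    qed
    then show ?thesis by blast
  qed
  have mono: "(\<forall>x\<in>itv a b. \<forall>y\<in>itv a b. x \<sqsubset> y \<longrightarrow> P y \<longrightarrow> P x) \<or>
      (\<forall>x\<in>itv a b. \<forall>y\<in>itv a b. x \<sqsubset> y \<longrightarrow> P x \<longrightarrow> P y)"
    using gl tot down by blast
  define A where "A = (\<lambda>x. a \<sqsubset> x \<and> x \<sqsubset> b \<and> P x)"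
  \<comment> \<open>Definability of \<open>P\<close> along the line enters only here, when
    \<open>P\<close> is already known to be an initial or final segment of the interval. This is the
    situation in which \<open>tame\<close> supplies it.\<close>
  have AD: "D 1 (\<lambda>e. A (hd e))" unfolding A_def by (rule PD[OF mono])
  have A12: "A x1 \<noteq> A x2" unfolding A_def using x12 by auto
  obtain s where s: "s \<in> itv a b" "bd A s"
  proof (cases x1 x2 rule: linorder_cases)
    case less
    have "x1 \<in> U" "x2 \<in> U" using x12 by auto
    from ex_bd[OF AD this less A12] show ?thesis using that itv_between[OF x12(1,2)] by blast
  next
    case greater
    have "x2 \<in> U" "x1 \<in> U" using x12 by auto
    from ex_bd[OF AD this greater A12[symmetric]] show ?thesis using that itv_between[OF x12(2,1)] by blast
  qed (use A12 in simp)
  have sU: "s \<in> U" "a \<sqsubset> s" "s \<sqsubset> b" using s by auto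
  have near: "\<exists>y\<in>itv u v. P y \<noteq> P s" if uv: "u \<in> itv a b \<or> u = a" "v \<in> itv a b \<or> v = b" "u \<sqsubset> s" "s \<sqsubset> v" for u v
  proof -
    have uvU: "u \<in> U" "v \<in> U" "a \<sqsubseteq> u" "v \<sqsubseteq> b" using uv ab by auto
    obtain y where y: "y \<in> U" "u \<sqsubset> y" "y \<sqsubset> v" "A y \<noteq> A s" using bdD[OF s(2) uvU(1,2) uv(3,4)] by blast
    have "a \<sqsubset> y" "y \<sqsubset> b" using y uvU le_less_trans less_le_trans by metis+
    then show ?thesis using y sU unfolding A_def by auto
  qed
  have ini: "(\<forall>z\<in>itv a b. z \<sqsubset> s \<longrightarrow> P z) \<and> (\<forall>z\<in>itv a b. s \<sqsubset> z \<longrightarrow> \<not> P z)"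
    if m: "\<forall>x\<in>itv a b. \<forall>y\<in>itv a b. x \<sqsubset> y \<longrightarrow> P y \<longrightarrow> P x"
  proof (intro conjI ballI impI)
    fix z assume z: "z \<in> itv a b" "z \<sqsubset> s"
    show "P z"
    proof (rule ccontr)
      assume nz: "\<not> P z"
      then have "\<not> P s" using m z s by blast
      moreover obtain y where y: "y \<in> itv z b" "P y \<noteq> P s" using near[of z b] z sU by blast
      moreover have "y \<in> itv a b" using y z by (auto intro: less_trans)
      ultimately show False using m z nz by auto
    qed
  next
    fix z assume z: "z \<in> itv a b" "s \<sqsubset> z"
    show "\<not> P z"
    proof
      assume pz: "P z"
      then have "P s" using m z s by blast
      moreover obtain y where y: "y \<in> itv a z" "P y \<noteq> P s" using near[of a z] z sU by blast
      moreover have "y \<in> itv a b" using y z by (auto intro: less_trans)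
      ultimately show False using m z pz by auto
    qed
  qed
  have fin: "(\<forall>z\<in>itv a b. s \<sqsubset> z \<longrightarrow> P z) \<and> (\<forall>z\<in>itv a b. z \<sqsubset> s \<longrightarrow> \<not> P z)"
    if m: "\<forall>x\<in>itv a b. \<forall>y\<in>itv a b. x \<sqsubset> y \<longrightarrow> P x \<longrightarrow> P y"
  proof (intro conjI ballI impI)
    fix z assume z: "z \<in> itv a b" "s \<sqsubset> z"
    show "P z"
    proof (rule ccontr)
      assume nz: "\<not> P z"
      then have "\<not> P s" using m z s by blast
      moreover obtain y where y: "y \<in> itv a z" "P y \<noteq> P s" using near[of a z] z sU by blast
      moreover have "y \<in> itv a b" using y z by (auto intro: less_trans)
      ultimately show False using m z nz by auto
    qed
  next
    fix z assume z: "z \<in> itv a b" "z \<sqsubset> s"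
    show "\<not> P z"
    proof
      assume pz: "P z"
      then have "P s" using m z s by blast
      moreover obtain y where y: "y \<in> itv z b" "P y \<noteq> P s" using near[of z b] z sU by blast
      moreover have "y \<in> itv a b" using y z by (auto intro: less_trans)
      ultimately show False using m z pz by auto
    qed
  qed
  have irr: "le s s" using tot[OF s(1,1)] by blast
  have "\<forall>z\<in>itv a b. (\<not> le s z \<longrightarrow> P z) \<and> (\<not> le z s \<longrightarrow> \<not> P z)"
    using gl
  proof
    assume g: "\<forall>x\<in>itv a b. \<forall>y\<in>itv a b. x \<sqsubset> y \<longrightarrow> \<not> le y x"
    then have "\<forall>x\<in>itv a b. \<forall>y\<in>itv a b. x \<sqsubset> y \<longrightarrow> P y \<longrightarrow> P x" using tot down by blast
    note i = ini[OF this]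
    show ?thesis
    proof (intro ballI)
      fix z assume z: "z \<in> itv a b"
      show "(\<not> le s z \<longrightarrow> P z) \<and> (\<not> le z s \<longrightarrow> \<not> P z)"
        using i g z s(1) irr tot[OF z s(1)] by (cases z s rule: linorder_cases) blast+
    qed
  next
    assume g: "\<forall>x\<in>itv a b. \<forall>y\<in>itv a b. x \<sqsubset> y \<longrightarrow> \<not> le x y"
    then have "\<forall>x\<in>itv a b. \<forall>y\<in>itv a b. x \<sqsubset> y \<longrightarrow> P x \<longrightarrow> P y" using tot down by blast
    note i = fin[OF this]
    show ?thesis
    proof (intro ballI)
      fix z assume z: "z \<in> itv a b"
      show "(\<not> le s z \<longrightarrow> P z) \<and> (\<not> le z s \<longrightarrow> \<not> P z)"
        using i g z s(1) irr tot[OF z s(1)] by (cases z s rule: linorder_cases) blast+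
    qed
  qed
  moreover have "\<not> (\<exists>u\<in>U. \<exists>v\<in>U. u \<sqsubset> s \<and> s \<sqsubset> v \<and> const_on le u v)" using noC[OF s(1)] unfolding C_def .
  ultimately show ?thesis using s(1) by blast
qed

text \<open>Lines in the direction of the first coordinate fall into pieces, uniformly finite in
  number. If \<open>P\<close> splits no piece, the pieces are the fibres of correspondences from
  dimension \<open>m\<close>. If \<open>P\<close> splits a piece, then near the splitting point
  \<open>s\<close> the preorder is strictly monotone; outside the gap at \<open>s\<close> comparison
  with the points of this one line decides \<open>P\<close>, and the gap is small enough to be
  handled by induction.\<close>

lemma definable_cut:
  assumes "is_cut m B le P" shows "D m P"
  using assms
proof (induction m arbitrary: B le P)
  case 0
  have "D 0 (\<lambda>_. P [])" by (rule D_const)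
  then show ?case by (rule D_cong) simp
next
  case (Suc m)
  note CUT = Suc.IH and cut = Suc.prems
  have BD: "D (Suc m) B" and leD: "D (Suc m + Suc m) (\<lambda>e. le (take (Suc m) e) (drop (Suc m) e))"
    and tot: "\<And>s t. s \<in> nlists (Suc m) U \<Longrightarrow> t \<in> nlists (Suc m) U \<Longrightarrow> B s \<Longrightarrow> B t \<Longrightarrow> le s t \<or> le t s"
    and tr: "\<And>s t r. s \<in> nlists (Suc m) U \<Longrightarrow> t \<in> nlists (Suc m) U \<Longrightarrow> r \<in> nlists (Suc m) U \<Longrightarrow>
      B s \<Longrightarrow> B t \<Longrightarrow> B r \<Longrightarrow> le s t \<Longrightarrow> le t r \<Longrightarrow> le s r"
    and PB: "\<And>t. t \<in> nlists (Suc m) U \<Longrightarrow> P t \<Longrightarrow> B t"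
    and down: "\<And>s t. s \<in> nlists (Suc m) U \<Longrightarrow> t \<in> nlists (Suc m) U \<Longrightarrow> B s \<Longrightarrow> P t \<Longrightarrow> le s t \<Longrightarrow> P s"
    and tm: "tame (Suc m) B P"
    using cut unfolding is_cut_def by blast+
  note d = D_l[OF BD] D_ll[OF leD]
  have gapD: "D (Suc m + Suc m) (\<lambda>e. gap B le (take (Suc m) e) (drop (Suc m) e))"
    unfolding gap_def by (rule dint refl d | simp)+
  note d = d D_ll[OF gapD]
  define lx where "lx = (\<lambda>t x y. le (x # t) (y # t))"
  \<comment> \<open>The clause on \<open>nsm\<close> removes the points whose gap has full
    dimension. As gaps along a strictly monotone stretch are disjoint, \<open>finite_nsm\<close>
    shows that this removes only finitely many points of a line.\<close>
  define nice where "nice = (\<lambda>x t. \<exists>u\<in>U. \<exists>v\<in>U. u \<sqsubset> x \<and> x \<sqsubset> v \<and>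
    ((\<forall>y\<in>itv u v. \<not> B (y # t)) \<or> (\<forall>y\<in>itv u v. B (y # t)) \<and> (const_on (lx t) u v \<or>
      (inc_on (lx t) u v \<or> inc_on (\<lambda>x y. lx t y x) u v) \<and> (\<forall>y\<in>itv u v. \<not> nsm (Suc m) (gap B le (y # t))))))"
  have niceI: "nice x t" if "u \<in> U" "v \<in> U" "u \<sqsubset> x" "x \<sqsubset> v"
    "(\<forall>y\<in>itv u v. \<not> B (y # t)) \<or> (\<forall>y\<in>itv u v. B (y # t)) \<and> (const_on (lx t) u v \<or>
      (inc_on (lx t) u v \<or> inc_on (\<lambda>x y. lx t y x) u v) \<and> (\<forall>y\<in>itv u v. \<not> nsm (Suc m) (gap B le (y # t))))" for u v x t
    unfolding nice_def using that by (intro bexI[of _ u] bexI[of _ v] conjI)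
  have niceD: "D (Suc m) (\<lambda>e. nice (hd e) (tl e))"
    unfolding nice_def const_on_def inc_on_def lx_def by (rule dint refl d | simp del: nsm.simps)+
  define Br where "Br = (\<lambda>x t. \<not> nice x t)"
  have BrD: "D (Suc m) (\<lambda>e. Br (hd e) (tl e))" unfolding Br_def by (rule D_neg[OF niceD])
  have lxD: "D 2 (\<lambda>e. lx t (hd e) (hd (tl e)))" if "t \<in> nlists m U" for t
    unfolding lx_def by (rule dint refl d | use that in simp)+
  have lx_tot: "lx t x y \<or> lx t y x" if "t \<in> nlists m U" "x \<in> U" "y \<in> U" "B (x # t)" "B (y # t)" for t x y
    unfolding lx_def using tot[of "x # t" "y # t"] that by simp
  have lx_tr: "lx t x z" if "t \<in> nlists m U" "x \<in> U" "y \<in> U" "z \<in> U" "B (x # t)" "B (y # t)" "B (z # t)"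
    "lx t x y" "lx t y z" for t x y z
    using tr[of "x # t" "y # t" "z # t"] that unfolding lx_def by simp
  have Br_fin: "finite {x\<in>U. Br x t}" if t: "t \<in> nlists m U" for t
  proof (rule ccontr)
    assume inf: "infinite {x\<in>U. Br x t}"
    have "D 1 (\<lambda>e. Br (hd e) t)" by (rule dint refl D_el[OF BrD] | use t in simp)+
    from infinite_ex_itv[OF this inf] obtain p q where pq: "p \<in> U" "q \<in> U" "p \<sqsubset> q" "\<forall>x\<in>itv p q. Br x t" by blast
    have "D 1 (\<lambda>e. B (hd e # t))" by (rule dint refl d | use t in simp)+
    from itv_split[OF this pq(1-3)] obtain p' q' where pq': "p' \<in> U" "q' \<in> U" "p \<sqsubseteq> p'" "p' \<sqsubset> q'" "q' \<sqsubseteq> q"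
      "(\<forall>x\<in>itv p' q'. B (x # t)) \<or> (\<forall>x\<in>itv p' q'. \<not> B (x # t))" by blast
    have sub: "x \<in> itv p q" if "x \<in> itv p' q'" for x using that pq' by (auto intro: le_less_trans less_le_trans)
    have "\<exists>x\<in>itv p' q'. nice x t"
    proof (cases "\<forall>x\<in>itv p' q'. \<not> B (x # t)")
      case True
      obtain x where x: "x \<in> U" "p' \<sqsubset> x" "x \<sqsubset> q'" using dns[OF pq'(1,2,4)] by blast
      have "nice x t" using niceI[OF pq'(1,2) x(2,3)] True by blast
      then show ?thesis using x by (intro bexI[of _ x]) auto
    next
      case False
      then have BI: "B (x # t)" if "x \<in> itv p' q'" for x using pq'(6) that by blast
      have "line_preorder (\<sqsubseteq>) (\<sqsubset>) U D (lx t) p' q'"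
      proof unfold_locales
        show "lx t x y \<or> lx t y x" if "x \<in> itv p' q'" "y \<in> itv p' q'" for x y
          using lx_tot[OF t] BI that by simp
        show "lx t x z" if "x \<in> itv p' q'" "y \<in> itv p' q'" "z \<in> itv p' q'" "lx t x y" "lx t y z" for x y z
          using lx_tr[OF t _ _ _ BI[OF that(1)] BI[OF that(2)] BI[OF that(3)]] that by simp
      qed (use lxD[OF t] pq' in auto)
      from line_preorder.preorder_monotone[OF this pq'(4)] obtain u v where uv: "u \<in> U" "v \<in> U" "p' \<sqsubseteq> u" "u \<sqsubset> v" "v \<sqsubseteq> q'"
        "const_on (lx t) u v \<or> inc_on (lx t) u v \<or> inc_on (\<lambda>x y. lx t y x) u v"
        unfolding const_on_def inc_on_def by blast
      have sub': "x \<in> itv p' q'" if "x \<in> itv u v" for x using that uv by (auto intro: le_less_trans less_le_trans)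
      have BI': "B (x # t)" if "x \<in> itv u v" for x using BI[OF sub'[OF that]] .
      obtain x where x: "x \<in> U" "u \<sqsubset> x" "x \<sqsubset> v" using dns[OF uv(1,2,4)] by blast
      then have xI: "x \<in> itv u v" by simp
      show ?thesis
      proof (cases "const_on (lx t) u v")
        case True
        then have "nice x t" using niceI[OF uv(1,2) x(2,3)] BI' by blast
        then show ?thesis using sub'[OF xI] by blast
      next
        case False
        then have mono: "inc_on (lx t) u v \<or> inc_on (\<lambda>x y. lx t y x) u v" using uv(6) by blast
        let ?G = "\<lambda>y e. u \<sqsubset> y \<and> y \<sqsubset> v \<and> gap B le (y # t) e"
        have GD: "D (Suc (Suc m)) (\<lambda>e. ?G (hd e) (tl e))" by (rule dint refl d | use t uv in simp)+
        have disj: False if y: "y1 \<in> itv u v" "y2 \<in> itv u v" "y1 \<sqsubset> y2" and e: "e \<in> nlists (Suc m) U"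
          "gap B le (y1 # t) e" "gap B le (y2 # t) e" for y1 y2 e
          using mono
        proof
          assume inc: "inc_on (lx t) u v"
          show False
          proof (rule gap_disjoint[of m B le t u v y1 y2 e])
            show "le s r \<or> le r s" if "s \<in> nlists (Suc m) U" "r \<in> nlists (Suc m) U" "B s" "B r" for s r
              using tot that by blast
            show "le s q" if "s \<in> nlists (Suc m) U" "r \<in> nlists (Suc m) U" "q \<in> nlists (Suc m) U"
              "B s" "B r" "B q" "le s r" "le r q" for s r q
              by (rule tr[OF that(1-6) that(7,8)])
            show "\<not> le (z # t) (y # t)" if "y \<in> itv u v" "z \<in> itv u v" "y \<sqsubset> z" for y z
              using inc that unfolding inc_on_def lx_def by blast
          qed (rule t BI' y e ; assumption?)+
        next
          assume inc: "inc_on (\<lambda>x y. lx t y x) u v"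
          note e' = e(2,3)[folded gap_rev[of B le]]
          show False
          proof (rule gap_disjoint[of m B "\<lambda>a b. le b a" t u v y1 y2 e])
            show "le r s \<or> le s r" if "s \<in> nlists (Suc m) U" "r \<in> nlists (Suc m) U" "B s" "B r" for s r
              using tot that by blast
            show "le q s" if "s \<in> nlists (Suc m) U" "r \<in> nlists (Suc m) U" "q \<in> nlists (Suc m) U"
              "B s" "B r" "B q" "le r s" "le q r" for s r q
              by (rule tr[OF that(3,2,1,6,5,4,8,7)])
            show "\<not> le (y # t) (z # t)" if "y \<in> itv u v" "z \<in> itv u v" "y \<sqsubset> z" for y z
              using inc that unfolding inc_on_def lx_def by blast
          qed (rule t BI' y e' e(1); assumption?)+
        qed
        have "finite {y\<in>U. nsm (Suc m) (?G y)}"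
        proof (rule finite_nsm[OF GD])
          fix e assume e: "e \<in> nlists (Suc m) U"
          have one: "y1 = y2" if "y1 \<in> U" "?G y1 e" "y2 \<in> U" "?G y2 e" for y1 y2
            using disj[OF _ _ _ e, of y1 y2] disj[OF _ _ _ e, of y2 y1] that
            by (cases y1 y2 rule: linorder_cases) auto
          show "finite {y\<in>U. ?G y e}"
          proof (cases "\<exists>y\<in>U. ?G y e")
            case True
            then obtain y where "y \<in> U" "?G y e" by blast
            then have "{y\<in>U. ?G y e} \<subseteq> {y}" using one by blast
            then show ?thesis by (rule finite_subset) simp
          next
            case False
            then have "{y\<in>U. ?G y e} = {}" by blast
            then show ?thesis by (simp only: finite.emptyI)
          qed
        qed
        from right_gap[OF this _ x(1)] obtain w where w: "w \<in> U" "x \<sqsubset> w"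
          "\<And>z. z \<in> U \<Longrightarrow> nsm (Suc m) (?G z) \<Longrightarrow> x \<sqsubset> z \<Longrightarrow> w \<sqsubset> z" by blast
        obtain w' where w': "w' \<in> U" "x \<sqsubset> w'" "w' \<sqsubset> w" "w' \<sqsubset> v" using dns_min[of x w v] w x uv by blast
        obtain z where z: "z \<in> U" "x \<sqsubset> z" "z \<sqsubset> w'" using dns[of x w'] x w' by blast
        have subw: "y \<in> itv u v" if "y \<in> itv x w'" for y
        proof -
          have y: "y \<in> U" "x \<sqsubset> y" "y \<sqsubset> w'" using that by auto
          then show ?thesis using less_trans[OF x(2) y(2)] less_trans[OF y(3) w'(4)] by simp
        qed
        have small: "\<not> nsm (Suc m) (gap B le (y # t))" if y: "y \<in> itv x w'" for y
        proof
          assume n: "nsm (Suc m) (gap B le (y # t))"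
          have "?G y = gap B le (y # t)" using subw[OF y] by (intro ext) auto
          then have "w \<sqsubset> y" using w(3)[of y] n y by (metis in_itv)
          then show False using y less_trans[OF w'(3), of y] by auto
        qed
        have mono': "inc_on (lx t) x w' \<or> inc_on (\<lambda>x y. lx t y x) x w'"
          using mono subw unfolding inc_on_def by blast
        have "nice z t" using niceI[OF x(1) w'(1) z(2,3)] mono' small BI'[OF subw] by blast
        moreover have "z \<in> itv p' q'" using subw sub' z by simp
        ultimately show ?thesis by blast
      qed
    qed
    then show False using pq(4) sub unfolding Br_def by blast
  qed
  obtain K where K: "\<And>t. t \<in> nlists m U \<Longrightarrow> card {x\<in>U. Br x t} \<le> K"
    using uniform_finiteness[OF BrD] Br_fin by blast
  \<comment> \<open>The fibres are the pieces of the line over \<open>t\<close>. For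
    \<open>c\<close> true this is the bad point of rank \<open>j\<close>, for \<open>c\<close> false
    the stretch of nice points with exactly \<open>j\<close> bad points below them.\<close>
  define R where "R = (\<lambda>c j t b. tl b = t \<and> Br (hd b) t = c \<and> rank j (\<lambda>x. Br x t) (hd b))"
  have RD: "D (m + Suc m) (\<lambda>e. R c j (take m e) (drop m e))" for c j
    unfolding R_def by (rule dint refl D_el[OF BrD] | simp)+
  have R_ex: "\<exists>c. \<exists>j\<le>K. R c j (tl b) b" if "b \<in> nlists (Suc m) U" for b
    using rank_ex[OF Br_fin K] nlists_tl[OF that] unfolding R_def by blast
  show ?case
  proof (cases "\<forall>c j. \<forall>t\<in>nlists m U. \<forall>b\<in>nlists (Suc m) U. \<forall>b'\<in>nlists (Suc m) U.
      R c j t b \<longrightarrow> R c j t b' \<longrightarrow> B b \<longrightarrow> B b' \<longrightarrow> P b = P b'")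
    case True
    have 1: "D (Suc m) (\<lambda>b. B b \<and> (\<exists>t\<in>nlists m U. R c j t b) \<and> P b)" for c j
    proof (rule cut_correspondence[OF _ cut RD])
      show "D m P" if "is_cut m B le P" for B le P by (rule CUT[OF that])
      show "P b = P b'" if "t \<in> nlists m U" "b \<in> nlists (Suc m) U" "b' \<in> nlists (Suc m) U"
        "R c j t b" "R c j t b'" "B b" "B b'" for t b b' using True that by blast
    qed
    have "D (Suc m) (\<lambda>b. \<exists>i\<in>UNIV \<times> {..K}. B b \<and> (\<exists>t\<in>nlists m U. R (fst i) (snd i) t b) \<and> P b)"
      by (rule D_fin_ex) (use 1 in auto)
    then show ?thesis
    proof (rule D_cong)
      fix b assume b: "b \<in> nlists (Suc m) U"
      obtain c j where "j \<le> K" "R c j (tl b) b" using R_ex[OF b] by blast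
      then have "\<exists>i\<in>UNIV \<times> {..K}. R (fst i) (snd i) (tl b) b" by (intro bexI[of _ "(c, j)"]) auto
      then show "(\<exists>i\<in>UNIV \<times> {..K}. B b \<and> (\<exists>t\<in>nlists m U. R (fst i) (snd i) t b) \<and> P b) = P b"
        using nlists_tl[OF b] PB[OF b] by blast
    qed
  next
    case False
    then obtain c j t b b' where tb: "t \<in> nlists m U" "b \<in> nlists (Suc m) U" "b' \<in> nlists (Suc m) U"
      "R c j t b" "R c j t b'" "B b" "B b'" "P b" "\<not> P b'" by blast
    obtain x1 x2 where x: "b = x1 # t" "b' = x2 # t" "x1 \<in> U" "x2 \<in> U"
      using tb unfolding R_def by (auto simp: in_nlists_Suc_iff)
    have r: "Br x1 t = c" "Br x2 t = c" "rank j (\<lambda>x. Br x t) x1" "rank j (\<lambda>x. Br x t) x2"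
      using tb(4,5) unfolding R_def x list.sel by blast+
    note t = tb(1)
    have "x1 \<noteq> x2" using tb(8,9) x by blast
    \<comment> \<open>Two different points in the same piece cannot be bad, by
      \<open>rank_gap\<close>. Niceness is an open condition, so the segment between them widens to
      an open interval of nice points.\<close>
    have ends: "\<exists>a\<in>U. \<exists>b\<in>U. a \<sqsubset> y1 \<and> y2 \<sqsubset> b \<and> (\<forall>x\<in>itv a b. nice x t)"
      if y: "y1 \<in> U" "y2 \<in> U" "y1 \<sqsubset> y2" "Br y1 t = Br y2 t" "rank j (\<lambda>x. Br x t) y1" "rank j (\<lambda>x. Br x t) y2" for y1 y2
    proof -
      note gp = rank_gap[OF Br_fin[OF t] y(5,6)]
      have n: "nice y1 t" "nice y2 t" using gp[OF y(1) _ order_refl y(3)] y(4) unfolding Br_def by blast+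
      have open_nice: "\<exists>u\<in>U. \<exists>v\<in>U. u \<sqsubset> y \<and> y \<sqsubset> v \<and> (\<forall>x\<in>itv u v. nice x t)" if "nice y t" for y
        using that unfolding nice_def by (metis in_itv)
      obtain a a' where a: "a \<in> U" "a \<sqsubset> y1" "y1 \<sqsubset> a'" "\<forall>x\<in>itv a a'. nice x t" using open_nice[OF n(1)] by blast
      obtain b b' where b: "b \<in> U" "b' \<sqsubset> y2" "y2 \<sqsubset> b" "\<forall>x\<in>itv b' b. nice x t" using open_nice[OF n(2)] by blast
      have "nice x t" if xx: "x \<in> itv a b" for x
      proof -
        consider "x \<sqsubset> y1" | "y1 \<sqsubseteq> x \<and> x \<sqsubset> y2" | "y2 \<sqsubseteq> x" by (meson not_le)
        then show ?thesis
        proof cases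
          case 1
          then show ?thesis using a xx less_trans[OF 1 a(3)] by auto
        next
          case 2
          then show ?thesis using gp[of x] xx unfolding Br_def by auto
        next
          case 3
          then show ?thesis using b xx less_le_trans[OF b(2) 3] by auto
        qed
      qed
      then show ?thesis using a b by blast
    qed
    have "\<exists>a\<in>U. \<exists>b\<in>U. x1 \<in> itv a b \<and> x2 \<in> itv a b \<and> (\<forall>x\<in>itv a b. nice x t)"
    proof (cases x1 x2 rule: linorder_cases)
      case less
      from ends[OF x(3,4) less _ r(3,4)] r obtain a b where "a \<in> U" "b \<in> U" "a \<sqsubset> x1" "x2 \<sqsubset> b" "\<forall>x\<in>itv a b. nice x t"
        by blast
      moreover from this have "x1 \<sqsubset> b" "a \<sqsubset> x2" using less less_trans by blast+
      ultimately show ?thesis using x by (intro bexI[of _ a] bexI[of _ b]) auto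
    next
      case greater
      from ends[OF x(4,3) greater _ r(4,3)] r obtain a b where "a \<in> U" "b \<in> U" "a \<sqsubset> x2" "x1 \<sqsubset> b" "\<forall>x\<in>itv a b. nice x t"
        by blast
      moreover from this have "x2 \<sqsubset> b" "a \<sqsubset> x1" using greater less_trans by blast+
      ultimately show ?thesis using x by (intro bexI[of _ a] bexI[of _ b]) auto
    qed (use \<open>x1 \<noteq> x2\<close> in simp)
    then obtain a b0 where ab: "a \<in> U" "b0 \<in> U" and xI: "x1 \<in> itv a b0" "x2 \<in> itv a b0"
      and nc: "\<And>x. x \<in> itv a b0 \<Longrightarrow> nice x t" by blast
    have BD1: "D 1 (\<lambda>e. B (hd e # t))" by (rule dint refl d | use t in simp)+
    have nbd: "\<not> bd (\<lambda>x. B (x # t)) y" if "y \<in> itv a b0" for y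
    proof -
      have "lcon (\<lambda>x. B (x # t)) y"
        using nc[OF that] that unfolding nice_def lcon_def by (metis in_itv)
      then show ?thesis unfolding lcon_iff .
    qed
    have BI: "B (y # t)" if y: "y \<in> itv a b0" for y
    proof (rule ccontr)
      assume nB: "\<not> B (y # t)"
      have Bx: "B (x1 # t)" using tb(6) x by simp
      have yU: "y \<in> U" using y by simp
      show False
      proof (cases x1 y rule: linorder_cases)
        case less
        from ex_bd[OF BD1 x(3) yU less] nB Bx obtain s where s: "s \<in> U" "x1 \<sqsubseteq> s" "s \<sqsubseteq> y" "bd (\<lambda>x. B (x # t)) s" by blast
        then show False using nbd[OF itv_between[OF xI(1) y s(1-3)]] by blast
      next
        case greater
        from ex_bd[OF BD1 yU x(3) greater] nB Bx obtain s where s: "s \<in> U" "y \<sqsubseteq> s" "s \<sqsubseteq> x1" "bd (\<lambda>x. B (x # t)) s" by blast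
        then show False using nbd[OF itv_between[OF y xI(1) s(1-3)]] by blast
      qed (use Bx nB in simp)
    qed
    have Lt: "y # t \<in> nlists (Suc m) U" if "y \<in> itv a b0" for y using that t by simp
    have nc': "\<exists>u\<in>U. \<exists>v\<in>U. u \<sqsubset> y \<and> y \<sqsubset> v \<and> (const_on (lx t) u v \<or>
      (inc_on (lx t) u v \<or> inc_on (\<lambda>x y. lx t y x) u v) \<and> \<not> nsm (Suc m) (gap B le (y # t)))"
      if y: "y \<in> itv a b0" for y
    proof -
      obtain u v where uv: "u \<in> U" "v \<in> U" "u \<sqsubset> y" "y \<sqsubset> v"
        "(\<forall>y\<in>itv u v. \<not> B (y # t)) \<or> (\<forall>y\<in>itv u v. B (y # t)) \<and> (const_on (lx t) u v \<or>
          (inc_on (lx t) u v \<or> inc_on (\<lambda>x y. lx t y x) u v) \<and> (\<forall>y\<in>itv u v. \<not> nsm (Suc m) (gap B le (y # t))))"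
        using nc[OF y] unfolding nice_def by blast
      have "y \<in> itv u v" using y uv by simp
      then show ?thesis using uv BI[OF y] by blast
    qed
    have "\<exists>s\<in>itv a b0. (\<forall>z\<in>itv a b0. (\<not> lx t s z \<longrightarrow> P (z # t)) \<and> (\<not> lx t z s \<longrightarrow> \<not> P (z # t))) \<and>
      \<not> (\<exists>u\<in>U. \<exists>v\<in>U. u \<sqsubset> s \<and> s \<sqsubset> v \<and> const_on (lx t) u v)"
    proof (rule split_point[OF lxD[OF t] _ _ _ ab _ _ xI])
      show "lx t x y \<or> lx t y x" if "x \<in> itv a b0" "y \<in> itv a b0" for x y
        using lx_tot[OF t _ _ BI[OF that(1)] BI[OF that(2)]] that by simp
      show "lx t x z" if "x \<in> itv a b0" "y \<in> itv a b0" "z \<in> itv a b0" "lx t x y" "lx t y z" for x y z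
        using lx_tr[OF t _ _ _ BI[OF that(1)] BI[OF that(2)] BI[OF that(3)]] that by simp
      show "\<exists>u\<in>U. \<exists>v\<in>U. u \<sqsubset> y \<and> y \<sqsubset> v \<and> (const_on (lx t) u v \<or> inc_on (lx t) u v \<or> inc_on (\<lambda>x y. lx t y x) u v)"
        if "y \<in> itv a b0" for y using nc'[OF that] by blast
      show "P (x # t)" if "x \<in> itv a b0" "y \<in> itv a b0" "P (y # t)" "lx t x y" for x y
        using down[OF Lt[OF that(1)] Lt[OF that(2)] BI[OF that(1)] that(3)] that(4) unfolding lx_def by blast
      show "P (x1 # t)" "\<not> P (x2 # t)" using tb x by auto
      assume mono: "(\<forall>x\<in>itv a b0. \<forall>y\<in>itv a b0. x \<sqsubset> y \<longrightarrow> P (y # t) \<longrightarrow> P (x # t)) \<or>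
        (\<forall>x\<in>itv a b0. \<forall>y\<in>itv a b0. x \<sqsubset> y \<longrightarrow> P (x # t) \<longrightarrow> P (y # t))"
      \<comment> \<open>The family consists of the single points of the line, so \<open>tame\<close>
        makes the trace of \<open>P\<close> on the line definable as soon as it is a
        segment.\<close>
      let ?F = "\<lambda>x e. a \<sqsubset> x \<and> x \<sqsubset> b0 \<and> e = x # t"
      have A: "(\<exists>e\<in>nlists (Suc m) U. ?F x e \<and> P e) \<longleftrightarrow> a \<sqsubset> x \<and> x \<sqsubset> b0 \<and> P (x # t)" if "x \<in> U" for x
        using that t by auto
      have dom: "(\<exists>e\<in>nlists (Suc m) U. ?F x e) \<longleftrightarrow> a \<sqsubset> x \<and> x \<sqsubset> b0" if "x \<in> U" for x
        using that t by auto
      have "D 1 (\<lambda>e. \<exists>t'\<in>nlists (Suc m) U. ?F (hd e) t' \<and> P t')"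
      proof (rule tm[unfolded tame_def, rule_format])
        show "D (Suc (Suc m)) (\<lambda>e. ?F (hd e) (tl e))" by (rule dint refl | use ab t in simp)+
        show "B e" if "x \<in> U" "e \<in> nlists (Suc m) U" "?F x e" for x e using that BI[of x] by simp
        show "P e = P e'" if "?F x e" "?F x e'" for x e e' using that by simp
        show "(\<forall>x\<in>U. \<forall>y\<in>U. x \<sqsubset> y \<longrightarrow> (\<exists>t\<in>nlists (Suc m) U. ?F x t) \<longrightarrow>
            (\<exists>t\<in>nlists (Suc m) U. ?F y t \<and> P t) \<longrightarrow> (\<exists>t\<in>nlists (Suc m) U. ?F x t \<and> P t)) \<or>
          (\<forall>x\<in>U. \<forall>y\<in>U. x \<sqsubset> y \<longrightarrow> (\<exists>t\<in>nlists (Suc m) U. ?F y t) \<longrightarrow>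
            (\<exists>t\<in>nlists (Suc m) U. ?F x t \<and> P t) \<longrightarrow> (\<exists>t\<in>nlists (Suc m) U. ?F y t \<and> P t))"
          using mono by (simp add: A dom cong: ball_cong) (auto simp: itv_def)
      qed
      then show "D 1 (\<lambda>e. a \<sqsubset> hd e \<and> hd e \<sqsubset> b0 \<and> P (hd e # t))"
        by (rule D_cong) (use A nlists_hd[of _ 0] in simp)
    qed
    then obtain s where s: "s \<in> itv a b0" "\<And>z. z \<in> itv a b0 \<Longrightarrow> \<not> lx t s z \<Longrightarrow> P (z # t)"
      "\<And>z. z \<in> itv a b0 \<Longrightarrow> \<not> lx t z s \<Longrightarrow> \<not> P (z # t)"
      "\<not> (\<exists>u\<in>U. \<exists>v\<in>U. u \<sqsubset> s \<and> s \<sqsubset> v \<and> const_on (lx t) u v)" by blast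
    have small: "\<not> nsm (Suc m) (gap B le (s # t))" using nc'[OF s(1)] s(4) by blast
    have sU: "s \<in> U" "a \<sqsubset> s" "s \<sqsubset> b0" using s(1) by auto
    have GD: "D (Suc m) (\<lambda>e. gap B le (s # t) e)" by (rule dint refl d | use sU t in simp)+
    from small_cover[OF GD small] obtain k :: nat and Q where Q: "\<And>i. i < k \<Longrightarrow> functional m (Suc m) (Q i)"
      "\<And>b. b \<in> nlists (Suc m) U \<Longrightarrow> gap B le (s # t) b \<Longrightarrow> \<exists>i<k. \<exists>u\<in>nlists m U. Q i u b" by blast
    have QP: "D (Suc m) (\<lambda>b. B b \<and> (\<exists>u\<in>nlists m U. Q i u b) \<and> P b)" if "i < k" for i
    proof (rule cut_correspondence[OF _ cut])
      show "D m P" if "is_cut m B le P" for B le P by (rule CUT[OF that])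
      show "D (m + Suc m) (\<lambda>e. Q i (take m e) (drop m e))" using Q(1)[OF that] unfolding functional_def by blast
      show "P b = P b'" if "u \<in> nlists m U" "b \<in> nlists (Suc m) U" "b' \<in> nlists (Suc m) U" "Q i u b" "Q i u b'" for u b b'
        using Q(1)[OF \<open>i < k\<close>] that unfolding functional_def by blast
    qed
    have "D (Suc m) (\<lambda>b. \<exists>i\<in>{..<k}. B b \<and> (\<exists>u\<in>nlists m U. Q i u b) \<and> P b)"
      by (rule D_fin_ex) (use QP in auto)
    note d1 = D_l[OF this]
    \<comment> \<open>An element of \<open>P\<close> that is not below any point of the line
      strictly below \<open>s\<close> lies above all of those, and it is strictly below the points
      above \<open>s\<close>, which are not in \<open>P\<close>. So it belongs to the gap at
      \<open>s\<close>.\<close>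
    have "D (Suc m) (\<lambda>e. (gap B le (s # t) e \<and> (\<exists>i\<in>{..<k}. B e \<and> (\<exists>u\<in>nlists m U. Q i u e) \<and> P e)) \<or>
        B e \<and> (\<exists>z\<in>itv a b0. \<not> le (s # t) (z # t) \<and> le e (z # t)))"
      by (rule dint refl d d1 | use sU t ab in simp)+
    then show ?thesis
    proof (rule D_cong)
      fix e assume e: "e \<in> nlists (Suc m) U"
      have "gap B le (s # t) e \<or> (\<exists>z\<in>itv a b0. \<not> le (s # t) (z # t) \<and> le e (z # t))" if Pe: "P e"
      proof (rule disjCI)
        assume n: "\<not> (\<exists>z\<in>itv a b0. \<not> le (s # t) (z # t) \<and> le e (z # t))"
        have "\<not> le (z # t) e" if z: "z \<in> itv a b0" "\<not> le (z # t) (s # t)" for z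
        proof
          assume "le (z # t) e"
          then have "P (z # t)" using down[OF Lt[OF z(1)] e BI[OF z(1)] Pe] by blast
          then show False using s(3)[OF z(1)] z(2) unfolding lx_def by blast
        qed
        then show "gap B le (s # t) e" unfolding gap_def list.sel using sU ab n PB[OF e Pe] by blast
      qed
      moreover have "P e" if Be: "B e" and z: "z \<in> itv a b0" "\<not> le (s # t) (z # t)" "le e (z # t)" for z
      proof -
        have "P (z # t)" using s(2)[OF z(1)] z(2) unfolding lx_def by blast
        then show ?thesis using down[OF e Lt[OF z(1)] Be] z(3) by blast
      qed
      moreover have "\<exists>i\<in>{..<k}. B e \<and> (\<exists>u\<in>nlists m U. Q i u e) \<and> P e" if "gap B le (s # t) e" "P e"
        using Q(2)[OF e that(1)] PB[OF e that(2)] that(2) by blast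
      ultimately show "((gap B le (s # t) e \<and> (\<exists>i\<in>{..<k}. B e \<and> (\<exists>u\<in>nlists m U. Q i u e) \<and> P e)) \<or>
        B e \<and> (\<exists>z\<in>itv a b0. \<not> le (s # t) (z # t) \<and> le e (z # t))) = P e"
        using PB[OF e] by blast
    qed
  qed
qed

end

section \<open>Elementary pairs\<close>

named_theorems jint

lemmas [jint] = adm_intros

locale dctx =
  fixes L :: "('f, 'r) language" and SS :: "('a, 'f, 'r) struct set" and A :: "'a set"
  assumes A_ne: "A \<noteq> {}" and A_sub: "S \<in> SS \<Longrightarrow> A \<subseteq> universe S"
begin

abbreviation J :: "nat \<Rightarrow> (('a, 'f, 'r) struct \<Rightarrow> 'a list \<Rightarrow> bool) \<Rightarrow> bool" where
  "J \<equiv> defble L SS A"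

lemma J_subst: "J k \<phi> \<Longrightarrow> adm A n k \<tau> \<Longrightarrow> J n (\<lambda>S e. \<phi> S (\<tau> e))"
  by (rule defble_subst[OF _ _ some_in_eq[THEN iffD2, OF A_ne] A_sub])

lemmas [jint] = defble_neg defble_and defble_ex

lemma J_lt [jint]: "adm1 A n s \<Longrightarrow> adm1 A n t \<Longrightarrow> J n (\<lambda>S e. lt S (s e) (t e))"
  using J_subst[OF defble_lt adm_append[of A n 1 "\<lambda>e. [s e]" 1 "\<lambda>e. [t e]" 2]] unfolding adm1_def by simp

lemma J_eq [jint]: "adm1 A n s \<Longrightarrow> adm1 A n t \<Longrightarrow> J n (\<lambda>S e. s e = t e)"
  using J_subst[OF defble_eq adm_append[of A n 1 "\<lambda>e. [s e]" 1 "\<lambda>e. [t e]" 2]] unfolding adm1_def by simp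

lemma J_True [jint]: "J n (\<lambda>_ _. True)"
  by (rule defble_True[OF some_in_eq[THEN iffD2, OF A_ne]])

lemma J_or [jint]:
  assumes "J n \<phi>" "J n \<psi>" shows "J n (\<lambda>S e. \<phi> S e \<or> \<psi> S e)"
  by (rule defble_cong[OF defble_neg[OF defble_and[OF defble_neg[OF assms(1)] defble_neg[OF assms(2)]]]]) blast

lemma J_imp [jint]:
  assumes "J n \<phi>" "J n \<psi>" shows "J n (\<lambda>S e. \<phi> S e \<longrightarrow> \<psi> S e)"
  by (rule defble_cong[OF J_or[OF defble_neg[OF assms(1)] assms(2)]]) blast

lemma J_iff [jint]:
  assumes "J n \<phi>" "J n \<psi>" shows "J n (\<lambda>S e. \<phi> S e = \<psi> S e)"
  by (rule defble_cong[OF defble_and[OF J_imp[OF assms] J_imp[OF assms(2,1)]]]) blast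

lemma J_all [jint]:
  assumes "J (Suc n) (\<lambda>S e. \<chi> S (hd e) (tl e))" shows "J n (\<lambda>S e. \<forall>x\<in>universe S. \<chi> S x e)"
  by (rule defble_cong[OF defble_neg[OF defble_ex[of L SS A n "\<lambda>S x e. \<not> \<chi> S x e", OF defble_neg[OF assms]]]]) blast

lemma J_exl [jint]:
  "J (k + n) (\<lambda>S e. \<chi> S (take k e) (drop k e)) \<Longrightarrow> J n (\<lambda>S e. \<exists>t\<in>nlists k (universe S). \<chi> S t e)"
proof (induction k arbitrary: n \<chi>)
  case 0
  then show ?case by simp
next
  case (Suc k)
  have "adm A (k + Suc n) (Suc k + n) (\<lambda>e. (hd (drop k e) # take k e) @ tl (drop k e))"
    by (rule jint refl | simp)+
  from J_subst[OF Suc.prems this]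
  have "J (k + Suc n) (\<lambda>S e. \<chi> S (hd (drop k e) # take k e) (tl (drop k e)))"
    by (rule defble_cong) (simp add: nlists_def)
  then have "J (Suc n) (\<lambda>S e. \<exists>t\<in>nlists k (universe S). \<chi> S (hd e # t) (tl e))" by (rule Suc.IH)
  then have "J n (\<lambda>S e. \<exists>x\<in>universe S. \<exists>t\<in>nlists k (universe S). \<chi> S (x # t) e)" by (rule defble_ex)
  then show ?case by (simp add: nlists_Suc)
qed

lemma J_alll [jint]:
  assumes "J (k + n) (\<lambda>S e. \<chi> S (take k e) (drop k e))"
  shows "J n (\<lambda>S e. \<forall>t\<in>nlists k (universe S). \<chi> S t e)"
  by (rule defble_cong[OF defble_neg[OF J_exl[of k n "\<lambda>S t e. \<not> \<chi> S t e", OF defble_neg[OF assms]]]]) blast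

lemma J_el: "J (Suc k) (\<lambda>S e. R S (hd e) (tl e)) \<Longrightarrow> adm1 A n s \<Longrightarrow> adm A n k \<tau> \<Longrightarrow> J n (\<lambda>S e. R S (s e) (\<tau> e))"
  using J_subst[of "Suc k" "\<lambda>S e. R S (hd e) (tl e)" n "\<lambda>e. s e # \<tau> e"] adm_Cons[of A n s k \<tau> "Suc k"]
  by simp

lemma J_at_least [jint]:
  "J (Suc n) (\<lambda>S e. \<chi> S (hd e) (tl e)) \<Longrightarrow> J n (\<lambda>S e. at_least (universe S) (lt S) k (\<lambda>x. \<chi> S x e))"
proof (induction k arbitrary: n \<chi>)
  case 0
  then show ?case by (simp add: J_True)
next
  case (Suc k)
  have "J (Suc (Suc n)) (\<lambda>S e. \<chi> S (hd e) (tl (tl e)) \<and> lt S (hd (tl e)) (hd e))"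
    by (rule jint refl J_el[OF Suc.prems] | simp)+
  then have "J (Suc n) (\<lambda>S e. at_least (universe S) (lt S) k (\<lambda>y. \<chi> S y (tl e) \<and> lt S (hd e) y))"
    by (rule Suc.IH)
  then have "J n (\<lambda>S e. \<exists>x\<in>universe S. \<chi> S x e \<and> at_least (universe S) (lt S) k (\<lambda>y. \<chi> S y e \<and> lt S x y))"
    by (intro defble_ex defble_and Suc.prems)
  then show ?case by simp
qed

lemma J_sat [jint]:
  assumes "wf_fm L k \<psi>" "adm A n k \<tau>" shows "J n (\<lambda>S e. sat S (\<tau> e) \<psi>)"
proof -
  have "J k (\<lambda>S e. sat S (e @ []) \<psi>)" by (rule defble_fm[of L k 0]) (use assms in simp_all)
  from J_subst[OF this assms(2)] show ?thesis by simp
qed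

end

lemma at_least_cong:
  "(\<And>x y. x \<in> A \<Longrightarrow> y \<in> A \<Longrightarrow> r x y = r' x y) \<Longrightarrow> (\<And>x. x \<in> A \<Longrightarrow> P x = P' x) \<Longrightarrow>
    at_least A r k P = at_least A r' k P'"
proof (induction k arbitrary: P P')
  case (Suc k)
  have "at_least A r k (\<lambda>y. P y \<and> r x y) = at_least A r' k (\<lambda>y. P' y \<and> r' x y)" if "x \<in> A" for x
    by (rule Suc.IH) (use Suc.prems that in auto)
  then show ?case using Suc.prems by auto
qed simp

text \<open>All quantifiers are bounded by the universe, which makes this recognizably a first-order
  sentence that passes from \<open>M\<close> to \<open>N\<close>.\<close>

definition dense_total :: "('a, 'f, 'r) struct \<Rightarrow> bool" where
  "dense_total S \<longleftrightarrow> (\<forall>x\<in>universe S. \<not> lt S x x) \<and>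
    (\<forall>x\<in>universe S. \<forall>y\<in>universe S. \<forall>z\<in>universe S. lt S x y \<longrightarrow> lt S y z \<longrightarrow> lt S x z) \<and>
    (\<forall>x\<in>universe S. \<forall>y\<in>universe S. x = y \<or> lt S x y \<or> lt S y x) \<and>
    (\<forall>x\<in>universe S. \<forall>y\<in>universe S. lt S x y \<longrightarrow> (\<exists>z\<in>universe S. lt S x z \<and> lt S z y)) \<and>
    (\<forall>x\<in>universe S. (\<exists>y\<in>universe S. lt S y x) \<and> (\<exists>y\<in>universe S. lt S x y))"

lemma dense_total_iff: "dense_linear_order_without_endpoints S \<longleftrightarrow> dense_total S"
  unfolding dense_linear_order_without_endpoints_def dense_total_def irreflp_on_def transp_on_def totalp_on_def
  by blast

text \<open>The locale \<open>omin\<close> works with a linear order of the whole type, while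
  \<open>lt S\<close> has a meaning only on the universe. The other elements are placed above the
  universe and ordered by some well-order of the type.\<close>

lemma ex_linorder:
  assumes "dense_total S"
  shows "\<exists>le ls. class.linorder le ls \<and> (\<forall>x\<in>universe S. \<forall>y\<in>universe S. ls x y = lt S x y)"
proof -
  let ?U = "universe S"
  obtain r :: "('a \<times> 'a) set" where "well_order_on UNIV r" using well_order_on by blast
  then have "refl_on UNIV r" "trans r" "antisym r" "total_on UNIV r"
    unfolding well_order_on_def linear_order_on_def partial_order_on_def preorder_on_def by simp_all
  then have r: "(x, x) \<in> r" "(x, y) \<in> r \<Longrightarrow> (y, z) \<in> r \<Longrightarrow> (x, z) \<in> r"
    "(x, y) \<in> r \<Longrightarrow> (y, x) \<in> r \<Longrightarrow> x = y" "(x, y) \<in> r \<or> (y, x) \<in> r" for x y z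
    by (auto dest: refl_onD transD antisymD simp: total_on_def) (metis UNIV_I refl_onD)
  define ls where "ls = (\<lambda>x y. if x \<in> ?U then (y \<in> ?U \<longrightarrow> lt S x y) else y \<notin> ?U \<and> x \<noteq> y \<and> (x, y) \<in> r)"
  have irr: "\<not> ls x x" for x using assms unfolding ls_def dense_total_def by auto
  have trU: "lt S x z" if "x \<in> ?U" "y \<in> ?U" "z \<in> ?U" "lt S x y" "lt S y z" for x y z
    using assms that unfolding dense_total_def by blast
  have tr: "ls x z" if xyz: "ls x y" "ls y z" for x y z
  proof (cases "x \<in> ?U")
    case True
    show ?thesis
    proof (cases "z \<in> ?U")
      case zU: True
      then have "y \<in> ?U" using xyz(2) unfolding ls_def by (cases "y \<in> ?U") auto
      then show ?thesis using True zU xyz trU[of x y z] unfolding ls_def by simp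
    qed (use True in \<open>simp add: ls_def\<close>)
  next
    case False
    then have *: "y \<notin> ?U" "x \<noteq> y" "(x, y) \<in> r" using xyz(1) unfolding ls_def by simp_all
    then have **: "z \<notin> ?U" "(y, z) \<in> r" using xyz(2) unfolding ls_def by simp_all
    have "x \<noteq> z" using r(3)[OF *(3)] * ** by blast
    then show ?thesis using False ** r(2)[OF *(3) **(2)] unfolding ls_def by simp
  qed
  have tot: "x = y \<or> ls x y \<or> ls y x" for x y
  proof (cases "x \<in> ?U \<and> y \<in> ?U")
    case True
    then have "x = y \<or> lt S x y \<or> lt S y x" using assms unfolding dense_total_def by blast
    then show ?thesis using True unfolding ls_def by simp
  next
    case False
    then show ?thesis using r(4)[of x y] unfolding ls_def by simp blast
  qed
  have "class.linorder (\<lambda>x y. x = y \<or> ls x y) ls"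
  proof (intro class.linorder.intro class.order.intro class.preorder.intro class.order_axioms.intro
      class.linorder_axioms.intro)
    show "ls x y \<longleftrightarrow> (x = y \<or> ls x y) \<and> \<not> (y = x \<or> ls y x)" for x y
      using irr[of x] tr[of x y x] by blast
    show "x = z \<or> ls x z" if "x = y \<or> ls x y" "y = z \<or> ls y z" for x y z
      using that tr[of x y z] by blast
    show "x = y" if "x = y \<or> ls x y" "y = x \<or> ls y x" for x y
      using that irr[of x] tr[of x y x] by blast
    show "(x = y \<or> ls x y) \<or> (y = x \<or> ls y x)" for x y
      using tot[of x y] by blast
  qed simp
  moreover have "\<forall>x\<in>?U. \<forall>y\<in>?U. ls x y = lt S x y" unfolding ls_def by simp
  ultimately show ?thesis by blast
qed

text \<open>The set \<open>X\<close> may change along the closed interval from \<open>x\<close> to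
  \<open>y\<close> only if this interval contains a point of \<open>E\<close>. Compared with a
  decomposition into points and intervals, this form avoids infinite end points and passes directly
  to finite unions.\<close>

definition break :: "('a \<Rightarrow> 'a \<Rightarrow> bool) \<Rightarrow> 'a set \<Rightarrow> 'a set \<Rightarrow> bool" where
  "break ls U X \<longleftrightarrow> (\<exists>E. finite E \<and> E \<subseteq> U \<and>
      (\<forall>x\<in>U. \<forall>y\<in>U. ls x y \<longrightarrow> (\<forall>z\<in>E. ls z x \<or> ls y z) \<longrightarrow> (x \<in> X) = (y \<in> X)))"

lemma break_Union: "finite F \<Longrightarrow> (\<And>X. X \<in> F \<Longrightarrow> break ls U X) \<Longrightarrow> break ls U (\<Union>F)"
proof (induction F rule: finite_induct)
  case empty
  then show ?case unfolding break_def by (intro exI[of _ "{}"]) simp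
next
  case (insert X F)
  obtain E where E: "finite E" "E \<subseteq> U"
    "\<forall>x\<in>U. \<forall>y\<in>U. ls x y \<longrightarrow> (\<forall>z\<in>E. ls z x \<or> ls y z) \<longrightarrow> (x \<in> X) = (y \<in> X)"
    using insert.prems[of X] unfolding break_def by auto
  obtain E' where E': "finite E'" "E' \<subseteq> U"
    "\<forall>x\<in>U. \<forall>y\<in>U. ls x y \<longrightarrow> (\<forall>z\<in>E'. ls z x \<or> ls y z) \<longrightarrow> (x \<in> \<Union>F) = (y \<in> \<Union>F)"
    using insert.IH insert.prems unfolding break_def by auto
  have "(x \<in> \<Union>(insert X F)) = (y \<in> \<Union>(insert X F))"
    if "x \<in> U" "y \<in> U" "ls x y" "\<forall>z\<in>E \<union> E'. ls z x \<or> ls y z" for x y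
  proof -
    have "(x \<in> X) = (y \<in> X)" using E(3) that by blast
    moreover have "(x \<in> \<Union>F) = (y \<in> \<Union>F)" using E'(3) that by blast
    ultimately show ?thesis by simp
  qed
  then show ?case unfolding break_def using E(1,2) E'(1,2) by (intro exI[of _ "E \<union> E'"]) auto
qed

lemma break_points_and_intervals:
  assumes "dense_total S" "X \<in> points_and_intervals S" shows "break (lt S) (universe S) X"
proof -
  let ?U = "universe S"
  have tot: "x = y \<or> lt S x y \<or> lt S y x" if "x \<in> ?U" "y \<in> ?U" for x y
    using assms(1) that unfolding dense_total_def by blast
  have tr: "lt S x z" if "x \<in> ?U" "y \<in> ?U" "z \<in> ?U" "lt S x y" "lt S y z" for x y z
    using assms(1) that unfolding dense_total_def by blast
  have irr: "\<not> lt S x x" if "x \<in> ?U" for x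
    using assms(1) that unfolding dense_total_def by blast
  consider a where "a \<in> ?U" "X = {a}" | l u where "l \<in> ext_universe S" "u \<in> ext_universe S" "X = open_interval S l u"
    using assms(2) unfolding points_and_intervals_def by blast
  then show ?thesis
  proof cases
    case 1
    have "(x \<in> X) = (y \<in> X)" if "x \<in> ?U" "y \<in> ?U" "lt S x y" "lt S a x \<or> lt S y a" for x y
      using that 1 irr[OF 1(1)] tr[of a x y] tr[of x y a] irr by blast
    then show ?thesis unfolding break_def using 1(1) by (intro exI[of _ "{a}"]) auto
  next
    case 2
    let ?E = "{a\<in>?U. Fin a = l \<or> Fin a = u}"
    have "?E \<subseteq> {a. Fin a = l} \<union> {a. Fin a = u}" by blast
    moreover have "finite {a. Fin a = l}" for l :: "'a extended" by (cases l) auto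
    ultimately have fin: "finite ?E" by (meson finite_UnI finite_subset)
    have "(x \<in> X) = (y \<in> X)" if xy: "x \<in> ?U" "y \<in> ?U" "lt S x y" "\<forall>z\<in>?E. lt S z x \<or> lt S y z" for x y
    proof -
      have "ext_lt S l (Fin x) = ext_lt S l (Fin y)"
      proof (cases l)
        case (Fin a)
        then have a: "a \<in> ?U" "lt S a x \<or> lt S y a" using 2(1) xy(4) unfolding ext_universe_def by auto
        then show ?thesis using Fin xy(1-3) tr irr by (metis ext_lt.simps(1))
      qed auto
      moreover have "ext_lt S (Fin x) u = ext_lt S (Fin y) u"
      proof (cases u)
        case (Fin a)
        then have a: "a \<in> ?U" "lt S a x \<or> lt S y a" using 2(2) xy(4) unfolding ext_universe_def by auto
        then show ?thesis using Fin xy(1-3) tr irr by (metis ext_lt.simps(1))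
      qed auto
      ultimately show ?thesis using xy(1,2) unfolding 2(3) open_interval_def by simp
    qed
    then show ?thesis unfolding break_def using fin by (intro exI[of _ ?E]) blast
  qed
qed

lemma omin_structure:
  assumes "is_structure L S" "dense_total S" "class.linorder le ls"
    and eq: "\<And>x y. x \<in> universe S \<Longrightarrow> y \<in> universe S \<Longrightarrow> ls x y = lt S x y"
    and br: "\<And>P. defble L {S} (universe S) 1 (\<lambda>_ e. P (hd e)) \<Longrightarrow> break (lt S) (universe S) {x\<in>universe S. P x}"
  shows "omin le ls (universe S) (\<lambda>n \<phi>. defble L {S} (universe S) n (\<lambda>_. \<phi>))"
proof (intro omin.intro assms(3) omin_axioms.intro)
  let ?U = "universe S" and ?D = "\<lambda>n \<phi>. defble L {S} (universe S) n (\<lambda>_. \<phi>)"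
  show ne: "?U \<noteq> {}" using assms(1) unfolding is_structure_def by blast
  interpret dctx L "{S}" ?U by unfold_locales (use ne in auto)
  show "?D n \<psi>" if "?D n \<phi>" "\<And>e. e \<in> nlists n ?U \<Longrightarrow> \<phi> e = \<psi> e" for n \<phi> \<psi>
    by (rule defble_cong[OF that(1)]) (use that(2) in simp)
  show "?D n (\<lambda>e. \<not> \<phi> e)" if "?D n \<phi>" for n \<phi> using that by (rule defble_neg)
  show "?D n (\<lambda>e. \<phi> e \<and> \<psi> e)" if "?D n \<phi>" "?D n \<psi>" for n \<phi> \<psi> using that by (rule defble_and)
  show "?D n (\<lambda>e. \<exists>x\<in>?U. \<chi> x e)" if "?D (Suc n) (\<lambda>e. \<chi> (hd e) (tl e))" for n \<chi>
    by (rule defble_cong[OF defble_ex[of L "{S}" ?U n "\<lambda>_. \<chi>", OF that]]) simp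
  show "?D n (\<lambda>e. \<phi> (\<tau> e))" if "?D k \<phi>" "adm ?U n k \<tau>" for n k \<phi> \<tau> using that by (rule J_subst)
  show "?D 2 (\<lambda>e. ls (hd e) (hd (tl e)))"
    by (rule defble_cong[OF defble_lt]) (auto simp: numeral_2_eq_2 in_nlists_Suc_iff eq)
  show "?D 2 (\<lambda>e. hd e = hd (tl e))" by (rule defble_eq)
  show "\<exists>z\<in>?U. ls x z \<and> ls z y" if xy: "x \<in> ?U" "y \<in> ?U" "ls x y" for x y
  proof -
    obtain z where "z \<in> ?U" "lt S x z" "lt S z y" using assms(2) xy eq unfolding dense_total_def by blast
    then show ?thesis using eq xy by blast
  qed
  show "\<exists>y\<in>?U. ls y x" if "x \<in> ?U" for x using assms(2) that eq unfolding dense_total_def by blast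
  show "\<exists>y\<in>?U. ls x y" if "x \<in> ?U" for x using assms(2) that eq unfolding dense_total_def by blast
  show "\<exists>E. finite E \<and> E \<subseteq> ?U \<and> (\<forall>x\<in>?U. \<forall>y\<in>?U. ls x y \<longrightarrow> (\<forall>z\<in>E. ls z x \<or> ls y z) \<longrightarrow> P x = P y)"
    if P: "?D 1 (\<lambda>e. P (hd e))" for P
  proof -
    obtain E where E: "finite E" "E \<subseteq> ?U" "\<forall>x\<in>?U. \<forall>y\<in>?U. lt S x y \<longrightarrow> (\<forall>z\<in>E. lt S z x \<or> lt S y z) \<longrightarrow>
        (x \<in> {x\<in>?U. P x}) = (y \<in> {x\<in>?U. P x})"
      using br[OF P] unfolding break_def by blast
    have "P x = P y" if xy: "x \<in> ?U" "y \<in> ?U" "ls x y" "\<forall>z\<in>E. ls z x \<or> ls y z" for x y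
    proof -
      have "\<forall>z\<in>E. lt S z x \<or> lt S y z" using xy E(2) eq by blast
      then show ?thesis using E(3) xy eq by simp
    qed
    then show ?thesis using E(1,2) by blast
  qed
qed

section \<open>Transfer between the two structures\<close>

locale elem_pair =
  fixes L :: "('f, 'r) language" and M N :: "('a, 'f, 'r) struct"
  assumes elem: "elementary_extension L M N"
begin

abbreviation U_M :: "'a set" where "U_M \<equiv> universe M"
abbreviation U_N :: "'a set" where "U_N \<equiv> universe N"

lemma sub: "U_M \<subseteq> U_N" and str: "is_structure L M" "is_structure L N"
  using elem unfolding elementary_extension_def by blast+

sublocale dctx L "{M, N}" U_M
  using str(1) sub unfolding is_structure_def by unfold_locales auto

lemma nlists_sub: "e \<in> nlists n U_M \<Longrightarrow> e \<in> nlists n U_N"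
  using sub unfolding nlists_def by blast

lemma transfer:
  assumes "J n \<phi>" "e \<in> nlists n U_M" shows "\<phi> M e = \<phi> N e"
proof -
  from assms(1) obtain m \<psi> b where 1: "wf_fm L (n + m) \<psi>" "b \<in> nlists m U_M"
    "\<And>S e. S \<in> {M, N} \<Longrightarrow> e \<in> nlists n (universe S) \<Longrightarrow> \<phi> S e = sat S (e @ b) \<psi>"
    by (rule defbleE) (rule that)
  have "e @ b \<in> nlists (n + m) U_M" by (rule nlists_appendI[OF assms(2) 1(2)])
  then have "sat M (e @ b) \<psi> = sat N (e @ b) \<psi>" using elem 1(1) unfolding elementary_extension_def by blast
  then show ?thesis using 1(3)[of M e] 1(3)[of N e] assms(2) nlists_sub by simp
qed

lemma transfer0: "J 0 (\<lambda>S e. \<phi> S) \<Longrightarrow> \<phi> M = \<phi> N"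
  using transfer[of 0 "\<lambda>S e. \<phi> S" "[]"] by simp

lemma lt_MN: "x \<in> U_M \<Longrightarrow> y \<in> U_M \<Longrightarrow> lt M x y = lt N x y"
  using transfer[OF defble_lt, of "[x, y]"] by (simp add: numeral_2_eq_2)

lemma dense_total_transfer: "dense_total M \<Longrightarrow> dense_total N"
proof -
  have "J 0 (\<lambda>S e. dense_total S)"
    unfolding dense_total_def by (rule jint refl | simp)+
  from transfer0[OF this] show "dense_total M \<Longrightarrow> dense_total N" by simp
qed

end

locale epair = elem_pair L M N for L :: "('f, 'r) language" and M N :: "('a, 'f, 'r) struct" +
  fixes le ls :: "'a \<Rightarrow> 'a \<Rightarrow> bool"
  assumes o_min: "o_minimal L M" and tame_ext: "tame_extension L M N"
    and lin: "class.linorder le ls"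
    and ls_N: "\<And>x y. x \<in> universe N \<Longrightarrow> y \<in> universe N \<Longrightarrow> ls x y = lt N x y"
begin

lemma ls_M: "x \<in> U_M \<Longrightarrow> y \<in> U_M \<Longrightarrow> ls x y = lt M x y"
  using lt_MN ls_N sub by blast

lemma dense_M: "dense_total M"
  using o_min unfolding o_minimal_def dense_total_iff by blast

lemma dense_N: "dense_total N"
  by (rule dense_total_transfer[OF dense_M])

definition DM :: "nat \<Rightarrow> ('a list \<Rightarrow> bool) \<Rightarrow> bool" where
  "DM n \<phi> \<longleftrightarrow> defble L {M} U_M n (\<lambda>_. \<phi>)"

definition DN :: "nat \<Rightarrow> ('a list \<Rightarrow> bool) \<Rightarrow> bool" where
  "DN n \<phi> \<longleftrightarrow> defble L {N} U_N n (\<lambda>_. \<phi>)"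

lemma DM_definable: "DM n \<phi> \<longleftrightarrow> definable L M n {e\<in>nlists n U_M. \<phi> e}"
proof
  assume "DM n \<phi>"
  then show "definable L M n {e\<in>nlists n U_M. \<phi> e}"
    unfolding DM_def definable_def fibre_def
  proof (rule defbleE)
    fix m \<psi> b assume 1: "wf_fm L (n + m) \<psi>" "b \<in> nlists m U_M"
      "\<And>S e. S \<in> {M} \<Longrightarrow> e \<in> nlists n (universe S) \<Longrightarrow> \<phi> e = sat S (e @ b) \<psi>"
    have "{e\<in>nlists n U_M. \<phi> e} = {x\<in>nlists n U_M. sat M (x @ b) \<psi>}" using 1(3) by blast
    then show "\<exists>m \<psi> b. wf_fm L (n + m) \<psi> \<and> b \<in> nlists m U_M \<and>
        {e\<in>nlists n U_M. \<phi> e} = {x\<in>nlists n U_M. sat M (x @ b) \<psi>}" using 1(1,2) by blast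
  qed
next
  assume "definable L M n {e\<in>nlists n U_M. \<phi> e}"
  then obtain m \<psi> b where 1: "wf_fm L (n + m) \<psi>" "b \<in> nlists m U_M"
    "{e\<in>nlists n U_M. \<phi> e} = {x\<in>nlists n U_M. sat M (x @ b) \<psi>}"
    unfolding definable_def fibre_def by blast
  show "DM n \<phi>" unfolding DM_def by (rule defbleI[OF 1(1,2)]) (use 1(3) in blast)
qed

sublocale Mo: omin le ls U_M DM
proof -
  have "break (lt M) U_M {x\<in>U_M. P x}" if "DM 1 (\<lambda>e. P (hd e))" for P
  proof -
    let ?X = "{e\<in>nlists 1 U_M. P (hd e)}"
    have "definable L M 1 ?X" using that unfolding DM_definable .
    then obtain F where F: "finite F" "F \<subseteq> points_and_intervals M" "{x. [x] \<in> ?X} = \<Union>F"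
      using o_min unfolding o_minimal_def by blast
    have "{x. [x] \<in> ?X} = {x\<in>U_M. P x}" by auto
    moreover have "break (lt M) U_M (\<Union>F)"
      by (rule break_Union[OF F(1)]) (use break_points_and_intervals[OF dense_M] F(2) in blast)
    ultimately show ?thesis using F(3) by simp
  qed
  from omin_structure[OF str(1) dense_M lin ls_M this[unfolded DM_def]]
  show "omin le ls U_M DM" unfolding DM_def .
qed

lemma J_M: "J n \<phi> \<Longrightarrow> DM n (\<phi> M)"
  unfolding DM_def by (erule defbleE) (rule defbleI; auto)

lemma J_ext:
  assumes "DM n \<phi>"
  obtains \<Phi> where "J n \<Phi>" "\<And>e. e \<in> nlists n U_M \<Longrightarrow> \<Phi> M e = \<phi> e"
  using assms unfolding DM_def
proof (rule defbleE)
  fix m \<psi> b assume 1: "wf_fm L (n + m) \<psi>" "b \<in> nlists m U_M"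
    "\<And>S e. S \<in> {M} \<Longrightarrow> e \<in> nlists n (universe S) \<Longrightarrow> \<phi> e = sat S (e @ b) \<psi>"
  show thesis by (rule that[of "\<lambda>S e. sat S (e @ b) \<psi>"]) (use defble_fm[OF 1(1,2)] 1(3) in auto)
qed

text \<open>The boundary written as a formula of the structure \<open>S\<close>, so that statements
  about boundary points can be transferred.\<close>

definition bdS :: "('a, 'f, 'r) struct \<Rightarrow> ('a \<Rightarrow> bool) \<Rightarrow> 'a \<Rightarrow> bool" where
  "bdS S P x \<longleftrightarrow> (\<forall>u\<in>universe S. \<forall>v\<in>universe S. lt S u x \<and> lt S x v \<longrightarrow>
     (\<exists>y\<in>universe S. lt S u y \<and> lt S y v \<and> P y \<noteq> P x))"

lemma J_bdS [jint]:
  assumes "J (Suc n) (\<lambda>S e. \<chi> S (hd e) (tl e))" "adm1 U_M n s"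
  shows "J n (\<lambda>S e. bdS S (\<lambda>x. \<chi> S x e) (s e))"
proof -
  have "J (Suc n) (\<lambda>S e. bdS S (\<lambda>x. \<chi> S x (tl e)) (hd e))"
    unfolding bdS_def by (rule jint refl J_el[OF assms(1)] | simp)+
  from J_el[OF this assms(2) adm_id[OF refl]] show ?thesis .
qed

lemma bdS_M: "x \<in> U_M \<Longrightarrow> bdS M P x = Mo.bd P x"
  unfolding bdS_def Mo.bd_def by (simp add: ls_M cong: ball_cong bex_cong conj_cong)

text \<open>O-minimality passes to \<open>N\<close>. Uniform finiteness in \<open>M\<close> bounds
  the number of boundary points by some \<open>K\<close> for all parameters at once. The bound
  \<open>\<Phi>\<close>, and the fact \<open>\<Psi>\<close> that a set changes only across a
  boundary point, are then sentences true in \<open>M\<close>, hence in \<open>N\<close>.\<close>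

lemma break_N:
  assumes wf: "wf_fm L (Suc m) \<psi>" and b: "b \<in> nlists m U_N"
  shows "break (lt N) U_N {x\<in>U_N. sat N (x # b) \<psi>}"
proof -
  let ?P = "\<lambda>S w x. sat S (x # w) \<psi>"
  have PJ: "J (Suc m) (\<lambda>S e. ?P S (tl e) (hd e))"
    by (rule J_sat[OF wf]; (rule jint refl | simp)+)
  note d = J_el[OF PJ]
  have PD: "DM (Suc m) (\<lambda>e. ?P M (tl e) (hd e))" using J_M[OF PJ] .
  have PD1: "DM 1 (\<lambda>e. ?P M w (hd e))" if "w \<in> nlists m U_M" for w
    by (rule dint refl Mo.D_el[OF PD, of _ _ "\<lambda>_. w"] | use that in simp)+
  have "DM (Suc m) (\<lambda>e. Mo.bd (?P M (tl e)) (hd e))"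
    by (rule dint refl Mo.D_el[OF PD] | simp)+
  from Mo.uniform_finiteness[OF this] Mo.finite_bd[OF PD1]
  obtain K where K: "\<And>w. w \<in> nlists m U_M \<Longrightarrow> card {x\<in>U_M. Mo.bd (?P M w) x} \<le> K" by blast
  define \<Phi> where "\<Phi> = (\<lambda>S. \<forall>w\<in>nlists m (universe S). \<not> at_least (universe S) (lt S) (Suc K) (bdS S (?P S w)))"
  have "J 0 (\<lambda>S e. \<Phi> S)" unfolding \<Phi>_def by (rule jint refl d | simp del: at_least.simps)+
  moreover have "\<Phi> M" unfolding \<Phi>_def
  proof
    fix w assume w: "w \<in> nlists m U_M"
    have "\<not> at_least U_M ls (Suc K) (Mo.bd (?P M w))"
      unfolding Mo.atl_card[OF Mo.finite_bd[OF PD1[OF w]]] using K[OF w] by simp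
    then show "\<not> at_least U_M (lt M) (Suc K) (bdS M (?P M w))"
      using at_least_cong[of U_M "lt M" ls "bdS M (?P M w)" "Mo.bd (?P M w)" "Suc K"] ls_M bdS_M by blast
  qed
  ultimately have \<Phi>: "\<Phi> N" using transfer0 by blast
  define \<Psi> where "\<Psi> = (\<lambda>S. \<forall>w\<in>nlists m (universe S). \<forall>x\<in>universe S. \<forall>y\<in>universe S. lt S x y \<longrightarrow>
    (\<forall>z\<in>universe S. \<not> lt S z x \<and> \<not> lt S y z \<longrightarrow> \<not> bdS S (?P S w) z) \<longrightarrow> ?P S w x = ?P S w y)"
  have "J 0 (\<lambda>S e. \<Psi> S)" unfolding \<Psi>_def by (rule jint refl d | simp)+
  moreover have "\<Psi> M" unfolding \<Psi>_def
  proof (intro ballI impI)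
    fix w x y assume w: "w \<in> nlists m U_M" and x: "x \<in> U_M" "y \<in> U_M" "lt M x y"
      and nb: "\<forall>z\<in>U_M. \<not> lt M z x \<and> \<not> lt M y z \<longrightarrow> \<not> bdS M (?P M w) z"
    show "?P M w x = ?P M w y"
    proof (rule ccontr)
      assume ne: "?P M w x \<noteq> ?P M w y"
      have "ls x y" using x ls_M by blast
      from Mo.ex_bd[OF PD1[OF w] x(1,2) this ne] obtain s where "s \<in> U_M" "le x s" "le s y" "Mo.bd (?P M w) s" by blast
      then show False using nb x ls_M bdS_M Mo.not_le by metis
    qed
  qed
  ultimately have \<Psi>: "\<Psi> N" using transfer0 by blast
  let ?E = "{x\<in>U_N. bdS N (?P N b) x}"
  interpret linorder le ls by (rule lin)
  have "finite ?E"
  proof (rule ccontr)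
    assume inf: "infinite ?E"
    have "at_least U_N ls k P" if "infinite {x\<in>U_N. P x}" for k P
      using infinite_arbitrarily_large[OF that, of k] unfolding linorder.at_least_iff[OF lin] by blast
    then have "at_least U_N ls (Suc K) (bdS N (?P N b))" using inf by blast
    then have "at_least U_N (lt N) (Suc K) (bdS N (?P N b))"
      using at_least_cong[of U_N "lt N" ls "bdS N (?P N b)" "bdS N (?P N b)" "Suc K"] ls_N by blast
    then show False using \<Phi> b unfolding \<Phi>_def by blast
  qed
  moreover have "?P N b x = ?P N b y" if xy: "x \<in> U_N" "y \<in> U_N" "lt N x y" "\<forall>z\<in>?E. lt N z x \<or> lt N y z" for x y
    using \<Psi> b xy unfolding \<Psi>_def by blast
  ultimately show ?thesis unfolding break_def by (intro exI[of _ ?E]) blast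
qed

sublocale No: omin le ls U_N DN
proof -
  have "break (lt N) U_N {x\<in>U_N. P x}" if "DN 1 (\<lambda>e. P (hd e))" for P
    using that unfolding DN_def
  proof (rule defbleE)
    fix m \<psi> b assume 1: "wf_fm L (1 + m) \<psi>" "b \<in> nlists m U_N"
      "\<And>S e. S \<in> {N} \<Longrightarrow> e \<in> nlists 1 (universe S) \<Longrightarrow> P (hd e) = sat S (e @ b) \<psi>"
    have "P x = sat N (x # b) \<psi>" if "x \<in> U_N" for x using 1(3)[of N "[x]"] that by simp
    then have "{x\<in>U_N. P x} = {x\<in>U_N. sat N (x # b) \<psi>}" by blast
    then show ?thesis using break_N[of m \<psi> b] 1(1,2) by simp
  qed
  from omin_structure[OF str(2) dense_N lin ls_N this[unfolded DN_def]]
  show "omin le ls U_N DN" unfolding DN_def .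
qed

lemma J_N:
  assumes "J n \<phi>" shows "DN n (\<phi> N)"
  using assms
proof (rule defbleE)
  fix m \<psi> b assume 1: "wf_fm L (n + m) \<psi>" "b \<in> nlists m U_M"
    "\<And>S e. S \<in> {M, N} \<Longrightarrow> e \<in> nlists n (universe S) \<Longrightarrow> \<phi> S e = sat S (e @ b) \<psi>"
  show ?thesis unfolding DN_def by (rule defbleI[OF 1(1) nlists_sub[OF 1(2)]]) (use 1(3) in auto)
qed

lemma DN_param:
  assumes "DN n \<phi>"
  obtains m \<Phi> c where "J (n + m) \<Phi>" "c \<in> nlists m U_N" "\<And>e. e \<in> nlists n U_N \<Longrightarrow> \<phi> e = \<Phi> N (e @ c)"
  using assms unfolding DN_def
proof (rule defbleE)
  fix m \<psi> b assume 1: "wf_fm L (n + m) \<psi>" "b \<in> nlists m U_N"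
    "\<And>S e. S \<in> {N} \<Longrightarrow> e \<in> nlists n (universe S) \<Longrightarrow> \<phi> e = sat S (e @ b) \<psi>"
  have "J (n + m) (\<lambda>S e. sat S e \<psi>)" by (rule J_sat[OF 1(1)]) (rule adm_id[OF refl])
  then show thesis by (rule that[OF _ 1(2)]) (use 1(3) in simp)
qed

lemma bdS_N: "x \<in> U_N \<Longrightarrow> bdS N P x = No.bd P x"
  unfolding bdS_def No.bd_def by (simp add: ls_N cong: ball_cong bex_cong conj_cong)

end

section \<open>Traces of sets definable in a tame extension\<close>

context omin begin

text \<open>Only finitely many break points lie above some element of \<open>C\<close>. As
  \<open>C\<close> has no least element, one can descend in \<open>C\<close> below all of these, and
  from there downward no break point is met.\<close>

lemma initial_piece:
  assumes PD: "D 1 (\<lambda>e. P (hd e))" and CU: "\<And>x. C x \<Longrightarrow> x \<in> U" and ne: "C x0"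
    and no_least: "\<And>x. C x \<Longrightarrow> \<exists>y. C y \<and> y \<sqsubset> x"
  shows "\<exists>c. C c \<and> (\<forall>z w. C z \<longrightarrow> z \<sqsubset> c \<longrightarrow> w \<in> U \<longrightarrow> z \<sqsubseteq> w \<longrightarrow> w \<sqsubseteq> c \<longrightarrow> P w = P c)"
proof -
  obtain E where E: "finite E" "E \<subseteq> U"
    "\<forall>x\<in>U. \<forall>y\<in>U. x \<sqsubset> y \<longrightarrow> (\<forall>z\<in>E. z \<sqsubset> x \<or> y \<sqsubset> z) \<longrightarrow> P x = P y"
    using finite_break[OF PD] by blast
  let ?E = "{e\<in>E. \<exists>c. C c \<and> c \<sqsubseteq> e}"
  have "\<exists>c. C c \<and> (\<forall>e\<in>?E. c \<sqsubset> e)"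
  proof (cases "?E = {}")
    case False
    then obtain m where m: "m \<in> ?E" "\<forall>e\<in>?E. m \<sqsubseteq> e" using fin_min[of ?E] E(1) by auto
    then obtain c where c: "C c" "c \<sqsubseteq> m" by blast
    obtain c' where "C c'" "c' \<sqsubset> c" using no_least[OF c(1)] by blast
    moreover from this have "\<forall>e\<in>?E. c' \<sqsubset> e" using c(2) m(2) less_le_trans by blast
    ultimately show ?thesis by blast
  qed (use ne in auto)
  then obtain c where c: "C c" "\<forall>e\<in>?E. c \<sqsubset> e" by blast
  have "P w = P c" if z: "C z" "z \<sqsubset> c" "w \<in> U" "z \<sqsubseteq> w" "w \<sqsubseteq> c" for z w
  proof (cases "w = c")
    case False
    then have wc: "w \<sqsubset> c" using z(5) by (metis le_less)
    have "e \<sqsubset> w \<or> c \<sqsubset> e" if "e \<in> E" for e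
    proof (cases "w \<sqsubseteq> e")
      case True
      then have "z \<sqsubseteq> e" using z(4) order_trans by blast
      then show ?thesis using c(2) z(1) that by blast
    qed (simp add: not_le)
    then show ?thesis using E(3) z(3) CU[OF c(1)] wc by blast
  qed simp
  then show ?thesis using c(1) by blast
qed

text \<open>Membership in the leftmost convex component of \<open>P\<close>.\<close>

definition comp :: "('a \<Rightarrow> bool) \<Rightarrow> 'a \<Rightarrow> bool" where
  "comp P t \<longleftrightarrow> P t \<and> (\<forall>z\<in>U. z \<sqsubset> t \<and> \<not> P z \<longrightarrow> (\<forall>s\<in>U. P s \<longrightarrow> z \<sqsubset> s))"

lemma comp_down:
  assumes "comp P t" "s \<sqsubset> t" "P s" shows "comp P s"
  using assms unfolding comp_def by (meson less_trans)

lemma comp_convex: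
  assumes "comp P s" "comp P t" "s \<in> U" "w \<in> U" "s \<sqsubseteq> w" "w \<sqsubseteq> t" shows "comp P w"
proof (cases "w = t")
  case False
  then have wt: "w \<sqsubset> t" using assms(6) by (simp add: le_less)
  have "P w"
  proof (rule ccontr)
    assume "\<not> P w"
    then have "w \<sqsubset> s" using assms wt unfolding comp_def by blast
    then show False using assms(5) by simp
  qed
  then show ?thesis using comp_down[OF assms(2) wt] by blast
qed (use assms in simp)

lemma ex_comp:
  assumes "D 1 (\<lambda>e. P (hd e))" "x0 \<in> U" "P x0" and no_least: "\<And>x. x \<in> U \<Longrightarrow> P x \<Longrightarrow> \<exists>y\<in>U. P y \<and> y \<sqsubset> x"
  shows "\<exists>t\<in>U. comp P t"
proof -
  have "\<exists>c. (c \<in> U \<and> P c) \<and> (\<forall>z w. z \<in> U \<and> P z \<longrightarrow> z \<sqsubset> c \<longrightarrow> w \<in> U \<longrightarrow> z \<sqsubseteq> w \<longrightarrow> w \<sqsubseteq> c \<longrightarrow> P w = P c)"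
    by (rule initial_piece[OF assms(1), of "\<lambda>x. x \<in> U \<and> P x" x0]) (use assms(2,3) no_least in blast)+
  then obtain c where c: "c \<in> U" "P c"
    "\<And>z w. z \<in> U \<Longrightarrow> P z \<Longrightarrow> z \<sqsubset> c \<Longrightarrow> w \<in> U \<Longrightarrow> z \<sqsubseteq> w \<Longrightarrow> w \<sqsubseteq> c \<Longrightarrow> P w" by blast
  have "z \<sqsubset> s" if zs: "z \<in> U" "z \<sqsubset> c" "\<not> P z" "s \<in> U" "P s" for z s
  proof (rule ccontr)
    assume "\<not> z \<sqsubset> s"
    then have "s \<sqsubseteq> z" by simp
    then have "P z" using c(3)[OF zs(4,5) le_less_trans[OF \<open>s \<sqsubseteq> z\<close> zs(2)] zs(1) \<open>s \<sqsubseteq> z\<close>] zs(2) by simp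
    then show False using zs by blast
  qed
  then have "comp P c" using c(2) unfolding comp_def by blast
  then show ?thesis using c(1) by blast
qed

text \<open>Along the leftmost component of \<open>P\<close>, \<open>stable\<close> marks the
  initial stretch on which \<open>Z\<close> has not changed yet. The point where this stretch ends
  is the \<open>switch\<close>, whether or not it belongs to the stretch; this makes it
  unique.\<close>

definition stable :: "('a \<Rightarrow> bool) \<Rightarrow> ('a \<Rightarrow> bool) \<Rightarrow> 'a \<Rightarrow> bool" where
  "stable P Z w \<longleftrightarrow> comp P w \<and> (\<forall>z\<in>U. comp P z \<and> z \<sqsubseteq> w \<longrightarrow> Z z = Z w)"

definition switch :: "('a \<Rightarrow> bool) \<Rightarrow> ('a \<Rightarrow> bool) \<Rightarrow> 'a \<Rightarrow> bool" where
  "switch P Z t \<longleftrightarrow> comp P t \<and> (\<forall>w\<in>U. comp P w \<longrightarrow> (w \<sqsubset> t \<longrightarrow> stable P Z w) \<and> (t \<sqsubset> w \<longrightarrow> \<not> stable P Z w))"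

lemma switch_unique:
  assumes "switch P Z s" "switch P Z t" "s \<in> U" "t \<in> U" shows "s = t"
proof -
  have *: "\<not> s \<sqsubset> t" if st: "switch P Z s" "switch P Z t" "s \<in> U" "t \<in> U" for s t
  proof
    assume "s \<sqsubset> t"
    then obtain w where w: "w \<in> U" "s \<sqsubset> w" "w \<sqsubset> t" using dns st by blast
    then have "comp P w" using comp_convex[of P s t w] st unfolding switch_def by simp
    then show False using st w unfolding switch_def by blast
  qed
  show ?thesis using *[OF assms] *[OF assms(2,1,4,3)] by simp
qed

text \<open>By \<open>initial_piece\<close>, \<open>Z\<close> is constant on an initial stretch of
  the component, so the stable part is not empty. It is not the whole component, since
  \<open>Z\<close> takes both values there. Its boundary point is the switch.\<close>

lemma ex_switch:
  assumes PD: "D 1 (\<lambda>e. P (hd e))" and ZD: "D 1 (\<lambda>e. Z (hd e))"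
    and no_least: "\<And>x. x \<in> U \<Longrightarrow> P x \<Longrightarrow> \<exists>y\<in>U. P y \<and> y \<sqsubset> x"
    and ab: "a \<in> U" "b \<in> U" "comp P a" "comp P b" "Z a \<noteq> Z b"
  shows "\<exists>t\<in>U. switch P Z t"
proof -
  have nl: "\<exists>y\<in>U. comp P y \<and> y \<sqsubset> x" if x: "x \<in> U" "comp P x" for x
  proof -
    have "P x" using x(2) unfolding comp_def by blast
    then obtain y where "y \<in> U" "P y" "y \<sqsubset> x" using no_least x(1) by blast
    then show ?thesis using comp_down[OF x(2)] by blast
  qed
  have "\<exists>c. (c \<in> U \<and> comp P c) \<and> (\<forall>z w. z \<in> U \<and> comp P z \<longrightarrow> z \<sqsubset> c \<longrightarrow> w \<in> U \<longrightarrow> z \<sqsubseteq> w \<longrightarrow> w \<sqsubseteq> c \<longrightarrow> Z w = Z c)"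
    by (rule initial_piece[OF ZD, of "\<lambda>x. x \<in> U \<and> comp P x" a]) (use ab nl in blast)+
  then obtain c where c: "c \<in> U" "comp P c"
    "\<And>z w. z \<in> U \<Longrightarrow> comp P z \<Longrightarrow> z \<sqsubset> c \<Longrightarrow> w \<in> U \<Longrightarrow> z \<sqsubseteq> w \<Longrightarrow> w \<sqsubseteq> c \<Longrightarrow> Z w = Z c" by blast
  have "Z z = Z c" if "z \<in> U" "comp P z" "z \<sqsubseteq> c" for z
    using c(3)[of z z] that by (cases "z = c") (auto simp: le_less)
  then have Wc: "stable P Z c" unfolding stable_def using c(2) by blast
  have down: "stable P Z w" if w: "stable P Z w'" "w \<in> U" "w' \<in> U" "comp P w" "w \<sqsubseteq> w'" for w w'
  proof -
    have "Z z = Z w" if z: "z \<in> U" "comp P z" "z \<sqsubseteq> w" for z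
    proof -
      have "z \<sqsubseteq> w'" using z(3) w(5) by (rule order_trans)
      then have "Z z = Z w'" "Z w = Z w'" using w z unfolding stable_def by blast+
      then show ?thesis by simp
    qed
    then show ?thesis unfolding stable_def using w(4) by blast
  qed
  have "\<not> (stable P Z a \<and> stable P Z b)"
    using ab linear[of a b] unfolding stable_def by blast
  then obtain d where d: "d \<in> U" "comp P d" "\<not> stable P Z d" using ab by blast
  have cd: "c \<sqsubset> d" using down[OF Wc d(1) c(1) d(2)] d(3) by (meson not_le)
  have WD: "D 1 (\<lambda>e. stable P Z (hd e))"
    unfolding stable_def comp_def by (rule dint refl D_e[OF PD] D_e[OF ZD] | simp)+
  obtain s where s: "s \<in> U" "c \<sqsubseteq> s" "s \<sqsubseteq> d" "bd (stable P Z) s"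
    using ex_bd[OF WD c(1) d(1) cd] Wc d(3) by blast
  have Cs: "comp P s" using comp_convex[OF c(2) d(2) c(1) s(1,2,3)] .
  have "stable P Z w" if w: "w \<in> U" "comp P w" "w \<sqsubset> s" for w
  proof (rule ccontr)
    assume n: "\<not> stable P Z w"
    obtain v where v: "v \<in> U" "s \<sqsubset> v" using above s(1) by blast
    have "\<not> stable P Z y" if y: "y \<in> U" "w \<sqsubset> y" for y
      using down[OF _ w(1) y(1) w(2) less_imp_le[OF y(2)]] n by blast
    moreover obtain y where "y \<in> U" "w \<sqsubset> y" "stable P Z y \<noteq> stable P Z s"
      using bdD[OF s(4) w(1) v(1) w(3) v(2)] by blast
    ultimately show False using s(1) w(3) by blast
  qed
  moreover have "\<not> stable P Z w" if w: "w \<in> U" "comp P w" "s \<sqsubset> w" for w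
  proof
    assume W: "stable P Z w"
    obtain z where z: "z \<in> U" "comp P z" "z \<sqsubset> s" using nl s(1) Cs by blast
    have "stable P Z y" if y: "y \<in> U" "z \<sqsubset> y" "y \<sqsubset> w" for y
      using down[OF W y(1) w(1)] comp_convex[OF z(2) w(2) z(1) y(1)] y by simp
    moreover obtain y where "y \<in> U" "z \<sqsubset> y" "y \<sqsubset> w" "stable P Z y \<noteq> stable P Z s"
      using bdD[OF s(4) z(1) w(1) z(3) w(3)] by blast
    ultimately show False using s(1) z(3) w(3) by blast
  qed
  ultimately have "switch P Z s" unfolding switch_def using Cs by blast
  then show ?thesis using s(1) by blast
qed

end

section \<open>Germs at an omitted cut\<close>

locale egap = epair L M N less_eq less
  for L :: "('f, 'r) language" and M N :: "('a, 'f, 'r) struct"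
    and less_eq :: "'a \<Rightarrow> 'a \<Rightarrow> bool" (infix "\<sqsubseteq>" 50) and less :: "'a \<Rightarrow> 'a \<Rightarrow> bool" (infix "\<sqsubset>" 50) +
  fixes Q1 Q2 :: "'a set"
  assumes Q_Un: "Q1 \<union> Q2 = universe M" and Q_less: "u \<in> Q1 \<Longrightarrow> v \<in> Q2 \<Longrightarrow> u \<sqsubset> v"
    and Q1_ne: "Q1 \<noteq> {}" and Q2_ne: "Q2 \<noteq> {}"
    and no_max: "u \<in> Q1 \<Longrightarrow> \<exists>u'\<in>Q1. u \<sqsubset> u'" and no_min: "v \<in> Q2 \<Longrightarrow> \<exists>v'\<in>Q2. v' \<sqsubset> v"
begin

lemma Q_U_M: "u \<in> Q1 \<Longrightarrow> u \<in> U_M" "v \<in> Q2 \<Longrightarrow> v \<in> U_M"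
  using Q_Un by blast+

lemma Q_U_N: "u \<in> Q1 \<Longrightarrow> u \<in> U_N" "v \<in> Q2 \<Longrightarrow> v \<in> U_N"
  using Q_Un sub by blast+

text \<open>This is the only use of tameness.\<close>

lemma omitted:
  assumes z: "z \<in> U_N" shows "(\<exists>u\<in>Q1. z \<sqsubset> u) \<or> (\<exists>v\<in>Q2. v \<sqsubset> z)"
proof (rule ccontr)
  assume n: "\<not> ?thesis"
  have q1: "u \<sqsubset> z" if uq: "u \<in> Q1" for u
  proof -
    obtain u' where "u' \<in> Q1" "u \<sqsubset> u'" using no_max[OF uq] by blast
    moreover from this have "u' \<sqsubseteq> z" using n Mo.not_less by blast
    ultimately show ?thesis using Mo.less_le_trans by blast
  qed
  have "{b\<in>U_M. lt N b z} = Q1"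
  proof (intro equalityI subsetI)
    fix b assume "b \<in> {b\<in>U_M. lt N b z}"
    then have "b \<in> U_M" "b \<sqsubset> z" using ls_N sub z by auto
    then show "b \<in> Q1" using n Q_Un by blast
  next
    fix b assume "b \<in> Q1"
    then show "b \<in> {b\<in>U_M. lt N b z}" using q1 Q_U_M Q_U_N ls_N z by blast
  qed
  then obtain s where s: "is_ext_sup M Q1 s" using tame_ext z unfolding tame_extension_def by metis
  have up: "s = Fin v \<or> ext_lt M s (Fin v)" if "v \<in> Q2" for v
  proof -
    have "\<forall>x\<in>Q1. Fin x = Fin v \<or> ext_lt M (Fin x) (Fin v)"
      using Q_less that ls_M Q_U_M by simp
    moreover have "Fin v \<in> ext_universe M" using Q_U_M that unfolding ext_universe_def by blast
    ultimately show ?thesis using s unfolding is_ext_sup_def by blast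
  qed
  obtain u0 v0 where 0: "u0 \<in> Q1" "v0 \<in> Q2" using Q1_ne Q2_ne by blast
  have ub: "Fin u = s \<or> ext_lt M (Fin u) s" if "u \<in> Q1" for u using s that unfolding is_ext_sup_def by blast
  show False
  proof (cases s)
    case (Fin x)
    then have x: "x \<in> U_M" using s unfolding is_ext_sup_def ext_universe_def by auto
    show False
    proof (cases "x \<in> Q1")
      case True
      then obtain u where u: "u \<in> Q1" "x \<sqsubset> u" using no_max by blast
      then have "u = x \<or> u \<sqsubset> x" using ub[OF u(1)] Fin x ls_M Q_U_M by simp
      then show False using u(2) by auto
    next
      case False
      then have "x \<in> Q2" using x Q_Un by blast
      then obtain v where v: "v \<in> Q2" "v \<sqsubset> x" using no_min by blast
      then have "x = v \<or> x \<sqsubset> v" using up[OF v(1)] Fin x ls_M Q_U_M by simp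
      then show False using v(2) by auto
    qed
  next
    case Pinf
    then show False using up[OF 0(2)] by simp
  next
    case Minf
    then show False using ub[OF 0(1)] by simp
  qed
qed

text \<open>The end points come from \<open>M\<close>, which keeps the interval definable over
  \<open>M\<close>, while the predicate is tested at points of \<open>N\<close>. As \<open>N\<close>
  has no point inside the cut, these intervals serve as its neighbourhoods.\<close>

definition near :: "('a \<Rightarrow> bool) \<Rightarrow> bool" where
  "near \<Phi> \<longleftrightarrow> (\<exists>u\<in>Q1. \<exists>v\<in>Q2. \<forall>x\<in>U_N. u \<sqsubset> x \<longrightarrow> x \<sqsubset> v \<longrightarrow> \<Phi> x)"

lemma near_mono: "near \<Phi> \<Longrightarrow> (\<And>x. x \<in> U_N \<Longrightarrow> \<Phi> x \<Longrightarrow> \<Psi> x) \<Longrightarrow> near \<Psi>"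
  unfolding near_def by blast

lemma near_conj:
  assumes "near \<Phi>" "near \<Psi>" shows "near (\<lambda>x. \<Phi> x \<and> \<Psi> x)"
proof -
  obtain u v where 1: "u \<in> Q1" "v \<in> Q2" "\<And>x. x \<in> U_N \<Longrightarrow> u \<sqsubset> x \<Longrightarrow> x \<sqsubset> v \<Longrightarrow> \<Phi> x"
    using assms(1) unfolding near_def by blast
  obtain u' v' where 2: "u' \<in> Q1" "v' \<in> Q2" "\<And>x. x \<in> U_N \<Longrightarrow> u' \<sqsubset> x \<Longrightarrow> x \<sqsubset> v' \<Longrightarrow> \<Psi> x"
    using assms(2) unfolding near_def by blast
  obtain p where p: "p \<in> Q1" "u \<sqsubseteq> p" "u' \<sqsubseteq> p" using 1(1) 2(1) Mo.linear[of u u'] by blast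
  obtain q where q: "q \<in> Q2" "q \<sqsubseteq> v" "q \<sqsubseteq> v'" using 1(2) 2(2) Mo.linear[of v v'] by blast
  have "\<Phi> x \<and> \<Psi> x" if "x \<in> U_N" "p \<sqsubset> x" "x \<sqsubset> q" for x
    using 1(3)[of x] 2(3)[of x] that p q Mo.le_less_trans Mo.less_le_trans by blast
  then show ?thesis unfolding near_def using p(1) q(1) by blast
qed

lemma near_True: "near (\<lambda>x. True)"
  unfolding near_def using Q1_ne Q2_ne by blast

lemma near_below: "near \<Phi> \<Longrightarrow> \<exists>u\<in>Q1. \<forall>x\<in>Q1. u \<sqsubset> x \<longrightarrow> \<Phi> x"
  unfolding near_def using Q_less Q_U_N by blast

lemma near_above: "near \<Phi> \<Longrightarrow> \<exists>v\<in>Q2. \<Phi> v"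
  unfolding near_def using Q_less Q_U_N no_min by meson

text \<open>By \<open>omitted\<close>, each of the finitely many break points can be kept outside an
  interval around the cut. The verdict is the same on both sides: a set definable in
  \<open>N\<close> cannot tell the points of \<open>Q1\<close> from those of \<open>Q2\<close> near
  the cut.\<close>

lemma near_cases:
  assumes "DN 1 (\<lambda>e. \<Phi> (hd e))" shows "near \<Phi> \<or> near (\<lambda>x. \<not> \<Phi> x)"
proof -
  obtain E where E: "finite E" "E \<subseteq> U_N"
    "\<forall>x\<in>U_N. \<forall>y\<in>U_N. x \<sqsubset> y \<longrightarrow> (\<forall>z\<in>E. z \<sqsubset> x \<or> y \<sqsubset> z) \<longrightarrow> \<Phi> x = \<Phi> y"
    using No.finite_break[OF assms] by blast
  have "\<exists>u\<in>Q1. \<exists>v\<in>Q2. \<forall>e\<in>E. e \<sqsubset> u \<or> v \<sqsubset> e"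
    using E(1,2)
  proof (induction E rule: finite_induct)
    case empty
    then show ?case using Q1_ne Q2_ne by blast
  next
    case (insert e E)
    then obtain u v where uv: "u \<in> Q1" "v \<in> Q2" "\<forall>e\<in>E. e \<sqsubset> u \<or> v \<sqsubset> e" by auto
    have "e \<in> U_N" using insert.prems by blast
    from omitted[OF this] show ?case
    proof
      assume "\<exists>u\<in>Q1. e \<sqsubset> u"
      then obtain u' where u': "u' \<in> Q1" "e \<sqsubset> u'" by blast
      obtain p where p: "p \<in> Q1" "u \<sqsubseteq> p" "u' \<sqsubseteq> p" using uv(1) u'(1) Mo.linear[of u u'] by blast
      then have "\<forall>x\<in>insert e E. x \<sqsubset> p \<or> v \<sqsubset> x" using uv(3) u'(2) Mo.less_le_trans by blast
      then show ?thesis using p uv by blast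
    next
      assume "\<exists>v\<in>Q2. v \<sqsubset> e"
      then obtain v' where v': "v' \<in> Q2" "v' \<sqsubset> e" by blast
      obtain q where q: "q \<in> Q2" "q \<sqsubseteq> v" "q \<sqsubseteq> v'" using uv(2) v'(1) Mo.linear[of v v'] by blast
      then have "\<forall>x\<in>insert e E. x \<sqsubset> u \<or> q \<sqsubset> x" using uv(3) v'(2) Mo.le_less_trans by blast
      then show ?thesis using q uv by blast
    qed
  qed
  then obtain u v where uv: "u \<in> Q1" "v \<in> Q2" "\<And>e. e \<in> E \<Longrightarrow> e \<sqsubset> u \<or> v \<sqsubset> e" by blast
  have const: "\<Phi> x = \<Phi> y" if x: "x \<in> U_N" "u \<sqsubset> x" "x \<sqsubset> v" and y: "y \<in> U_N" "u \<sqsubset> y" "y \<sqsubset> v" for x y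
  proof -
    have *: "\<Phi> x = \<Phi> y" if "x \<in> U_N" "u \<sqsubset> x" "x \<sqsubset> v" "y \<in> U_N" "u \<sqsubset> y" "y \<sqsubset> v" "x \<sqsubset> y" for x y
    proof -
      have "\<forall>z\<in>E. z \<sqsubset> x \<or> y \<sqsubset> z" using uv(3) that Mo.less_trans by blast
      then show ?thesis using E(3) that by blast
    qed
    show ?thesis using *[OF x y] *[OF y x] Mo.neqE[of x y] by blast
  qed
  show ?thesis unfolding near_def using uv(1,2) const by meson
qed

text \<open>\<open>R\<close> defines over \<open>M\<close> a family of nonempty sets, and the germ of this family at the cut is
  contained in, or disjoint from, every set definable in \<open>N\<close>.\<close>

definition generic :: "nat \<Rightarrow> (('a, 'f, 'r) struct \<Rightarrow> 'a \<Rightarrow> 'a list \<Rightarrow> bool) \<Rightarrow> bool" where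
  "generic k R \<longleftrightarrow> J (Suc k) (\<lambda>S e. R S (hd e) (tl e)) \<and>
     near (\<lambda>x. \<exists>y\<in>nlists k U_N. R N x y) \<and>
     (\<forall>Z. DN (Suc k) (\<lambda>e. Z (hd e) (tl e)) \<longrightarrow>
       near (\<lambda>x. \<forall>y\<in>nlists k U_N. R N x y \<longrightarrow> Z x y) \<or> near (\<lambda>x. \<forall>y\<in>nlists k U_N. R N x y \<longrightarrow> \<not> Z x y))"

text \<open>If a formula with parameters in \<open>N\<close> selects a point of each fibre near the
  cut, then the existence of such parameters is a sentence over \<open>M\<close>, so parameters from
  \<open>M\<close> do as well. The selection they define extends \<open>R\<close> by one coordinate
  that is determined by the others, and so inherits genericity.\<close>

lemma generic_step_choice:
  assumes R: "generic k R" and FJ: "J (Suc (Suc k)) (\<lambda>S e. F S (hd e) (tl e))"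
    and fD: "DN (Suc (Suc k)) (\<lambda>e. f (hd e) (hd (tl e)) (tl (tl e)))"
    and f: "near (\<lambda>x. \<forall>y\<in>nlists k U_N. R N x y \<longrightarrow>
      (\<exists>t\<in>U_N. f t x y \<and> F N x (t # y) \<and> (\<forall>s\<in>U_N. f s x y \<longrightarrow> s = t)))"
  shows "\<exists>R'. generic (Suc k) R' \<and> near (\<lambda>x. \<forall>y\<in>nlists (Suc k) U_N. R' N x y \<longrightarrow> F N x y)"
proof -
  have RJ: "J (Suc k) (\<lambda>S e. R S (hd e) (tl e))" and Rne: "near (\<lambda>x. \<exists>y\<in>nlists k U_N. R N x y)"
    and Rg: "\<And>Z. DN (Suc k) (\<lambda>e. Z (hd e) (tl e)) \<Longrightarrow>
       near (\<lambda>x. \<forall>y\<in>nlists k U_N. R N x y \<longrightarrow> Z x y) \<or> near (\<lambda>x. \<forall>y\<in>nlists k U_N. R N x y \<longrightarrow> \<not> Z x y)"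
    using R unfolding generic_def by blast+
  from fD obtain l \<Psi> c where \<Psi>: "J (Suc (Suc k) + l) \<Psi>" "c \<in> nlists l U_N"
    "\<And>e. e \<in> nlists (Suc (Suc k)) U_N \<Longrightarrow> f (hd e) (hd (tl e)) (tl (tl e)) = \<Psi> N (e @ c)"
    by (rule DN_param) blast
  obtain u v where uv: "u \<in> Q1" "v \<in> Q2" "\<And>x y. x \<in> U_N \<Longrightarrow> u \<sqsubset> x \<Longrightarrow> x \<sqsubset> v \<Longrightarrow> y \<in> nlists k U_N \<Longrightarrow> R N x y \<Longrightarrow>
      \<exists>t\<in>U_N. f t x y \<and> F N x (t # y) \<and> (\<forall>s\<in>U_N. f s x y \<longrightarrow> s = t)"
    using f unfolding near_def by blast
  note d = J_el[OF FJ] J_el[OF RJ] J_subst[OF \<Psi>(1)]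
  note uvM = Q_U_M(1)[OF uv(1)] Q_U_M(2)[OF uv(2)]
  note uvN = Q_U_N(1)[OF uv(1)] Q_U_N(2)[OF uv(2)]
  define \<phi> where "\<phi> = (\<lambda>S c. \<forall>x\<in>universe S. lt S u x \<and> lt S x v \<longrightarrow> (\<forall>y\<in>nlists k (universe S). R S x y \<longrightarrow>
      (\<exists>t\<in>universe S. \<Psi> S ((t # x # y) @ c) \<and> F S x (t # y) \<and>
        (\<forall>s\<in>universe S. \<Psi> S ((s # x # y) @ c) \<longrightarrow> s = t))))"
  have \<phi>J: "J l (\<lambda>S c. \<phi> S c)" unfolding \<phi>_def by (rule jint refl d | use uvM in simp)+
  have "J 0 (\<lambda>S e. \<exists>c\<in>nlists l (universe S). \<phi> S c)"
    by (rule jint refl J_subst[OF \<phi>J] | simp)+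
  note tr = transfer0[OF this]
  have "\<phi> N c"
    unfolding \<phi>_def
  proof (intro ballI impI)
    fix x y assume x: "x \<in> U_N" "lt N u x \<and> lt N x v" and y: "y \<in> nlists k U_N" "R N x y"
    have "u \<sqsubset> x" "x \<sqsubset> v" using x uvN ls_N by blast+
    from uv(3)[OF x(1) this y] obtain t where t: "t \<in> U_N" "f t x y" "F N x (t # y)" "\<forall>s\<in>U_N. f s x y \<longrightarrow> s = t" by blast
    have "\<Psi> N ((s # x # y) @ c) = f s x y" if "s \<in> U_N" for s using \<Psi>(3)[of "s # x # y"] that x y by simp
    then show "\<exists>t\<in>U_N. \<Psi> N ((t # x # y) @ c) \<and> F N x (t # y) \<and> (\<forall>s\<in>U_N. \<Psi> N ((s # x # y) @ c) \<longrightarrow> s = t)"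
      using t by blast
  qed
  then obtain c' where c': "c' \<in> nlists l U_M" "\<phi> M c'" using tr \<Psi>(2) by blast
  then have \<phi>N: "\<phi> N c'" using transfer[OF \<phi>J c'(1)] by blast
  define R' where "R' = (\<lambda>S x w. R S x (tl w) \<and> \<Psi> S ((hd w # x # tl w) @ c'))"
  have R'J: "J (Suc (Suc k)) (\<lambda>S e. R' S (hd e) (tl e))"
    unfolding R'_def by (rule jint refl d | use c' in simp)+
  have key: "\<exists>t\<in>U_N. R' N x (t # y) \<and> F N x (t # y) \<and> (\<forall>s\<in>U_N. R' N x (s # y) \<longrightarrow> s = t)"
    if x: "x \<in> U_N" "u \<sqsubset> x" "x \<sqsubset> v" "y \<in> nlists k U_N" "R N x y" for x y
  proof -
    have "lt N u x \<and> lt N x v" using x uvN ls_N by blast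
    then show ?thesis using \<phi>N x unfolding \<phi>_def R'_def list.sel by blast
  qed
  have nuv: "near (\<lambda>x. u \<sqsubset> x \<and> x \<sqsubset> v)" unfolding near_def using uv(1,2) by blast
  have "generic (Suc k) R'"
    unfolding generic_def
  proof (intro conjI allI impI R'J)
    show "near (\<lambda>x. \<exists>y\<in>nlists (Suc k) U_N. R' N x y)"
    proof (rule near_mono[OF near_conj[OF nuv Rne]])
      fix x assume x: "x \<in> U_N" "(u \<sqsubset> x \<and> x \<sqsubset> v) \<and> (\<exists>y\<in>nlists k U_N. R N x y)"
      then obtain y where y: "y \<in> nlists k U_N" "R N x y" by blast
      obtain t where "t \<in> U_N" "R' N x (t # y)" using key[of x y] x y by blast
      then show "\<exists>y\<in>nlists (Suc k) U_N. R' N x y" using y by (intro bexI[of _ "t # y"]) auto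
    qed
    fix Z assume ZD: "DN (Suc (Suc k)) (\<lambda>e. Z (hd e) (tl e))"
    let ?Z = "\<lambda>x y. \<exists>t\<in>U_N. R' N x (t # y) \<and> Z x (t # y)"
    have R'D: "DN (Suc (Suc k)) (\<lambda>e. R' N (hd e) (tl e))" by (rule J_N[OF R'J])
    have "DN (Suc k) (\<lambda>e. ?Z (hd e) (tl e))"
      by (rule dint refl No.D_el[OF R'D] No.D_el[OF ZD] | simp)+
    from Rg[OF this] show "near (\<lambda>x. \<forall>w\<in>nlists (Suc k) U_N. R' N x w \<longrightarrow> Z x w) \<or>
      near (\<lambda>x. \<forall>w\<in>nlists (Suc k) U_N. R' N x w \<longrightarrow> \<not> Z x w)"
    proof
      assume n: "near (\<lambda>x. \<forall>y\<in>nlists k U_N. R N x y \<longrightarrow> ?Z x y)"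
      have "near (\<lambda>x. \<forall>w\<in>nlists (Suc k) U_N. R' N x w \<longrightarrow> Z x w)"
      proof (rule near_mono[OF near_conj[OF nuv n]], intro ballI impI)
        fix x w assume x: "x \<in> U_N" "(u \<sqsubset> x \<and> x \<sqsubset> v) \<and> (\<forall>y\<in>nlists k U_N. R N x y \<longrightarrow> ?Z x y)"
          and w: "w \<in> nlists (Suc k) U_N" "R' N x w"
        obtain t y where ty: "w = t # y" "t \<in> U_N" "y \<in> nlists k U_N" using w by (auto simp: in_nlists_Suc_iff)
        have Rxy: "R N x y" using w(2) unfolding R'_def ty by simp
        then obtain s where s: "s \<in> U_N" "R' N x (s # y)" "Z x (s # y)" using x ty by blast
        have "s = t" using key[of x y] x ty Rxy s w(2) by blast
        then show "Z x w" using s ty by simp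
      qed
      then show ?thesis ..
    next
      assume n: "near (\<lambda>x. \<forall>y\<in>nlists k U_N. R N x y \<longrightarrow> \<not> ?Z x y)"
      have "near (\<lambda>x. \<forall>w\<in>nlists (Suc k) U_N. R' N x w \<longrightarrow> \<not> Z x w)"
      proof (rule near_mono[OF n], intro ballI impI)
        fix x w assume x: "\<forall>y\<in>nlists k U_N. R N x y \<longrightarrow> \<not> ?Z x y" and w: "w \<in> nlists (Suc k) U_N" "R' N x w"
        obtain t y where ty: "w = t # y" "t \<in> U_N" "y \<in> nlists k U_N" using w by (auto simp: in_nlists_Suc_iff)
        have "R N x y" using w(2) unfolding R'_def ty by simp
        then show "\<not> Z x w" using x ty w(2) by blast
      qed
      then show ?thesis ..
    qed
  qed
  moreover have "near (\<lambda>x. \<forall>w\<in>nlists (Suc k) U_N. R' N x w \<longrightarrow> F N x w)"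
  proof (rule near_mono[OF nuv], intro ballI impI)
    fix x w assume x: "x \<in> U_N" "u \<sqsubset> x \<and> x \<sqsubset> v" and w: "w \<in> nlists (Suc k) U_N" "R' N x w"
    obtain t y where ty: "w = t # y" "t \<in> U_N" "y \<in> nlists k U_N" using w by (auto simp: in_nlists_Suc_iff)
    have Rxy: "R N x y" using w(2) unfolding R'_def ty by simp
    then show "F N x w" using key[of x y] x ty w(2) by blast
  qed
  ultimately show ?thesis by blast
qed

text \<open>If nothing definable in \<open>N\<close> selects points of the fibres, the leftmost
  component of the fibre is used instead. A least point of the fibre would be a selection, so there
  is none and the leftmost component exists. If a set \<open>Z\<close> definable in \<open>N\<close>
  split these components near the cut, its switch would be a selection, too.\<close>

lemma generic_step:
  assumes R: "generic k R" and FJ: "J (Suc (Suc k)) (\<lambda>S e. F S (hd e) (tl e))"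
    and Fne: "near (\<lambda>x. \<forall>y\<in>nlists k U_N. R N x y \<longrightarrow> (\<exists>t\<in>U_N. F N x (t # y)))"
  shows "\<exists>R'. generic (Suc k) R' \<and> near (\<lambda>x. \<forall>y\<in>nlists (Suc k) U_N. R' N x y \<longrightarrow> F N x y)"
proof (rule ccontr)
  assume contra: "\<not> ?thesis"
  have RJ: "J (Suc k) (\<lambda>S e. R S (hd e) (tl e))" and Rne: "near (\<lambda>x. \<exists>y\<in>nlists k U_N. R N x y)"
    and Rg: "\<And>Z. DN (Suc k) (\<lambda>e. Z (hd e) (tl e)) \<Longrightarrow>
       near (\<lambda>x. \<forall>y\<in>nlists k U_N. R N x y \<longrightarrow> Z x y) \<or> near (\<lambda>x. \<forall>y\<in>nlists k U_N. R N x y \<longrightarrow> \<not> Z x y)"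
    using R unfolding generic_def by blast+
  have FD: "DN (Suc (Suc k)) (\<lambda>e. F N (hd e) (tl e))" using J_N[OF FJ] .
  \<comment> \<open>Genericity of \<open>R\<close> sharpens the failure of a selection: a formula
    that does not select everywhere on \<open>R\<close> near the cut selects nowhere on it.\<close>
  have no_choice: "near (\<lambda>x. \<forall>y\<in>nlists k U_N. R N x y \<longrightarrow>
      \<not> (\<exists>t\<in>U_N. f t x y \<and> F N x (t # y) \<and> (\<forall>s\<in>U_N. f s x y \<longrightarrow> s = t)))"
    if fD: "DN (Suc (Suc k)) (\<lambda>e. f (hd e) (hd (tl e)) (tl (tl e)))" for f
  proof -
    let ?Z = "\<lambda>x y. \<exists>t\<in>U_N. f t x y \<and> F N x (t # y) \<and> (\<forall>s\<in>U_N. f s x y \<longrightarrow> s = t)"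
    have "DN (Suc k) (\<lambda>e. ?Z (hd e) (tl e))"
      by (rule dint refl No.D_el[OF FD] No.D_eel[OF fD] | simp)+
    from Rg[OF this] show ?thesis using generic_step_choice[OF R FJ fD] contra by blast
  qed
  let ?P = "\<lambda>x y t. F N x (t # y)"
  have fib: "DN 1 (\<lambda>e. ?P x y (hd e))" if "x \<in> U_N" "y \<in> nlists k U_N" for x y
    by (rule dint refl No.D_el[OF FD, of _ "\<lambda>_. x" "\<lambda>e. hd e # y"] | use that in simp)+
  have nl: "near (\<lambda>x. \<forall>y\<in>nlists k U_N. R N x y \<longrightarrow> (\<forall>t\<in>U_N. ?P x y t \<longrightarrow> (\<exists>s\<in>U_N. ?P x y s \<and> s \<sqsubset> t)))"
  proof -
    let ?f = "\<lambda>t x y. ?P x y t \<and> (\<forall>s\<in>U_N. ?P x y s \<longrightarrow> \<not> s \<sqsubset> t)"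
    have "DN (Suc (Suc k)) (\<lambda>e. ?f (hd e) (hd (tl e)) (tl (tl e)))"
      by (rule dint refl No.D_el[OF FD] | simp)+
    from no_choice[OF this] show ?thesis
    proof (rule near_mono, intro ballI impI)
      fix x y t assume x: "\<forall>y\<in>nlists k U_N. R N x y \<longrightarrow>
          \<not> (\<exists>t\<in>U_N. ?f t x y \<and> F N x (t # y) \<and> (\<forall>s\<in>U_N. ?f s x y \<longrightarrow> s = t))"
        and y: "y \<in> nlists k U_N" "R N x y" and t: "t \<in> U_N" "?P x y t"
      show "\<exists>s\<in>U_N. ?P x y s \<and> s \<sqsubset> t"
      proof (rule ccontr)
        assume n: "\<not> ?thesis"
        then have "?f t x y" using t by blast
        moreover have "s = t" if "s \<in> U_N" "?f s x y" for s using n t that Mo.neqE[of s t] by blast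
        ultimately show False using x y t by blast
      qed
    qed
  qed
  define R' where "R' = (\<lambda>S x w. R S x (tl w) \<and> F S x w \<and>
    (\<forall>z\<in>universe S. lt S z (hd w) \<and> \<not> F S x (z # tl w) \<longrightarrow> (\<forall>s\<in>universe S. F S x (s # tl w) \<longrightarrow> lt S z s)))"
  have R'J: "J (Suc (Suc k)) (\<lambda>S e. R' S (hd e) (tl e))"
    unfolding R'_def by (rule jint refl J_el[OF FJ] J_el[OF RJ] | simp)+
  then have R'D: "DN (Suc (Suc k)) (\<lambda>e. R' N (hd e) (tl e))" by (rule J_N)
  have R'_iff: "R' N x (t # y) \<longleftrightarrow> R N x y \<and> No.comp (?P x y) t" if "t \<in> U_N" for x t y
    unfolding R'_def No.comp_def using that ls_N by simp
  have "near (\<lambda>x. \<forall>w\<in>nlists (Suc k) U_N. R' N x w \<longrightarrow> F N x w)"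
    by (rule near_mono[OF near_True]) (simp add: R'_def)
  moreover have "generic (Suc k) R'"
    unfolding generic_def
  proof (intro conjI allI impI R'J)
    show "near (\<lambda>x. \<exists>y\<in>nlists (Suc k) U_N. R' N x y)"
    proof (rule near_mono[OF near_conj[OF Rne near_conj[OF Fne nl]]])
      fix x assume x: "x \<in> U_N" "(\<exists>y\<in>nlists k U_N. R N x y) \<and>
        (\<forall>y\<in>nlists k U_N. R N x y \<longrightarrow> (\<exists>t\<in>U_N. F N x (t # y))) \<and>
        (\<forall>y\<in>nlists k U_N. R N x y \<longrightarrow> (\<forall>t\<in>U_N. ?P x y t \<longrightarrow> (\<exists>s\<in>U_N. ?P x y s \<and> s \<sqsubset> t)))"
      then obtain y where y: "y \<in> nlists k U_N" "R N x y" by blast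
      then obtain t0 where t0: "t0 \<in> U_N" "?P x y t0" using x(2) by blast
      have nl': "\<exists>s\<in>U_N. ?P x y s \<and> s \<sqsubset> t" if "t \<in> U_N" "?P x y t" for t using x(2) y that by blast
      obtain t where "t \<in> U_N" "No.comp (?P x y) t"
        using No.ex_comp[OF fib[OF x(1) y(1)] t0 nl'] by blast
      then show "\<exists>y\<in>nlists (Suc k) U_N. R' N x y" using R'_iff y by (intro bexI[of _ "t # y"]) auto
    qed
    fix Z assume ZD: "DN (Suc (Suc k)) (\<lambda>e. Z (hd e) (tl e))"
    let ?Z1 = "\<lambda>x y. \<forall>t\<in>U_N. R' N x (t # y) \<longrightarrow> Z x (t # y)" and ?Z0 = "\<lambda>x y. \<forall>t\<in>U_N. R' N x (t # y) \<longrightarrow> \<not> Z x (t # y)"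
    have "DN (Suc k) (\<lambda>e. ?Z1 (hd e) (tl e))" by (rule dint refl No.D_el[OF R'D] No.D_el[OF ZD] | simp)+
    note 1 = Rg[OF this]
    have "DN (Suc k) (\<lambda>e. ?Z0 (hd e) (tl e))" by (rule dint refl No.D_el[OF R'D] No.D_el[OF ZD] | simp)+
    note 0 = Rg[OF this]
    have R'R: "\<exists>t\<in>U_N. \<exists>y\<in>nlists k U_N. w = t # y \<and> R N x y" if "w \<in> nlists (Suc k) U_N" "R' N x w" for x w
      using that unfolding R'_def by (auto simp: in_nlists_Suc_iff)
    show "near (\<lambda>x. \<forall>w\<in>nlists (Suc k) U_N. R' N x w \<longrightarrow> Z x w) \<or>
      near (\<lambda>x. \<forall>w\<in>nlists (Suc k) U_N. R' N x w \<longrightarrow> \<not> Z x w)"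
    proof (rule ccontr)
      assume n: "\<not> ?thesis"
      have "\<not> near (\<lambda>x. \<forall>y\<in>nlists k U_N. R N x y \<longrightarrow> ?Z1 x y)"
      proof
        assume "near (\<lambda>x. \<forall>y\<in>nlists k U_N. R N x y \<longrightarrow> ?Z1 x y)"
        then have "near (\<lambda>x. \<forall>w\<in>nlists (Suc k) U_N. R' N x w \<longrightarrow> Z x w)"
          by (rule near_mono) (use R'R in blast)
        then show False using n by blast
      qed
      moreover have "\<not> near (\<lambda>x. \<forall>y\<in>nlists k U_N. R N x y \<longrightarrow> ?Z0 x y)"
      proof
        assume "near (\<lambda>x. \<forall>y\<in>nlists k U_N. R N x y \<longrightarrow> ?Z0 x y)"
        then have "near (\<lambda>x. \<forall>w\<in>nlists (Suc k) U_N. R' N x w \<longrightarrow> \<not> Z x w)"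
          by (rule near_mono) (use R'R in blast)
        then show False using n by blast
      qed
      ultimately have mixed: "near (\<lambda>x. \<forall>y\<in>nlists k U_N. R N x y \<longrightarrow> \<not> ?Z1 x y)"
        "near (\<lambda>x. \<forall>y\<in>nlists k U_N. R N x y \<longrightarrow> \<not> ?Z0 x y)" using 0 1 by blast+
      have "DN (Suc (Suc k)) (\<lambda>e. No.switch (?P (hd (tl e)) (tl (tl e))) (\<lambda>t. Z (hd (tl e)) (t # tl (tl e))) (hd e))"
        unfolding No.switch_def No.stable_def No.comp_def
        by (rule dint refl No.D_el[OF FD] No.D_el[OF ZD] | simp)+
      from no_choice[of "\<lambda>t x y. No.switch (?P x y) (\<lambda>t. Z x (t # y)) t", OF this]
      have nsw: "near (\<lambda>x. \<forall>y\<in>nlists k U_N. R N x y \<longrightarrow>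
        \<not> (\<exists>t\<in>U_N. No.switch (?P x y) (\<lambda>t. Z x (t # y)) t \<and> ?P x y t \<and> (\<forall>s\<in>U_N. No.switch (?P x y) (\<lambda>t. Z x (t # y)) s \<longrightarrow> s = t)))" .
      obtain x y where x0: "x \<in> Q2" and y: "y \<in> nlists k U_N" "R N x y" and x:
          "\<forall>y\<in>nlists k U_N. R N x y \<longrightarrow> (\<forall>t\<in>U_N. ?P x y t \<longrightarrow> (\<exists>s\<in>U_N. ?P x y s \<and> s \<sqsubset> t))"
          "\<forall>y\<in>nlists k U_N. R N x y \<longrightarrow> \<not> ?Z1 x y" "\<forall>y\<in>nlists k U_N. R N x y \<longrightarrow> \<not> ?Z0 x y"
          "\<forall>y\<in>nlists k U_N. R N x y \<longrightarrow>
        \<not> (\<exists>t\<in>U_N. No.switch (?P x y) (\<lambda>t. Z x (t # y)) t \<and> ?P x y t \<and> (\<forall>s\<in>U_N. No.switch (?P x y) (\<lambda>t. Z x (t # y)) s \<longrightarrow> s = t))"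
        using near_above[OF near_conj[OF Rne near_conj[OF nl near_conj[OF mixed(1) near_conj[OF mixed(2) nsw]]]]] by (elim bexE conjE) (rule that; assumption)
      have xN: "x \<in> U_N" using Q_U_N x0 by blast
      obtain a where a: "a \<in> U_N" "No.comp (?P x y) a" "\<not> Z x (a # y)" using x(2) y R'_iff by blast
      obtain b where b: "b \<in> U_N" "No.comp (?P x y) b" "Z x (b # y)" using x(3) y R'_iff by blast
      have nl': "\<exists>s\<in>U_N. ?P x y s \<and> s \<sqsubset> t" if "t \<in> U_N" "?P x y t" for t using x(1) y that by blast
      have zf: "DN 1 (\<lambda>e. Z x (hd e # y))"
        by (rule dint refl No.D_el[OF ZD, of _ "\<lambda>_. x" "\<lambda>e. hd e # y"] | use xN y in simp)+
      have "Z x (a # y) \<noteq> Z x (b # y)" using a(3) b(3) by simp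
      then obtain t where t: "t \<in> U_N" "No.switch (?P x y) (\<lambda>t. Z x (t # y)) t"
        using No.ex_switch[OF fib[OF xN y(1)] zf nl' a(1) b(1) a(2) b(2)] by blast
      moreover have "?P x y t" using t(2) unfolding No.switch_def No.comp_def by blast
      moreover have "\<forall>s\<in>U_N. No.switch (?P x y) (\<lambda>t. Z x (t # y)) s \<longrightarrow> s = t"
        using No.switch_unique[OF _ t(2) _ t(1)] by blast
      ultimately show False using x(4) y by blast
    qed
  qed
  ultimately show False using contra by blast
qed

text \<open>Tuples are built one coordinate at a time. The start is the line itself, where
  genericity is the dichotomy \<open>near_cases\<close>.\<close>

lemma generic_ex:
  assumes "J (Suc k) (\<lambda>S e. F S (hd e) (tl e))" "near (\<lambda>x. \<exists>y\<in>nlists k U_N. F N x y)"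
  shows "\<exists>R. generic k R \<and> near (\<lambda>x. \<forall>y\<in>nlists k U_N. R N x y \<longrightarrow> F N x y)"
  using assms
proof (induction k arbitrary: F)
  case 0
  have "generic 0 (\<lambda>_ _ _. True)"
    unfolding generic_def
  proof (intro conjI allI impI)
    show "J (Suc 0) (\<lambda>S e. True)" by (rule jint)
    show "near (\<lambda>x. \<exists>y\<in>nlists 0 U_N. True)" by (rule near_mono[OF near_True]) simp
    fix Z assume "DN (Suc 0) (\<lambda>e. Z (hd e) (tl e))"
    then have "DN 1 (\<lambda>e. Z (hd e) [])" using No.D_fibre[of 0 Z "[]"] by simp
    from near_cases[OF this] show "near (\<lambda>x. \<forall>y\<in>nlists 0 U_N. True \<longrightarrow> Z x y) \<or> near (\<lambda>x. \<forall>y\<in>nlists 0 U_N. True \<longrightarrow> \<not> Z x y)"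
      by simp
  qed
  moreover have "near (\<lambda>x. \<forall>y\<in>nlists 0 U_N. True \<longrightarrow> F N x y)" by (rule near_mono[OF 0(2)]) simp
  ultimately show ?case by blast
next
  case (Suc k)
  let ?F = "\<lambda>S x y. \<exists>t\<in>universe S. F S x (t # y)"
  have J1: "J (Suc k) (\<lambda>S e. ?F S (hd e) (tl e))" by (rule jint refl J_el[OF Suc.prems(1)] | simp)+
  have ne: "near (\<lambda>x. \<exists>y\<in>nlists k U_N. ?F N x y)"
    by (rule near_mono[OF Suc.prems(2)], auto simp: in_nlists_Suc_iff) blast
  from Suc.IH[of ?F, OF J1 ne] obtain R where R: "generic k R"
    "near (\<lambda>x. \<forall>y\<in>nlists k U_N. R N x y \<longrightarrow> ?F N x y)" by blast
  from generic_step[OF R(1) Suc.prems(1) R(2)] show ?case .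
qed

end

context epair begin

text \<open>It suffices that the downward closure \<open>Q1\<close> of the index set
  \<open>A\<close> is definable. With an end point, or if it is empty or everything, it plainly is.
  Otherwise \<open>N\<close> omits this cut, and a generic subfamily of \<open>F\<close> lies inside
  \<open>\<psi>\<close>, or outside it, on both sides of the cut. But indices in \<open>A\<close>
  are cofinal in \<open>Q1\<close>, and there are none in \<open>Q2\<close>.\<close>

lemma initial_trace:
  assumes \<psi>D: "DN m \<psi>" and FD: "DM (Suc m) (\<lambda>e. F (hd e) (tl e))"
    and ns: "\<And>x t t'. x \<in> U_M \<Longrightarrow> t \<in> nlists m U_M \<Longrightarrow> t' \<in> nlists m U_M \<Longrightarrow> F x t \<Longrightarrow> F x t' \<Longrightarrow> \<psi> t = \<psi> t'"
    and init: "\<And>x y. x \<in> U_M \<Longrightarrow> y \<in> U_M \<Longrightarrow> ls x y \<Longrightarrow> \<exists>t\<in>nlists m U_M. F x t \<Longrightarrow>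
      \<exists>t\<in>nlists m U_M. F y t \<and> \<psi> t \<Longrightarrow> \<exists>t\<in>nlists m U_M. F x t \<and> \<psi> t"
  shows "DM 1 (\<lambda>e. \<exists>t\<in>nlists m U_M. F (hd e) t \<and> \<psi> t)"
proof -
  define A where "A = (\<lambda>x. \<exists>t\<in>nlists m U_M. F x t \<and> \<psi> t)"
  define Q1 where "Q1 = {z\<in>U_M. \<exists>x\<in>U_M. A x \<and> le z x}"
  define Q2 where "Q2 = U_M - Q1"
  have A_iff: "A x \<longleftrightarrow> (\<exists>t\<in>nlists m U_M. F x t) \<and> x \<in> Q1" if x: "x \<in> U_M" for x
  proof
    assume "A x"
    then show "(\<exists>t\<in>nlists m U_M. F x t) \<and> x \<in> Q1" using x unfolding A_def Q1_def by blast
  next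
    assume a: "(\<exists>t\<in>nlists m U_M. F x t) \<and> x \<in> Q1"
    then obtain y where y: "y \<in> U_M" "A y" "le x y" unfolding Q1_def by blast
    show "A x"
    proof (cases "x = y")
      case False
      then have "ls x y" using y(3) Mo.le_less by blast
      then show ?thesis using init[OF x y(1)] a y(2) unfolding A_def by blast
    qed (use y in simp)
  qed
  have down: "z \<in> Q1" if "z \<in> U_M" "x \<in> Q1" "le z x" for z x
    using that Mo.order_trans unfolding Q1_def by blast
  have Q12: "ls u v" if "u \<in> Q1" "v \<in> Q2" for u v
  proof (rule ccontr)
    assume "\<not> ls u v"
    then have "le v u" using Mo.not_less by blast
    then show False using down[of v u] that unfolding Q2_def by blast
  qed
  have "DM 1 (\<lambda>e. hd e \<in> Q1)"
  proof (cases "Q1 = {} \<or> Q2 = {} \<or> (\<exists>u\<in>Q1. \<forall>u'\<in>Q1. le u' u) \<or> (\<exists>v\<in>Q2. \<forall>v'\<in>Q2. le v v')")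
    case True
    then consider "Q1 = {}" | "Q2 = {}" | u where "u \<in> Q1" "\<forall>u'\<in>Q1. le u' u" | v where "v \<in> Q2" "\<forall>v'\<in>Q2. le v v'"
      by blast
    then show ?thesis
    proof cases
      case 1
      then show ?thesis using Mo.D_const by simp
    next
      case 2
      show ?thesis by (rule Mo.D_cong[OF Mo.D_const[of _ True]]) (use 2 in \<open>auto simp: Q2_def in_nlists_Suc_iff\<close>)
    next
      case (3 u)
      have "DM 1 (\<lambda>e. le (hd e) u)" by (rule dint refl | use 3 in \<open>simp add: Q1_def\<close>)+
      then show ?thesis
      proof (rule Mo.D_cong)
        fix e assume "e \<in> nlists 1 U_M"
        then have "hd e \<in> U_M" by (auto simp: in_nlists_Suc_iff)
        then show "le (hd e) u = (hd e \<in> Q1)" using 3 down by blast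
      qed
    next
      case (4 v)
      have "DM 1 (\<lambda>e. ls (hd e) v)" by (rule dint refl | use 4 in \<open>simp add: Q2_def\<close>)+
      then show ?thesis
      proof (rule Mo.D_cong)
        fix e assume "e \<in> nlists 1 U_M"
        then have "hd e \<in> U_M" by (auto simp: in_nlists_Suc_iff)
        then show "ls (hd e) v = (hd e \<in> Q1)" using 4 Q12 Mo.not_less unfolding Q2_def by blast
      qed
    qed
  next
    case False
    then have ne: "Q1 \<noteq> {}" "Q2 \<noteq> {}" and nmax: "\<exists>u'\<in>Q1. ls u u'" if "u \<in> Q1" for u
      using that Mo.not_less by blast+
    have nmin: "\<exists>v'\<in>Q2. ls v' v" if "v \<in> Q2" for v using False that Mo.not_less by blast
    interpret egap L M N le ls Q1 Q2
      by unfold_locales (use False nmax nmin Q12 in \<open>auto simp: Q1_def Q2_def\<close>)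
    have cofinal: "\<exists>a\<in>Q1. ls u a \<and> A a" if u: "u \<in> Q1" for u
    proof -
      obtain u' where u': "u' \<in> Q1" "ls u u'" using nmax u by blast
      then obtain a where a: "a \<in> U_M" "A a" "le u' a" unfolding Q1_def by blast
      then have "a \<in> Q1" unfolding Q1_def by blast
      then show ?thesis using a u' Mo.less_le_trans by blast
    qed
    obtain \<Phi> where \<Phi>: "J (Suc m) \<Phi>" "\<And>e. e \<in> nlists (Suc m) U_M \<Longrightarrow> \<Phi> M e = F (hd e) (tl e)"
      by (rule J_ext[OF FD], rule that)
    let ?F = "\<lambda>S x t. \<Phi> S (x # t)"
    have FJ: "J (Suc m) (\<lambda>S e. ?F S (hd e) (tl e))"
      by (rule jint refl J_subst[OF \<Phi>(1)] | simp)+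
    have F_iff: "F x t \<longleftrightarrow> ?F N x t" if "x \<in> U_M" "t \<in> nlists m U_M" for x t
      using \<Phi>(2)[of "x # t"] transfer[OF \<Phi>(1), of "x # t"] that by simp
    have "DN 1 (\<lambda>e. \<exists>t\<in>nlists m U_N. ?F N (hd e) t)"
      by (rule dint refl No.D_el[OF J_N[OF FJ]] | simp)+
    from near_cases[OF this] have Fne: "near (\<lambda>x. \<exists>t\<in>nlists m U_N. ?F N x t)"
    proof
      assume "near (\<lambda>x. \<not> (\<exists>t\<in>nlists m U_N. ?F N x t))"
      from near_below[OF this] obtain u where u: "u \<in> Q1"
        "\<forall>x\<in>Q1. ls u x \<longrightarrow> \<not> (\<exists>t\<in>nlists m U_N. ?F N x t)" by blast
      obtain a where a: "a \<in> Q1" "ls u a" "A a" using cofinal[OF u(1)] by blast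
      then obtain t where "t \<in> nlists m U_M" "F a t" unfolding A_def by blast
      then show ?thesis using u a F_iff Q_U_M nlists_sub by blast
    qed
    from generic_ex[OF FJ Fne] obtain R where R: "generic m R" "near (\<lambda>x. \<forall>t\<in>nlists m U_N. R N x t \<longrightarrow> ?F N x t)"
      by blast
    have RJ: "J (Suc m) (\<lambda>S e. R S (hd e) (tl e))" and Rne: "near (\<lambda>x. \<exists>y\<in>nlists m U_N. R N x y)"
      and Rg: "\<And>Z. DN (Suc m) (\<lambda>e. Z (hd e) (tl e)) \<Longrightarrow>
         near (\<lambda>x. \<forall>y\<in>nlists m U_N. R N x y \<longrightarrow> Z x y) \<or> near (\<lambda>x. \<forall>y\<in>nlists m U_N. R N x y \<longrightarrow> \<not> Z x y)"
      using R(1) unfolding generic_def by blast+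
    \<comment> \<open>The family \<open>R\<close> is definable over \<open>M\<close>, so a nonempty
      fibre over a point of \<open>M\<close> has a point in \<open>M\<close>. Only such points are
      governed by \<open>ns\<close> and counted in \<open>A\<close>.\<close>
    have descend: "\<exists>t\<in>nlists m U_M. R N x t" if x: "x \<in> U_M" "\<exists>t\<in>nlists m U_N. R N x t" for x
    proof -
      have "J 1 (\<lambda>S e. \<exists>t\<in>nlists m (universe S). R S (hd e) t)"
        by (rule jint refl J_el[OF RJ] | simp)+
      from transfer[OF this, of "[x]"] x have "\<exists>t\<in>nlists m U_M. R M x t" by simp
      then show ?thesis using transfer[OF RJ, of "x # _"] x by auto
    qed
    have "DN (Suc m) (\<lambda>e. \<psi> (tl e))" by (rule dint refl No.D_l[OF \<psi>D] | simp)+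
    from Rg[of "\<lambda>x y. \<psi> y", OF this] have False
    proof
      assume n: "near (\<lambda>x. \<forall>t\<in>nlists m U_N. R N x t \<longrightarrow> \<psi> t)"
      from near_above[OF near_conj[OF Rne near_conj[OF R(2) n]]]
      obtain v where v: "v \<in> Q2" "\<exists>t\<in>nlists m U_N. R N v t"
        "\<forall>t\<in>nlists m U_N. R N v t \<longrightarrow> ?F N v t" "\<forall>t\<in>nlists m U_N. R N v t \<longrightarrow> \<psi> t" by blast
      have vM: "v \<in> U_M" using Q_U_M v(1) by blast
      obtain t where t: "t \<in> nlists m U_M" "R N v t" using descend[OF vM v(2)] by blast
      then have "F v t" "\<psi> t" using v F_iff[OF vM] nlists_sub by blast+
      then have "A v" using t(1) unfolding A_def by blast
      then show False using A_iff[OF vM] v(1) unfolding Q2_def by blast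
    next
      assume n: "near (\<lambda>x. \<forall>t\<in>nlists m U_N. R N x t \<longrightarrow> \<not> \<psi> t)"
      from near_below[OF near_conj[OF Rne near_conj[OF R(2) n]]]
      obtain u where u: "u \<in> Q1" "\<And>x. x \<in> Q1 \<Longrightarrow> ls u x \<Longrightarrow> (\<exists>t\<in>nlists m U_N. R N x t) \<and>
        (\<forall>t\<in>nlists m U_N. R N x t \<longrightarrow> ?F N x t) \<and> (\<forall>t\<in>nlists m U_N. R N x t \<longrightarrow> \<not> \<psi> t)" by blast
      obtain a where a: "a \<in> Q1" "ls u a" "A a" using cofinal[OF u(1)] by blast
      have aM: "a \<in> U_M" using Q_U_M a(1) by blast
      obtain t where t: "t \<in> nlists m U_M" "R N a t" using descend[OF aM] u(2)[OF a(1,2)] by blast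
      have "F a t" "\<not> \<psi> t" using u(2)[OF a(1,2)] F_iff[OF aM t(1)] nlists_sub[OF t(1)] t(2) by blast+
      then show False using a(3) ns[OF aM t(1)] unfolding A_def by blast
    qed
    then show ?thesis ..
  qed
  note Q1D = Mo.D_e[of "\<lambda>x. x \<in> Q1", OF this]
  have "DM 1 (\<lambda>e. (\<exists>t\<in>nlists m U_M. F (hd e) t) \<and> hd e \<in> Q1)"
    by (rule dint refl Q1D Mo.D_el[OF FD] | simp)+
  then have "DM 1 (\<lambda>e. A (hd e))"
    by (rule Mo.D_cong) (use A_iff in \<open>auto simp: in_nlists_Suc_iff\<close>)
  then show ?thesis unfolding A_def .
qed

text \<open>A final segment for \<open>\<psi>\<close> is an initial segment for its complement: no
  member of the family is split, so meeting the complement means being nonempty and missing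
  \<open>\<psi>\<close>.\<close>

lemma tame_trace:
  assumes \<psi>D: "DN m \<psi>" shows "Mo.tame m B \<psi>"
  unfolding Mo.tame_def
proof (intro allI impI)
  fix F assume FD: "DM (Suc m) (\<lambda>e. F (hd e) (tl e))"
    and ns: "\<forall>x\<in>U_M. \<forall>t\<in>nlists m U_M. \<forall>t'\<in>nlists m U_M. F x t \<longrightarrow> F x t' \<longrightarrow> \<psi> t = \<psi> t'"
    and mono: "(\<forall>x\<in>U_M. \<forall>y\<in>U_M. ls x y \<longrightarrow> (\<exists>t\<in>nlists m U_M. F x t) \<longrightarrow>
        (\<exists>t\<in>nlists m U_M. F y t \<and> \<psi> t) \<longrightarrow> (\<exists>t\<in>nlists m U_M. F x t \<and> \<psi> t)) \<or>
      (\<forall>x\<in>U_M. \<forall>y\<in>U_M. ls x y \<longrightarrow> (\<exists>t\<in>nlists m U_M. F y t) \<longrightarrow>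
        (\<exists>t\<in>nlists m U_M. F x t \<and> \<psi> t) \<longrightarrow> (\<exists>t\<in>nlists m U_M. F y t \<and> \<psi> t))"
  from mono show "DM 1 (\<lambda>e. \<exists>t\<in>nlists m U_M. F (hd e) t \<and> \<psi> t)"
  proof
    assume "\<forall>x\<in>U_M. \<forall>y\<in>U_M. ls x y \<longrightarrow> (\<exists>t\<in>nlists m U_M. F x t) \<longrightarrow>
        (\<exists>t\<in>nlists m U_M. F y t \<and> \<psi> t) \<longrightarrow> (\<exists>t\<in>nlists m U_M. F x t \<and> \<psi> t)"
    then show ?thesis using initial_trace[OF \<psi>D FD] ns by blast
  next
    assume fin: "\<forall>x\<in>U_M. \<forall>y\<in>U_M. ls x y \<longrightarrow> (\<exists>t\<in>nlists m U_M. F y t) \<longrightarrow>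
        (\<exists>t\<in>nlists m U_M. F x t \<and> \<psi> t) \<longrightarrow> (\<exists>t\<in>nlists m U_M. F y t \<and> \<psi> t)"
    have split: "(\<exists>t\<in>nlists m U_M. F x t \<and> \<not> \<psi> t) \<longleftrightarrow>
      (\<exists>t\<in>nlists m U_M. F x t) \<and> \<not> (\<exists>t\<in>nlists m U_M. F x t \<and> \<psi> t)" if "x \<in> U_M" for x
      using ns that by blast
    have "DM 1 (\<lambda>e. \<exists>t\<in>nlists m U_M. F (hd e) t \<and> \<not> \<psi> t)"
    proof (rule initial_trace[OF No.D_neg[OF \<psi>D] FD])
      show "(\<not> \<psi> t) = (\<not> \<psi> t')" if "x \<in> U_M" "t \<in> nlists m U_M" "t' \<in> nlists m U_M" "F x t" "F x t'" for x t t'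
        using ns that by blast
      show "\<exists>t\<in>nlists m U_M. F x t \<and> \<not> \<psi> t" if "x \<in> U_M" "y \<in> U_M" "ls x y" "\<exists>t\<in>nlists m U_M. F x t"
        "\<exists>t\<in>nlists m U_M. F y t \<and> \<not> \<psi> t" for x y
        using that fin split by blast
    qed
    note nD = Mo.D_e[of "\<lambda>x. \<exists>t\<in>nlists m U_M. F x t \<and> \<not> \<psi> t", OF this]
    have "DM 1 (\<lambda>e. (\<exists>t\<in>nlists m U_M. F (hd e) t) \<and> \<not> (\<exists>t\<in>nlists m U_M. F (hd e) t \<and> \<not> \<psi> t))"
      by (rule Mo.D_and Mo.D_neg nD dint refl Mo.D_el[OF FD] | simp)+
    then show ?thesis
    proof (rule Mo.D_cong)
      fix e assume "e \<in> nlists 1 U_M"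
      then have "hd e \<in> U_M" by (auto simp: in_nlists_Suc_iff)
      from split[OF this] show "((\<exists>t\<in>nlists m U_M. F (hd e) t) \<and> \<not> (\<exists>t\<in>nlists m U_M. F (hd e) t \<and> \<not> \<psi> t)) =
        (\<exists>t\<in>nlists m U_M. F (hd e) t \<and> \<psi> t)" by blast
    qed
  qed
qed

end

section \<open>Definability of types\<close>

lemma at_least_mono:
  "at_least A r k P \<Longrightarrow> (\<And>x. x \<in> A \<Longrightarrow> P x \<Longrightarrow> Q x) \<Longrightarrow> at_least A r k Q"
proof (induction k arbitrary: P Q)
  case (Suc k)
  then obtain x where x: "x \<in> A" "P x" "at_least A r k (\<lambda>y. P y \<and> r x y)" by auto
  have "at_least A r k (\<lambda>y. Q y \<and> r x y)" by (rule Suc.IH[OF x(3)]) (use Suc.prems(2) in blast)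
  then show ?case using x Suc.prems(2) by auto
qed simp

context omin begin

text \<open>A change of \<open>P\<close> between two points needs a boundary point. Equal rank
  leaves only the right one of the two for it, and then the left one would be a boundary point as
  well, which the rank excludes.\<close>

lemma rank_determines:
  assumes PD: "D 1 (\<lambda>e. P (hd e))" and xy: "x \<in> U" "y \<in> U"
    and r: "rank j (bd P) x" "rank j (bd P) y" and b: "bd P x = bd P y"
  shows "P x = P y"
proof -
  note fin = finite_bd[OF PD]
  have *: "P x = P y" if xy: "x \<in> U" "y \<in> U" "rank j (bd P) x" "rank j (bd P) y" "bd P x = bd P y" "x \<sqsubset> y" for x y
  proof (rule ccontr)
    assume "P x \<noteq> P y"
    then obtain s where s: "s \<in> U" "x \<sqsubseteq> s" "s \<sqsubseteq> y" "bd P s" using ex_bd[OF PD xy(1,2,6)] by blast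
    have "\<not> s \<sqsubset> y" using rank_gap[OF fin xy(3,4) s(1,4,2)] by blast
    then have "s = y" using s(3) by simp
    then have "bd P x" using s(4) xy(5) by simp
    then show False using rank_gap[OF fin xy(3,4,1)] xy(6) by blast
  qed
  show ?thesis using *[OF xy r b] *[OF xy(2,1) r(2,1) b[symmetric]] neqE[of x y] by blast
qed

text \<open>Whether \<open>x\<close> satisfies \<open>P\<close> is recovered from two counts that
  are monotone in \<open>x\<close>: of the points below \<open>x\<close> and of those not above
  \<open>x\<close>. Only monotone conditions give rise to cuts, so membership itself has to be
  expressed through them.\<close>

lemma rank_self:
  assumes fin: "finite {t\<in>U. P t}" and x: "x \<in> U" "rank j P x"
  shows "atl (Suc j) (\<lambda>t. P t \<and> \<not> x \<sqsubset> t) \<longleftrightarrow> P x"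
proof -
  let ?A = "{t\<in>U. P t \<and> t \<sqsubset> x}" and ?B = "{t\<in>U. P t \<and> \<not> x \<sqsubset> t}"
  have fA: "finite ?A" and fB: "finite ?B" by (rule finite_subset[OF _ fin]; blast)+
  have A: "card ?A = j" using x(2) unfolding rank_iff[OF fin] .
  have B: "?B = (if P x then insert x ?A else ?A)" using x(1) by (auto simp: not_less le_less)
  show ?thesis
  proof (cases "P x")
    case True
    then have "?B = insert x ?A" using B by presburger
    moreover have "x \<notin> ?A" by simp
    ultimately have "card ?B = Suc j" using A fA by (metis card_insert_disjoint)
    then show ?thesis unfolding atl_card[OF fB] using True by simp
  next
    case False
    then have "?B = ?A" using B by presburger
    then have "card ?B = j" using A by argo
    then show ?thesis unfolding atl_card[OF fB] using False by simp
  qed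
qed

end

context epair begin

text \<open>Let \<open>X\<^sub>b = {y. \<Phi> N (y # c @ b)}\<close>. The position of \<open>d\<close> among the boundary points of \<open>X\<^sub>b\<close> determines
  whether \<open>d \<in> X\<^sub>b\<close>. For each \<open>j\<close> the upward closed sets of those points with at least \<open>j\<close> boundary
  points below them form a chain as \<open>b\<close> varies, so the set of \<open>b\<close> for which \<open>d\<close> is such a point is a
  cut, and it is tame because it is a trace.\<close>

lemma definable_trace:
  "J (n + m) \<Phi> \<Longrightarrow> c \<in> nlists n U_N \<Longrightarrow> DM m (\<lambda>b. \<Phi> N (c @ b))"
proof (induction n arbitrary: m \<Phi> c)
  case 0
  have "DM m (\<Phi> M)" using J_M[of m \<Phi>] 0(1) by simp
  then show ?case by (rule Mo.D_cong) (use 0 transfer[of m \<Phi>] in simp)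
next
  case (Suc n)
  obtain d c' where c: "c = d # c'" "d \<in> U_N" "c' \<in> nlists n U_N" using Suc.prems(2) by (auto simp: in_nlists_Suc_iff)
  define X where "X = (\<lambda>S y e. \<Phi> S (y # e))"
  have XJ: "J (Suc (n + m)) (\<lambda>S e. X S (hd e) (tl e))"
    unfolding X_def by (rule jint refl J_subst[OF Suc.prems(1)] | simp)+
  have XD: "DN (Suc (n + m)) (\<lambda>e. X N (hd e) (tl e))" using J_N[OF XJ] .
  have XD1: "DN 1 (\<lambda>e. X N (hd e) w)" if "w \<in> nlists (n + m) U_N" for w
    using No.D_fibre[OF XD that] .
  let ?bd = "\<lambda>e. No.bd (\<lambda>x. X N x e)"
  note fin = No.finite_bd[OF XD1]
  have "DN (Suc (n + m)) (\<lambda>e. ?bd (tl e) (hd e))"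
    by (rule dint refl No.D_el[OF XD] | simp)+
  from No.uniform_finiteness[OF this] fin
  obtain K where K: "\<And>w. w \<in> nlists (n + m) U_N \<Longrightarrow> card {x\<in>U_N. ?bd w x} \<le> K" by blast
  \<comment> \<open>Since \<open>r\<close> is upward closed in \<open>y\<close>, the sets of
    \<open>y\<close> with \<open>r N y (c' @ b)\<close> form a chain as \<open>b\<close> varies.
    Inclusion between them quantifies over \<open>y\<close> instead of naming \<open>d\<close>, so
    the induction hypothesis for \<open>c'\<close> makes it definable on tuples of
    \<open>M\<close>.\<close>
  have cut: "DM m (\<lambda>b. r N d (c' @ b))"
    if rJ: "J (Suc (n + m)) (\<lambda>S e. r S (hd e) (tl e))"
      and mono: "\<And>x y e. x \<in> U_N \<Longrightarrow> y \<in> U_N \<Longrightarrow> ls x y \<Longrightarrow> r N x e \<Longrightarrow> r N y e" for r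
  proof -
    \<comment> \<open>At \<open>e = c' @ b @ b'\<close> the two arguments of \<open>r\<close> are
      \<open>c' @ b'\<close> and \<open>c' @ b\<close>.\<close>
    define G where "G = (\<lambda>S e. \<forall>y\<in>universe S. r S y (take n e @ drop (n + m) e) \<longrightarrow> r S y (take (n + m) e))"
    have "J (n + (m + m)) G" unfolding G_def by (rule jint refl J_el[OF rJ] | simp)+
    from Suc.IH[OF this c(3)] have GD: "DM (m + m) (\<lambda>b. G N (c' @ b))" .
    let ?le = "\<lambda>b b'. \<forall>y\<in>U_N. r N y (c' @ b') \<longrightarrow> r N y (c' @ b)"
    have "Mo.is_cut m (\<lambda>_. True) ?le (\<lambda>b. r N d (c' @ b))"
      unfolding Mo.is_cut_def
    proof (intro conjI ballI impI)
      show "DM m (\<lambda>_. True)" by (rule Mo.D_const)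
      show "DM (m + m) (\<lambda>e. ?le (take m e) (drop m e))"
        by (rule Mo.D_cong[OF GD]) (simp add: G_def nlistsE_length[OF c(3)])
      show "?le s t \<or> ?le t s" for s t
      proof (rule ccontr)
        assume "\<not> ?thesis"
        then obtain x y where "x \<in> U_N" "r N x (c' @ t)" "\<not> r N x (c' @ s)"
          "y \<in> U_N" "r N y (c' @ s)" "\<not> r N y (c' @ t)" by blast
        then show False using mono Mo.neqE[of x y] by metis
      qed
      show "r N d (c' @ s)" if "r N d (c' @ t)" "?le s t" for s t using that c(2) by blast
      have "DN m (\<lambda>b. r N d (c' @ b))"
        by (rule dint refl No.D_el[OF J_N[OF rJ], of _ "\<lambda>_. d"] | use c in simp)+
      then show "Mo.tame m (\<lambda>_. True) (\<lambda>b. r N d (c' @ b))" by (rule tame_trace)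
    qed blast+
    then show ?thesis by (rule Mo.definable_cut)
  qed
  \<comment> \<open>\<open>r\<close> counts the boundary points strictly below \<open>y\<close>, and
    \<open>r'\<close> below counts those not above \<open>y\<close>. They differ exactly when
    \<open>y\<close> is itself a boundary point.\<close>
  define r where "r = (\<lambda>j S y e. at_least (universe S) (lt S) j (\<lambda>t. bdS S (\<lambda>x. X S x e) t \<and> lt S t y))"
  define r' where "r' = (\<lambda>j S y e. at_least (universe S) (lt S) j (\<lambda>t. bdS S (\<lambda>x. X S x e) t \<and> \<not> lt S y t))"
  have rJ: "J (Suc (n + m)) (\<lambda>S e. r j S (hd e) (tl e))" for j
    unfolding r_def by (rule jint refl J_el[OF XJ] | simp)+
  have r'J: "J (Suc (n + m)) (\<lambda>S e. r' j S (hd e) (tl e))" for j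
    unfolding r'_def by (rule jint refl J_el[OF XJ] | simp)+
  have rD: "DM m (\<lambda>b. r j N d (c' @ b))" for j
  proof (rule cut[OF rJ])
    show "r j N y e" if "x \<in> U_N" "y \<in> U_N" "ls x y" "r j N x e" for x y e
      using that(4) unfolding r_def
      by (rule at_least_mono) (use that(1-3) ls_N Mo.less_trans in blast)
  qed
  have r'D: "DM m (\<lambda>b. r' j N d (c' @ b))" for j
  proof (rule cut[OF r'J])
    show "r' j N y e" if "x \<in> U_N" "y \<in> U_N" "ls x y" "r' j N x e" for x y e
      using that(4) unfolding r'_def
      by (rule at_least_mono) (use that(1-3) ls_N Mo.less_trans in blast)
  qed
  have r_iff: "r j N y e \<longleftrightarrow> No.atl j (\<lambda>t. ?bd e t \<and> ls t y)" if "y \<in> U_N" for j y e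
    unfolding r_def by (rule at_least_cong) (use ls_N bdS_N that in auto)
  have r'_iff: "r' j N y e \<longleftrightarrow> No.atl j (\<lambda>t. ?bd e t \<and> \<not> ls y t)" if "y \<in> U_N" for j y e
    unfolding r'_def by (rule at_least_cong) (use ls_N bdS_N that in auto)
  have rank: "r j N y e \<and> \<not> r (Suc j) N y e \<longleftrightarrow> No.rank j (?bd e) y" if "y \<in> U_N" for j y e
    unfolding No.rank_def r_iff[OF that] ..
  \<comment> \<open>For each rank, \<open>v\<close> records whether the boundary point of that rank
    lies in the fibre, and \<open>g\<close> whether the stretch of other points of that rank does.
    Neither mentions \<open>d\<close>, so the induction hypothesis applies to both.\<close>
  define v where "v = (\<lambda>j S e. \<exists>y\<in>universe S. bdS S (\<lambda>x. X S x e) y \<and> (r j S y e \<and> \<not> r (Suc j) S y e) \<and> X S y e)"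
  define g where "g = (\<lambda>j S e. \<exists>y\<in>universe S. \<not> bdS S (\<lambda>x. X S x e) y \<and> (r j S y e \<and> \<not> r (Suc j) S y e) \<and> X S y e)"
  have vD: "DM m (\<lambda>b. v j N (c' @ b))" for j
  proof (rule Suc.IH[OF _ c(3)])
    show "J (n + m) (v j)" unfolding v_def by (rule jint refl J_el[OF XJ] J_el[OF rJ] | simp)+
  qed
  have gD: "DM m (\<lambda>b. g j N (c' @ b))" for j
  proof (rule Suc.IH[OF _ c(3)])
    show "J (n + m) (g j)" unfolding g_def by (rule jint refl J_el[OF XJ] J_el[OF rJ] | simp)+
  qed
  have dec: "X N d e \<longleftrightarrow> (\<exists>j\<in>{..K}. (r j N d e \<and> \<not> r (Suc j) N d e) \<and>
      ((r' (Suc j) N d e \<and> v j N e) \<or> (\<not> r' (Suc j) N d e \<and> g j N e)))" (is "_ = (\<exists>j\<in>_. ?Q j)")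
    if e: "e \<in> nlists (n + m) U_N" for e
  proof -
    have r'd: "r' (Suc j) N d e \<longleftrightarrow> ?bd e d" if "No.rank j (?bd e) d" for j
      unfolding r'_iff[OF c(2)] using No.rank_self[OF fin[OF e] c(2) that] .
    have Q: "?Q j \<longleftrightarrow> X N d e" if j: "No.rank j (?bd e) d" for j
    proof -
      have "?Q j \<longleftrightarrow> (\<exists>y\<in>U_N. ?bd e y = ?bd e d \<and> No.rank j (?bd e) y \<and> X N y e)"
        unfolding rank[OF c(2)] r'd[OF j] v_def g_def using j rank bdS_N by auto
      also have "\<dots> \<longleftrightarrow> X N d e"
        using No.rank_determines[OF XD1[OF e] c(2) _ j] j c(2) by blast
      finally show ?thesis .
    qed
    obtain j where j: "j \<le> K" "No.rank j (?bd e) d" using No.rank_ex[OF fin[OF e] K[OF e]] by blast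
    have "?Q i \<Longrightarrow> X N d e" for i using Q[of i] rank[OF c(2)] by blast
    then show ?thesis using Q[OF j(2)] j(1) by blast
  qed
  have "DM m (\<lambda>b. \<exists>j\<in>{..K}. (r j N d (c' @ b) \<and> \<not> r (Suc j) N d (c' @ b)) \<and>
      ((r' (Suc j) N d (c' @ b) \<and> v j N (c' @ b)) \<or> (\<not> r' (Suc j) N d (c' @ b) \<and> g j N (c' @ b))))"
    by (intro Mo.D_fin_ex Mo.D_and Mo.D_or Mo.D_neg rD r'D vD gD) simp
  then show ?case
  proof (rule Mo.D_cong)
    fix b assume "b \<in> nlists m U_M"
    then have "c' @ b \<in> nlists (n + m) U_N" by (intro nlists_appendI c(3) nlists_sub)
    from dec[OF this] show "(\<exists>j\<in>{..K}. (r j N d (c' @ b) \<and> \<not> r (Suc j) N d (c' @ b)) \<and>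
      ((r' (Suc j) N d (c' @ b) \<and> v j N (c' @ b)) \<or> (\<not> r' (Suc j) N d (c' @ b) \<and> g j N (c' @ b)))) = \<Phi> N (c @ b)"
      unfolding c(1) X_def by simp
  qed
qed

text \<open>A set in \<open>tp L M N a\<close> may come from a different formula with different
  parameters. That two formulas over \<open>M\<close> define the same subset of \<open>M\<close> is
  a sentence over \<open>M\<close>; it holds in \<open>N\<close> as well, so they agree at
  \<open>a\<close>.\<close>

lemma fibre_in_tp:
  assumes a: "a \<in> nlists n U_N" and wf: "wf_fm L (n + m) \<phi>" and b: "b \<in> nlists m U_M"
  shows "fibre M n \<phi> b \<in> tp L M N a \<longleftrightarrow> sat N (a @ b) \<phi>"
proof
  have len: "length a = n" using a by (rule nlistsE_length)
  show "fibre M n \<phi> b \<in> tp L M N a" if "sat N (a @ b) \<phi>"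
    unfolding tp_def len using wf b that by blast
  assume "fibre M n \<phi> b \<in> tp L M N a"
  then obtain m' \<phi>' b' where 1: "wf_fm L (n + m') \<phi>'" "b' \<in> nlists m' U_M" "sat N (a @ b') \<phi>'"
    and eq: "fibre M n \<phi> b = fibre M n \<phi>' b'"
    unfolding tp_def len by blast
  have "J 0 (\<lambda>S e. \<forall>x\<in>nlists n (universe S). sat S (x @ b) \<phi> = sat S (x @ b') \<phi>')"
    by (rule jint refl J_sat[OF wf] J_sat[OF 1(1)] | use b 1(2) in simp)+
  from transfer0[OF this] have "\<forall>x\<in>nlists n U_N. sat N (x @ b) \<phi> = sat N (x @ b') \<phi>'"
    using eq unfolding fibre_def by blast
  then show "sat N (a @ b) \<phi>" using 1(3) a by blast
qed

lemma J_in_tp: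
  assumes "a \<in> nlists n U_N" "J n \<Phi>"
  shows "{x\<in>nlists n U_M. \<Phi> M x} \<in> tp L M N a \<longleftrightarrow> \<Phi> N a"
  using assms(2)
proof (rule defbleE)
  fix m \<psi> b assume 1: "wf_fm L (n + m) \<psi>" "b \<in> nlists m U_M"
    "\<And>S e. S \<in> {M, N} \<Longrightarrow> e \<in> nlists n (universe S) \<Longrightarrow> \<Phi> S e = sat S (e @ b) \<psi>"
  have "{x\<in>nlists n U_M. \<Phi> M x} = fibre M n \<psi> b" unfolding fibre_def using 1(3) by blast
  then show ?thesis using fibre_in_tp[OF assms(1) 1(1,2)] 1(3) assms(1) by simp
qed

lemma definable_J:
  assumes "definable L M n X" obtains \<Phi> where "J n \<Phi>" "X = {x\<in>nlists n U_M. \<Phi> M x}"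
proof -
  obtain m \<psi> b where 1: "wf_fm L (n + m) \<psi>" "b \<in> nlists m U_M" "X = fibre M n \<psi> b"
    using assms unfolding definable_def by blast
  show thesis by (rule that[OF defble_fm[OF 1(1,2)]]) (simp add: 1(3) fibre_def)
qed

lemma tp_types:
  assumes a: "a \<in> nlists n U_N" shows "tp L M N a \<in> types L M n"
proof -
  let ?p = "tp L M N a"
  have len: "length a = n" using a by (rule nlistsE_length)
  have def: "definable L M n X" if "X \<in> ?p" for X
    using that unfolding tp_def len definable_def by blast
  have iff: "{x\<in>nlists n U_M. \<Phi> M x} \<in> ?p \<longleftrightarrow> \<Phi> N a" if "J n \<Phi>" for \<Phi> by (rule J_in_tp[OF a that])
  show ?thesis
    unfolding types_def mem_Collect_eq
  proof (intro conjI ballI allI impI)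
    show "definable L M n X" if "X \<in> ?p" for X using def that .
    show "nlists n U_M \<in> ?p" using iff[OF J_True] by simp
    show "{} \<notin> ?p" using iff[OF defble_neg[OF J_True]] by simp
    show "X \<inter> Y \<in> ?p" if X: "X \<in> ?p" and Y: "Y \<in> ?p" for X Y
    proof -
      obtain \<Phi> where \<Phi>: "J n \<Phi>" "X = {x\<in>nlists n U_M. \<Phi> M x}" by (rule definable_J[OF def[OF X]])
      obtain \<Psi> where \<Psi>: "J n \<Psi>" "Y = {x\<in>nlists n U_M. \<Psi> M x}" by (rule definable_J[OF def[OF Y]])
      have "X \<inter> Y = {x\<in>nlists n U_M. \<Phi> M x \<and> \<Psi> M x}" unfolding \<Phi>(2) \<Psi>(2) by blast
      then show ?thesis using iff[OF defble_and[OF \<Phi>(1) \<Psi>(1)]] iff[OF \<Phi>(1)] iff[OF \<Psi>(1)] X Y \<Phi>(2) \<Psi>(2) by simp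
    qed
    show "Y \<in> ?p" if X: "X \<in> ?p" and Y: "definable L M n Y \<and> X \<subseteq> Y" for X Y
    proof -
      obtain \<Phi> where \<Phi>: "J n \<Phi>" "X = {x\<in>nlists n U_M. \<Phi> M x}" by (rule definable_J[OF def[OF X]])
      obtain \<Psi> where \<Psi>: "J n \<Psi>" "Y = {x\<in>nlists n U_M. \<Psi> M x}" by (rule definable_J[OF conjunct1[OF Y]])
      have "J 0 (\<lambda>S e. \<forall>x\<in>nlists n (universe S). \<Phi> S x \<longrightarrow> \<Psi> S x)"
        by (rule jint refl J_subst[OF \<Phi>(1)] J_subst[OF \<Psi>(1)] | simp)+
      from transfer0[OF this] have "\<Phi> N a \<longrightarrow> \<Psi> N a" using Y a unfolding \<Phi>(2) \<Psi>(2) by blast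
      then show ?thesis using iff[OF \<Phi>(1)] iff[OF \<Psi>(1)] X \<Phi>(2) \<Psi>(2) by simp
    qed
    show "X \<in> ?p \<or> nlists n U_M - X \<in> ?p" if X: "definable L M n X" for X
    proof -
      obtain \<Phi> where \<Phi>: "J n \<Phi>" "X = {x\<in>nlists n U_M. \<Phi> M x}" by (rule definable_J[OF X])
      have "nlists n U_M - X = {x\<in>nlists n U_M. \<not> \<Phi> M x}" unfolding \<Phi>(2) by blast
      then show ?thesis using iff[OF \<Phi>(1)] iff[OF defble_neg[OF \<Phi>(1)]] \<Phi>(2) by simp
    qed
  qed
qed

lemma tp_definable:
  assumes a: "a \<in> nlists n U_N" shows "definable_type L M n (tp L M N a)"
  unfolding definable_type_def
proof (intro allI impI)
  fix m \<phi> assume wf: "wf_fm L (n + m) \<phi>"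
  have "J (n + m) (\<lambda>S e. sat S e \<phi>)" by (rule J_sat[OF wf]) (rule adm_id[OF refl])
  from definable_trace[OF this a] have "definable L M m {b\<in>nlists m U_M. sat N (a @ b) \<phi>}"
    unfolding DM_definable .
  moreover have "{b\<in>nlists m U_M. fibre M n \<phi> b \<in> tp L M N a} = {b\<in>nlists m U_M. sat N (a @ b) \<phi>}"
    using fibre_in_tp[OF a wf] by blast
  ultimately show "definable L M m {b\<in>nlists m U_M. fibre M n \<phi> b \<in> tp L M N a}" by simp
qed

end

theorem theorem2p3:
  fixes L :: "('f, 'r) language" and M N :: "('a, 'f, 'r) struct"
  assumes "o_minimal L M"
    and "tame_extension L M N"
  shows "\<forall>n\<ge>1. \<forall>a \<in> nlists n (universe N). tp L M N a \<in> types L M n \<and> definable_type L M n (tp L M N a)"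
proof -
  have elem: "elementary_extension L M N" using assms(2) unfolding tame_extension_def by blast
  have "dense_total M" using assms(1) unfolding o_minimal_def dense_total_iff by blast
  then have "dense_total N" by (rule elem_pair.dense_total_transfer[OF elem_pair.intro[OF elem]])
  from ex_linorder[OF this] obtain le ls where le: "class.linorder le ls"
    "\<And>x y. x \<in> universe N \<Longrightarrow> y \<in> universe N \<Longrightarrow> ls x y = lt N x y" by blast
  interpret epair L M N le ls
    by (intro epair.intro elem_pair.intro epair_axioms.intro elem assms le)
  show ?thesis using tp_types tp_definable by blast
qed

end
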